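(* Let $\alpha\in\mathbb R\setminus\mathbb Q$, $\gamma>0$, and let $f\colon\mathbb R\to[-\infty,+\infty)$ be $1$-periodic with $f(y)-f(x)\ge\gamma(y-x)$ for all $0\le x<y<1$ and $\int_0^1\log(1+|f(x)|)\,dx<+\infty$. For every $\delta>0$ and $M>0$ there exists a sequence $\varepsilon_n=\varepsilon_n(M,f,\alpha,\delta)\to+0$ as $n\to+\infty$ such that, for every $x\in\mathbb R$ and every solution of the eigenvalue equation $$H(x)\psi=E\psi,\quad\|\psi\|_{\ell^\infty(\mathbb Z)}=1,\quad L(E)>\beta(\alpha)+\delta,\quad|E|<M,$$ there exists $n_0=n_0(\psi)\in\mathbb Z$ such that $$|\psi(n)|\le\exp\{-(L(E)-\beta(\alpha)-\varepsilon_{|n-n_0|})|n-n_0|\},\quad n\in\mathbb Z.$$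
   Context: The operator is $(H(x)\psi)(n)=\psi(n+1)+\psi(n-1)+f(x+n\alpha)\psi(n)$. If $f(x+m\alpha)=-\infty$ for some $m\in\mathbb Z$ (there is at most one such $m$), one imposes $\psi(m)=0$ and requires the equation only for $n\ne m$. $H_n(x)$ is the $n\times n$ matrix with diagonal entries $f(x+j\alpha)$, $0\le j\le n-1$, entries $1$ next to the diagonal, and $0$ elsewhere. If a diagonal entry equals $-\infty$, the corresponding eigenvalue is taken to be $-\infty$ and the remaining eigenvalues are those of the matrix with that row and column removed. $N_n(x,E)$ is the number of eigenvalues of $H_n(x)$ in $[-\infty,E)$, $N(E)=\lim_{n\to\infty}\frac1n\int_0^1N_n(x,E)\,dx$ is the integrated density of states, $dN$ is the corresponding probability measure, and $L(E)=\int_{\mathbb R}\log|E-E'|\,dN(E')$ is the Lyapunov exponent. If $p_k/q_k$ are the continued fraction approximants of $\alpha$, then $\beta(\alpha)=\limsup_{k\to\infty}\frac{\log q_{k+1}}{q_k}$. *)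

theory Defs
  imports
    "HOL-Analysis.Analysis"
    "Jordan_Normal_Form.Char_Poly"
    "Jordan_Normal_Form.DL_Submatrix"
begin

section \<open>Continued fractions\<close>

text \<open>The complete quotients: the regular continued fraction of an irrational \<open>\<alpha>\<close> is
  \<open>[a\<^sub>0; a\<^sub>1, a\<^sub>2, \<dots>]\<close> with \<open>a\<^sub>k = \<lfloor>cf_complete \<alpha> k\<rfloor>\<close>.\<close>

fun cf_complete :: "real \<Rightarrow> nat \<Rightarrow> real" where
  "cf_complete \<alpha> 0 = \<alpha>"
| "cf_complete \<alpha> (Suc k) = 1 / frac (cf_complete \<alpha> k)"

definition cf_coeff :: "real \<Rightarrow> nat \<Rightarrow> int" where
  "cf_coeff \<alpha> k = \<lfloor>cf_complete \<alpha> k\<rfloor>"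

text \<open>The denominators \<open>q\<^sub>k\<close> of the convergents \<open>p\<^sub>k / q\<^sub>k = [a\<^sub>0; a\<^sub>1, \<dots>, a\<^sub>k]\<close>.\<close>

fun cf_denom :: "real \<Rightarrow> nat \<Rightarrow> int" where
  "cf_denom \<alpha> 0 = 1"
| "cf_denom \<alpha> (Suc 0) = cf_coeff \<alpha> 1"
| "cf_denom \<alpha> (Suc (Suc k)) = cf_coeff \<alpha> (Suc (Suc k)) * cf_denom \<alpha> (Suc k) + cf_denom \<alpha> k"

definition cf_beta :: "real \<Rightarrow> ereal" where
  "cf_beta \<alpha> =
     limsup (\<lambda>k. ereal (ln (of_int (cf_denom \<alpha> (Suc k))) / of_int (cf_denom \<alpha> k)))"

section \<open>The potential\<close>

text \<open>\<open>log (1 + |y|)\<close> with the value \<open>\<infinity>\<close> at \<open>y = \<plusminus>\<infinity>\<close>.\<close>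

definition log1p_abs :: "ereal \<Rightarrow> ennreal" where
  "log1p_abs y = (if \<bar>y\<bar> = \<infinity> then \<infinity> else ennreal (ln (1 + \<bar>real_of_ereal y\<bar>)))"

text \<open>In the monotonicity condition, \<open>f y - f x = \<infinity>\<close> when \<open>f x = -\<infinity>\<close>, also if \<open>f y = -\<infinity>\<close>
  (\<open>ereal\<close> subtraction). The latter cannot occur for \<open>0 \<le> x < y < 1\<close>: the condition would force
  \<open>f = -\<infinity>\<close> on \<open>[0, y]\<close>, against the integrability condition.\<close>

definition monotone_potential :: "real \<Rightarrow> (real \<Rightarrow> ereal) \<Rightarrow> bool" where
  "monotone_potential \<gamma> f \<longleftrightarrow>
     (\<forall>x. f x < \<infinity>) \<and>
     (\<forall>x. f (x + 1) = f x) \<and>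
     (\<forall>x y. 0 \<le> x \<longrightarrow> x < y \<longrightarrow> y < 1 \<longrightarrow> f y - f x \<ge> ereal (\<gamma> * (y - x))) \<and>
     (\<integral>\<^sup>+x\<in>{0..1}. log1p_abs (f x) \<partial>lborel) < \<infinity>"

section \<open>The eigenvalue equation\<close>

text \<open>At a site where the potential is \<open>-\<infinity>\<close> the equation is replaced by \<open>\<psi> n = 0\<close>.\<close>

definition eigen_solution ::
    "(real \<Rightarrow> ereal) \<Rightarrow> real \<Rightarrow> real \<Rightarrow> real \<Rightarrow> (int \<Rightarrow> complex) \<Rightarrow> bool" where
  "eigen_solution f \<alpha> x E \<psi> \<longleftrightarrow>
     (\<forall>n. if f (x + of_int n * \<alpha>) = -\<infinity> then \<psi> n = 0
          else \<psi> (n + 1) + \<psi> (n - 1) + of_real (real_of_ereal (f (x + of_int n * \<alpha>))) * \<psi> n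
               = of_real E * \<psi> n)"

definition linf_norm_eq :: "(int \<Rightarrow> complex) \<Rightarrow> real \<Rightarrow> bool" where
  "linf_norm_eq \<psi> c \<longleftrightarrow> bdd_above (range (\<lambda>n. cmod (\<psi> n))) \<and> (SUP n. cmod (\<psi> n)) = c"

section \<open>Integrated density of states and Lyapunov exponent\<close>

definition box_matrix :: "(real \<Rightarrow> ereal) \<Rightarrow> real \<Rightarrow> nat \<Rightarrow> real \<Rightarrow> ereal mat" where
  "box_matrix f \<alpha> n x =
     mat n n (\<lambda>(i, j). if i = j then f (x + real j * \<alpha>)
                       else if i = Suc j \<or> j = Suc i then 1 else 0)"

text \<open>The eigenvalues with algebraic multiplicity: one eigenvalue \<open>-\<infinity>\<close> for every diagonal entry
  \<open>-\<infinity>\<close>, and the eigenvalues of the real symmetric matrix left after removing the corresponding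
  rows and columns (all the roots of its characteristic polynomial are real).\<close>

definition box_eigenvalues :: "(real \<Rightarrow> ereal) \<Rightarrow> real \<Rightarrow> nat \<Rightarrow> real \<Rightarrow> ereal multiset" where
  "box_eigenvalues f \<alpha> n x =
     (let A = box_matrix f \<alpha> n x;
          S = {j. j < n \<and> A $$ (j, j) = -\<infinity>};
          I = {..<n} - S
      in replicate_mset (card S) (-\<infinity>) +
         image_mset ereal (proots (char_poly (map_mat real_of_ereal (submatrix A I I)))))"

definition box_count :: "(real \<Rightarrow> ereal) \<Rightarrow> real \<Rightarrow> nat \<Rightarrow> real \<Rightarrow> real \<Rightarrow> nat" where
  "box_count f \<alpha> n x E = size (filter_mset (\<lambda>e. e < ereal E) (box_eigenvalues f \<alpha> n x))"

definition ids :: "(real \<Rightarrow> ereal) \<Rightarrow> real \<Rightarrow> real \<Rightarrow> real" where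
  "ids f \<alpha> E = lim (\<lambda>n. (LBINT x:{0..1}. real (box_count f \<alpha> n x E)) / real n)"

text \<open>The Stieltjes measure \<open>dN\<close>. For the potentials considered here \<open>N\<close> is nondecreasing and
  Lipschitz continuous with constant \<open>1/\<gamma>\<close>, so the half-open intervals by which
  \<^const>\<open>interval_measure\<close> is defined may be open or closed at either end.\<close>

definition dos_measure :: "(real \<Rightarrow> ereal) \<Rightarrow> real \<Rightarrow> real measure" where
  "dos_measure f \<alpha> = interval_measure (ids f \<alpha>)"

text \<open>The value \<open>ln 0 = 0\<close> at \<open>E' = E\<close> is irrelevant, since \<open>dN\<close> has no atoms.\<close>

definition lyapunov :: "(real \<Rightarrow> ereal) \<Rightarrow> real \<Rightarrow> real \<Rightarrow> real" where
  "lyapunov f \<alpha> E = (\<integral>E'. ln \<bar>E - E'\<bar> \<partial>dos_measure f \<alpha>)"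

end

theory Submission
  imports
    Defs
    "HOL-Number_Theory.Cong"
    "HOL-Probability.Distribution_Functions"
begin

text \<open>Monotonicity of \<open>f\<close> makes the labelled eigenvalues of a box increase in the phase with speed at
  least \<open>\<gamma>\<close>, so for fixed \<open>E\<close> a box of length \<open>h\<close> has only \<open>h\<close> phases modulo 1 at which its determinant
  vanishes (crossings), and the determinant has size \<open>exp (L(E) h)\<close> up to the logarithmic distances to
  these. By Green's formula, if the peak of \<open>\<psi>\<close> lies well inside a box, then the determinant is small
  and the box must sit near a crossing. Translates by less than a denominator \<open>q\<close> of \<open>\<alpha>\<close> are separated,
  hence the boxes around the peak use up almost all crossings one by one, and almost all other
  boxes have large determinants. A maximum principle then gives decay at rate \<open>L(E)\<close> up to
  distance about \<open>q/2\<close>. Between \<open>q\<^sub>k\<close> and \<open>q\<^sub>k\<^sub>+\<^sub>1\<close> the obstructions are the translates of the peak by multiples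
  of \<open>q\<^sub>k\<close>: the box of length \<open>q\<^sub>k\<close> around the peak has one crossing extremely close to it, which
  therefore is at distance comparable to \<open>1/q\<^sub>k\<^sub>+\<^sub>1\<close> from the translates, at a cost of
  \<open>ln q\<^sub>k\<^sub>+\<^sub>1 \<le> (\<beta>(\<alpha>) + o(1)) q\<^sub>k\<close> in the exponent.\<close>

section \<open>Distance to the integers\<close>

text \<open>The potential is unbounded and may equal \<open>-\<infinity>\<close>, so box
  determinants have no common size. Each site is therefore divided by
  \<open>|E + iR - v| / R\<close>: at \<open>E + iR\<close> the off-diagonal entries change the
  logarithm of the determinant by at most \<open>1 / R\<close> per site, so up to that error the
  normalised determinant at \<open>E\<close> is governed by the eigenvalues alone, and
  \<open>-\<infinity>\<close> becomes an ordinary value of \<open>v\<close>. Every estimate must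
  hold for all phases and energies at once. For eigenvalue counts this comes from the labels: any
  phase is reached by fewer than \<open>q\<close> orbit steps and a shift of at most
  \<open>3 / q\<close>, which changes few labels. The logarithm is clamped at distance
  \<open>\<gamma> * r\<close> from \<open>E\<close>, where counts suffice; the rest is charged to
  the crossings. Over \<open>\<sigma>\<close>-separated boxes it adds up to
  \<open>O(1 + r / \<sigma>)\<close> per crossing, with \<open>1 / \<sigma> \<le> 2 * q\<close>, so
  \<open>r\<close> is taken small relative to the permitted loss \<open>\<eta>\<close> of rate.
  Integrability of \<open>ln |E - E'|\<close> is extracted from \<open>L(E) > 0\<close>, a
  nonexistent integral having the value \<open>0\<close>. The peak is a site with
  \<open>|\<psi>| \<ge> 1/2\<close>, and the left half-line is the right one for
  \<open>- \<alpha>\<close>.\<close>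

definition circ_dist :: "real \<Rightarrow> real" where
  "circ_dist x = min (frac x) (1 - frac x)"

lemma circ_dist_le: "circ_dist x \<le> \<bar>x - of_int m\<bar>"
proof (cases "m \<le> \<lfloor>x\<rfloor>")
  case True
  then have "of_int m \<le> (of_int \<lfloor>x\<rfloor> :: real)" by simp
  then show ?thesis unfolding circ_dist_def frac_def by linarith
next
  case False
  then have "of_int (\<lfloor>x\<rfloor> + 1) \<le> (of_int m :: real)" by (intro of_int_le_iff[THEN iffD2]) linarith
  then show ?thesis unfolding circ_dist_def frac_def by linarith
qed

lemma circ_dist_attained: obtains m :: int where "circ_dist x = \<bar>x - of_int m\<bar>"
proof (cases "frac x \<le> 1 - frac x")
  case True
  then have "circ_dist x = \<bar>x - of_int \<lfloor>x\<rfloor>\<bar>" unfolding circ_dist_def frac_def by linarith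
  then show ?thesis using that by blast
next
  case False
  then have "circ_dist x = \<bar>x - of_int (\<lfloor>x\<rfloor> + 1)\<bar>"
    unfolding circ_dist_def frac_def of_int_add of_int_1 by linarith
  then show ?thesis using that by blast
qed

lemma circ_dist_nonneg: "circ_dist x \<ge> 0"
  by (metis abs_ge_zero circ_dist_attained)

lemma circ_dist_le_abs: "circ_dist x \<le> \<bar>x\<bar>"
  using circ_dist_le[of x 0] by simp

lemma circ_dist_triangle: "circ_dist (x + y) \<le> circ_dist x + circ_dist y"
proof -
  obtain m where m: "circ_dist x = \<bar>x - of_int m\<bar>" by (rule circ_dist_attained)
  obtain k where k: "circ_dist y = \<bar>y - of_int k\<bar>" by (rule circ_dist_attained)
  show ?thesis using circ_dist_le[of "x + y" "m + k"] m k by simp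
qed

lemma circ_dist_minus: "circ_dist (- x) = circ_dist x"
proof -
  have *: "circ_dist (- x) \<le> circ_dist x" for x
  proof -
    obtain m where m: "circ_dist x = \<bar>x - of_int m\<bar>" by (rule circ_dist_attained)
    show ?thesis using circ_dist_le[of "- x" "- m"] m by simp
  qed
  show ?thesis using *[of x] *[of "- x"] by simp
qed

lemma circ_dist_commute: "circ_dist (x - y) = circ_dist (y - x)"
  using circ_dist_minus[of "x - y"] by simp

lemma circ_dist_triangle2: "circ_dist (x - z) \<le> circ_dist (x - y) + circ_dist (y - z)"
  using circ_dist_triangle[of "x - y" "y - z"] by simp

lemma circ_dist_add_int: "circ_dist (x + of_int m) = circ_dist x"
  unfolding circ_dist_def by simp

text \<open>Nearest-integer lifts of the points within \<open>s\<close> of \<open>w\<close> lie in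
  an interval of length \<open>2 * s\<close>. Cut into cells of length \<open>\<sigma>\<close>, it
  has at most one point per cell, as two points in a cell would violate the separation.\<close>

lemma separated_card:
  fixes z :: "'a \<Rightarrow> real"
  assumes "finite A" and "\<sigma> > 0" and "\<And>i j. i \<in> A \<Longrightarrow> j \<in> A \<Longrightarrow> i \<noteq> j \<Longrightarrow> circ_dist (z i - z j) \<ge> \<sigma>"
    and "s \<ge> 0"
  shows "real (card {i \<in> A. circ_dist (z i - w) \<le> s}) \<le> 2 * s / \<sigma> + 1"
proof -
  let ?B = "{i \<in> A. circ_dist (z i - w) \<le> s}"
  have "\<exists>m :: int. circ_dist (z i - w) = \<bar>z i - w - of_int m\<bar>" for i
    using circ_dist_attained by metis
  then obtain m where m: "\<And>i. circ_dist (z i - w) = \<bar>z i - w - of_int (m i :: int)\<bar>" by metis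
  define g where "g i = \<lfloor>(z i - w - of_int (m i) + s) / \<sigma>\<rfloor>" for i
  have inj: "inj_on g ?B"
  proof (rule inj_onI, rule ccontr)
    fix i j assume ij: "i \<in> ?B" "j \<in> ?B" "g i = g j" "i \<noteq> j"
    let ?a = "(z i - w - of_int (m i) + s) / \<sigma>" and ?b = "(z j - w - of_int (m j) + s) / \<sigma>"
    have "\<bar>?a - ?b\<bar> < 1" using ij(3) unfolding g_def by linarith
    then have "\<bar>?a - ?b\<bar> * \<sigma> < \<sigma>" using assms(2) by simp
    moreover have "\<bar>?a - ?b\<bar> * \<sigma> = \<bar>(?a - ?b) * \<sigma>\<bar>" using assms(2) by (simp add: abs_mult)
    moreover have "(?a - ?b) * \<sigma> = z i - z j - of_int (m i - m j)"
      using assms(2) by (simp add: field_simps)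
    ultimately have "\<bar>z i - z j - of_int (m i - m j)\<bar> < \<sigma>" by simp
    moreover have "circ_dist (z i - z j) \<ge> \<sigma>" using assms(3) ij by simp
    ultimately show False using circ_dist_le[of "z i - z j" "m i - m j"] by linarith
  qed
  have sub: "g ` ?B \<subseteq> {0..\<lfloor>2 * s / \<sigma>\<rfloor>}"
  proof
    fix c assume "c \<in> g ` ?B"
    then obtain i where i: "i \<in> ?B" "c = g i" by blast
    then have "\<bar>z i - w - of_int (m i)\<bar> \<le> s" using m[of i] by simp
    then have "0 \<le> z i - w - of_int (m i) + s" "z i - w - of_int (m i) + s \<le> 2 * s" by linarith+
    then have "0 \<le> (z i - w - of_int (m i) + s) / \<sigma>" "(z i - w - of_int (m i) + s) / \<sigma> \<le> 2 * s / \<sigma>"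
      using assms(2) by (simp_all add: divide_right_mono)
    then show "c \<in> {0..\<lfloor>2 * s / \<sigma>\<rfloor>}" unfolding i g_def by (auto intro: floor_mono)
  qed
  have "card ?B = card (g ` ?B)" using inj by (simp add: card_image)
  also have "\<dots> \<le> card {0..\<lfloor>2 * s / \<sigma>\<rfloor>}" by (rule card_mono[OF _ sub]) simp
  also have "\<dots> = nat (\<lfloor>2 * s / \<sigma>\<rfloor> + 1)" by simp
  finally have "real (card ?B) \<le> real (nat (\<lfloor>2 * s / \<sigma>\<rfloor> + 1))" by linarith
  moreover have "0 \<le> 2 * s / \<sigma>" using assms by simp
  ultimately show ?thesis by linarith
qed

section \<open>Sums of logarithmic distances to separated points\<close>

definition logp :: "real \<Rightarrow> real" where "logp t = max 0 (ln t)"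

lemma logp_nonneg: "logp t \<ge> 0" unfolding logp_def by simp

lemma logp_mono: "0 < s \<Longrightarrow> s \<le> t \<Longrightarrow> logp s \<le> logp t"
  unfolding logp_def by (auto intro: max.coboundedI2)

text \<open>Dyadic layer cake: if \<open>M\<close> is the last scale with
  \<open>d \<le> r / 2 ^ M\<close>, then \<open>r / d < 2 ^ Suc M\<close>, and because
  \<open>ln 2 < 1\<close> each of the scales \<open>0, ..., M\<close> pays for one unit of the
  logarithm. The lower bound \<open>\<tau>\<close> on \<open>d\<close> caps the scales at
  \<open>N\<close>.\<close>

lemma logp_le_count:
  fixes r d \<tau> :: real
  assumes "r > 0" "\<tau> > 0" "d \<ge> \<tau>" and N: "real N \<ge> r / \<tau>"
  shows "logp (r / d) \<le> real (card {m. m \<le> N \<and> d \<le> r / 2 ^ m})"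
proof (cases "d \<le> r")
  case False
  then have "r / d \<le> 1" "r / d > 0" using assms by auto
  then have "logp (r / d) = 0" unfolding logp_def by simp
  then show ?thesis by simp
next
  case True
  define S where "S = {m::nat. m \<le> N \<and> d \<le> r / 2 ^ m}"
  have fin: "finite S" unfolding S_def by simp
  have "0 \<in> S" using True unfolding S_def by simp
  define M where "M = Max S"
  have MS: "M \<in> S" unfolding M_def using fin \<open>0 \<in> S\<close> by (intro Max_in) auto
  have "d > 0" using assms by linarith
  have lt: "r / 2 ^ Suc M < d"
  proof (rule ccontr)
    assume "\<not> ?thesis"
    then have le: "d \<le> r / 2 ^ Suc M" by simp
    then have "2 ^ Suc M \<le> r / d" using \<open>d > 0\<close> by (simp add: field_simps)
    also have "\<dots> \<le> r / \<tau>" using assms by (intro divide_left_mono) auto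
    also have "\<dots> \<le> real N" by (rule N)
    finally have "(2::real) ^ Suc M \<le> real N" .
    moreover have "real (Suc M) < 2 ^ Suc M" by (rule of_nat_less_two_power)
    ultimately have "Suc M \<le> N" by linarith
    with le have "Suc M \<in> S" unfolding S_def by simp
    then have "Suc M \<le> M" unfolding M_def using fin by (intro Max_ge)
    then show False by simp
  qed
  have "{0..M} \<subseteq> S"
  proof
    fix m assume "m \<in> {0..M}"
    then have "m \<le> M" by simp
    then have "(2::real) ^ m \<le> 2 ^ M" by (intro power_increasing) auto
    then have "r / 2 ^ M \<le> r / 2 ^ m" using assms by (intro divide_left_mono) auto
    then show "m \<in> S" using MS \<open>m \<le> M\<close> unfolding S_def by auto
  qed
  then have "card {0..M} \<le> card S" using fin by (intro card_mono)
  then have c: "real (Suc M) \<le> real (card S)" by simp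
  have "r / d \<le> 2 ^ Suc M" using lt \<open>d > 0\<close> by (simp add: field_simps)
  then have "ln (r / d) \<le> ln (2 ^ Suc M)" using assms \<open>d > 0\<close> by (subst ln_le_cancel_iff) auto
  also have "\<dots> = real (Suc M) * ln 2" by (subst ln_realpow) auto
  also have "\<dots> \<le> real (Suc M) * 1" using ln2_le_25_over_36 by (intro mult_left_mono) auto
  finally have "logp (r / d) \<le> real (Suc M)" unfolding logp_def by simp
  then show ?thesis using c unfolding S_def by linarith
qed

text \<open>After exchanging points and dyadic scales, \<open>separated_card\<close> bounds scale
  \<open>m\<close> by \<open>2 * r / (2 ^ m * \<sigma>) + 1\<close>. The geometric part sums to at
  most \<open>4 * r / \<sigma>\<close>; the ones add \<open>N + 1\<close>, with \<open>N\<close>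
  about \<open>16 * r / \<sigma>\<close> thanks to the cutoff \<open>\<sigma> / 16\<close>.
  Linearity in \<open>r / \<sigma>\<close> is what later makes the cost small for small
  \<open>r\<close>.\<close>

lemma sum_logp_separated:
  fixes z :: "'a \<Rightarrow> real"
  assumes fin: "finite A" and s: "\<sigma> > 0" "\<sigma> \<le> 1"
    and sep: "\<And>i j. i \<in> A \<Longrightarrow> j \<in> A \<Longrightarrow> i \<noteq> j \<Longrightarrow> circ_dist (z i - z j) \<ge> \<sigma>"
    and r: "r > 0"
  shows "(\<Sum>i\<in>{i \<in> A. circ_dist (z i - w) \<ge> \<sigma> / 16}. logp (r / circ_dist (z i - w))) \<le> 20 * r / \<sigma> + 2"
proof -
  let ?d = "\<lambda>i. circ_dist (z i - w)"
  let ?B = "{i \<in> A. ?d i \<ge> \<sigma> / 16}"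
  define N where "N = nat \<lceil>16 * r / \<sigma>\<rceil>"
  have "16 * r / \<sigma> \<ge> 0" using r s(1) by simp
  then have N: "real N \<ge> 16 * r / \<sigma>" "real N \<le> 16 * r / \<sigma> + 1"
    unfolding N_def by linarith+
  then have N3: "real N \<ge> r / (\<sigma> / 16)" by (simp add: mult.commute)
  have "(\<Sum>i\<in>?B. logp (r / ?d i)) \<le> (\<Sum>i\<in>?B. real (card {m. m \<le> N \<and> ?d i \<le> r / 2 ^ m}))"
    by (intro sum_mono logp_le_count[of r "\<sigma> / 16"]) (use r s N3 in auto)
  also have "\<dots> = (\<Sum>i\<in>?B. \<Sum>m\<in>{..N}. if ?d i \<le> r / 2 ^ m then 1 else 0)"
    by (intro sum.cong refl) (simp add: sum.If_cases Int_def conj_commute atMost_def)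
  also have "\<dots> = (\<Sum>m\<in>{..N}. \<Sum>i\<in>?B. if ?d i \<le> r / 2 ^ m then 1 else 0)" by (rule sum.swap)
  also have "\<dots> = (\<Sum>m\<in>{..N}. real (card {i \<in> ?B. ?d i \<le> r / 2 ^ m}))"
    using fin by (intro sum.cong refl) (simp add: sum.If_cases Int_def conj_commute)
  also have "\<dots> \<le> (\<Sum>m\<in>{..N}. 2 * (r / 2 ^ m) / \<sigma> + 1)"
  proof (intro sum_mono)
    fix m
    have "card {i \<in> ?B. ?d i \<le> r / 2 ^ m} \<le> card {i \<in> A. ?d i \<le> r / 2 ^ m}"
      using fin by (intro card_mono) auto
    moreover have "real (card {i \<in> A. ?d i \<le> r / 2 ^ m}) \<le> 2 * (r / 2 ^ m) / \<sigma> + 1"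
      by (intro separated_card) (use fin s sep r in auto)
    ultimately show "real (card {i \<in> ?B. ?d i \<le> r / 2 ^ m}) \<le> 2 * (r / 2 ^ m) / \<sigma> + 1" by linarith
  qed
  also have "\<dots> = (2 * r / \<sigma>) * (\<Sum>m\<in>{..N}. (1/2) ^ m) + (real N + 1)"
    by (simp add: sum.distrib sum_distrib_left power_divide field_simps)
  also have "\<dots> \<le> (2 * r / \<sigma>) * 2 + (real N + 1)"
  proof -
    have "(\<Sum>m\<in>{..N}. (1/2::real) ^ m) \<le> 2"
      by (subst sum_gp0) (simp add: field_simps)
    then show ?thesis using r s by (intro add_right_mono mult_left_mono) auto
  qed
  also have "\<dots> \<le> 20 * r / \<sigma> + 2"
  proof -
    have "20 * r / \<sigma> = (2 * r / \<sigma>) * 2 + 16 * r / \<sigma>" by (simp add: field_simps)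
    then show ?thesis using N(2) by linarith
  qed
  finally show ?thesis .
qed

section \<open>Continued fractions\<close>

fun cf_num :: "real \<Rightarrow> nat \<Rightarrow> int" where
  "cf_num \<alpha> 0 = cf_coeff \<alpha> 0"
| "cf_num \<alpha> (Suc 0) = cf_coeff \<alpha> 1 * cf_coeff \<alpha> 0 + 1"
| "cf_num \<alpha> (Suc (Suc k)) = cf_coeff \<alpha> (Suc (Suc k)) * cf_num \<alpha> (Suc k) + cf_num \<alpha> k"

definition cf_err :: "real \<Rightarrow> nat \<Rightarrow> real" where
  "cf_err \<alpha> k = of_int (cf_denom \<alpha> k) * \<alpha> - of_int (cf_num \<alpha> k)"

lemma frac_irrational:
  assumes "x \<notin> \<rat>" shows "frac x \<notin> \<rat>"
proof
  assume "frac x \<in> \<rat>"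
  then have "frac x + of_int \<lfloor>x\<rfloor> \<in> \<rat>" by (intro Rats_add) auto
  then show False using assms by (simp add: frac_def)
qed

context
  fixes \<alpha> :: real
  assumes irr: "\<alpha> \<notin> \<rat>"
begin

lemma cf_complete_irr: "cf_complete \<alpha> k \<notin> \<rat>"
proof (induction k)
  case (Suc k)
  have "frac (cf_complete \<alpha> k) \<notin> \<rat>" using frac_irrational[OF Suc] .
  then show ?case using Rats_inverse by (fastforce simp: divide_inverse)
qed (use irr in simp)

lemma cf_frac_pos: "0 < frac (cf_complete \<alpha> k)" "frac (cf_complete \<alpha> k) < 1"
proof -
  have "cf_complete \<alpha> k \<notin> \<int>" using cf_complete_irr Ints_subset_Rats by blast
  then show "0 < frac (cf_complete \<alpha> k)" by (simp add: frac_gt_0_iff)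
  show "frac (cf_complete \<alpha> k) < 1" by (rule frac_lt_1)
qed

lemma cf_complete_gt1: "cf_complete \<alpha> (Suc k) > 1"
  using cf_frac_pos[of k] by (simp add: field_simps)

lemma cf_coeff_ge1: "cf_coeff \<alpha> (Suc k) \<ge> 1"
  using cf_complete_gt1[of k] unfolding cf_coeff_def by linarith

lemma cf_denom_pos: "cf_denom \<alpha> k \<ge> 1 \<and> cf_denom \<alpha> (Suc k) \<ge> 1"
proof (induction k)
  case 0 show ?case using cf_coeff_ge1[of 0] by simp
next
  case (Suc k)
  have "cf_coeff \<alpha> (Suc (Suc k)) * cf_denom \<alpha> (Suc k) \<ge> 1 * cf_denom \<alpha> (Suc k)"
    using Suc cf_coeff_ge1[of "Suc k"] by (intro mult_right_mono) auto
  then have "cf_coeff \<alpha> (Suc (Suc k)) * cf_denom \<alpha> (Suc k) + cf_denom \<alpha> k \<ge> 1" using Suc by linarith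
  then show ?case using Suc by simp
qed

lemma cf_denom_Suc_Suc_ge: "cf_denom \<alpha> (Suc (Suc k)) \<ge> cf_denom \<alpha> (Suc k) + cf_denom \<alpha> k"
proof -
  have "cf_coeff \<alpha> (Suc (Suc k)) * cf_denom \<alpha> (Suc k) \<ge> 1 * cf_denom \<alpha> (Suc k)"
    using cf_denom_pos[of k] cf_coeff_ge1[of "Suc k"] by (intro mult_right_mono) auto
  then show ?thesis by simp
qed

lemma cf_denom_mono_Suc: "cf_denom \<alpha> k \<le> cf_denom \<alpha> (Suc k)"
proof (cases k)
  case 0 then show ?thesis using cf_denom_pos[of 0] by simp
next
  case (Suc j) then show ?thesis using cf_denom_Suc_Suc_ge[of j] cf_denom_pos[of j] by (simp del: cf_denom.simps)
qed

lemma cf_denom_ge: "cf_denom \<alpha> (Suc k) \<ge> int (Suc k)"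
proof (induction k)
  case 0 then show ?case using cf_denom_pos[of 0] by simp
next
  case (Suc k) then show ?case using cf_denom_Suc_Suc_ge[of k] cf_denom_pos[of k] by (simp del: cf_denom.simps)
qed

lemma cf_unimodular:
  "cf_denom \<alpha> k * cf_num \<alpha> (Suc k) - cf_denom \<alpha> (Suc k) * cf_num \<alpha> k = (- 1) ^ k"
proof (induction k)
  case 0 then show ?case by simp
next
  case (Suc k)
  have "cf_denom \<alpha> (Suc k) * cf_num \<alpha> (Suc (Suc k)) - cf_denom \<alpha> (Suc (Suc k)) * cf_num \<alpha> (Suc k)
     = - (cf_denom \<alpha> k * cf_num \<alpha> (Suc k) - cf_denom \<alpha> (Suc k) * cf_num \<alpha> k)"
    by (simp add: algebra_simps)
  then show ?case using Suc by simp
qed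

lemma cf_err_0: "cf_err \<alpha> 0 = frac (cf_complete \<alpha> 0)"
  unfolding cf_err_def by (simp add: cf_coeff_def frac_def)

lemma cf_complete_frac: "cf_complete \<alpha> (Suc k) = of_int (cf_coeff \<alpha> (Suc k)) + frac (cf_complete \<alpha> (Suc k))"
  unfolding cf_coeff_def frac_def by simp

text \<open>Consecutive complete quotients satisfy \<open>a + g = 1 / f\<close> for the coefficient
  \<open>a\<close> and the fractional parts \<open>f\<close>, \<open>g\<close>, which closes the
  induction. The factor lies in \<open>(-1, 0)\<close>: errors alternate in sign and shrink.\<close>

lemma cf_err_Suc: "cf_err \<alpha> (Suc k) = - cf_err \<alpha> k * frac (cf_complete \<alpha> (Suc k))"
proof (induction k)
  case 0
  let ?f = "frac (cf_complete \<alpha> 0)" and ?g = "frac (cf_complete \<alpha> (Suc 0))"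
  let ?a = "of_int (cf_coeff \<alpha> (Suc 0)) :: real"
  have "cf_err \<alpha> (Suc 0) = ?a * ?f - 1"
    unfolding cf_err_def by (simp add: cf_coeff_def frac_def algebra_simps)
  moreover have "?a + ?g = 1 / ?f" using cf_complete_frac[of 0] by simp
  then have "?a * ?f = 1 - ?g * ?f" using cf_frac_pos[of 0] by (simp add: field_simps)
  ultimately show ?case unfolding cf_err_0 by (simp add: algebra_simps)
next
  case (Suc k)
  let ?f = "frac (cf_complete \<alpha> (Suc k))" and ?g = "frac (cf_complete \<alpha> (Suc (Suc k)))"
  let ?a = "of_int (cf_coeff \<alpha> (Suc (Suc k))) :: real"
  have "cf_err \<alpha> (Suc (Suc k)) = ?a * cf_err \<alpha> (Suc k) + cf_err \<alpha> k"
    unfolding cf_err_def by (simp add: algebra_simps)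
  moreover have "?a + ?g = 1 / ?f" using cf_complete_frac[of "Suc k"] by simp
  then have a: "?a * ?f = 1 - ?g * ?f" using cf_frac_pos[of "Suc k"] by (simp add: field_simps)
  have "?a * cf_err \<alpha> (Suc k) = - cf_err \<alpha> k * (?a * ?f)" unfolding Suc by simp
  then have "?a * cf_err \<alpha> (Suc k) = - cf_err \<alpha> k + cf_err \<alpha> k * ?f * ?g"
    unfolding a by (simp add: algebra_simps)
  ultimately show ?case unfolding Suc by simp
qed

lemma cf_err_sign: "(- 1) ^ k * cf_err \<alpha> k > 0"
proof (induction k)
  case 0 then show ?case using cf_err_0 cf_frac_pos[of 0] by simp
next
  case (Suc k)
  have "(- 1) ^ Suc k * cf_err \<alpha> (Suc k) = ((- 1) ^ k * cf_err \<alpha> k) * frac (cf_complete \<alpha> (Suc k))"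
    unfolding cf_err_Suc by simp
  then show ?case using mult_pos_pos[OF Suc cf_frac_pos(1)[of "Suc k"]] by simp
qed

lemma cf_err_abs: "\<bar>cf_err \<alpha> k\<bar> = (- 1) ^ k * cf_err \<alpha> k"
proof -
  have "\<bar>(- 1) ^ k * cf_err \<alpha> k\<bar> = \<bar>cf_err \<alpha> k\<bar>" by (simp add: abs_mult power_abs)
  then show ?thesis using cf_err_sign[of k] by simp
qed

text \<open>The unimodular determinant written with errors in place of numerators; the alternating
  signs turn a difference into a sum of absolute values. Both bounds of \<open>cf_err\<close> by the
  next denominator rest on it.\<close>

lemma cf_err_identity:
  "of_int (cf_denom \<alpha> (Suc k)) * \<bar>cf_err \<alpha> k\<bar> + of_int (cf_denom \<alpha> k) * \<bar>cf_err \<alpha> (Suc k)\<bar> = 1"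
proof -
  have "of_int (cf_denom \<alpha> (Suc k)) * cf_err \<alpha> k - of_int (cf_denom \<alpha> k) * cf_err \<alpha> (Suc k)
    = of_int (cf_denom \<alpha> k * cf_num \<alpha> (Suc k) - cf_denom \<alpha> (Suc k) * cf_num \<alpha> k)"
    unfolding cf_err_def by (simp add: algebra_simps)
  also have "\<dots> = (- 1) ^ k" unfolding cf_unimodular by simp
  finally have "(- 1) ^ k * (of_int (cf_denom \<alpha> (Suc k)) * cf_err \<alpha> k - of_int (cf_denom \<alpha> k) * cf_err \<alpha> (Suc k))
     = (- 1) ^ k * (- 1) ^ k" by simp
  then show ?thesis unfolding cf_err_abs
    by (simp add: algebra_simps flip: power_mult_distrib)
qed

lemma cf_err_le: "\<bar>cf_err \<alpha> k\<bar> \<le> 1 / of_int (cf_denom \<alpha> (Suc k))"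
proof -
  have "of_int (cf_denom \<alpha> (Suc k)) * \<bar>cf_err \<alpha> k\<bar> \<le> 1"
    using cf_err_identity[of k] cf_denom_pos[of k] by (smt (verit) mult_nonneg_nonneg of_int_nonneg abs_ge_zero)
  then show ?thesis using cf_denom_pos[of k] by (simp add: field_simps)
qed

lemma cf_err_mono: "\<bar>cf_err \<alpha> (Suc k)\<bar> \<le> \<bar>cf_err \<alpha> k\<bar>"
  unfolding cf_err_Suc abs_mult abs_minus using cf_frac_pos[of "Suc k"]
  by (simp add: mult_left_le)

lemma cf_err_ge: "\<bar>cf_err \<alpha> k\<bar> \<ge> 1 / (2 * of_int (cf_denom \<alpha> (Suc k)))"
proof -
  let ?q = "of_int (cf_denom \<alpha> (Suc k)) :: real"
  have "of_int (cf_denom \<alpha> k) * \<bar>cf_err \<alpha> (Suc k)\<bar> \<le> ?q * \<bar>cf_err \<alpha> k\<bar>"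
    using cf_err_mono[of k] cf_denom_mono_Suc[of k] cf_denom_pos[of k] by (intro mult_mono) auto
  then have "1 \<le> 2 * ?q * \<bar>cf_err \<alpha> k\<bar>" using cf_err_identity[of k] by linarith
  then show ?thesis using cf_denom_pos[of k] by (simp add: field_simps)
qed

text \<open>Lattice points \<open>(n, m)\<close> are written in the basis of two consecutive convergents; as the errors
  alternate in sign, no cancellation is possible when \<open>0 < \<bar>n\<bar> < q\<^sub>k\<^sub>+\<^sub>1\<close>.\<close>
lemma cf_best_approx:
  assumes n: "n \<noteq> 0" "\<bar>n\<bar> < cf_denom \<alpha> (Suc k)"
  shows "circ_dist (of_int n * \<alpha>) \<ge> \<bar>cf_err \<alpha> k\<bar>"
proof -
  obtain m where m: "circ_dist (of_int n * \<alpha>) = \<bar>of_int n * \<alpha> - of_int m\<bar>" by (rule circ_dist_attained)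
  let ?q = "cf_denom \<alpha> k" and ?Q = "cf_denom \<alpha> (Suc k)" and ?p = "cf_num \<alpha> k" and ?P = "cf_num \<alpha> (Suc k)"
  define e :: int where "e = (- 1) ^ k"
  have e2: "e * e = 1" unfolding e_def by (simp flip: power_mult_distrib)
  have un: "?q * ?P - ?Q * ?p = e" using cf_unimodular unfolding e_def .
  define u where "u = e * (n * ?P - m * ?Q)"
  define v where "v = e * (m * ?q - n * ?p)"
  have "u * ?q + v * ?Q = e * n * (?q * ?P - ?Q * ?p)" unfolding u_def v_def by (simp add: algebra_simps)
  then have nn: "n = u * ?q + v * ?Q" using un e2 by (metis mult.commute mult.left_commute mult.right_neutral)
  have "u * ?p + v * ?P = e * m * (?q * ?P - ?Q * ?p)" unfolding u_def v_def by (simp add: algebra_simps)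
  then have mm: "m = u * ?p + v * ?P" using un e2 by (metis mult.commute mult.left_commute mult.right_neutral)
  have eq: "of_int n * \<alpha> - of_int m = of_int u * cf_err \<alpha> k + of_int v * cf_err \<alpha> (Suc k)"
    unfolding cf_err_def by (subst nn, subst mm) (simp add: algebra_simps)
  have Q: "?Q \<ge> 1" "?q \<ge> 1" using cf_denom_pos by auto
  have u0: "u \<noteq> 0"
  proof
    assume "u = 0"
    then have "n = v * ?Q" using nn by simp
    then have "\<bar>n\<bar> = \<bar>v\<bar> * ?Q" using Q by (simp add: abs_mult)
    moreover have "v \<noteq> 0" using \<open>n = v * ?Q\<close> n by auto
    then have "\<bar>v\<bar> * ?Q \<ge> 1 * ?Q" using Q by (intro mult_right_mono) auto
    ultimately show False using n by simp
  qed
  have opp: "u * v \<le> 0"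
  proof (rule ccontr)
    assume "\<not> ?thesis"
    then consider "u > 0" "v > 0" | "u < 0" "v < 0" by (metis linorder_not_le mult_le_0_iff linorder_neqE nle_le)
    then show False
    proof cases
      case 1
      then have "u * ?q \<ge> 0" "v * ?Q \<ge> 1 * ?Q" using Q by (auto intro: mult_right_mono)
      then show False using nn n by linarith
    next
      case 2
      then have "u * ?q \<le> 0" using Q by (simp add: mult_le_0_iff)
      moreover have "(- v) * ?Q \<ge> 1 * ?Q" using 2 Q by (intro mult_right_mono) auto
      ultimately show False using nn n by (simp add: algebra_simps)
    qed
  qed
  define s where "s = cf_err \<alpha> k"
  define t where "t = cf_err \<alpha> (Suc k)"
  have "(of_int u * s) * (of_int v * t) = of_int (u * v) * (s * t)" by simp
  moreover have "s * t \<le> 0" unfolding s_def t_def cf_err_Suc using cf_frac_pos[of "Suc k"]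
    by (simp add: mult_le_0_iff zero_le_mult_iff) (meson linear less_imp_le)
  ultimately have "(of_int u * s) * (of_int v * t) \<ge> 0"
    using opp by (metis mult_nonpos_nonpos of_int_le_0_iff)
  then have "\<bar>of_int u * s + of_int v * t\<bar> \<ge> \<bar>of_int u * s\<bar>"
    by (smt (verit) zero_le_mult_iff)
  moreover have "\<bar>of_int u * s\<bar> \<ge> 1 * \<bar>s\<bar>" unfolding abs_mult
    using u0 by (intro mult_right_mono) auto
  ultimately show ?thesis unfolding m eq s_def t_def by linarith
qed

end

section \<open>Pruefer angles\<close>

text \<open>In the coordinate \<open>r = - cot (\<pi> \<theta>)\<close> on the projective line, \<open>shear a\<close> is the lift of
  \<open>r \<mapsto> r + a\<close> that fixes the integers (the point \<open>r = \<infinity>\<close>).\<close>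

definition shear :: "real \<Rightarrow> real \<Rightarrow> real" where
  "shear a \<theta> = (if \<theta> \<in> \<int> then \<theta>
     else of_int \<lfloor>\<theta>\<rfloor> + 1/2 + arctan (tan (pi * (frac \<theta> - 1/2)) + a) / pi)"

lemma shear_int: "\<theta> \<in> \<int> \<Longrightarrow> shear a \<theta> = \<theta>"
  unfolding shear_def by simp

lemma frac_pos_nonint: "\<theta> \<notin> \<int> \<Longrightarrow> 0 < frac \<theta>" by (simp add: frac_gt_0_iff)

lemma tan_arg_bounds: "\<theta> \<notin> \<int> \<Longrightarrow> - (pi/2) < pi * (frac \<theta> - 1/2) \<and> pi * (frac \<theta> - 1/2) < pi/2"
  using frac_pos_nonint[of \<theta>] frac_lt_1[of \<theta>] by (simp add: field_simps)

lemma shear_floor: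
  assumes "\<theta> \<notin> \<int>" shows "of_int \<lfloor>\<theta>\<rfloor> < shear a \<theta>" "shear a \<theta> < of_int \<lfloor>\<theta>\<rfloor> + 1"
proof -
  let ?x = "tan (pi * (frac \<theta> - 1/2)) + a"
  have "- (pi/2) < arctan ?x" "arctan ?x < pi/2" using arctan_bounded by auto
  then have "- (1/2) < arctan ?x / pi" "arctan ?x / pi < 1/2" by (simp_all add: field_simps)
  moreover have "shear a \<theta> = of_int \<lfloor>\<theta>\<rfloor> + 1/2 + arctan ?x / pi" using assms unfolding shear_def by simp
  ultimately show "of_int \<lfloor>\<theta>\<rfloor> < shear a \<theta>" "shear a \<theta> < of_int \<lfloor>\<theta>\<rfloor> + 1" by linarith+
qed

lemma shear_floor_eq: "\<lfloor>shear a \<theta>\<rfloor> = \<lfloor>\<theta>\<rfloor>"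
proof (cases "\<theta> \<in> \<int>")
  case False
  then show ?thesis using shear_floor[OF False, of a] by (intro floor_unique) auto
qed (simp add: shear_int)

lemma shear_nonint: "\<theta> \<notin> \<int> \<Longrightarrow> shear a \<theta> \<notin> \<int>"
  using shear_floor[of \<theta> a] shear_floor_eq[of a \<theta>] by (auto elim!: Ints_cases)

lemma shear_add_int: "shear a (\<theta> + of_int k) = shear a \<theta> + of_int k"
  unfolding shear_def by auto

lemma shear_mono_a: "a \<le> b \<Longrightarrow> shear a \<theta> \<le> shear b \<theta>"
  unfolding shear_def by (auto intro!: divide_right_mono arctan_monotone')

lemma shear_strict_a: "a < b \<Longrightarrow> \<theta> \<notin> \<int> \<Longrightarrow> shear a \<theta> < shear b \<theta>"
  unfolding shear_def by (auto intro!: divide_strict_right_mono arctan_monotone)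

lemma shear_strict_mono:
  assumes "\<theta> < \<phi>" shows "shear a \<theta> < shear a \<phi>"
proof (cases "\<lfloor>\<theta>\<rfloor> = \<lfloor>\<phi>\<rfloor>")
  case fl: True
  have phi: "\<phi> \<notin> \<int>"
  proof
    assume "\<phi> \<in> \<int>"
    then have "\<phi> = of_int \<lfloor>\<phi>\<rfloor>" by (auto elim!: Ints_cases)
    then show False using fl assms by linarith
  qed
  show ?thesis
  proof (cases "\<theta> \<in> \<int>")
    case True
    then have "\<theta> = of_int \<lfloor>\<phi>\<rfloor>" using fl by (auto elim!: Ints_cases)
    then show ?thesis using shear_floor(1)[OF phi, of a] shear_int[OF True] by simp
  next
    case False
    have "pi * (frac \<theta> - 1/2) < pi * (frac \<phi> - 1/2)"
      using assms fl by (simp add: frac_def)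
    then have "tan (pi * (frac \<theta> - 1/2)) < tan (pi * (frac \<phi> - 1/2))"
      using tan_arg_bounds[OF False] tan_arg_bounds[OF phi] by (intro tan_monotone) auto
    then have "arctan (tan (pi * (frac \<theta> - 1/2)) + a) < arctan (tan (pi * (frac \<phi> - 1/2)) + a)"
      by (intro arctan_monotone) simp
    then show ?thesis using False phi fl unfolding shear_def by (simp add: divide_strict_right_mono)
  qed
next
  case False
  then have lt: "\<lfloor>\<theta>\<rfloor> + 1 \<le> \<lfloor>\<phi>\<rfloor>" using assms floor_mono[of \<theta> \<phi>] by linarith
  have 1: "of_int \<lfloor>\<phi>\<rfloor> \<le> shear a \<phi>" using shear_floor_eq[of a \<phi>] by linarith
  have 2: "shear a \<theta> < of_int \<lfloor>\<theta>\<rfloor> + 1" using shear_floor_eq[of a \<theta>] by linarith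
  have "of_int (\<lfloor>\<theta>\<rfloor> + 1) \<le> (of_int \<lfloor>\<phi>\<rfloor> :: real)" using lt by (simp only: of_int_le_iff)
  then show ?thesis using 1 2 by simp
qed

lemma shear_mono: "\<theta> \<le> \<phi> \<Longrightarrow> shear a \<theta> \<le> shear a \<phi>"
  using shear_strict_mono[of \<theta> \<phi> a] by (cases "\<theta> = \<phi>") auto

lemma shear_shear: "shear a (shear b \<theta>) = shear (a + b) \<theta>"
proof (cases "\<theta> \<in> \<int>")
  case False
  let ?w = "arctan (tan (pi * (frac \<theta> - 1/2)) + b)"
  have "frac (shear b \<theta>) = shear b \<theta> - of_int \<lfloor>\<theta>\<rfloor>" unfolding frac_def shear_floor_eq by simp
  also have "\<dots> = 1/2 + ?w / pi" using False unfolding shear_def by simp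
  finally have "pi * (frac (shear b \<theta>) - 1/2) = ?w" by simp
  then have "tan (pi * (frac (shear b \<theta>) - 1/2)) = tan (pi * (frac \<theta> - 1/2)) + b"
    using arctan by simp
  then show ?thesis using False shear_nonint[OF False, of b]
    unfolding shear_def[of a] shear_def[of "a + b"] shear_floor_eq by (simp add: add_ac)
qed (simp add: shear_int)

lemma shear_0: "shear 0 \<theta> = \<theta>"
proof (cases "\<theta> \<in> \<int>")
  case False
  have "arctan (tan (pi * (frac \<theta> - 1/2))) = pi * (frac \<theta> - 1/2)"
    using tan_arg_bounds[OF False] by (intro arctan_tan) auto
  then show ?thesis using False unfolding shear_def by (simp add: frac_def)
qed (simp add: shear_int)

lemma shear_inverse: "shear (- a) (shear a \<theta>) = \<theta>" "shear a (shear (- a) \<theta>) = \<theta>"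
  by (simp_all add: shear_shear shear_0)

lemma shear_less_iff: "shear a \<theta> < u \<longleftrightarrow> \<theta> < shear (- a) u"
  by (metis shear_inverse shear_strict_mono)

lemma less_shear_iff: "u < shear a \<theta> \<longleftrightarrow> shear (- a) u < \<theta>"
  by (metis shear_inverse shear_strict_mono)

lemma tendsto_shear_a:
  assumes "(g \<longlongrightarrow> a) F" shows "((\<lambda>t. shear (g t) \<theta>) \<longlongrightarrow> shear a \<theta>) F"
proof (cases "\<theta> \<in> \<int>")
  case True then show ?thesis by (simp add: shear_int)
next
  case False
  then show ?thesis unfolding shear_def using assms by (auto intro!: tendsto_intros)
qed

text \<open>Joint continuity reduces to continuity in the shear parameter: inverting the shear turns
  \<open>shear a \<theta> < u\<close> into \<open>\<theta> < shear (- a) u\<close>, where the moving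
  angle no longer stands inside a shear.\<close>

lemma tendsto_shear:
  assumes g: "(g \<longlongrightarrow> a) F" and h: "(h \<longlongrightarrow> \<theta>) F"
  shows "((\<lambda>t. shear (g t) (h t)) \<longlongrightarrow> shear a \<theta>) F"
proof (rule order_tendstoI)
  have diff: "((\<lambda>t. shear (- g t) u - h t) \<longlongrightarrow> shear (- a) u - \<theta>) F" for u
    using g h by (intro tendsto_diff tendsto_shear_a tendsto_minus)
  fix u
  { assume "u < shear a \<theta>"
    then have "shear (- a) u - \<theta> < 0" by (simp add: less_shear_iff)
    then have "eventually (\<lambda>t. shear (- g t) u - h t < 0) F" using diff order_tendstoD(2) by blast
    then show "eventually (\<lambda>t. u < shear (g t) (h t)) F"
      by eventually_elim (simp add: less_shear_iff) }
  { assume "shear a \<theta> < u"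
    then have "shear (- a) u - \<theta> > 0" by (simp add: shear_less_iff)
    then have "eventually (\<lambda>t. shear (- g t) u - h t > 0) F" using diff order_tendstoD(1) by blast
    then show "eventually (\<lambda>t. shear (g t) (h t) < u) F"
      by eventually_elim (simp add: shear_less_iff) }
qed

lemma sin_cos_add_int_pi:
  "sin (x + pi * of_int k) = (if even k then sin x else - sin x)"
  "cos (x + pi * of_int k) = (if even k then cos x else - cos x)"
  by (simp_all add: sin_add cos_add sin_times_pi_eq_0 mult.commute)

text \<open>The link with linear algebra: on the vector \<open>(sin, cos)\<close> of
  \<open>pi\<close> times the angle, the map is a unipotent matrix up to the factor
  \<open>c\<close>. That \<open>c\<close> is positive keeps the vector itself, and not only its
  line, under control.\<close>

lemma shear_vec:
  obtains c where "c > 0" "c * sin (pi * shear a \<phi>) = sin (pi * \<phi>)"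
    "c * cos (pi * shear a \<phi>) = cos (pi * \<phi>) - a * sin (pi * \<phi>)"
proof (cases "\<phi> \<in> \<int>")
  case True
  then have "sin (pi * \<phi>) = 0" by (metis mult.commute sin_times_pi_eq_0)
  then show ?thesis using that[of 1] shear_int[OF True] by simp
next
  case False
  define k where "k = \<lfloor>\<phi>\<rfloor>"
  define u where "u = pi * (frac \<phi> - 1/2)"
  define w where "w = arctan (tan u + a)"
  have ub: "- (pi/2) < u" "u < pi/2" using tan_arg_bounds[OF False] unfolding u_def by auto
  have wb: "- (pi/2) < w" "w < pi/2" unfolding w_def using arctan_bounded by auto
  have cu: "cos u > 0" and cw: "cos w > 0" using ub wb by (auto intro: cos_gt_zero_pi)
  have tw: "tan w = tan u + a" unfolding w_def by (simp add: arctan)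
  have phi: "pi * \<phi> = (u + pi/2) + pi * of_int k" unfolding u_def k_def frac_def by (simp add: field_simps)
  have sh: "pi * shear a \<phi> = (w + pi/2) + pi * of_int k"
    using False unfolding shear_def w_def u_def k_def by (simp add: field_simps)
  have s: "sin (x + pi/2) = cos x" "cos (x + pi/2) = - sin x" for x :: real
    by (simp_all add: sin_add cos_add)
  define c where "c = cos u / cos w"
  have c: "c > 0" using cu cw unfolding c_def by simp
  have 1: "c * cos w = cos u" using cw unfolding c_def by simp
  have "c * sin w = cos u * tan w" unfolding c_def tan_def by simp
  also have "\<dots> = sin u + a * cos u" unfolding tw using cu by (simp add: tan_def algebra_simps)
  finally have 2: "c * sin w = sin u + a * cos u" .
  show ?thesis
  proof (rule that[OF c])
    show "c * sin (pi * shear a \<phi>) = sin (pi * \<phi>)"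
      unfolding phi sh sin_cos_add_int_pi s using 1 by simp
    show "c * cos (pi * shear a \<phi>) = cos (pi * \<phi>) - a * sin (pi * \<phi>)"
      unfolding phi sh sin_cos_add_int_pi s using 2 by (simp add: algebra_simps)
  qed
qed

text \<open>At \<open>k + 1/4\<close> the coordinate is \<open>-1\<close>; adding \<open>2\<close>
  gives \<open>1\<close>, the coordinate of \<open>k + 3/4\<close>. The thresholds
  \<open>E - 2\<close> and \<open>E + 2\<close> of the counting bounds originate here.\<close>

lemma shear_ge_quarter:
  assumes "\<theta> \<ge> of_int k + 1/4" "a \<ge> 2" shows "shear a \<theta> \<ge> of_int k + 3/4"
proof -
  have "shear 2 (1/4) = 3/4"
  proof -
    have ni: "(1/4::real) \<notin> \<int>" by (auto elim!: Ints_cases)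
    have fl: "\<lfloor>1/4::real\<rfloor> = 0" by simp
    have "tan (pi * (frac (1/4) - 1/2)) = tan (- (pi/4))" by (simp add: frac_def fl)
    then have "tan (pi * (frac (1/4) - 1/2)) = - 1" by (simp add: tan_45)
    then show ?thesis using ni fl unfolding shear_def by (simp add: arctan_one)
  qed
  then have "of_int k + 3/4 = shear 2 (1/4 + of_int k)" by (simp add: shear_add_int)
  also have "\<dots> \<le> shear a (1/4 + of_int k)" using assms by (intro shear_mono_a)
  also have "\<dots> \<le> shear a \<theta>" using assms by (intro shear_mono) simp
  finally show ?thesis .
qed

lemma shear_le_quarter:
  assumes "\<theta> \<le> of_int k + 3/4" "a \<le> - 2" shows "shear a \<theta> \<le> of_int k + 1/4"
proof -
  have "\<not> (of_int k + 1/4 < shear a \<theta>)"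
  proof
    assume "of_int k + 1/4 < shear a \<theta>"
    then have "shear (- a) (of_int k + 1/4) < \<theta>" by (simp add: less_shear_iff)
    moreover have "shear (- a) (of_int k + 1/4) \<ge> of_int k + 3/4"
      using assms by (intro shear_ge_quarter) auto
    ultimately show False using assms by linarith
  qed
  then show ?thesis by simp
qed

text \<open>One step of the Pruefer map at a site with potential \<open>v\<close>; at \<open>v = -\<infinity>\<close> it is the limit
  \<open>a \<rightarrow> \<infinity>\<close> of \<open>shear a\<close>.\<close>

definition pstep :: "real \<Rightarrow> ereal \<Rightarrow> real \<Rightarrow> real" where
  "pstep E v \<theta> = (if v = -\<infinity> then of_int \<lceil>\<theta> + 1/2\<rceil> else shear (E - real_of_ereal v) (\<theta> + 1/2))"

text \<open>Started at \<open>0\<close>, this is the angle of the pair of two consecutive box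
  determinants (see \<open>kont_angle\<close>), in units of \<open>pi\<close> and lifted to the
  line.\<close>

fun rot :: "(nat \<Rightarrow> ereal) \<Rightarrow> real \<Rightarrow> nat \<Rightarrow> real \<Rightarrow> real" where
  "rot V E 0 \<theta> = \<theta>"
| "rot V E (Suc n) \<theta> = pstep E (V n) (rot V E n \<theta>)"

lemma shear_le_ceiling: "shear a \<theta> \<le> of_int \<lceil>\<theta>\<rceil>"
proof (cases "\<theta> \<in> \<int>")
  case True then show ?thesis by (simp add: shear_int)
next
  case False
  then show ?thesis using shear_floor(2)[OF False, of a] by (simp add: ceiling_altdef) (metis Ints_of_int)
qed

lemma shear_ge_floor: "of_int \<lfloor>\<theta>\<rfloor> \<le> shear a \<theta>"
  using shear_floor_eq[of a \<theta>] by linarith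

lemma pstep_le_ceiling: "pstep E v \<theta> \<le> of_int \<lceil>\<theta> + 1/2\<rceil>"
  unfolding pstep_def using shear_le_ceiling by auto

lemma pstep_ge_ceiling: "pstep E v \<theta> \<ge> of_int \<lceil>\<theta> + 1/2\<rceil> - 1"
proof -
  have "of_int \<lceil>\<theta> + 1/2\<rceil> - 1 \<le> (of_int \<lfloor>\<theta> + 1/2\<rfloor> :: real)" by (simp add: ceiling_altdef)
  then show ?thesis unfolding pstep_def using shear_ge_floor[of "\<theta> + 1/2" "E - real_of_ereal v"] by auto
qed

lemma pstep_add_int: "pstep E v (\<theta> + of_int k) = pstep E v \<theta> + of_int k"
proof -
  have e: "\<theta> + of_int k + 1/2 = (\<theta> + 1/2) + of_int k" by simp
  show ?thesis unfolding pstep_def e shear_add_int by simp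
qed

lemma pstep_mono: "\<theta> \<le> \<phi> \<Longrightarrow> pstep E v \<theta> \<le> pstep E v \<phi>"
  unfolding pstep_def by (auto intro!: shear_mono ceiling_mono)

lemma pstep_mono_E: "E \<le> E' \<Longrightarrow> pstep E v \<theta> \<le> pstep E' v \<theta>"
  unfolding pstep_def by (auto intro!: shear_mono_a)

lemma rot_add_int: "rot V E n (\<theta> + of_int k) = rot V E n \<theta> + of_int k"
  by (induction n) (simp_all add: pstep_add_int)

lemma rot_mono: "\<theta> \<le> \<phi> \<Longrightarrow> rot V E n \<theta> \<le> rot V E n \<phi>"
  by (induction n) (simp_all add: pstep_mono)

lemma rot_mono_E: "E \<le> E' \<Longrightarrow> rot V E n \<theta> \<le> rot V E' n \<theta>"
proof (induction n)
  case (Suc n)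
  have "pstep E (V n) (rot V E n \<theta>) \<le> pstep E (V n) (rot V E' n \<theta>)" using Suc by (intro pstep_mono) auto
  also have "\<dots> \<le> pstep E' (V n) (rot V E' n \<theta>)" using Suc by (intro pstep_mono_E)
  finally show ?case by simp
qed simp

lemma rot_add: "rot V E (m + n) \<theta> = rot (\<lambda>j. V (m + j)) E n (rot V E m \<theta>)"
  by (induction n) simp_all

lemma rot_cong: "(\<And>j. j < n \<Longrightarrow> V j = W j) \<Longrightarrow> rot V E n \<theta> = rot W E n \<theta>"
  by (induction n) simp_all

text \<open>The number of half-integers \<open>k + 1/2\<close>, \<open>k \<ge> 0\<close>, strictly
  below the final angle. For finite potentials the determinant vanishes exactly at half-integer
  angles and the angle increases with \<open>E\<close>, so this counts eigenvalues below
  \<open>E\<close>; the formula also makes sense when an entry is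
  \<open>-\<infinity>\<close>.\<close>

definition ecount :: "(nat \<Rightarrow> ereal) \<Rightarrow> real \<Rightarrow> nat \<Rightarrow> int" where
  "ecount V E n = \<lceil>rot V E n 0 - 1/2\<rceil>"

text \<open>The slack \<open>1/4\<close> reproduces itself. With \<open>c\<close> low sites so far,
  the angle after adding \<open>1/2\<close> is at least \<open>c + 1/4\<close>; one more site below
  \<open>E - 2\<close> raises it to \<open>c + 3/4 = (c + 1) - 1/4\<close>, and any other site
  leaves it at least the integer \<open>c\<close>.\<close>

lemma rot_ge_card:
  assumes "\<And>j. V j \<noteq> \<infinity>"
  shows "rot V E n 0 \<ge> real (card {j. j < n \<and> V j < ereal (E - 2)}) - 1/4"
proof (induction n)
  case (Suc n)
  let ?c = "\<lambda>n. card {j. j < n \<and> V j < ereal (E - 2)}"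
  have eq: "{j. j < Suc n \<and> V j < ereal (E - 2)} =
     (if V n < ereal (E - 2) then insert n {j. j < n \<and> V j < ereal (E - 2)} else {j. j < n \<and> V j < ereal (E - 2)})"
    by (auto simp: less_Suc_eq)
  have th: "rot V E n 0 + 1/2 \<ge> of_int (int (?c n)) + 1/4" using Suc by simp
  show ?case
  proof (cases "V n < ereal (E - 2)")
    case True
    then have c: "?c (Suc n) = Suc (?c n)" unfolding eq by simp
    show ?thesis
    proof (cases "V n = -\<infinity>")
      case True
      have "int (?c n) + 1 \<le> \<lceil>rot V E n 0 + 1/2\<rceil>"
        using th unfolding le_ceiling_iff by simp
      then have "of_int (int (?c n) + 1) \<le> (of_int \<lceil>rot V E n 0 + 1/2\<rceil> :: real)"
        by (simp only: of_int_le_iff)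
      then show ?thesis using True c unfolding rot.simps pstep_def by simp
    next
      case False
      then obtain v where v: "V n = ereal v" using assms[of n] by (cases "V n") auto
      have "shear (E - v) (rot V E n 0 + 1/2) \<ge> of_int (int (?c n)) + 3/4"
        using th True v by (intro shear_ge_quarter) auto
      then show ?thesis using v c unfolding rot.simps pstep_def by simp
    qed
  next
    case False
    then have c: "?c (Suc n) = ?c n" unfolding eq by simp
    have "int (?c n) \<le> \<lfloor>rot V E n 0 + 1/2\<rfloor>" using th by (simp add: le_floor_iff)
    then have "real (?c n) \<le> of_int \<lfloor>rot V E n 0 + 1/2\<rfloor>" by (metis of_int_le_iff of_int_of_nat_eq)
    then show ?thesis using shear_ge_floor[of "rot V E n 0 + 1/2" "E - real_of_ereal (V n)"] False c
      unfolding rot.simps pstep_def by auto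
  qed
qed simp

lemma rot_le_card:
  assumes "\<And>j. V j \<noteq> \<infinity>"
  shows "rot V E n 0 \<le> real (card {j. j < n \<and> V j \<le> ereal (E + 2)}) + 1/4"
proof (induction n)
  case (Suc n)
  let ?c = "\<lambda>n. card {j. j < n \<and> V j \<le> ereal (E + 2)}"
  have eq: "{j. j < Suc n \<and> V j \<le> ereal (E + 2)} =
     (if V n \<le> ereal (E + 2) then insert n {j. j < n \<and> V j \<le> ereal (E + 2)} else {j. j < n \<and> V j \<le> ereal (E + 2)})"
    by (auto simp: less_Suc_eq)
  have th: "rot V E n 0 + 1/2 \<le> of_int (int (?c n)) + 3/4" using Suc by simp
  show ?case
  proof (cases "V n \<le> ereal (E + 2)")
    case True
    then have c: "?c (Suc n) = Suc (?c n)" unfolding eq by simp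
    have "\<lceil>rot V E n 0 + 1/2\<rceil> \<le> int (?c n) + 1" using th by (simp add: ceiling_le_iff)
    then have "(of_int \<lceil>rot V E n 0 + 1/2\<rceil> :: real) \<le> of_int (int (?c n) + 1)" by (simp only: of_int_le_iff)
    then show ?thesis using pstep_le_ceiling[of E "V n" "rot V E n 0"] c by simp
  next
    case False
    then obtain v where v: "V n = ereal v" using assms[of n] by (cases "V n") auto
    have "shear (E - v) (rot V E n 0 + 1/2) \<le> of_int (int (?c n)) + 1/4"
      using th False v by (intro shear_le_quarter) auto
    then show ?thesis using v False unfolding rot.simps pstep_def eq by simp
  qed
qed simp

lemma ecount_bounds:
  assumes "\<And>j. V j \<noteq> \<infinity>"
  shows "0 \<le> ecount V E n" "ecount V E n \<le> int n"
    "int (card {j. j < n \<and> V j < ereal (E - 2)}) \<le> ecount V E n"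
    "ecount V E n \<le> int (card {j. j < n \<and> V j \<le> ereal (E + 2)})"
proof -
  let ?c = "card {j. j < n \<and> V j < ereal (E - 2)}" and ?d = "card {j. j < n \<and> V j \<le> ereal (E + 2)}"
  show 1: "int ?c \<le> ecount V E n"
    using rot_ge_card[where V=V and n=n and E=E, OF assms] unfolding ecount_def by (simp add: le_ceiling_iff)
  show 2: "ecount V E n \<le> int ?d"
    using rot_le_card[where V=V and n=n and E=E, OF assms] unfolding ecount_def by (simp add: ceiling_le_iff)
  have "?d \<le> card {..<n}" by (intro card_mono) auto
  then show "0 \<le> ecount V E n" "ecount V E n \<le> int n" using 1 2 by auto
qed

lemma ecount_mono: "E \<le> E' \<Longrightarrow> ecount V E n \<le> ecount V E' n"
  unfolding ecount_def using rot_mono_E by (intro ceiling_mono) simp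

text \<open>The angle reached at site \<open>m\<close> lies between \<open>k - 1\<close> and
  \<open>k + 1\<close>, where \<open>k\<close> is the count so far. Since \<open>rot\<close> is
  monotone and commutes with integer translations, the remaining box behaves like one started at
  \<open>0\<close>, up to one eigenvalue.\<close>

lemma ecount_add: "\<bar>ecount V E (m + n) - ecount V E m - ecount (\<lambda>j. V (m + j)) E n\<bar> \<le> 1"
proof -
  define a where "a = rot V E m 0"
  define W where "W = (\<lambda>j. V (m + j))"
  define k where "k = \<lceil>a - 1/2\<rceil>"
  have "of_int (k - 1) \<le> a" "a \<le> of_int (k + 1)" unfolding k_def by (simp_all, linarith+)
  then have "rot W E n (0 + of_int (k - 1)) \<le> rot W E n a" "rot W E n a \<le> rot W E n (0 + of_int (k + 1))"
    by (auto intro: rot_mono)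
  then have "rot W E n 0 + of_int (k - 1) \<le> rot V E (m + n) 0" "rot V E (m + n) 0 \<le> rot W E n 0 + of_int (k + 1)"
    unfolding rot_add_int by (simp_all add: rot_add a_def W_def)
  then have "\<lceil>rot W E n 0 - 1/2 + of_int (k - 1)\<rceil> \<le> \<lceil>rot V E (m + n) 0 - 1/2\<rceil>"
     "\<lceil>rot V E (m + n) 0 - 1/2\<rceil> \<le> \<lceil>rot W E n 0 - 1/2 + of_int (k + 1)\<rceil>"
    by (intro ceiling_mono; simp)+
  then show ?thesis unfolding ecount_def W_def[symmetric] a_def[symmetric] k_def[symmetric] ceiling_add_of_int
    by linarith
qed

section \<open>Spectra of finite boxes\<close>

text \<open>The determinant of \<open>z\<close> minus the tridiagonal box with diagonal
  \<open>v\<close> and unit off-diagonal entries, expanded along the last row; \<open>kpoly\<close>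
  is the same as a polynomial.\<close>

fun kont :: "(nat \<Rightarrow> 'a::comm_ring_1) \<Rightarrow> 'a \<Rightarrow> nat \<Rightarrow> 'a" where
  "kont v z 0 = 1"
| "kont v z (Suc 0) = z - v 0"
| "kont v z (Suc (Suc n)) = (z - v (Suc n)) * kont v z (Suc n) - kont v z n"

fun kpoly :: "(nat \<Rightarrow> 'a::comm_ring_1) \<Rightarrow> nat \<Rightarrow> 'a poly" where
  "kpoly v 0 = 1"
| "kpoly v (Suc 0) = [:- v 0, 1:]"
| "kpoly v (Suc (Suc n)) = [:- v (Suc n), 1:] * kpoly v (Suc n) - kpoly v n"

lemma poly_kpoly: "poly (kpoly v n) z = kont v z n"
  by (induction v n rule: kpoly.induct) (simp_all add: algebra_simps)

lemma kpoly_monic: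
  fixes v :: "nat \<Rightarrow> 'a::idom"
  shows "degree (kpoly v n) = n \<and> coeff (kpoly v n) n = 1"
proof (induction v n rule: kpoly.induct)
  case (3 v n)
  have nz: "kpoly v (Suc n) \<noteq> 0" using 3 by auto
  let ?p = "[:- v (Suc n), 1:] * kpoly v (Suc n)"
  have dp: "degree ?p = Suc (Suc n)" using nz 3 by (subst degree_mult_eq) auto
  have "degree (?p - kpoly v n) \<le> Suc (Suc n)" using dp 3 by (intro degree_diff_le) auto
  moreover have "coeff (?p - kpoly v n) (Suc (Suc n)) = 1"
  proof -
    have "coeff ?p (Suc (Suc n)) = 1"
      using lead_coeff_mult[of "[:- v (Suc n), 1:]" "kpoly v (Suc n)"] dp 3 by simp
    moreover have "coeff (kpoly v n) (Suc (Suc n)) = 0" using 3 by (intro coeff_eq_0) auto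
    ultimately show ?thesis by simp
  qed
  ultimately have d1: "degree (?p - kpoly v n) \<le> Suc (Suc n)" and c1: "coeff (?p - kpoly v n) (Suc (Suc n)) = 1"
    by blast+
  have "Suc (Suc n) \<le> degree (?p - kpoly v n)" by (rule le_degree, subst c1, rule one_neq_zero)
  then show ?case unfolding kpoly.simps using d1 c1 by (intro conjI antisym)
qed auto

lemma monic_poly_eq_prod:
  fixes p :: "'a::{field} poly"
  assumes "degree p = n" "coeff p n = 1" "finite S" "card S = n" "\<And>x. x \<in> S \<Longrightarrow> poly p x = 0"
  shows "p = (\<Prod>x\<in>S. [:- x, 1:])"
proof (rule poly_eqI_degree_lead_coeff[where n = n and A = S])
  show "coeff p n = coeff (\<Prod>x\<in>S. [:- x, 1:]) n"
  proof -
    have "lead_coeff (\<Prod>x\<in>S. [:- x, 1:]) = 1" by (subst lead_coeff_prod) simp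
    moreover have "degree (\<Prod>x\<in>S. [:- x, 1::'a:]) = n" using assms by (subst degree_prod_eq_sum_degree) auto
    ultimately show ?thesis using assms by simp
  qed
  show "degree (\<Prod>x\<in>S. [:- x, 1::'a:]) \<le> n" using assms by (subst degree_prod_eq_sum_degree) auto
qed (use assms in \<open>auto simp: poly_prod\<close>)

lemma kont_of_real: "kont (\<lambda>i. complex_of_real (v i)) (of_real E) n = of_real (kont v E n)"
  by (induction v E n rule: kont.induct) simp_all

definition kprev :: "(nat \<Rightarrow> 'a::comm_ring_1) \<Rightarrow> 'a \<Rightarrow> nat \<Rightarrow> 'a" where
  "kprev v z n = (case n of 0 \<Rightarrow> 0 | Suc k \<Rightarrow> kont v z k)"

lemma kont_Suc: "kont v z (Suc n) = (z - v n) * kont v z n - kprev v z n"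
  by (cases n) (simp_all add: kprev_def)

text \<open>Polar coordinates for consecutive determinants. Written with \<open>shear_vec\<close>,
  each step of the recursion picks up a sign, which \<open>(- 1) ^ n\<close> collects. As
  \<open>\<rho>\<close> is positive, zeros of the determinant are exactly the half-integer
  angles.\<close>

lemma kont_angle:
  fixes v :: "nat \<Rightarrow> real" and E :: real
  defines "\<theta> \<equiv> \<lambda>n. rot (\<lambda>i. ereal (v i)) E n 0"
  shows "\<exists>\<rho>>0. kont v E n = (- 1) ^ n * \<rho> * cos (pi * \<theta> n) \<and> kprev v E n = (- 1) ^ Suc n * \<rho> * sin (pi * \<theta> n)"
proof (induction n)
  case 0 show ?case unfolding \<theta>_def kprev_def by (intro exI[of _ 1]) simp
next
  case (Suc n)
  then obtain \<rho> where r: "\<rho> > 0" "kont v E n = (- 1) ^ n * \<rho> * cos (pi * \<theta> n)"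
    "kprev v E n = (- 1) ^ Suc n * \<rho> * sin (pi * \<theta> n)" by blast
  define \<phi> where "\<phi> = \<theta> n + 1/2"
  define a where "a = E - v n"
  have cs: "cos (pi * \<theta> n) = sin (pi * \<phi>)" "sin (pi * \<theta> n) = - cos (pi * \<phi>)"
    unfolding \<phi>_def by (simp_all add: distrib_left sin_add cos_add)
  obtain c where c: "c > 0" "c * sin (pi * shear a \<phi>) = sin (pi * \<phi>)"
    "c * cos (pi * shear a \<phi>) = cos (pi * \<phi>) - a * sin (pi * \<phi>)" by (rule shear_vec)
  have th: "\<theta> (Suc n) = shear a \<phi>" unfolding \<theta>_def \<phi>_def a_def by (simp add: pstep_def)
  have "kont v E (Suc n) = (- 1) ^ n * \<rho> * (a * sin (pi * \<phi>) - cos (pi * \<phi>))"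
    unfolding kont_Suc r cs a_def by (simp add: algebra_simps)
  also have "\<dots> = (- 1) ^ Suc n * (\<rho> * c) * cos (pi * \<theta> (Suc n))"
    unfolding th by (simp add: mult.assoc c(3)) (simp add: algebra_simps)
  finally have 1: "kont v E (Suc n) = (- 1) ^ Suc n * (\<rho> * c) * cos (pi * \<theta> (Suc n))" .
  have "kprev v E (Suc n) = (- 1) ^ n * \<rho> * sin (pi * \<phi>)" unfolding kprev_def using r cs by simp
  also have "\<dots> = (- 1) ^ Suc (Suc n) * (\<rho> * c) * sin (pi * \<theta> (Suc n))"
    unfolding th using c(2) by (simp add: algebra_simps)
  finally show ?case using 1 r(1) c(1) by (intro exI[of _ "\<rho> * c"]) simp
qed

lemma isCont_rot: "isCont (\<lambda>E. rot (\<lambda>i. ereal (v i)) E n 0) E"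
proof (induction n)
  case (Suc n)
  then show ?case unfolding isCont_def rot.simps pstep_def
    by (auto intro!: tendsto_shear tendsto_intros)
qed simp

lemma rot_strict_mono_E:
  assumes "E < E'" "n > 0"
  shows "rot (\<lambda>i. ereal (v i)) E n 0 < rot (\<lambda>i. ereal (v i)) E' n 0"
  using assms(2)
proof (induction n rule: nat_induct_non_zero)
  case 1
  have "(1/2::real) \<notin> \<int>" by (auto elim!: Ints_cases)
  then show ?case using assms by (auto simp: pstep_def intro: shear_strict_a)
next
  case (Suc n)
  let ?t = "\<lambda>E. rot (\<lambda>i. ereal (v i)) E n 0"
  have "shear (E - v n) (?t E + 1/2) < shear (E - v n) (?t E' + 1/2)"
    using Suc by (intro shear_strict_mono) simp
  also have "\<dots> \<le> shear (E' - v n) (?t E' + 1/2)" using assms by (intro shear_mono_a) simp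
  finally show ?case by (simp add: pstep_def)
qed

text \<open>The eigenvalue number \<open>j\<close> is the energy at which the angle equals
  \<open>j + 1/2\<close>. It exists by the intermediate value theorem, the angle being at most
  \<open>1/4\<close> below all \<open>v i\<close> and at least \<open>n - 1/4\<close> above them,
  and the order follows from strict monotonicity in the energy.\<close>

lemma finite_spectrum:
  fixes v :: "nat \<Rightarrow> real"
  obtains e :: "nat \<Rightarrow> real" where
    "\<And>j s. j < n \<Longrightarrow> e j < s \<longleftrightarrow> int j < ecount (\<lambda>i. ereal (v i)) s n"
    "\<And>i j. i < j \<Longrightarrow> j < n \<Longrightarrow> e i < e j"
    "\<And>j. j < n \<Longrightarrow> kont v (e j) n = 0"
proof -
  let ?V = "\<lambda>i. ereal (v i)"
  let ?t = "\<lambda>E. rot ?V E n 0"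
  have ex: "\<exists>E. ?t E = real j + 1/2" if j: "j < n" for j
  proof -
    define m where "m = Min (v ` {..<n})"
    define M where "M = Max (v ` {..<n})"
    have mM: "m \<le> v i" "v i \<le> M" if "i < n" for i unfolding m_def M_def using that by auto
    have "n > 0" using j by simp
    have "m \<le> M" using mM[OF j] by linarith
    have none: "{j. j < n \<and> ?V j \<le> ereal (m - 3 + 2)} = {}" using mM by force
    have all: "{j. j < n \<and> ?V j < ereal (M + 3 - 2)} = {..<n}" using mM by force
    have "?t (m - 3) \<le> 1/4" using rot_le_card[where V="?V" and n=n and E="m - 3"] unfolding none by simp
    then have lo: "?t (m - 3) \<le> real j + 1/2" by simp
    have "?t (M + 3) \<ge> real n - 1/4" using rot_ge_card[where V="?V" and n=n and E="M + 3"] unfolding all by simp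
    moreover have "real j + 1 \<le> real n" using j by linarith
    ultimately have hi: "real j + 1/2 \<le> ?t (M + 3)" by linarith
    show ?thesis using IVT[of ?t "m - 3" "real j + 1/2" "M + 3", OF lo hi] \<open>m \<le> M\<close> isCont_rot by auto
  qed
  define e where "e j = (SOME E. ?t E = real j + 1/2)" for j
  have e: "?t (e j) = real j + 1/2" if "j < n" for j
    unfolding e_def using someI_ex[OF ex[OF that]] .
  have lt: "a < b \<longleftrightarrow> ?t a < ?t b" if "n > 0" for a b
    using rot_strict_mono_E[OF _ that] by (metis linorder_less_linear order_less_asym)
  show ?thesis
  proof (rule that[of e])
    fix j s assume j: "j < n"
    have "e j < s \<longleftrightarrow> real j + 1/2 < ?t s" using lt[of "e j" s] e[OF j] j by simp
    also have "\<dots> \<longleftrightarrow> int j < ecount ?V s n" unfolding ecount_def less_ceiling_iff by auto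
    finally show "e j < s \<longleftrightarrow> int j < ecount ?V s n" .
  next
    fix i j assume ij: "i < j" "j < n"
    then show "e i < e j" using lt[of "e i" "e j"] e[of i] e[of j] by simp
  next
    fix j assume j: "j < n"
    obtain \<rho> where r: "kont v (e j) n = (- 1) ^ n * \<rho> * cos (pi * ?t (e j))" using kont_angle by blast
    have "cos (pi * (real j + 1/2)) = 0" by (simp add: distrib_left cos_add)
    then show "kont v (e j) n = 0" using r e[OF j] by simp
  qed
qed

lemma kont_complex_prod:
  assumes inj: "\<And>i j. i < j \<Longrightarrow> j < n \<Longrightarrow> e i < (e j :: real)" and root: "\<And>j. j < n \<Longrightarrow> kont v (e j) n = 0"
  shows "kont (\<lambda>i. complex_of_real (v i)) z n = (\<Prod>j<n. z - of_real (e j))"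
    "kont v E n = (\<Prod>j<n. E - e j)"
proof -
  let ?f = "\<lambda>j. complex_of_real (e j)"
  have i1: "inj_on e {..<n}" by (rule inj_onI) (metis inj lessThan_iff linorder_neqE_nat less_irrefl)
  then have i2: "inj_on ?f {..<n}" by (auto simp: inj_on_def)
  have "kpoly (\<lambda>i. complex_of_real (v i)) n = (\<Prod>x\<in>?f ` {..<n}. [:- x, 1:])"
    by (rule monic_poly_eq_prod[where n = n])
      (use kpoly_monic i2 root in \<open>auto simp: card_image poly_kpoly kont_of_real\<close>)
  then have "kont (\<lambda>i. complex_of_real (v i)) z n = poly (\<Prod>x\<in>?f ` {..<n}. [:- x, 1:]) z"
    by (metis poly_kpoly)
  also have "\<dots> = (\<Prod>j<n. z - of_real (e j))" using i2 by (simp add: prod.reindex poly_prod)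
  finally show "kont (\<lambda>i. complex_of_real (v i)) z n = (\<Prod>j<n. z - of_real (e j))" .
  have "kpoly v n = (\<Prod>x\<in>e ` {..<n}. [:- x, 1:])"
    by (rule monic_poly_eq_prod[where n = n])
      (use kpoly_monic i1 root in \<open>auto simp: card_image poly_kpoly\<close>)
  then have "kont v E n = poly (\<Prod>x\<in>e ` {..<n}. [:- x, 1:]) E" by (metis poly_kpoly)
  also have "\<dots> = (\<Prod>j<n. E - e j)" using i1 by (simp add: prod.reindex poly_prod)
  finally show "kont v E n = (\<Prod>j<n. E - e j)" .
qed

text \<open>Far from the potential the off-diagonal entries are a small perturbation: the previous
  determinant is at most \<open>1 / (R - 1)\<close> times the current one, so a step multiplies by
  \<open>z - v n\<close> up to the relative error \<open>x = 1 / (R * (R - 1))\<close>, and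
  \<open>2 * x \<le> 1 / R\<close> bounds its logarithm. It is applied at \<open>z = E + iR\<close>,
  which has distance at least \<open>R\<close> from every real number.\<close>

lemma kont_imag:
  fixes v :: "nat \<Rightarrow> complex"
  assumes R: "R \<ge> 3" and far: "\<And>j. j < n \<Longrightarrow> cmod (z - v j) \<ge> R"
  shows "kont v z n \<noteq> 0 \<and> \<bar>ln (cmod (kont v z n)) - (\<Sum>j<n. ln (cmod (z - v j)))\<bar> \<le> real n / R
     \<and> cmod (kprev v z n) * (R - 1) \<le> cmod (kont v z n)"
  using far
proof (induction n)
  case 0 show ?case by (simp add: kprev_def)
next
  case (Suc n)
  let ?k = "cmod (kont v z n)" and ?k' = "cmod (kont v z (Suc n))" and ?d = "cmod (z - v n)"
  have IH: "kont v z n \<noteq> 0" "\<bar>ln ?k - (\<Sum>j<n. ln (cmod (z - v j)))\<bar> \<le> real n / R"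
    "cmod (kprev v z n) * (R - 1) \<le> ?k" using Suc by auto
  have d: "?d \<ge> R" using Suc by simp
  have k: "?k > 0" using IH by simp
  have kp: "cmod (kprev v z n) \<le> ?k / (R - 1)" using IH R by (simp add: field_simps)
  have k1: "?k / (R - 1) \<le> ?k * 1" using R k by (simp add: field_simps)
  have tri: "\<bar>?k' - ?d * ?k\<bar> \<le> cmod (kprev v z n)"
    unfolding kont_Suc by (metis norm_minus_commute norm_mult norm_triangle_ineq3 diff_diff_eq2 add_diff_cancel_left')
  have "?d * ?k \<ge> R * ?k" using d k by (intro mult_right_mono) auto
  then have low: "(R - 1) * ?k \<le> ?k'" using tri kp k1 by (simp add: algebra_simps)
  then have k': "?k' > 0" using k R by (smt (verit) mult_pos_pos)
  define x where "x = 1 / (R * (R - 1))"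
  have RR: "R * (R - 1) > 0" "R * (R - 1) \<ge> 6" using R mult_mono[of 3 R 2 "R - 1"] by auto
  then have x: "0 < x" "x \<le> 1/6" unfolding x_def by (simp_all add: field_simps)
  have x2: "2 * x \<le> 1 / R" unfolding x_def using R by (simp add: field_simps)
  define y where "y = ?k' / (?d * ?k)"
  have dk: "?d * ?k > 0" using d k R by (intro mult_pos_pos) auto
  have "?k / (R - 1) = R * ?k * x" unfolding x_def using R by (simp add: field_simps)
  also have "\<dots> \<le> ?d * ?k * x" using d k x by (intro mult_right_mono) auto
  finally have "\<bar>?k' - ?d * ?k\<bar> \<le> ?d * ?k * x" using tri kp by linarith
  then have "\<bar>?k' - ?d * ?k\<bar> / (?d * ?k) \<le> x" using dk by (simp add: field_simps)
  moreover have "\<bar>y - 1\<bar> = \<bar>?k' - ?d * ?k\<bar> / (?d * ?k)"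
  proof -
    have "y - 1 = (?k' - ?d * ?k) / (?d * ?k)" unfolding y_def diff_divide_distrib
      using divide_self[OF less_imp_neq[OF dk, symmetric]] by simp
    then show ?thesis using dk by (simp only: abs_divide abs_of_pos)
  qed
  ultimately have y: "\<bar>y - 1\<bar> \<le> x" by simp
  have y0: "y > 0" unfolding y_def using k' dk by simp
  have "ln y \<le> y - 1" using y0 by (rule ln_le_minus_one)
  moreover have "- ln y \<le> 1 / y - 1" using ln_le_minus_one[of "1 / y"] y0 by (simp add: ln_div)
  moreover have "1 / y - 1 \<le> 2 * x"
  proof -
    have "1 / y \<le> 1 / (1 - x)" using y x by (intro divide_left_mono) (auto intro: mult_pos_pos)
    moreover have "1 / (1 - x) \<le> 1 + 2 * x" 
    proof -
      have "(1 + 2 * x) * (1 - x) = 1 + x * (1 - 2 * x)" by (simp add: algebra_simps)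
      also have "\<dots> \<ge> 1" using x by simp
      finally show ?thesis using x by (simp add: field_simps)
    qed
    ultimately show ?thesis by simp
  qed
  ultimately have "\<bar>ln y\<bar> \<le> 1 / R" using y x x2 by linarith
  moreover have "ln ?k' = ln y + (ln ?d + ln ?k)"
  proof -
    have "?d * ?k \<noteq> 0" using dk by linarith
    then have "?k' = y * (?d * ?k)" using nonzero_eq_divide_eq[of "?d * ?k" y ?k'] y_def by metis
    then have "ln ?k' = ln (y * (?d * ?k))" by simp
    also have "\<dots> = ln y + ln (?d * ?k)" using y0 dk by (rule ln_mult_pos)
    also have "ln (?d * ?k) = ln ?d + ln ?k" using d k R by (intro ln_mult_pos) auto
    finally show ?thesis .
  qed
  ultimately have "\<bar>ln ?k' - (\<Sum>j<Suc n. ln (cmod (z - v j)))\<bar> \<le> real n / R + 1 / R"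
    using IH(2) unfolding sum.lessThan_Suc by linarith
  moreover have "real n / R + 1 / R = real (Suc n) / R" by (simp add: add_divide_distrib)
  moreover have "cmod (kprev v z (Suc n)) = ?k" by (simp add: kprev_def)
  ultimately show ?case using k' low by (simp add: mult.commute)
qed

section \<open>Normalised boxes\<close>

text \<open>Equal to \<open>|E + iR - x| / R\<close>. Dividing row \<open>j\<close> of the box by
  its weight keeps all entries bounded, whatever the potential.\<close>

definition wgt :: "real \<Rightarrow> real \<Rightarrow> real \<Rightarrow> real" where
  "wgt R E x = sqrt (1 + ((E - x) / R)\<^sup>2)"

text \<open>The value \<open>R\<close> is the limit of \<open>(E - x) / wgt R E x\<close> as
  \<open>x\<close> tends to \<open>-\<infinity>\<close>. In the same limit the weight
  \<open>shop\<close> of the off-diagonal entries tends to \<open>0\<close>, so such a site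
  decouples the box.\<close>

definition sdiag :: "real \<Rightarrow> real \<Rightarrow> ereal \<Rightarrow> real" where
  "sdiag R E x = (if x = -\<infinity> then R else (E - real_of_ereal x) / wgt R E (real_of_ereal x))"

definition shop :: "real \<Rightarrow> real \<Rightarrow> ereal \<Rightarrow> real" where
  "shop R E x = (if x = -\<infinity> then 0 else 1 / wgt R E (real_of_ereal x))"

lemma wgt_ge1: "wgt R E x \<ge> 1" unfolding wgt_def by simp

lemma shop_bounds: "0 \<le> shop R E x" "shop R E x \<le> 1"
  using wgt_ge1[of R E "real_of_ereal x"] unfolding shop_def by auto

text \<open>The determinant of the tridiagonal matrix with diagonal entry \<open>u j\<close> and, up
  to sign, both neighbouring entries \<open>w j\<close> in row \<open>j\<close>.\<close>

fun tcont :: "(nat \<Rightarrow> real) \<Rightarrow> (nat \<Rightarrow> real) \<Rightarrow> nat \<Rightarrow> real" where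
  "tcont u w 0 = 1"
| "tcont u w (Suc 0) = u 0"
| "tcont u w (Suc (Suc n)) = u (Suc n) * tcont u w (Suc n) - w (Suc n) * w n * tcont u w n"

lemma tcont_cong:
  "(\<And>j. j < n \<Longrightarrow> u j = u' j) \<Longrightarrow> (\<And>j. j < n \<Longrightarrow> w j = w' j) \<Longrightarrow> tcont u w n = tcont u' w' n"
  by (induction u w n rule: tcont.induct) auto

text \<open>A row without off-diagonal entries makes the matrix block triangular, so the determinant
  factors. This is applied to a site with potential \<open>-\<infinity>\<close>.\<close>

lemma tcont_split:
  assumes "w b = 0"
  shows "tcont u w (Suc b + n) = u b * tcont u w b * tcont (\<lambda>j. u (Suc b + j)) (\<lambda>j. w (Suc b + j)) n"
proof -
  have b: "tcont u w (Suc b) = u b * tcont u w b" using assms by (cases b) auto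
  show ?thesis
  proof (induction n rule: less_induct)
    case (less n)
    consider "n = 0" | "n = Suc 0" | m where "n = Suc (Suc m)" by (metis not0_implies_Suc)
    then show ?case
    proof cases
      case 1 then show ?thesis using b by simp
    next
      case 2
      have "tcont u w (Suc (Suc b)) = u (Suc b) * tcont u w (Suc b)" using assms by simp
      then show ?thesis using 2 b by simp
    next
      case (3 m)
      have e: "Suc b + n = Suc (Suc (Suc b + m))" using 3 by simp
      have "tcont u w (Suc b + n) = u (Suc (Suc b + m)) * tcont u w (Suc (Suc b + m))
         - w (Suc (Suc b + m)) * w (Suc b + m) * tcont u w (Suc b + m)" unfolding e by simp
      also have "tcont u w (Suc b + m) = u b * tcont u w b * tcont (\<lambda>j. u (Suc b + j)) (\<lambda>j. w (Suc b + j)) m"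
        using less[of m] 3 by simp
      also have "tcont u w (Suc (Suc b + m)) = u b * tcont u w b * tcont (\<lambda>j. u (Suc b + j)) (\<lambda>j. w (Suc b + j)) (Suc m)"
        using less[of "Suc m"] 3 by simp
      finally show ?thesis unfolding 3 by (simp add: algebra_simps)
    qed
  qed
qed

definition pbox :: "real \<Rightarrow> real \<Rightarrow> (nat \<Rightarrow> ereal) \<Rightarrow> nat \<Rightarrow> real" where
  "pbox R E V n = tcont (\<lambda>j. sdiag R E (V j)) (\<lambda>j. shop R E (V j)) n"

lemma pbox_finite:
  "pbox R E (\<lambda>i. ereal (v i)) n * (\<Prod>j<n. wgt R E (v j)) = kont v E n"
proof -
  have w: "wgt R E x \<noteq> 0" for E x using wgt_ge1[of R E x] by simp
  show ?thesis
  proof (induction v E n rule: kont.induct)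
    case (3 v E n)
    let ?p = "pbox R E (\<lambda>i. ereal (v i))" and ?w = "\<lambda>j. wgt R E (v j)"
    have "?p (Suc (Suc n)) * (\<Prod>j<Suc (Suc n). ?w j)
       = (E - v (Suc n)) * (?p (Suc n) * (\<Prod>j<Suc n. ?w j)) - ?p n * (\<Prod>j<n. ?w j)"
      unfolding pbox_def by (simp add: sdiag_def shop_def field_simps w)
    then show ?case using 3 by simp
  qed (use w in \<open>auto simp: pbox_def sdiag_def shop_def\<close>)
qed

text \<open>This is \<open>ln |E + iR - x| - ln |E - x|\<close>, the contribution of an eigenvalue
  \<open>x\<close> to the difference of the log-determinants at \<open>E + iR\<close> and at
  \<open>E\<close>.\<close>

definition loggap :: "real \<Rightarrow> real \<Rightarrow> real \<Rightarrow> real" where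
  "loggap R E x = ln ((E - x)\<^sup>2 + R\<^sup>2) / 2 - ln \<bar>E - x\<bar>"

text \<open>The list \<open>es\<close> holds the finite eigenvalues, \<open>m\<close> the number of
  eigenvalues \<open>-\<infinity>\<close>. The last clause compares the determinant at
  \<open>E\<close> with that at \<open>E + iR\<close>, known up to \<open>n / R\<close> by
  \<open>kont_imag\<close>. An eigenvalue \<open>-\<infinity>\<close> has gap zero and contributes
  only its \<open>ln R\<close> in \<open>n * ln R\<close>.\<close>

definition spectral_data :: "(nat \<Rightarrow> ereal) \<Rightarrow> nat \<Rightarrow> real list \<Rightarrow> nat \<Rightarrow> bool" where
  "spectral_data V n es m \<longleftrightarrow> sorted es \<and> length es + m = n \<and>
     (\<forall>s. ecount V s n = int m + int (length (filter (\<lambda>e. e < s) es))) \<and>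
     (\<forall>R E. R \<ge> 3 \<longrightarrow> (E \<in> set es \<longrightarrow> pbox R E V n = 0) \<and>
        (E \<notin> set es \<longrightarrow> pbox R E V n \<noteq> 0 \<and>
          \<bar>ln \<bar>pbox R E V n\<bar> - (real n * ln R - (\<Sum>e\<leftarrow>es. loggap R E e))\<bar> \<le> real n / R))"

lemma ln_cmod_imag: "ln (cmod (Complex a R)) = ln (a\<^sup>2 + R\<^sup>2) / 2" if "R > 0"
proof -
  have "a\<^sup>2 + R\<^sup>2 > 0" using that by (simp add: add_nonneg_pos)
  then show ?thesis unfolding cmod_def by (simp add: ln_sqrt)
qed

lemma finite_spectral_data:
  fixes v :: "nat \<Rightarrow> real"
  shows "\<exists>es. spectral_data (\<lambda>i. ereal (v i)) n es 0"
proof -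
  let ?V = "\<lambda>i. ereal (v i)"
  obtain e where e: "\<And>j s. j < n \<Longrightarrow> e j < s \<longleftrightarrow> int j < ecount ?V s n"
    "\<And>i j. i < j \<Longrightarrow> j < n \<Longrightarrow> e i < e j" "\<And>j. j < n \<Longrightarrow> kont v (e j) n = 0"
    using finite_spectrum by blast
  define es where "es = map e [0..<n]"
  have sorted: "sorted es" unfolding es_def sorted_iff_nth_mono_less using e(2) by (force intro: less_imp_le)
  have set: "set es = e ` {..<n}" unfolding es_def by auto
  have cnt: "ecount ?V s n = int (length (filter (\<lambda>e. e < s) es))" for s
  proof -
    have b: "0 \<le> ecount ?V s n" "ecount ?V s n \<le> int n" using ecount_bounds[of ?V] by auto
    have "length (filter (\<lambda>e. e < s) es) = card {j. j < length es \<and> es ! j < s}"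
      by (rule length_filter_conv_card)
    also have "{j. j < length es \<and> es ! j < s} = {..<nat (ecount ?V s n)}"
      using e(1) b unfolding es_def by auto
    finally show ?thesis using b by simp
  qed
  have main: "(E \<in> set es \<longrightarrow> pbox R E ?V n = 0) \<and> (E \<notin> set es \<longrightarrow> pbox R E ?V n \<noteq> 0 \<and>
          \<bar>ln \<bar>pbox R E ?V n\<bar> - (real n * ln R - (\<Sum>e\<leftarrow>es. loggap R E e))\<bar> \<le> real n / R)"
    if R: "R \<ge> 3" for R E
  proof -
    let ?W = "\<Prod>j<n. wgt R E (v j)"
    have wp: "wgt R E x > 0" for x using wgt_ge1[of R E x] by linarith
    then have W: "?W > 0" by (intro prod_pos) auto
    have pk: "pbox R E ?V n * ?W = kont v E n" by (rule pbox_finite)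
    have kE: "kont v E n = (\<Prod>j<n. E - e j)" using kont_complex_prod(2)[OF e(2,3)] .
    show ?thesis
    proof (intro conjI impI)
      assume "E \<in> set es"
      then have "kont v E n = 0" unfolding kE set by (auto simp: prod_zero_iff)
      then show "pbox R E ?V n = 0" using pk W by (metis less_irrefl mult_eq_0_iff)
    next
      assume "E \<notin> set es"
      then have ne: "E - e j \<noteq> 0" if "j < n" for j using that unfolding set by auto
      then have k0: "kont v E n \<noteq> 0" unfolding kE by (auto simp: prod_zero_iff)
      then show p0: "pbox R E ?V n \<noteq> 0" using pk by auto
      have "\<bar>pbox R E ?V n\<bar> * ?W = (\<Prod>j<n. \<bar>E - e j\<bar>)"
        using arg_cong[OF pk, of abs] unfolding kE abs_mult abs_of_pos[OF W] by (simp only: abs_prod)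
      then have "ln (\<bar>pbox R E ?V n\<bar> * ?W) = ln (\<Prod>j<n. \<bar>E - e j\<bar>)" by simp
      then have "ln \<bar>pbox R E ?V n\<bar> + ln ?W = (\<Sum>j<n. ln \<bar>E - e j\<bar>)"
        using p0 W ne by (subst ln_prod[symmetric]) (auto simp: ln_mult_pos)
      moreover have "ln ?W = (\<Sum>j<n. ln (wgt R E (v j)))" using wp
        by (subst ln_prod) (auto simp: less_imp_neq[OF wp, symmetric])
      moreover have "ln (wgt R E x) = ln ((E - x)\<^sup>2 + R\<^sup>2) / 2 - ln R" for x
      proof -
        have "wgt R E x = sqrt (((E - x)\<^sup>2 + R\<^sup>2) / R\<^sup>2)" unfolding wgt_def using R by (simp add: field_simps)
        then have "ln (wgt R E x) = ln (((E - x)\<^sup>2 + R\<^sup>2) / R\<^sup>2) / 2" using R by (simp add: ln_sqrt add_nonneg_pos)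
        also have "\<dots> = (ln ((E - x)\<^sup>2 + R\<^sup>2) - ln (R\<^sup>2)) / 2" using R by (subst ln_div) (auto simp: add_nonneg_pos)
        also have "ln (R\<^sup>2) = 2 * ln R" using R by (simp add: ln_realpow)
        finally show ?thesis by (simp add: diff_divide_distrib)
      qed
      ultimately have lp: "ln \<bar>pbox R E ?V n\<bar> = (\<Sum>j<n. ln \<bar>E - e j\<bar>) - (\<Sum>j<n. ln ((E - v j)\<^sup>2 + R\<^sup>2) / 2) + real n * ln R"
        by (simp add: sum_subtractf)
      \<comment> \<open>At \<open>E + iR\<close> the determinant is evaluated twice, as a product
        over the eigenvalues \<open>e j\<close> and by \<open>kont_imag\<close> over the potential
        \<open>v j\<close>. This trades the sum over \<open>v j\<close>, which comes from the
        weights, for one over \<open>e j\<close>.\<close>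
      define z where "z = Complex E R"
      have zz: "z - complex_of_real a = Complex (E - a) R" for a unfolding z_def by (simp add: complex_eq_iff)
      have cz: "ln (cmod (z - complex_of_real a)) = ln ((E - a)\<^sup>2 + R\<^sup>2) / 2" for a
        unfolding zz using R by (intro ln_cmod_imag) simp
      have far: "cmod (z - complex_of_real a) \<ge> R" for a
        unfolding zz using abs_Im_le_cmod[of "Complex (E - a) R"] by simp
      have "\<bar>ln (cmod (kont (\<lambda>i. complex_of_real (v i)) z n)) - (\<Sum>j<n. ln (cmod (z - complex_of_real (v j))))\<bar> \<le> real n / R"
        using kont_imag[of R n z "\<lambda>i. complex_of_real (v i)"] R far by blast
      moreover have "ln (cmod (kont (\<lambda>i. complex_of_real (v i)) z n)) = (\<Sum>j<n. ln (cmod (z - complex_of_real (e j))))"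
      proof -
        have "cmod (z - complex_of_real a) > 0" for a using far[of a] R by linarith
        moreover have "cmod (kont (\<lambda>i. complex_of_real (v i)) z n) = (\<Prod>j<n. cmod (z - complex_of_real (e j)))"
          using kont_complex_prod(1)[of n e v z, OF e(2,3)] by (simp add: prod_norm)
        ultimately show ?thesis by (simp only:) (rule ln_prod, auto)
      qed
      ultimately have "\<bar>(\<Sum>j<n. ln ((E - e j)\<^sup>2 + R\<^sup>2) / 2) - (\<Sum>j<n. ln ((E - v j)\<^sup>2 + R\<^sup>2) / 2)\<bar> \<le> real n / R"
        unfolding cz by simp
      moreover have "(\<Sum>e\<leftarrow>es. loggap R E e) = (\<Sum>j<n. ln ((E - e j)\<^sup>2 + R\<^sup>2) / 2) - (\<Sum>j<n. ln \<bar>E - e j\<bar>)"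
        unfolding es_def loggap_def by (simp add: interv_sum_list_conv_sum_set_nat atLeast0LessThan sum_subtractf)
      ultimately show "\<bar>ln \<bar>pbox R E ?V n\<bar> - (real n * ln R - (\<Sum>e\<leftarrow>es. loggap R E e))\<bar> \<le> real n / R"
        unfolding lp by linarith
    qed
  qed
  show ?thesis unfolding spectral_data_def using sorted cnt main by (intro exI[of _ es]) (simp add: es_def)
qed

lemma spectral_data_cong:
  assumes "\<And>j. j < n \<Longrightarrow> V j = W j" "spectral_data W n es m"
  shows "spectral_data V n es m"
proof -
  have "ecount V s n = ecount W s n" for s unfolding ecount_def using rot_cong[OF assms(1)] by simp
  moreover have "pbox R E V n = pbox R E W n" for R E unfolding pbox_def using assms(1) by (intro tcont_cong) auto
  ultimately show ?thesis using assms(2) unfolding spectral_data_def by simp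
qed

text \<open>At a site \<open>-\<infinity>\<close> the angle is rounded up to an integer and forgets
  its past: the rest of the box restarts at \<open>0\<close> modulo an integer translation, and the
  rounding contributes one eigenvalue.\<close>

lemma ecount_split:
  assumes "V b = -\<infinity>"
  shows "ecount V E (Suc b + n) = ecount V E b + 1 + ecount (\<lambda>j. V (Suc b + j)) E n"
proof -
  have e: "rot V E b 0 + 1/2 = (rot V E b 0 - 1/2) + of_int 1" by simp
  have "rot V E (Suc b) 0 = of_int (\<lceil>rot V E b 0 + 1/2\<rceil>)" using assms by (simp add: pstep_def)
  also have "\<lceil>rot V E b 0 + 1/2\<rceil> = ecount V E b + 1"
    unfolding ecount_def e ceiling_add_of_int ..
  finally have b: "rot V E (Suc b) 0 = 0 + of_int (ecount V E b + 1)" by simp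
  have "rot V E (Suc b + n) 0 = rot (\<lambda>j. V (Suc b + j)) E n 0 + of_int (ecount V E b + 1)"
    unfolding rot_add[of V E "Suc b"] b rot_add_int ..
  then have r: "rot V E (Suc b + n) 0 - 1/2 = rot (\<lambda>j. V (Suc b + j)) E n 0 - 1/2 + of_int (ecount V E b + 1)"
    by simp
  show ?thesis unfolding ecount_def[of V E "Suc b + n"] r ceiling_add_of_int
    unfolding ecount_def[of "\<lambda>j. V (Suc b + j)"] by simp
qed

text \<open>A site \<open>-\<infinity>\<close> splits the box into two finite boxes, whose
  eigenvalue lists are merged. The factor \<open>R\<close> that \<open>sdiag\<close> leaves at the
  site supplies the \<open>ln R\<close> of the eigenvalue \<open>-\<infinity>\<close>.\<close>

lemma box_spectrum:
  assumes inf: "\<And>j. V j \<noteq> \<infinity>" and one: "\<And>i j. i < n \<Longrightarrow> j < n \<Longrightarrow> V i = -\<infinity> \<Longrightarrow> V j = -\<infinity> \<Longrightarrow> i = j"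
  shows "\<exists>es m. spectral_data V n es m"
proof (cases "\<exists>b<n. V b = -\<infinity>")
  case False
  have "V j = ereal (real_of_ereal (V j))" if "j < n" for j using False inf[of j] that by (cases "V j") auto
  moreover obtain es where "spectral_data (\<lambda>j. ereal (real_of_ereal (V j))) n es 0"
    using finite_spectral_data[of "\<lambda>j. real_of_ereal (V j)" n] by blast
  ultimately have "spectral_data V n es 0" using spectral_data_cong by metis
  then show ?thesis by blast
next
  case True
  then obtain b where b: "b < n" "V b = -\<infinity>" by blast
  define k where "k = n - Suc b"
  have n: "n = Suc b + k" using b unfolding k_def by simp
  let ?U = "\<lambda>j. V (Suc b + j)"
  have "V j = ereal (real_of_ereal (V j))" if "j < n" "j \<noteq> b" for j
    using one[OF that(1) b(1)] that b(2) inf[of j] by (cases "V j") auto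
  then have 1: "V j = ereal (real_of_ereal (V j))" if "j < b" for j using that b by auto
  have 2: "?U j = ereal (real_of_ereal (?U j))" if "j < k" for j
    using \<open>\<And>j. \<lbrakk>j < n; j \<noteq> b\<rbrakk> \<Longrightarrow> V j = ereal (real_of_ereal (V j))\<close>[of "Suc b + j"] that n by simp
  obtain l where l: "spectral_data V b l 0"
    using finite_spectral_data[of "\<lambda>j. real_of_ereal (V j)" b] spectral_data_cong[of b V, OF 1] by blast
  obtain r where r: "spectral_data ?U k r 0"
    using finite_spectral_data[of "\<lambda>j. real_of_ereal (?U j)" k] spectral_data_cong[of k ?U, OF 2] by blast
  define es where "es = sort (l @ r)"
  have pb: "pbox R E V n = R * pbox R E V b * pbox R E ?U k" for R E
    unfolding pbox_def n by (subst tcont_split) (use b in \<open>auto simp: shop_def sdiag_def\<close>)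
  have "mset (filter P es) = mset (filter P l) + mset (filter P r)" for P unfolding es_def by simp
  then have len: "length (filter P es) = length (filter P l) + length (filter P r)" for P
    by (metis size_mset size_union)
  have "mset (map g es) = mset (map g l) + mset (map g r)" for g :: "real \<Rightarrow> real" unfolding es_def by simp
  then have sm: "(\<Sum>e\<leftarrow>es. g e) = (\<Sum>e\<leftarrow>l. g e) + (\<Sum>e\<leftarrow>r. g e)" for g :: "real \<Rightarrow> real"
    by (metis sum_mset_sum_list sum_mset.union)
  have "spectral_data V n es 1" unfolding spectral_data_def
  proof (intro conjI allI impI)
    show "sorted es" unfolding es_def by simp
    show "length es + 1 = n" using l r n unfolding spectral_data_def es_def by simp
    fix s show "ecount V s n = int 1 + int (length (filter (\<lambda>e. e < s) es))"
      using l r unfolding n ecount_split[of V, OF b(2)] len spectral_data_def by simp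
  next
    fix R E :: real assume R: "R \<ge> 3" and "E \<in> set es"
    then have "E \<in> set l \<or> E \<in> set r" unfolding es_def by auto
    then show "pbox R E V n = 0" using l r R unfolding pb spectral_data_def by auto
  next
    fix R E :: real assume R: "R \<ge> 3" and "E \<notin> set es"
    then have ne: "E \<notin> set l" "E \<notin> set r" unfolding es_def by auto
    have pl: "pbox R E V b \<noteq> 0" "\<bar>ln \<bar>pbox R E V b\<bar> - (real b * ln R - (\<Sum>e\<leftarrow>l. loggap R E e))\<bar> \<le> real b / R"
      using l R ne unfolding spectral_data_def by auto
    have pr: "pbox R E ?U k \<noteq> 0" "\<bar>ln \<bar>pbox R E ?U k\<bar> - (real k * ln R - (\<Sum>e\<leftarrow>r. loggap R E e))\<bar> \<le> real k / R"
      using r R ne unfolding spectral_data_def by auto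
    show "pbox R E V n \<noteq> 0" using pl pr R unfolding pb by simp
    have lp: "ln \<bar>pbox R E V n\<bar> = ln R + ln \<bar>pbox R E V b\<bar> + ln \<bar>pbox R E ?U k\<bar>"
      unfolding pb abs_mult using pl pr R by (simp add: ln_mult_pos)
    have nn: "real n * ln R = ln R + real b * ln R + real k * ln R" "real b / R + real k / R \<le> real n / R"
      using R unfolding n by (simp_all add: algebra_simps add_divide_distrib)
    show "\<bar>ln \<bar>pbox R E V n\<bar> - (real n * ln R - (\<Sum>e\<leftarrow>es. loggap R E e))\<bar> \<le> real n / R"
      unfolding lp sm nn(1) using pl(2) pr(2) nn(2) by linarith
  qed
  then show ?thesis by blast
qed

section \<open>The density of states of monotone potentials\<close>

text \<open>Large convergent denominators have this property (\<open>cf_dioph\<close>). Coprimality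
  lets \<open>i * p\<close> run through all residues modulo \<open>q\<close>, so that
  \<open>q\<close> orbit points are almost equally spaced; \<open>q \<ge> 4\<close> gives
  \<open>3 / q < 1\<close> in \<open>cnt_osc\<close>.\<close>

definition dioph :: "real \<Rightarrow> nat \<Rightarrow> bool" where
  "dioph \<alpha> q \<longleftrightarrow> q \<ge> 4 \<and> (\<exists>p::int. coprime p (int q) \<and> \<bar>real q * \<alpha> - of_int p\<bar> \<le> 1 / real q)"

definition orbit :: "(real \<Rightarrow> ereal) \<Rightarrow> real \<Rightarrow> real \<Rightarrow> nat \<Rightarrow> ereal" where
  "orbit f \<alpha> y j = f (y + real j * \<alpha>)"

text \<open>Its increments count how often a site passes an integer, where the potential may drop.
  Subtracted from the angle, it relabels the eigenvalues so that each label increases with the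
  phase.\<close>

definition fsum :: "real \<Rightarrow> real \<Rightarrow> nat \<Rightarrow> int" where
  "fsum \<alpha> y n = (\<Sum>j<n. \<lfloor>y + real j * \<alpha>\<rfloor>)"

lemma fsum_mono: "x \<le> y \<Longrightarrow> fsum \<alpha> x n \<le> fsum \<alpha> y n"
  unfolding fsum_def by (intro sum_mono floor_mono) simp

text \<open>If site \<open>i\<close> arrives at or passes the integer \<open>c\<close>, then
  \<open>q * c - i * p\<close> is an integer in a window of length \<open>q * \<tau> + 2\<close>,
  since \<open>i * (q * \<alpha> - p)\<close> is at most \<open>1\<close>. As \<open>p\<close> is
  invertible modulo \<open>q\<close>, different sites give different integers.\<close>

lemma fsum_block:
  assumes q: "q \<ge> 1" and cop: "coprime p (int q)" and ap: "\<bar>real q * \<alpha> - of_int p\<bar> \<le> 1 / real q"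
    and t: "0 \<le> \<tau>" "\<tau> < 1"
  shows "of_int (fsum \<alpha> (y + \<tau>) q - fsum \<alpha> y q) \<le> real q * \<tau> + 3"
proof -
  let ?B = "{i. i < q \<and> \<lfloor>y + \<tau> + real i * \<alpha>\<rfloor> \<noteq> \<lfloor>y + real i * \<alpha>\<rfloor>}"
  define g where "g i = \<lfloor>y + \<tau> + real i * \<alpha>\<rfloor> * int q - int i * p" for i
  have le: "\<lfloor>y + \<tau> + real i * \<alpha>\<rfloor> - \<lfloor>y + real i * \<alpha>\<rfloor> \<le> (if i \<in> ?B then 1 else 0)" if "i < q" for i
  proof -
    have "\<lfloor>y + \<tau> + real i * \<alpha>\<rfloor> \<le> \<lfloor>y + real i * \<alpha> + of_int 1\<rfloor>" using t by (intro floor_mono) simp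
    then show ?thesis using that by (auto simp only: floor_add_int[symmetric]) auto
  qed
  have "fsum \<alpha> (y + \<tau>) q - fsum \<alpha> y q = (\<Sum>i<q. \<lfloor>y + \<tau> + real i * \<alpha>\<rfloor> - \<lfloor>y + real i * \<alpha>\<rfloor>)"
    unfolding fsum_def by (simp add: sum_subtractf)
  also have "\<dots> \<le> (\<Sum>i<q. if i \<in> ?B then 1 else 0)" by (intro sum_mono le) simp
  also have "\<dots> = (\<Sum>i\<in>{..<q} \<inter> ?B. 1)" by (rule sum.inter_restrict[symmetric]) simp
  also have "\<dots> = int (card ({..<q} \<inter> ?B))" by simp
  also have "{..<q} \<inter> ?B = ?B" by auto
  finally have 1: "fsum \<alpha> (y + \<tau>) q - fsum \<alpha> y q \<le> int (card ?B)" .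
  have inj: "inj_on g ?B"
  proof (rule inj_onI)
    fix i j assume ij: "i \<in> ?B" "j \<in> ?B" "g i = g j"
    let ?c = "\<lfloor>y + \<tau> + real i * \<alpha>\<rfloor>" and ?d = "\<lfloor>y + \<tau> + real j * \<alpha>\<rfloor>"
    have "(int i - int j) * p = (?c - ?d) * int q" using ij(3) unfolding g_def by (simp add: algebra_simps)
    then have "int q dvd (int i - int j) * p" by simp
    then have "int q dvd int i - int j" using cop by (simp add: coprime_commute coprime_dvd_mult_left_iff)
    have "int i - int j = 0"
    proof (rule ccontr)
      assume "int i - int j \<noteq> 0"
      then have "\<bar>int q\<bar> \<le> \<bar>int i - int j\<bar>" using \<open>int q dvd int i - int j\<close> by (rule dvd_imp_le_int)
      then show False using ij by auto
    qed
    then show "i = j" by simp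
  qed
  have sub: "g ` ?B \<subseteq> {\<lfloor>real q * y - 1\<rfloor><..\<lfloor>real q * y + real q * \<tau> + 1\<rfloor>}"
  proof
    fix z assume "z \<in> g ` ?B"
    then obtain i where i: "i \<in> ?B" "z = g i" by blast
    let ?c = "\<lfloor>y + \<tau> + real i * \<alpha>\<rfloor>"
    have "\<lfloor>y + real i * \<alpha>\<rfloor> \<le> ?c" using t by (intro floor_mono) simp
    then have "\<lfloor>y + real i * \<alpha>\<rfloor> + 1 \<le> ?c" using i by auto
    then have c: "y + real i * \<alpha> < of_int ?c" "of_int ?c \<le> y + \<tau> + real i * \<alpha>" by linarith+
    then have qc: "real q * y + real q * (real i * \<alpha>) < real q * of_int ?c"
      "real q * of_int ?c \<le> real q * y + real q * \<tau> + real q * (real i * \<alpha>)"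
      using q mult_strict_left_mono[OF c(1), of "real q"] mult_left_mono[OF c(2), of "real q"]
      by (simp_all add: algebra_simps)
    have "\<bar>real i * (real q * \<alpha> - of_int p)\<bar> \<le> real q * (1 / real q)"
      unfolding abs_mult using ap i by (intro mult_mono) auto
    then have "\<bar>real i * (real q * \<alpha> - of_int p)\<bar> \<le> 1" using q by simp
    then have "\<bar>real q * (real i * \<alpha>) - real i * of_int p\<bar> \<le> 1" by (simp add: algebra_simps)
    moreover have "of_int z = real q * of_int ?c - real i * of_int p"
      unfolding i g_def by (simp add: mult.commute)
    ultimately have "real q * y - 1 < of_int z" "of_int z \<le> real q * y + real q * \<tau> + 1"
      using qc by linarith+
    then show "z \<in> {\<lfloor>real q * y - 1\<rfloor><..\<lfloor>real q * y + real q * \<tau> + 1\<rfloor>}"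
      unfolding greaterThanAtMost_iff floor_less_iff le_floor_iff by blast
  qed
  have "card ?B = card (g ` ?B)" using inj by (simp add: card_image)
  also have "\<dots> \<le> card {\<lfloor>real q * y - 1\<rfloor><..\<lfloor>real q * y + real q * \<tau> + 1\<rfloor>}" by (rule card_mono[OF _ sub]) simp
  also have "\<dots> = nat (\<lfloor>real q * y + real q * \<tau> + 1\<rfloor> - \<lfloor>real q * y - 1\<rfloor>)" by simp
  finally have "int (card ?B) \<le> \<lfloor>real q * y + real q * \<tau> + 1\<rfloor> - \<lfloor>real q * y - 1\<rfloor>"
    using t floor_mono[of "real q * y - 1" "real q * y + real q * \<tau> + 1"] by simp
  then have "of_int (int (card ?B)) \<le> real q * \<tau> + 3" by linarith
  moreover have "of_int (fsum \<alpha> (y + \<tau>) q - fsum \<alpha> y q) \<le> (of_int (int (card ?B)) :: real)"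
    using 1 by (simp only: of_int_le_iff)
  ultimately show ?thesis by linarith
qed

lemma fsum_add: "fsum \<alpha> y (m + n) = fsum \<alpha> y m + fsum \<alpha> (y + real m * \<alpha>) n"
  unfolding fsum_def by (induction n) (simp_all add: algebra_simps)

lemma fsum_diff_le:
  assumes "dioph \<alpha> q" and t: "0 \<le> \<tau>" "\<tau> < 1"
  shows "of_int (fsum \<alpha> (y + \<tau>) n - fsum \<alpha> y n) \<le> (real n / real q + 1) * (real q * \<tau> + 3)"
proof (induction n arbitrary: y rule: less_induct)
  case (less n)
  obtain p where p: "coprime p (int q)" "\<bar>real q * \<alpha> - of_int p\<bar> \<le> 1 / real q" and q: "q \<ge> 4"
    using assms(1) unfolding dioph_def by blast
  have blk: "of_int (fsum \<alpha> (y + \<tau>) q - fsum \<alpha> y q) \<le> real q * \<tau> + 3" for y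
    using fsum_block[OF _ p t] q by simp
  have pos: "real q * \<tau> + 3 \<ge> 0" using t by simp
  show ?case
  proof (cases "n < q")
    case True
    have "fsum \<alpha> (y + \<tau>) q - fsum \<alpha> y q = fsum \<alpha> (y + \<tau>) n - fsum \<alpha> y n
      + (fsum \<alpha> (y + real n * \<alpha> + \<tau>) (q - n) - fsum \<alpha> (y + real n * \<alpha>) (q - n))"
      using fsum_add[of \<alpha> "y + \<tau>" n "q - n"] fsum_add[of \<alpha> y n "q - n"] True by (simp add: add_ac)
    moreover have "fsum \<alpha> (y + real n * \<alpha> + \<tau>) (q - n) - fsum \<alpha> (y + real n * \<alpha>) (q - n) \<ge> 0"
      using fsum_mono[of "y + real n * \<alpha>" "y + real n * \<alpha> + \<tau>" \<alpha> "q - n"] t by simp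
    ultimately have "of_int (fsum \<alpha> (y + \<tau>) n - fsum \<alpha> y n) \<le> (of_int (fsum \<alpha> (y + \<tau>) q - fsum \<alpha> y q) :: real)"
      by (simp only: of_int_le_iff)
    also have "\<dots> \<le> 1 * (real q * \<tau> + 3)" using blk by simp
    also have "\<dots> \<le> (real n / real q + 1) * (real q * \<tau> + 3)" using pos by (intro mult_right_mono) auto
    finally show ?thesis .
  next
    case False
    define m where "m = n - q"
    have n: "n = q + m" "m < n" using False q unfolding m_def by auto
    have "fsum \<alpha> (y + \<tau>) n - fsum \<alpha> y n = (fsum \<alpha> (y + \<tau>) q - fsum \<alpha> y q)
       + (fsum \<alpha> (y + real q * \<alpha> + \<tau>) m - fsum \<alpha> (y + real q * \<alpha>) m)"
      unfolding n(1) fsum_add by (simp add: add_ac)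
    then have "of_int (fsum \<alpha> (y + \<tau>) n - fsum \<alpha> y n) = of_int (fsum \<alpha> (y + \<tau>) q - fsum \<alpha> y q)
       + (of_int (fsum \<alpha> (y + real q * \<alpha> + \<tau>) m - fsum \<alpha> (y + real q * \<alpha>) m) :: real)" by simp
    also have "\<dots> \<le> (real q * \<tau> + 3) + (real m / real q + 1) * (real q * \<tau> + 3)"
      using blk less[OF n(2)] by (intro add_mono) auto
    also have "\<dots> = (real n / real q + 1) * (real q * \<tau> + 3)"
      unfolding n(1) using q by (simp add: field_simps)
    finally show ?thesis .
  qed
qed

text \<open>One solves \<open>j * p = l\<close> modulo \<open>q\<close> with \<open>l / q\<close>
  just below \<open>y - x\<close>. Replacing \<open>q * \<alpha>\<close> by \<open>p\<close> moves
  \<open>q\<close> times the orbit point by at most \<open>1\<close>, and the \<open>- 1\<close> in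
  the choice of \<open>l\<close> keeps the point below \<open>y\<close> nevertheless.\<close>

lemma dioph_net:
  assumes "dioph \<alpha> q"
  obtains j c where "j < q" "y - 3 / real q \<le> x + real j * \<alpha> + of_int c" "x + real j * \<alpha> + of_int c \<le> y"
proof -
  obtain p where p: "coprime p (int q)" "\<bar>real q * \<alpha> - of_int p\<bar> \<le> 1 / real q" and q: "q \<ge> 4"
    using assms unfolding dioph_def by blast
  define l where "l = \<lfloor>real q * (y - x) - 1\<rfloor>"
  obtain r where r: "[p * r = 1] (mod int q)" using cong_solve_coprime_int[OF p(1)] by blast
  define j where "j = nat ((l * r) mod int q)"
  have j: "int j = (l * r) mod int q" "j < q" using q unfolding j_def by (auto simp: nat_less_iff)
  have "[int j * p = l * r * p] (mod int q)" unfolding j by (simp add: cong_def mod_mult_left_eq)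
  also have "[l * r * p = l * 1] (mod int q)" using cong_scalar_left[OF r, of l] by (simp add: mult_ac)
  finally have "int q dvd l - int j * p" by (simp add: cong_iff_dvd_diff dvd_diff_commute)
  then obtain c where c: "l - int j * p = int q * c" by (elim dvdE)
  then have c': "of_int l = real j * of_int p + real q * of_int c" by (metis add_diff_cancel_left' diff_add_cancel of_int_add of_int_mult of_int_of_nat_eq)
  define s where "s = x + real j * \<alpha> + of_int c"
  have "\<bar>real j * (real q * \<alpha> - of_int p)\<bar> \<le> real q * (1 / real q)"
    unfolding abs_mult using p(2) j by (intro mult_mono) auto
  then have d: "\<bar>real j * (real q * \<alpha> - of_int p)\<bar> \<le> 1" using q by simp
  have "real q * s = real q * x + of_int l + real j * (real q * \<alpha> - of_int p)"
    unfolding s_def c' by (simp add: algebra_simps)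
  moreover have "real q * y - real q * x - 2 \<le> of_int l" "of_int l \<le> real q * y - real q * x - 1"
    unfolding l_def by (simp_all add: algebra_simps) linarith+
  ultimately have "real q * y - 3 \<le> real q * s" "real q * s \<le> real q * y" using d by linarith+
  then have "y - 3 / real q \<le> s" "s \<le> y" using q by (simp_all add: field_simps)
  then show ?thesis using that[OF j(2), of c] unfolding s_def by blast
qed

text \<open>The growth condition is stated with floors, so that it applies to any phase without
  reducing it modulo \<open>1\<close> first. Its finiteness part confines the value
  \<open>-\<infinity>\<close> to integers (\<open>fneg_int\<close>).\<close>

locale mpot =
  fixes \<alpha> \<gamma> :: real and f :: "real \<Rightarrow> ereal"
  assumes dio: "\<And>n. \<exists>q\<ge>n. dioph \<alpha> q" and gam: "\<gamma> > 0"
    and ninf: "\<And>x. f x \<noteq> \<infinity>" and per: "\<And>x k. f (x + of_int k) = f x"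
    and mono: "\<And>y \<tau>. \<tau> > 0 \<Longrightarrow> \<lfloor>y + \<tau>\<rfloor> = \<lfloor>y\<rfloor> \<Longrightarrow>
        f (y + \<tau>) \<noteq> -\<infinity> \<and> (f y = -\<infinity> \<or> real_of_ereal (f (y + \<tau>)) \<ge> real_of_ereal (f y) + \<gamma> * \<tau>)"
begin

abbreviation "orb \<equiv> orbit f \<alpha>"

definition cnt :: "real \<Rightarrow> nat \<Rightarrow> real \<Rightarrow> int" where "cnt y n E = ecount (orb y) E n"

lemma orb_ninf: "orb y j \<noteq> \<infinity>" unfolding orbit_def by (rule ninf)

lemma orb_shift: "(\<lambda>j. orb y (m + j)) = orb (y + real m * \<alpha>)"
  unfolding orbit_def by (rule ext) (simp add: algebra_simps)

lemma orb_int: "orb (y + of_int k) = orb y"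
proof (rule ext)
  fix j show "orb (y + of_int k) j = orb y j"
    unfolding orbit_def using per[of "y + real j * \<alpha>" k] by (simp add: add_ac)
qed

lemma fneg_int: "f y = -\<infinity> \<Longrightarrow> y \<in> \<int>"
proof (rule ccontr)
  assume "f y = -\<infinity>" "y \<notin> \<int>"
  then have "frac y > 0" by (simp add: frac_gt_0_iff)
  moreover have "y = of_int \<lfloor>y\<rfloor> + frac y" by (simp add: frac_def)
  ultimately show False using mono[of "frac y" "of_int \<lfloor>y\<rfloor>"] \<open>f y = -\<infinity>\<close> by auto
qed

text \<open>If no integer is passed, \<open>f\<close> grows by at least
  \<open>\<gamma> * \<tau>\<close>, which compensates the rise of the energy. If one is passed, the
  floor grows by at least \<open>1\<close>, which outweighs any change of the potential, because for
  fixed \<open>\<theta>\<close> the values of \<open>pstep\<close> fill an interval of length at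
  most \<open>1\<close>.\<close>

lemma pstep_label:
  assumes t: "\<tau> \<ge> 0"
  shows "pstep (E + \<gamma> * \<tau>) (f (y + \<tau>)) \<theta> - of_int \<lfloor>y + \<tau>\<rfloor> \<le> pstep E (f y) \<theta> - of_int \<lfloor>y\<rfloor>"
proof (cases "\<tau> = 0")
  case False
  then have t: "\<tau> > 0" using t by simp
  show ?thesis
  proof (cases "\<lfloor>y + \<tau>\<rfloor> = \<lfloor>y\<rfloor>")
    case True
    have m: "f (y + \<tau>) \<noteq> -\<infinity>" "f y = -\<infinity> \<or> real_of_ereal (f (y + \<tau>)) \<ge> real_of_ereal (f y) + \<gamma> * \<tau>"
      using mono[OF t True] by auto
    show ?thesis
    proof (cases "f y = -\<infinity>")
      case True
      then show ?thesis using \<open>\<lfloor>y + \<tau>\<rfloor> = \<lfloor>y\<rfloor>\<close> pstep_le_ceiling[of "E + \<gamma> * \<tau>" "f (y + \<tau>)" \<theta>]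
        unfolding pstep_def[of E "f y"] by simp
    next
      case False
      then show ?thesis using \<open>\<lfloor>y + \<tau>\<rfloor> = \<lfloor>y\<rfloor>\<close> m unfolding pstep_def by (auto intro!: shear_mono_a)
    qed
  next
    case False
    then have "\<lfloor>y\<rfloor> + 1 \<le> \<lfloor>y + \<tau>\<rfloor>" using t floor_mono[of y "y + \<tau>"] by simp
    then have "of_int (\<lfloor>y\<rfloor> + 1) \<le> (of_int \<lfloor>y + \<tau>\<rfloor> :: real)" by (simp only: of_int_le_iff)
    then show ?thesis using pstep_le_ceiling[of "E + \<gamma> * \<tau>" "f (y + \<tau>)" \<theta>] pstep_ge_ceiling[of \<theta> E "f y"]
      by simp
  qed
qed simp

text \<open>Read through \<open>ecount\<close>, every labelled eigenvalue rises by at least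
  \<open>\<gamma> * \<tau>\<close> when the phase rises by \<open>\<tau>\<close>. The induction uses
  that a whole number of turns can be pulled out of \<open>pstep\<close>.\<close>

lemma rot_label:
  assumes t: "\<tau> \<ge> 0"
  shows "rot (orb (y + \<tau>)) (E + \<gamma> * \<tau>) n 0 - of_int (fsum \<alpha> (y + \<tau>) n) \<le> rot (orb y) E n 0 - of_int (fsum \<alpha> y n)"
proof (induction n)
  case (Suc n)
  let ?T' = "rot (orb (y + \<tau>)) (E + \<gamma> * \<tau>)" and ?T = "rot (orb y) E"
  define k where "k = fsum \<alpha> (y + \<tau>) n - fsum \<alpha> y n"
  let ?y = "y + real n * \<alpha>"
  have e: "y + \<tau> + real n * \<alpha> = ?y + \<tau>" by simp
  have "?T' n 0 \<le> ?T n 0 + of_int k" using Suc unfolding k_def by simp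
  then have "pstep (E + \<gamma> * \<tau>) (f (?y + \<tau>)) (?T' n 0) \<le> pstep (E + \<gamma> * \<tau>) (f (?y + \<tau>)) (?T n 0) + of_int k"
    unfolding pstep_add_int[symmetric] by (rule pstep_mono)
  also have "\<dots> \<le> pstep E (f ?y) (?T n 0) + of_int (\<lfloor>?y + \<tau>\<rfloor> - \<lfloor>?y\<rfloor> + k)"
    using pstep_label[OF t, of E ?y "?T n 0"] by simp
  finally have "?T' (Suc n) 0 \<le> ?T (Suc n) 0 + of_int (\<lfloor>?y + \<tau>\<rfloor> - \<lfloor>?y\<rfloor> + k)"
    unfolding rot.simps orbit_def e .
  then show ?case unfolding k_def by (simp add: fsum_def e)
qed (simp add: fsum_def)

lemma cnt_shift:
  assumes t: "\<tau> \<ge> 0"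
  shows "cnt (y + \<tau>) n (E + \<gamma> * \<tau>) \<le> cnt y n E + (fsum \<alpha> (y + \<tau>) n - fsum \<alpha> y n)"
proof -
  have "rot (orb (y + \<tau>)) (E + \<gamma> * \<tau>) n 0 - 1/2 \<le> (rot (orb y) E n 0 - 1/2) + of_int (fsum \<alpha> (y + \<tau>) n - fsum \<alpha> y n)"
    using rot_label[OF t, of y E n] by simp
  then show ?thesis unfolding cnt_def ecount_def
    by (metis ceiling_add_of_int ceiling_mono)
qed

lemma cnt_mono: "E \<le> E' \<Longrightarrow> cnt y n E \<le> cnt y n E'"
  unfolding cnt_def by (rule ecount_mono)

lemma cnt_bounds: "0 \<le> cnt y n E" "cnt y n E \<le> int n"
  unfolding cnt_def using ecount_bounds[of "orb y"] orb_ninf by auto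

lemma cnt_int: "cnt (y + of_int k) n E = cnt y n E"
  unfolding cnt_def orb_int ..

lemma cnt_add: "\<bar>cnt y (m + n) E - cnt y m E - cnt (y + real m * \<alpha>) n E\<bar> \<le> 1"
  unfolding cnt_def using ecount_add[of "orb y" E m n] unfolding orb_shift .

text \<open>The box of length \<open>j + n\<close> is cut once after \<open>j\<close> and once after
  \<open>n\<close> sites; each short piece holds between \<open>0\<close> and \<open>j\<close>
  eigenvalues, and each cut costs at most one.\<close>

lemma cnt_orbit: "\<bar>cnt (x + real j * \<alpha>) n E - cnt x n E\<bar> \<le> int j + 2"
  using cnt_add[of x j n E] cnt_add[of x n j E] cnt_bounds[of x j E] cnt_bounds[of "x + real n * \<alpha>" j E]
  by (simp add: add.commute)

definition osc :: "nat \<Rightarrow> nat \<Rightarrow> real" where "osc q n = real q + 2 + 6 * (real n / real q + 1)"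

text \<open>Two phases are compared in two moves: along the orbit to a point at most
  \<open>3 / q\<close> below the target, at cost \<open>q + 2\<close>, and then straight up, where
  \<open>fsum_diff_le\<close> with \<open>q * \<tau> + 3 \<le> 6\<close> bounds the change of
  labels. The bound therefore holds for every phase and every energy.\<close>

lemma cnt_osc:
  assumes "dioph \<alpha> q" shows "\<bar>of_int (cnt x n E) - of_int (cnt y n E)\<bar> \<le> osc q n"
proof -
  have q: "q \<ge> 4" using assms unfolding dioph_def by simp
  have *: "of_int (cnt y n E) \<le> of_int (cnt x n E) + osc q n" for x y
  proof -
    obtain j c where j: "j < q" "y - 3 / real q \<le> x + real j * \<alpha> + of_int c" "x + real j * \<alpha> + of_int c \<le> y"
      using dioph_net[OF assms] by blast
    define z where "z = x + real j * \<alpha> + of_int c"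
    define \<tau> where "\<tau> = y - z"
    have t: "0 \<le> \<tau>" "\<tau> \<le> 3 / real q" using j unfolding \<tau>_def z_def by auto
    have "3 / real q < 1" using q by simp
    then have t1: "\<tau> < 1" using t by simp
    have y: "y = z + \<tau>" unfolding \<tau>_def by simp
    have "cnt y n E \<le> cnt (z + \<tau>) n (E + \<gamma> * \<tau>)" unfolding y using gam t by (intro cnt_mono) simp
    also have "\<dots> \<le> cnt z n E + (fsum \<alpha> (z + \<tau>) n - fsum \<alpha> z n)" by (rule cnt_shift[OF t(1)])
    finally have "of_int (cnt y n E) \<le> of_int (cnt z n E) + (of_int (fsum \<alpha> (z + \<tau>) n - fsum \<alpha> z n) :: real)"
      by (metis of_int_add of_int_le_iff)
    also have "of_int (fsum \<alpha> (z + \<tau>) n - fsum \<alpha> z n) \<le> (real n / real q + 1) * (real q * \<tau> + 3)"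
      by (rule fsum_diff_le[OF assms t(1) t1])
    also have "\<dots> \<le> (real n / real q + 1) * 6"
      using t(2) q by (intro mult_left_mono) (auto simp: field_simps)
    also have "(real n / real q + 1) * 6 = 6 * (real n / real q + 1)" by (rule mult.commute)
    also have "cnt z n E = cnt (x + real j * \<alpha>) n E" unfolding z_def by (rule cnt_int)
    also have "of_int (cnt (x + real j * \<alpha>) n E) \<le> of_int (cnt x n E) + (real q + 2)"
    proof -
      have "cnt (x + real j * \<alpha>) n E \<le> cnt x n E + (int q + 2)" using cnt_orbit[of x j n E] j(1) by linarith
      then have "of_int (cnt (x + real j * \<alpha>) n E) \<le> (of_int (cnt x n E + (int q + 2)) :: real)" by (simp only: of_int_le_iff)
      then show ?thesis by simp
    qed
    finally show ?thesis unfolding osc_def by linarith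
  qed
  show ?thesis using *[of x y] *[of y x] by linarith
qed

lemma cnt_mult:
  assumes "dioph \<alpha> q"
  shows "\<bar>of_int (cnt 0 (m * n) E) - real m * of_int (cnt 0 n E)\<bar> \<le> real m * (1 + osc q n)"
proof (induction m)
  case 0
  have "cnt 0 0 E = 0" using cnt_bounds[of 0 0 E] by simp
  then show ?case by simp
next
  case (Suc m)
  have "\<bar>of_int (cnt 0 (m * n + n) E - cnt 0 (m * n) E - cnt (0 + real (m * n) * \<alpha>) n E)\<bar> \<le> (1::real)"
    using cnt_add[of 0 "m * n" n E] by (metis of_int_1 of_int_abs of_int_le_iff)
  then have "\<bar>of_int (cnt 0 (m * n + n) E) - of_int (cnt 0 (m * n) E) - of_int (cnt (0 + real (m * n) * \<alpha>) n E)\<bar> \<le> (1::real)"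
    by simp
  moreover have "\<bar>of_int (cnt (0 + real (m * n) * \<alpha>) n E) - of_int (cnt 0 n E)\<bar> \<le> osc q n"
    by (rule cnt_osc[OF assms])
  ultimately have "\<bar>of_int (cnt 0 (m * n + n) E) - (real m + 1) * of_int (cnt 0 n E)\<bar> \<le> (real m + 1) * (1 + osc q n)"
    using Suc by (simp only: distrib_right mult_1)
  then show ?case by (simp add: add.commute)
qed

lemma osc_small:
  assumes "\<epsilon> > 0" obtains q where "dioph \<alpha> q" "\<And>n. osc q n \<le> \<epsilon> * real n + (real q + 8)"
proof -
  obtain q where q: "q \<ge> nat \<lceil>6 / \<epsilon>\<rceil>" "dioph \<alpha> q" using dio by blast
  have q0: "real q > 0" using q(2) unfolding dioph_def by simp
  have "6 / \<epsilon> \<le> real q" using q(1) by linarith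
  then have "6 / real q \<le> \<epsilon>" using assms q0 by (simp add: field_simps)
  then have "6 / real q * real n \<le> \<epsilon> * real n" for n by (intro mult_right_mono) auto
  then show ?thesis using that[OF q(2)] unfolding osc_def by (simp add: algebra_simps)
qed

section \<open>Existence, uniformity and regularity of the density of states\<close>

definition dens :: "real \<Rightarrow> real" where "dens E = lim (\<lambda>n. of_int (cnt 0 n E) / real n)"

lemma dens_aux:
  assumes "n > 0" "m > 0" "dioph \<alpha> q"
  shows "\<bar>of_int (cnt 0 n E) / real n - of_int (cnt 0 m E) / real m\<bar> \<le> (1 + osc q n) / real n + (1 + osc q m) / real m"
proof -
  let ?a = "\<lambda>n. of_int (cnt 0 n E) :: real"
  have 1: "\<bar>?a (m * n) / real (m * n) - ?a n / real n\<bar> \<le> (1 + osc q n) / real n" if "n > 0" "m > 0" for m n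
  proof -
    have "?a (m * n) / real (m * n) - ?a n / real n = (?a (m * n) - real m * ?a n) / real (m * n)"
      using that by (simp add: field_simps)
    then have "\<bar>?a (m * n) / real (m * n) - ?a n / real n\<bar> = \<bar>?a (m * n) - real m * ?a n\<bar> / real (m * n)"
      by simp
    also have "\<dots> \<le> real m * (1 + osc q n) / real (m * n)"
      using cnt_mult[OF assms(3), of m n E] by (intro divide_right_mono) auto
    finally show ?thesis using that by simp
  qed
  show ?thesis using 1[OF assms(1,2)] 1[OF assms(2,1)] by (simp add: mult.commute)
qed

lemma dens_lim: "(\<lambda>n. of_int (cnt 0 n E) / real n) \<longlonglongrightarrow> dens E"
proof -
  let ?b = "\<lambda>n. of_int (cnt 0 n E) / real n :: real"
  have "Cauchy ?b"
  proof (rule metric_CauchyI)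
    fix e :: real assume e: "e > 0"
    obtain q where q: "dioph \<alpha> q" "\<And>n. osc q n \<le> (e / 8) * real n + (real q + 8)"
      using osc_small[of "e / 8"] e by auto
    define M where "M = nat \<lceil>8 * (real q + 9) / e\<rceil> + 1"
    have small: "(1 + osc q n) / real n \<le> e / 4" if "n \<ge> M" for n
    proof -
      have "8 * (real q + 9) / e \<le> real n" using that unfolding M_def by linarith
      then have "8 * (real q + 9) \<le> e * real n" using e by (simp add: field_simps)
      then have "8 * (real q + 9) + 8 * osc q n \<le> e * real n + (e * real n + 8 * (real q + 8))"
        using q(2)[of n] by (intro add_mono) auto
      then have "1 + osc q n \<le> e / 4 * real n" by simp
      then show ?thesis using that unfolding M_def by (simp add: field_simps)
    qed
    have "dist (?b m) (?b n) < e" if "m \<ge> M" "n \<ge> M" for m n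
    proof -
      have "m > 0" "n > 0" using that unfolding M_def by auto
      then show ?thesis using dens_aux[of m n q E] small[OF that(1)] small[OF that(2)] q(1) e
        unfolding dist_real_def by linarith
    qed
    then show "\<exists>M. \<forall>m\<ge>M. \<forall>n\<ge>M. dist (?b m) (?b n) < e" by blast
  qed
  then have "convergent ?b" by (simp add: Cauchy_convergent_iff)
  then show ?thesis unfolding dens_def by (simp add: convergent_LIMSEQ_iff)
qed

lemma dens_close:
  assumes "dioph \<alpha> q"
  shows "\<bar>of_int (cnt y n E) - real n * dens E\<bar> \<le> 1 + 2 * osc q n"
proof (cases "n = 0")
  case True
  then have "cnt y n E = 0" using cnt_bounds[of y 0 E] by simp
  then show ?thesis using True unfolding osc_def by simp
next
  case False
  let ?a = "\<lambda>n. of_int (cnt 0 n E) :: real"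
  have lim: "(\<lambda>m. \<bar>?a n / real n - ?a m / real m\<bar>) \<longlonglongrightarrow> \<bar>?a n / real n - dens E\<bar>"
    using dens_lim by (intro tendsto_intros)
  have "(\<lambda>m. ?a (m * n) / real (m * n)) \<longlonglongrightarrow> dens E"
    using LIMSEQ_subseq_LIMSEQ[OF dens_lim, of "\<lambda>m. m * n"] False by (simp add: strict_mono_def comp_def)
  then have lim: "(\<lambda>m. \<bar>?a n / real n - ?a (m * n) / real (m * n)\<bar>) \<longlonglongrightarrow> \<bar>?a n / real n - dens E\<bar>"
    by (intro tendsto_intros)
  have "\<bar>?a n / real n - dens E\<bar> \<le> (1 + osc q n) / real n"
  proof (rule LIMSEQ_le_const2[OF lim], intro exI[of _ 1] allI impI)
    fix m :: nat assume m: "1 \<le> m"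
    have "?a n / real n - ?a (m * n) / real (m * n) = (real m * ?a n - ?a (m * n)) / real (m * n)"
      using m False by (simp add: field_simps)
    then have "\<bar>?a n / real n - ?a (m * n) / real (m * n)\<bar> = \<bar>?a (m * n) - real m * ?a n\<bar> / real (m * n)"
      by (simp add: abs_minus_commute)
    also have "\<dots> \<le> real m * (1 + osc q n) / real (m * n)"
      using cnt_mult[OF assms(1), of m n E] by (intro divide_right_mono) auto
    also have "\<dots> = (1 + osc q n) / real n" using m by simp
    finally show "\<bar>?a n / real n - ?a (m * n) / real (m * n)\<bar> \<le> (1 + osc q n) / real n" .
  qed
  then have "real n * \<bar>?a n / real n - dens E\<bar> \<le> 1 + osc q n" using False by (simp add: field_simps)
  also have "real n * \<bar>?a n / real n - dens E\<bar> = \<bar>?a n - real n * dens E\<bar>"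
  proof -
    have "?a n - real n * dens E = real n * (?a n / real n - dens E)" using False by (simp add: algebra_simps)
    then show ?thesis by (simp add: abs_mult)
  qed
  finally have "\<bar>?a n - real n * dens E\<bar> \<le> 1 + osc q n" .
  moreover have "\<bar>of_int (cnt y n E) - ?a n\<bar> \<le> osc q n" by (rule cnt_osc[OF assms])
  ultimately show ?thesis by linarith
qed

text \<open>For large \<open>q\<close> the oscillation is a small multiple of \<open>n\<close> plus
  a constant depending on \<open>q\<close>. Uniformity in \<open>y\<close> and \<open>E\<close> is
  what \<open>sum_clampgap\<close> consumes when it counts eigenvalues in many intervals at
  once.\<close>

lemma dens_uniform:
  assumes "\<epsilon> > 0"
  obtains C where "C \<ge> 0" "\<And>y n E. \<bar>of_int (cnt y n E) - real n * dens E\<bar> \<le> \<epsilon> * real n + C"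
proof -
  obtain q where q: "dioph \<alpha> q" "\<And>n. osc q n \<le> (\<epsilon> / 2) * real n + (real q + 8)"
    using osc_small[of "\<epsilon> / 2"] assms by auto
  show ?thesis
  proof (rule that[of "1 + 2 * (real q + 8)"])
    fix y n E
    have "1 + 2 * osc q n \<le> \<epsilon> * real n + (1 + 2 * (real q + 8))" using q(2)[of n] by simp
    then show "\<bar>of_int (cnt y n E) - real n * dens E\<bar> \<le> \<epsilon> * real n + (1 + 2 * (real q + 8))"
      using dens_close[OF q(1), of y n E] by linarith
  qed simp
qed

lemma dens_lim_y: "(\<lambda>n. of_int (cnt y n E) / real n) \<longlonglongrightarrow> dens E"
proof (rule LIMSEQ_I)
  fix e :: real assume e: "e > 0"
  obtain C where C: "C \<ge> 0" "\<And>y n E. \<bar>of_int (cnt y n E) - real n * dens E\<bar> \<le> e / 2 * real n + C"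
    using dens_uniform[of "e / 2"] e by auto
  define M where "M = nat \<lceil>2 * C / e\<rceil> + 1"
  have "norm (of_int (cnt y n E) / real n - dens E) < e" if n: "n \<ge> M" for n
  proof -
    have n0: "real n > 0" using n unfolding M_def by simp
    have "2 * C / e < real n" using n unfolding M_def by linarith
    then have "C < e / 2 * real n" using e by (simp add: field_simps)
    then have "\<bar>of_int (cnt y n E) - real n * dens E\<bar> < e * real n" using C(2)[of y n E] by simp
    then have "\<bar>of_int (cnt y n E) - real n * dens E\<bar> / real n < e" using n0 by (simp add: field_simps)
    moreover have "of_int (cnt y n E) / real n - dens E = (of_int (cnt y n E) - real n * dens E) / real n"
      using n0 by (simp add: field_simps)
    ultimately show ?thesis using n0 by (simp add: abs_divide)
  qed
  then show "\<exists>no. \<forall>n\<ge>no. norm (of_int (cnt y n E) / real n - dens E) < e" by blast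
qed

lemma dens_mono: "E \<le> E' \<Longrightarrow> dens E \<le> dens E'"
  by (rule LIMSEQ_le[OF dens_lim dens_lim]) (auto intro!: exI[of _ 0] divide_right_mono cnt_mono)

lemma dens_from_freq:
  assumes le: "\<And>q n. dioph \<alpha> q \<Longrightarrow> of_int (cnt y n E) \<le> real n * b + (real n / real q + 1) * (real q * \<tau> + 3)"
    and t: "\<tau> \<ge> 0"
  shows "dens E \<le> b + \<tau>"
proof (rule field_le_epsilon)
  fix e :: real assume e: "e > 0"
  obtain q where q: "q \<ge> nat \<lceil>3 / e\<rceil>" "dioph \<alpha> q" using dio by blast
  have q0: "real q > 0" using q(2) unfolding dioph_def by simp
  have "3 / e \<le> real q" using q(1) by linarith
  then have qe: "3 / real q \<le> e" using e q0 by (simp add: field_simps)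
  have lim: "(\<lambda>n. b + (\<tau> + 3 / real q) + (real q * \<tau> + 3) / real n) \<longlonglongrightarrow> b + (\<tau> + 3 / real q) + 0"
    by (intro tendsto_intros lim_const_over_n)
  have "dens E \<le> b + (\<tau> + 3 / real q) + 0"
  proof (rule LIMSEQ_le[OF dens_lim_y[of y E] lim], intro exI[of _ 1] allI impI)
    fix n :: nat assume "1 \<le> n"
    then show "of_int (cnt y n E) / real n \<le> b + (\<tau> + 3 / real q) + (real q * \<tau> + 3) / real n"
      using le[OF q(2), of n] q0 by (simp add: field_simps)
  qed
  then show "dens E \<le> b + \<tau> + e" using qe by simp
qed

text \<open>Raising the phase by \<open>\<tau>\<close> lifts the labelled eigenvalues by at least
  \<open>\<gamma> * \<tau>\<close>, while labels change with frequency \<open>\<tau>\<close> and the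
  density does not depend on the phase. Phase shifts below \<open>1\<close> are iterated to reach
  every \<open>s\<close>.\<close>

lemma dens_Lipschitz:
  assumes "s \<ge> 0" shows "dens (E + s) \<le> dens E + s / \<gamma>"
proof -
  have small: "dens (E + \<gamma> * \<tau>) \<le> dens E + \<tau>" if t: "0 \<le> \<tau>" "\<tau> < 1" for E \<tau>
  proof (rule field_le_epsilon)
    fix e :: real assume e: "e > 0"
    obtain C where C: "C \<ge> 0" "\<And>y n E. \<bar>of_int (cnt y n E) - real n * dens E\<bar> \<le> e / 4 * real n + C"
      using dens_uniform[of "e / 4"] e by auto
    obtain q where q: "q \<ge> nat \<lceil>12 / e\<rceil>" "dioph \<alpha> q" using dio by blast
    have q0: "real q > 0" using q(2) unfolding dioph_def by simp
    have "12 / e \<le> real q" using q(1) by linarith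
    then have qe: "3 / real q \<le> e / 4" using e q0 by (simp add: field_simps)
    define D where "D = 2 * C + (real q * \<tau> + 3)"
    define n where "n = nat \<lceil>4 * D / e\<rceil> + 1"
    have "4 * D / e \<le> real n" unfolding n_def by linarith
    then have n: "D \<le> e / 4 * real n" "real n > 0" using e unfolding n_def by (simp_all add: field_simps)
    have "of_int (cnt (0 + \<tau>) n (E + \<gamma> * \<tau>)) \<le> of_int (cnt 0 n E) + (of_int (fsum \<alpha> (0 + \<tau>) n - fsum \<alpha> 0 n) :: real)"
      using cnt_shift[OF t(1), of 0 n E] by (metis of_int_add of_int_le_iff)
    then have "of_int (cnt (0 + \<tau>) n (E + \<gamma> * \<tau>)) \<le> of_int (cnt 0 n E) + (real n / real q + 1) * (real q * \<tau> + 3)"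
      using fsum_diff_le[OF q(2) t, of 0 n] by linarith
    also have "(real n / real q + 1) * (real q * \<tau> + 3) = real n * \<tau> + real n * (3 / real q) + (real q * \<tau> + 3)"
      using q0 by (simp add: field_simps)
    also have "real n * (3 / real q) \<le> real n * (e / 4)" using qe by (intro mult_left_mono) auto
    finally have "real n * dens (E + \<gamma> * \<tau>) \<le> real n * dens E + real n * \<tau> + 3 * (real n * (e / 4)) + D"
      using C(2)[of "0 + \<tau>" n "E + \<gamma> * \<tau>"] C(2)[of 0 n E] unfolding D_def by (simp add: mult.commute)
    also have "\<dots> \<le> real n * (dens E + \<tau> + e)" using n(1) by (simp add: algebra_simps)
    finally show "dens (E + \<gamma> * \<tau>) \<le> dens E + \<tau> + e" using n(2) by simp
  qed
  have big: "dens (E + real k * (\<gamma> * \<tau>)) \<le> dens E + real k * \<tau>" if t: "0 \<le> \<tau>" "\<tau> < 1" for k \<tau>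
  proof (induction k)
    case (Suc k)
    have "dens (E + real (Suc k) * (\<gamma> * \<tau>)) = dens ((E + real k * (\<gamma> * \<tau>)) + \<gamma> * \<tau>)"
      by (simp add: algebra_simps)
    also have "\<dots> \<le> dens (E + real k * (\<gamma> * \<tau>)) + \<tau>" by (rule small[OF t])
    finally show ?case using Suc by (simp add: algebra_simps)
  qed simp
  define k where "k = nat \<lceil>s / \<gamma>\<rceil> + 1"
  have k: "real k > s / \<gamma>" "real k > 0" unfolding k_def by linarith+
  have sg: "s / \<gamma> \<ge> 0" using assms gam by simp
  have "dens (E + real k * (\<gamma> * (s / \<gamma> / real k))) \<le> dens E + real k * (s / \<gamma> / real k)"
  proof (rule big)
    show "0 \<le> s / \<gamma> / real k" by (rule divide_nonneg_pos[OF sg k(2)])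
    show "s / \<gamma> / real k < 1" using k by (subst divide_less_eq_1) auto
  qed
  then show ?thesis using k gam by simp
qed

text \<open>Sites with fractional part below \<open>1 - \<tau>\<close> have potential at most about
  \<open>f (1 - \<tau>)\<close> and all count for large \<open>E\<close>. The others pass an integer
  when the phase is raised by \<open>\<tau>\<close>, so \<open>fsum_diff_le\<close> controls their
  frequency.\<close>

lemma dens_top:
  assumes t: "0 < \<tau>" "\<tau> < 1"
  shows "\<exists>E0. \<forall>E\<ge>E0. dens E \<ge> 1 - \<tau>"
proof -
  have nz: "1 - \<tau> \<notin> \<int>" using t by (auto elim!: Ints_cases)
  define b where "b = real_of_ereal (f (1 - \<tau>))"
  have fb: "f (1 - \<tau>) = ereal b" unfolding b_def using fneg_int[of "1 - \<tau>"] nz ninf[of "1 - \<tau>"] by (cases "f (1 - \<tau>)") auto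
  have less: "f y < ereal (b + 1)" if "frac y < 1 - \<tau>" for y
  proof -
    have "f y = f (frac y)" using per[of "frac y" "\<lfloor>y\<rfloor>"] by (simp add: frac_def)
    moreover have "\<lfloor>1 - \<tau>\<rfloor> = 0" using t by (intro floor_unique) auto
    then have "\<lfloor>frac y + (1 - \<tau> - frac y)\<rfloor> = \<lfloor>frac y\<rfloor>" by simp
    then have "f (frac y) = -\<infinity> \<or> b \<ge> real_of_ereal (f (frac y)) + \<gamma> * (1 - \<tau> - frac y)"
      using mono[of "1 - \<tau> - frac y" "frac y"] that fb by simp
    moreover have "\<gamma> * (1 - \<tau> - frac y) \<ge> 0" using gam that by simp
    ultimately show ?thesis using ninf[of "frac y"] by (cases "f (frac y)") auto
  qed
  show ?thesis
  proof (intro exI[of _ "b + 3"] allI impI)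
    fix E assume E: "b + 3 \<le> E"
    have key: "real n - of_int (cnt 0 n E) \<le> real n * 0 + (real n / real q + 1) * (real q * \<tau> + 3)" if q: "dioph \<alpha> q" for q n
    proof -
      let ?A = "{j. j < n \<and> orb 0 j < ereal (E - 2)}" and ?B = "{j. j < n \<and> \<not> frac (0 + real j * \<alpha>) < 1 - \<tau>}"
      have "{..<n} \<subseteq> ?A \<union> ?B"
      proof
        fix j assume j: "j \<in> {..<n}"
        have "ereal (b + 1) \<le> ereal (E - 2)" using E by simp
        then have "orb 0 j < ereal (E - 2)" if "frac (0 + real j * \<alpha>) < 1 - \<tau>"
          using less[OF that] unfolding orbit_def by (rule order.strict_trans2[rotated])
        then show "j \<in> ?A \<union> ?B" using j by auto
      qed
      then have "card {..<n} \<le> card (?A \<union> ?B)" by (intro card_mono) auto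
      also have "\<dots> \<le> card ?A + card ?B" by (rule card_Un_le)
      finally have 1: "real n \<le> real (card ?A) + real (card ?B)" by simp
      have 2: "real (card ?A) \<le> of_int (cnt 0 n E)"
        using ecount_bounds(3)[of "orb 0" n E, OF orb_ninf] unfolding cnt_def by linarith
      have "int (card ?B) = (\<Sum>j<n. if j \<in> ?B then 1 else 0)" by (simp add: sum.If_cases Int_def)
      also have "\<dots> \<le> (\<Sum>j<n. \<lfloor>0 + \<tau> + real j * \<alpha>\<rfloor> - \<lfloor>0 + real j * \<alpha>\<rfloor>)"
      proof (intro sum_mono)
        fix j
        let ?x = "0 + real j * \<alpha>"
        have "\<lfloor>?x\<rfloor> \<le> \<lfloor>?x + \<tau>\<rfloor>" using t by (intro floor_mono) simp
        moreover have "\<lfloor>?x\<rfloor> + 1 \<le> \<lfloor>?x + \<tau>\<rfloor>" if "\<not> frac ?x < 1 - \<tau>"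
          using that by (simp add: le_floor_iff frac_def)
        ultimately show "(if j \<in> ?B then 1 else 0) \<le> \<lfloor>0 + \<tau> + real j * \<alpha>\<rfloor> - \<lfloor>0 + real j * \<alpha>\<rfloor>"
          by (auto simp: add_ac)
      qed
      also have "\<dots> = fsum \<alpha> (0 + \<tau>) n - fsum \<alpha> 0 n" unfolding fsum_def by (simp add: sum_subtractf)
      finally have "real (card ?B) \<le> of_int (fsum \<alpha> (0 + \<tau>) n - fsum \<alpha> 0 n)"
        by (metis of_int_le_iff of_int_of_nat_eq)
      also have "\<dots> \<le> (real n / real q + 1) * (real q * \<tau> + 3)" using fsum_diff_le[OF q, of \<tau> 0 n] t by simp
      finally show ?thesis using 1 2 by simp
    qed
    have "1 - dens E \<le> 0 + \<tau>"
    proof (rule field_le_epsilon)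
      fix e :: real assume e: "e > 0"
      obtain q where q: "q \<ge> nat \<lceil>3 / e\<rceil>" "dioph \<alpha> q" using dio by blast
      have q0: "real q > 0" using q(2) unfolding dioph_def by simp
      have "3 / e \<le> real q" using q(1) by linarith
      then have qe: "3 / real q \<le> e" using e q0 by (simp add: field_simps)
      have lim1: "(\<lambda>n. 1 - of_int (cnt 0 n E) / real n) \<longlonglongrightarrow> 1 - dens E"
        by (intro tendsto_intros dens_lim)
      have lim2: "(\<lambda>n. (\<tau> + 3 / real q) + (real q * \<tau> + 3) / real n) \<longlonglongrightarrow> (\<tau> + 3 / real q) + 0"
        by (intro tendsto_intros lim_const_over_n)
      have "1 - dens E \<le> (\<tau> + 3 / real q) + 0"
      proof (rule LIMSEQ_le[OF lim1 lim2], intro exI[of _ 1] allI impI)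
        fix n :: nat assume n: "1 \<le> n"
        have "(real n / real q + 1) * (real q * \<tau> + 3) = real n * (\<tau> + 3 / real q) + (real q * \<tau> + 3)"
          using q0 by (simp add: field_simps)
        then have "real n - of_int (cnt 0 n E) \<le> real n * (\<tau> + 3 / real q) + (real q * \<tau> + 3)"
          using key[OF q(2), of n] by simp
        then have "(real n - of_int (cnt 0 n E)) / real n \<le> (real n * (\<tau> + 3 / real q) + (real q * \<tau> + 3)) / real n"
          by (intro divide_right_mono) auto
        then show "1 - of_int (cnt 0 n E) / real n \<le> (\<tau> + 3 / real q) + (real q * \<tau> + 3) / real n"
          unfolding diff_divide_distrib add_divide_distrib using n by simp
      qed
      then show "1 - dens E \<le> 0 + \<tau> + e" using qe by simp
    qed
    then show "1 - \<tau> \<le> dens E" by simp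
  qed
qed

lemma dens_bot:
  assumes t: "0 < \<tau>" "\<tau> < 1"
  shows "\<exists>E0. \<forall>E\<le>E0. dens E \<le> \<tau>"
proof -
  have nz: "\<tau> \<notin> \<int>" using t by (auto elim!: Ints_cases)
  define b where "b = real_of_ereal (f \<tau>)"
  have fb: "f \<tau> = ereal b" unfolding b_def using fneg_int[of \<tau>] nz ninf[of \<tau>] by (cases "f \<tau>") auto
  have greater: "ereal (b - 1) < f y" if "frac y \<ge> \<tau>" for y
  proof (cases "frac y = \<tau>")
    case True
    then have "y = \<tau> + of_int \<lfloor>y\<rfloor>" by (simp add: frac_def)
    then have "f y = f \<tau>" using per by metis
    then show ?thesis using fb by simp
  next
    case False
    have "f y = f (frac y)" using per[of "frac y" "\<lfloor>y\<rfloor>"] by (simp add: frac_def)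
    moreover have "\<lfloor>\<tau>\<rfloor> = 0" using t by (intro floor_unique) auto
    then have "\<lfloor>\<tau> + (frac y - \<tau>)\<rfloor> = \<lfloor>\<tau>\<rfloor>" by simp
    then have "f (frac y) \<noteq> -\<infinity> \<and> real_of_ereal (f (frac y)) \<ge> b + \<gamma> * (frac y - \<tau>)"
      using mono[of "frac y - \<tau>" \<tau>] that False fb by simp
    moreover have "\<gamma> * (frac y - \<tau>) \<ge> 0" using gam that by simp
    ultimately show ?thesis using ninf[of "frac y"] by (cases "f (frac y)") auto
  qed
  show ?thesis
  proof (intro exI[of _ "b - 3"] allI impI)
    fix E assume E: "E \<le> b - 3"
    have "dens E \<le> 0 + \<tau>"
    proof (rule dens_from_freq[of \<tau>])
      fix q n assume q: "dioph \<alpha> q"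
      let ?A = "{j. j < n \<and> orb \<tau> j \<le> ereal (E + 2)}"
      have 1: "of_int (cnt \<tau> n E) \<le> real (card ?A)"
        using ecount_bounds(4)[of "orb \<tau>" E n, OF orb_ninf] unfolding cnt_def by linarith
      have "int (card ?A) = (\<Sum>j<n. if j \<in> ?A then 1 else 0)" by (simp add: sum.If_cases Int_def)
      also have "\<dots> \<le> (\<Sum>j<n. \<lfloor>0 + \<tau> + real j * \<alpha>\<rfloor> - \<lfloor>0 + real j * \<alpha>\<rfloor>)"
      proof (intro sum_mono)
        fix j
        let ?x = "\<tau> + real j * \<alpha>"
        have "\<lfloor>?x - \<tau>\<rfloor> \<le> \<lfloor>?x\<rfloor>" using t by (intro floor_mono) simp
        moreover have "\<lfloor>?x - \<tau>\<rfloor> + 1 \<le> \<lfloor>?x\<rfloor>" if "j \<in> ?A"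
        proof -
          have "f ?x \<le> ereal (E + 2)" using that unfolding orbit_def by simp
          also have "\<dots> \<le> ereal (b - 1)" using E by simp
          finally have "\<not> frac ?x \<ge> \<tau>" using greater[of ?x] by auto
          then have "?x - \<tau> < of_int \<lfloor>?x\<rfloor>" by (simp add: frac_def)
          then have "\<lfloor>?x - \<tau>\<rfloor> < \<lfloor>?x\<rfloor>" unfolding floor_less_iff .
          then show ?thesis by linarith
        qed
        ultimately show "(if j \<in> ?A then 1 else 0) \<le> \<lfloor>0 + \<tau> + real j * \<alpha>\<rfloor> - \<lfloor>0 + real j * \<alpha>\<rfloor>"
          by auto
      qed
      also have "\<dots> = fsum \<alpha> (0 + \<tau>) n - fsum \<alpha> 0 n" unfolding fsum_def by (simp add: sum_subtractf)
      finally have "real (card ?A) \<le> of_int (fsum \<alpha> (0 + \<tau>) n - fsum \<alpha> 0 n)"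
        by (metis of_int_le_iff of_int_of_nat_eq)
      also have "\<dots> \<le> (real n / real q + 1) * (real q * \<tau> + 3)" using fsum_diff_le[OF q, of \<tau> 0 n] t by simp
      finally show "of_int (cnt \<tau> n E) \<le> real n * 0 + (real n / real q + 1) * (real q * \<tau> + 3)" using 1 by simp
    qed (use t in simp)
    then show "dens E \<le> \<tau>" by simp
  qed
qed

end

section \<open>Box counts and the density of states measure\<close>

lemma cf_dioph:
  assumes "\<alpha> \<notin> \<rat>" shows "\<exists>q\<ge>n. dioph \<alpha> q"
proof -
  define k where "k = max n 4"
  define q where "q = nat (cf_denom \<alpha> (Suc k))"
  have Q: "cf_denom \<alpha> (Suc k) \<ge> int (Suc k)" using cf_denom_ge[OF assms] .
  then have q: "int q = cf_denom \<alpha> (Suc k)" "q \<ge> n" "q \<ge> 4" unfolding q_def k_def by auto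
  have "coprime (cf_num \<alpha> (Suc k)) (int q)"
  proof (rule coprimeI)
    fix d assume "d dvd cf_num \<alpha> (Suc k)" "d dvd int q"
    then have "d dvd cf_denom \<alpha> k * cf_num \<alpha> (Suc k) - cf_denom \<alpha> (Suc k) * cf_num \<alpha> k"
      unfolding q by (intro dvd_diff) auto
    then show "d dvd 1" unfolding cf_unimodular[OF assms] by (metis dvd_minus_iff minus_one_power_iff)
  qed
  moreover have "\<bar>real q * \<alpha> - of_int (cf_num \<alpha> (Suc k))\<bar> \<le> 1 / real q"
  proof -
    have r: "real q = of_int (cf_denom \<alpha> (Suc k))" using q(1) by (metis of_int_of_nat_eq)
    have "\<bar>cf_err \<alpha> (Suc k)\<bar> \<le> 1 / of_int (cf_denom \<alpha> (Suc (Suc k)))" by (rule cf_err_le[OF assms])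
    also have "\<dots> \<le> 1 / of_int (cf_denom \<alpha> (Suc k))"
      using cf_denom_mono_Suc[OF assms, of "Suc k"] Q by (intro divide_left_mono) (auto simp: zero_less_mult_iff simp del: cf_denom.simps)
    finally show ?thesis unfolding cf_err_def r .
  qed
  ultimately show ?thesis using q unfolding dioph_def by blast
qed

lemma monotone_potential_finite:
  assumes mp: "monotone_potential \<gamma> f" and g: "\<gamma> > 0" and x: "0 < x" "x < 1"
  shows "f x \<noteq> -\<infinity>"
proof
  assume fx: "f x = -\<infinity>"
  have z: "f z = -\<infinity>" if "0 \<le> z" "z < x" for z
  proof (rule ccontr)
    assume ne: "f z \<noteq> -\<infinity>"
    have "f x - f z \<ge> ereal (\<gamma> * (x - z))" "f z < \<infinity>" using mp that x unfolding monotone_potential_def by auto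
    then show False using ne fx by (cases "f z") auto
  qed
  have "(\<integral>\<^sup>+z\<in>{0..1}. log1p_abs (f z) \<partial>lborel) \<ge> (\<integral>\<^sup>+z. \<infinity> * indicator {0..<x} z \<partial>lborel)"
    using z x by (intro nn_integral_mono) (auto simp: log1p_abs_def indicator_def)
  also have "(\<integral>\<^sup>+z. \<infinity> * indicator {0..<x} z \<partial>lborel) = \<infinity> * emeasure lborel {0..<x}"
    by (intro nn_integral_cmult_indicator) simp
  also have "\<dots> = \<infinity>" using x by (simp add: ennreal_top_mult)
  finally show False using mp unfolding monotone_potential_def by (auto simp: top_unique)
qed

lemma periodic_int:
  fixes f :: "real \<Rightarrow> 'a" assumes "\<And>x. f (x + 1) = f x" shows "f (x + of_int k) = f x"
proof -
  have n: "f (x + real n) = f x" for x n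
  proof (induction n)
    case (Suc n)
    have "f (x + real (Suc n)) = f ((x + real n) + 1)" by (simp add: algebra_simps)
    then show ?case using assms Suc by simp
  qed simp
  show ?thesis
  proof (cases "k \<ge> 0")
    case True then show ?thesis using n[of x "nat k"] by simp
  next
    case False then show ?thesis using n[of "x + of_int k" "nat (- k)"] by simp
  qed
qed

lemma mpot_monotone_potential:
  assumes irr: "\<alpha> \<notin> \<rat>" and g: "\<gamma> > 0" and mp: "monotone_potential \<gamma> f"
  shows "mpot \<alpha> \<gamma> f"
proof
  show "\<exists>q\<ge>n. dioph \<alpha> q" for n using cf_dioph[OF irr] .
  show "\<gamma> > 0" by (rule g)
  show "f x \<noteq> \<infinity>" for x using mp unfolding monotone_potential_def by (metis less_irrefl)
  show per: "f (x + of_int k) = f x" for x k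
    by (rule periodic_int) (use mp in \<open>auto simp: monotone_potential_def\<close>)
  fix y \<tau> :: real assume t: "\<tau> > 0" and fl: "\<lfloor>y + \<tau>\<rfloor> = \<lfloor>y\<rfloor>"
  define u where "u = frac y"
  have e: "y = u + of_int \<lfloor>y\<rfloor>" "y + \<tau> = (u + \<tau>) + of_int \<lfloor>y\<rfloor>" unfolding u_def frac_def by simp_all
  have u: "0 \<le> u" "u + \<tau> < 1" unfolding u_def frac_def using fl by linarith+
  have fe: "f y = f u" "f (y + \<tau>) = f (u + \<tau>)" by (subst e, rule per)+
  have "\<forall>x y. 0 \<le> x \<longrightarrow> x < y \<longrightarrow> y < 1 \<longrightarrow> f y - f x \<ge> ereal (\<gamma> * (y - x))" "\<forall>x. f x < \<infinity>"
    using mp unfolding monotone_potential_def by blast+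
  moreover have "u < u + \<tau>" using t by simp
  ultimately have ge: "f (u + \<tau>) - f u \<ge> ereal (\<gamma> * (u + \<tau> - u))" "f u < \<infinity>" "f (u + \<tau>) < \<infinity>"
    using u by blast+
  have fin: "f (u + \<tau>) \<noteq> -\<infinity>" using monotone_potential_finite[OF mp g, of "u + \<tau>"] u t by simp
  show "f (y + \<tau>) \<noteq> -\<infinity> \<and> (f y = -\<infinity> \<or> real_of_ereal (f (y + \<tau>)) \<ge> real_of_ereal (f y) + \<gamma> * \<tau>)"
    unfolding fe using fin ge by (cases "f u"; cases "f (u + \<tau>)") auto
qed

section \<open>Angle counts as eigenvalue counts of box matrices\<close>

definition jac :: "(nat \<Rightarrow> real) \<Rightarrow> nat \<Rightarrow> real mat" where
  "jac v n = mat n n (\<lambda>(i, j). if i = j then v j else if i = Suc j \<or> j = Suc i then 1 else 0)"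

lemma jac_eigenvalue:
  assumes n: "n > 0" and k: "kont v E n = 0"
  shows "poly (char_poly (jac v n)) E = 0"
proof -
  have A: "jac v n \<in> carrier_mat n n" unfolding jac_def by simp
  \<comment> \<open>The determinants of the initial sub-boxes form an eigenvector: their recursion
    is the eigenvalue equation, and \<open>kont v E n = 0\<close> is the boundary condition at the
    last site.\<close>
  define w where "w = vec n (kont v E)"
  have w0: "w $ 0 = 1" using n unfolding w_def by simp
  have "jac v n *\<^sub>v w = E \<cdot>\<^sub>v w"
  proof (rule eq_vecI)
    show "dim_vec (jac v n *\<^sub>v w) = dim_vec (E \<cdot>\<^sub>v w)" unfolding jac_def w_def by simp
    fix i assume "i < dim_vec (E \<cdot>\<^sub>v w)"
    then have i: "i < n" unfolding w_def by simp
    have "(jac v n *\<^sub>v w) $ i = (\<Sum>j<n. (if i = j then v j else if i = Suc j \<or> j = Suc i then 1 else 0) * kont v E j)"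
      using i unfolding jac_def w_def by (simp add: scalar_prod_def lessThan_atLeast0)
    also have "\<dots> = (\<Sum>j<n. (if j = i then v j * kont v E j else 0) + (if Suc j = i then kont v E j else 0)
        + (if j = Suc i then kont v E j else 0))"
      by (intro sum.cong refl) auto
    also have "\<dots> = v i * kont v E i + (\<Sum>j<n. if Suc j = i then kont v E j else 0)
        + (\<Sum>j<n. if j = Suc i then kont v E j else 0)"
      using i by (simp add: sum.distrib)
    also have "(\<Sum>j<n. if Suc j = i then kont v E j else 0) = kprev v E i"
    proof (cases i)
      case 0 then show ?thesis by (simp add: kprev_def)
    next
      case (Suc m) then show ?thesis using i by (simp add: kprev_def)
    qed
    also have "(\<Sum>j<n. if j = Suc i then kont v E j else 0) = kont v E (Suc i)"
    proof (cases "Suc i < n")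
      case False
      then have "Suc i = n" using i by simp
      then show ?thesis using k by simp
    qed simp
    also have "v i * kont v E i + kprev v E i + kont v E (Suc i) = E * kont v E i"
      unfolding kont_Suc by (simp add: algebra_simps)
    finally show "(jac v n *\<^sub>v w) $ i = (E \<cdot>\<^sub>v w) $ i" using i unfolding w_def by simp
  qed
  moreover have "w \<in> carrier_vec n" "w \<noteq> 0\<^sub>v n" using w0 n unfolding w_def by (auto simp: vec_eq_iff)
  ultimately have "eigenvalue (jac v n) E" unfolding eigenvalue_def eigenvector_def using A by auto
  then show ?thesis using eigenvalue_root_char_poly[OF A] by simp
qed

lemma jac_count:
  "int (size (filter_mset (\<lambda>e. e < E) (proots (char_poly (jac v n))))) = ecount (\<lambda>i. ereal (v i)) E n"
proof (cases "n = 0")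
  case True
  have "char_poly (jac v n) = 1" using degree_monic_char_poly[of "jac v n" n] True unfolding jac_def
    by (auto intro!: monic_degree_0[THEN iffD1])
  moreover have "ecount (\<lambda>i. ereal (v i)) E 0 = 0" using ecount_bounds[where V="\<lambda>i. ereal (v i)" and E=E and n=0] by simp
  ultimately show ?thesis using True by simp
next
  case False
  obtain e where e: "\<And>j s. j < n \<Longrightarrow> e j < s \<longleftrightarrow> int j < ecount (\<lambda>i. ereal (v i)) s n"
    "\<And>i j. i < j \<Longrightarrow> j < n \<Longrightarrow> e i < e j" "\<And>j. j < n \<Longrightarrow> kont v (e j) n = 0"
    using finite_spectrum by blast
  have i1: "inj_on e {..<n}" by (rule inj_onI) (metis e(2) lessThan_iff linorder_neqE_nat less_irrefl)
  let ?S = "e ` {..<n}"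
  have A: "jac v n \<in> carrier_mat n n" unfolding jac_def by simp
  have "char_poly (jac v n) = (\<Prod>x\<in>?S. [:- x, 1:])"
    by (rule monic_poly_eq_prod[where n = n])
      (use degree_monic_char_poly[OF A] i1 jac_eigenvalue e(3) False in \<open>auto simp: card_image\<close>)
  then have "proots (char_poly (jac v n)) = (\<Sum>x\<in>?S. {#x#})" by (simp add: proots_prod)
  also have "\<dots> = mset_set ?S" by (simp add: sum_mset.eq_fold flip: sum_unfold_sum_mset) 
  finally have "size (filter_mset (\<lambda>e. e < E) (proots (char_poly (jac v n)))) = card {x \<in> ?S. x < E}"
    by (simp add: filter_mset_mset_set)
  also have "{x \<in> ?S. x < E} = e ` {..<nat (ecount (\<lambda>i. ereal (v i)) E n)}"
    using e(1)[of _ E] ecount_bounds(2)[where V="\<lambda>i. ereal (v i)" and E=E and n=n] by (auto simp: zless_nat_eq_int_zless)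
  also have "card \<dots> = nat (ecount (\<lambda>i. ereal (v i)) E n)"
    using ecount_bounds(2)[where V="\<lambda>i. ereal (v i)" and E=E and n=n] by (subst card_image[OF inj_on_subset[OF i1]]) auto
  finally show ?thesis using ecount_bounds(1)[where V="\<lambda>i. ereal (v i)" and E=E and n=n] by simp
qed

lemma pick_lessThan: "i < n \<Longrightarrow> pick {..<n} i = i"
proof -
  assume i: "i < n"
  have "{a \<in> {..<n}. a < i} = {..<i}" using i by auto
  then show "pick {..<n} i = i" using pick_card_in_set[of i "{..<n}"] i by simp
qed

context mpot begin

lemma box_count_cnt:
  assumes fin: "\<And>j. j < n \<Longrightarrow> f (x + real j * \<alpha>) \<noteq> -\<infinity>"
  shows "int (box_count f \<alpha> n x E) = cnt x n E"
proof -
  let ?A = "box_matrix f \<alpha> n x"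
  let ?v = "\<lambda>j. real_of_ereal (orb x j)"
  have S: "{j. j < n \<and> ?A $$ (j, j) = -\<infinity>} = {}" using fin unfolding box_matrix_def by auto
  have sub: "map_mat real_of_ereal (submatrix ?A {..<n} {..<n}) = jac ?v n"
    unfolding jac_def submatrix_def box_matrix_def orbit_def
    by (rule eq_matI) (auto simp: pick_lessThan)
  have "box_eigenvalues f \<alpha> n x = image_mset ereal (proots (char_poly (jac ?v n)))"
    unfolding box_eigenvalues_def Let_def S using sub by simp
  then have "box_count f \<alpha> n x E = size (filter_mset (\<lambda>e. e < E) (proots (char_poly (jac ?v n))))"
    unfolding box_count_def by (simp add: filter_mset_image_mset)
  then have "int (box_count f \<alpha> n x E) = ecount (\<lambda>i. ereal (?v i)) E n" by (simp add: jac_count)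
  also have "\<dots> = cnt x n E"
  proof -
    have "ereal (?v j) = orb x j" if "j < n" for j
      using fin[OF that] orb_ninf[of x j] unfolding orbit_def by (cases "f (x + real j * \<alpha>)") auto
    then have "rot (\<lambda>i. ereal (?v i)) E n 0 = rot (orb x) E n 0" by (rule rot_cong)
    then show ?thesis unfolding cnt_def ecount_def by simp
  qed
  finally show ?thesis .
qed

text \<open>The labelled angle is antitone in the phase, hence measurable, and the count differs
  from its rounding by the floor sum.\<close>

lemma cnt_measurable: "(\<lambda>x. real_of_int (cnt x n E)) \<in> borel_measurable borel"
proof -
  define g where "g x = rot (orb x) E n 0 - of_int (fsum \<alpha> x n)" for x
  have "mono (\<lambda>x. - g x)"
  proof (rule monoI)
    fix x y :: real assume xy: "x \<le> y"
    have "rot (orb y) E n 0 \<le> rot (orb (x + (y - x))) (E + \<gamma> * (y - x)) n 0"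
      using gam xy by (simp add: rot_mono_E)
    then show "- g x \<le> - g y" using rot_label[of "y - x" x E n] xy unfolding g_def by simp
  qed
  then have "(\<lambda>x. - g x) \<in> borel_measurable borel" by (rule borel_measurable_mono)
  then have g: "g \<in> borel_measurable borel" using borel_measurable_uminus by force
  have fs: "(\<lambda>x. real_of_int (fsum \<alpha> x n)) \<in> borel_measurable borel" unfolding fsum_def by simp
  have "real_of_int (cnt x n E) = real_of_int \<lceil>g x - 1/2\<rceil> + real_of_int (fsum \<alpha> x n)" for x
  proof -
    have "rot (orb x) E n 0 - 1/2 = (g x - 1/2) + of_int (fsum \<alpha> x n)" unfolding g_def by simp
    then show ?thesis unfolding cnt_def ecount_def by (metis ceiling_add_of_int of_int_add)
  qed
  then show ?thesis using g fs by simp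
qed

lemma cnt_real_bounds: "0 \<le> real_of_int (cnt y n E)" "real_of_int (cnt y n E) \<le> real n"
proof -
  show "0 \<le> real_of_int (cnt y n E)" using cnt_bounds(1) by simp
  have "real_of_int (cnt y n E) \<le> real_of_int (int n)" using cnt_bounds(2)[of y n E] by (simp only: of_int_le_iff)
  then show "real_of_int (cnt y n E) \<le> real n" by simp
qed

text \<open>Phases that put \<open>-\<infinity>\<close> on the diagonal are countably many and leave
  the integral unchanged. At all others the matrix count is \<open>cnt\<close>, whose uniform
  approximation by \<open>n * dens E\<close> can be integrated over the phase.\<close>

lemma ids_dens: "ids f \<alpha> E = dens E"
proof -
  let ?I = "\<lambda>n. LBINT x:{0..1}. real (box_count f \<alpha> n x E)"
  have I: "?I n = (LBINT x:{0..1}. real_of_int (cnt x n E))" for n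
  proof -
    let ?X = "\<Union>j<n. \<Union>k::int. {of_int k - real j * \<alpha>}"
    have cX: "countable ?X" by (intro countable_UN) auto
    have "\<integral>x. indicator {0..1} x *\<^sub>R real_of_int (cnt x n E) \<partial>lborel
        = \<integral>x. indicator {0..1} x *\<^sub>R real (box_count f \<alpha> n x E) \<partial>lborel"
    proof (rule integral_discrete_difference[OF cX])
      fix x assume x: "x \<in> ?X"
      show "emeasure lborel {x} = 0" "{x} \<in> sets lborel" by auto
    next
      fix x assume x: "x \<in> space lborel" "x \<notin> ?X"
      have "f (x + real j * \<alpha>) \<noteq> -\<infinity>" if "j < n" for j
      proof
        assume "f (x + real j * \<alpha>) = -\<infinity>"
        then obtain k :: int where "x + real j * \<alpha> = of_int k" using fneg_int by (auto elim!: Ints_cases)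
        then have "x = of_int k - real j * \<alpha>" by simp
        then show False using x that by blast
      qed
      then have "int (box_count f \<alpha> n x E) = cnt x n E" by (rule box_count_cnt)
      then show "indicator {0..1} x *\<^sub>R real_of_int (cnt x n E) = indicator {0..1} x *\<^sub>R real (box_count f \<alpha> n x E)"
        by (metis of_int_of_nat_eq)
    qed
    then show ?thesis unfolding set_lebesgue_integral_def by simp
  qed
  have bd: "\<bar>?I n - real n * dens E\<bar> \<le> \<epsilon> * real n + C"
    if C: "\<And>y n E. \<bar>of_int (cnt y n E) - real n * dens E\<bar> \<le> \<epsilon> * real n + C" for \<epsilon> C n
  proof -
    have int: "set_integrable lborel {0..1} (\<lambda>x. real_of_int (cnt x n E))"
      unfolding set_integrable_def
    proof (rule integrableI_bounded_set_indicator[where B = "real n"])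
      show "(\<lambda>x. real_of_int (cnt x n E)) \<in> borel_measurable lborel" using cnt_measurable by simp
      show "AE x in lborel. x \<in> {0..1} \<longrightarrow> norm (real_of_int (cnt x n E)) \<le> real n"
      proof (intro AE_I2 impI)
        fix x show "norm (real_of_int (cnt x n E)) \<le> real n"
          using cnt_real_bounds[of x n E] by simp
      qed
    qed (auto)
    have c: "(LBINT x:{0..1::real}. (c::real)) = c" for c by (simp add: set_lebesgue_integral_def measure_def)
    have ic: "set_integrable lborel {0..1::real} (\<lambda>x. c::real)" for c by (simp add: set_integrable_def)
    have "?I n \<le> (LBINT x:{0..1::real}. real n * dens E + (\<epsilon> * real n + C))" unfolding I
      using C[of _ n E] by (intro set_integral_mono int ic) (smt (verit))
    moreover have "(LBINT x:{0..1::real}. real n * dens E - (\<epsilon> * real n + C)) \<le> ?I n" unfolding I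
      using C[of _ n E] by (intro set_integral_mono int ic) (smt (verit))
    ultimately show ?thesis unfolding c by linarith
  qed
  have "(\<lambda>n. ?I n / real n) \<longlonglongrightarrow> dens E"
  proof (rule LIMSEQ_I)
    fix e :: real assume e: "e > 0"
    obtain C where C: "C \<ge> 0" "\<And>y n E. \<bar>of_int (cnt y n E) - real n * dens E\<bar> \<le> e / 2 * real n + C"
      using dens_uniform[of "e / 2"] e by auto
    define M where "M = nat \<lceil>2 * C / e\<rceil> + 1"
    have "norm (?I n / real n - dens E) < e" if n: "n \<ge> M" for n
    proof -
      have n0: "real n > 0" using n unfolding M_def by simp
      have "2 * C / e < real n" using n unfolding M_def by linarith
      then have "C < e / 2 * real n" using e by (simp add: field_simps)
      then have "\<bar>?I n - real n * dens E\<bar> < e * real n" using bd[OF C(2), of n] by simp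
      then have "\<bar>?I n - real n * dens E\<bar> / real n < e" using n0 by (simp add: field_simps)
      moreover have "?I n / real n - dens E = (?I n - real n * dens E) / real n"
        using n0 by (simp add: diff_divide_distrib)
      ultimately show ?thesis using n0 by (simp add: abs_divide)
    qed
    then show "\<exists>no. \<forall>n\<ge>no. norm (?I n / real n - dens E) < e" by blast
  qed
  then show ?thesis unfolding ids_def by (rule limI)
qed

lemma ids_eq: "ids f \<alpha> = dens" using ids_dens by auto

lemma dens_isCont: "isCont dens E"
proof -
  have lip: "\<bar>dens x - dens y\<bar> \<le> \<bar>x - y\<bar> / \<gamma>" for x y
    using dens_Lipschitz[of "x - y" y] dens_Lipschitz[of "y - x" x] dens_mono[of x y] dens_mono[of y x]
    by (cases "x \<le> y") (auto simp: abs_if)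
  have "((\<lambda>x. dens E - \<bar>x - E\<bar> / \<gamma>) \<longlongrightarrow> dens E - \<bar>E - E\<bar> / \<gamma>) (at E)"
     "((\<lambda>x. dens E + \<bar>x - E\<bar> / \<gamma>) \<longlongrightarrow> dens E + \<bar>E - E\<bar> / \<gamma>) (at E)"
    using gam by (intro tendsto_intros; simp)+
  then have l: "((\<lambda>x. dens E - \<bar>x - E\<bar> / \<gamma>) \<longlongrightarrow> dens E) (at E)"
     "((\<lambda>x. dens E + \<bar>x - E\<bar> / \<gamma>) \<longlongrightarrow> dens E) (at E)" by simp_all
  have b: "dens E - \<bar>x - E\<bar> / \<gamma> \<le> dens x" "dens x \<le> dens E + \<bar>x - E\<bar> / \<gamma>" for x
    using lip[of x E] by linarith+
  have "(dens \<longlongrightarrow> dens E) (at E)"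
    by (rule tendsto_sandwich[OF _ _ l]) (simp_all add: b)
  then show ?thesis by (simp add: isCont_def)
qed

lemma dens_at_top: "(dens \<longlongrightarrow> 1) at_top"
proof -
  have le1: "dens E \<le> 1" for E
    by (rule LIMSEQ_le_const2[OF dens_lim]) (use cnt_real_bounds in \<open>auto intro!: exI[of _ 1] simp: divide_le_eq_1\<close>)
  show ?thesis
  proof (rule order_tendstoI)
    fix a :: real assume "a < 1"
    define t where "t = min ((1 - a) / 2) (1/2)"
    have t: "0 < t" "t < 1" "a < 1 - t" using \<open>a < 1\<close> unfolding t_def by (auto simp: min_def field_simps)
    obtain E0 where "\<forall>E\<ge>E0. dens E \<ge> 1 - t" using dens_top[OF t(1,2)] by blast
    then show "eventually (\<lambda>E. a < dens E) at_top" using t unfolding eventually_at_top_linorder by (intro exI[of _ E0]) force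
  next
    fix a :: real assume "a > 1"
    then show "eventually (\<lambda>E. dens E < a) at_top" using le1 by (intro always_eventually) (auto intro: le_less_trans)
  qed
qed

lemma dens_at_bot: "(dens \<longlongrightarrow> 0) at_bot"
proof -
  have ge0: "dens E \<ge> 0" for E
    by (rule LIMSEQ_le_const[OF dens_lim]) (use cnt_bounds(1) in \<open>auto intro!: exI[of _ 1]\<close>)
  show ?thesis
  proof (rule order_tendstoI)
    fix a :: real assume "a > 0"
    define t where "t = min (a / 2) (1/2)"
    have t: "0 < t" "t < 1" "t < a" using \<open>a > 0\<close> unfolding t_def by (auto simp: min_def field_simps)
    obtain E0 where "\<forall>E\<le>E0. dens E \<le> t" using dens_bot[OF t(1,2)] by blast
    then show "eventually (\<lambda>E. dens E < a) at_bot" using t unfolding eventually_at_bot_linorder by (intro exI[of _ E0]) force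
  next
    fix a :: real assume "a < 0"
    then show "eventually (\<lambda>E. a < dens E) at_bot" using ge0 by (intro always_eventually) (auto intro: less_le_trans)
  qed
qed

section \<open>The density of states as a measure without atoms\<close>

definition mu :: "real measure" where "mu = interval_measure dens"

lemma dos_measure_eq: "dos_measure f \<alpha> = mu" unfolding dos_measure_def mu_def ids_eq ..

lemma mu_prob: "real_distribution mu"
  unfolding mu_def
  by (rule real_distribution_interval_measure)
    (use dens_mono dens_isCont dens_at_top dens_at_bot in \<open>auto intro: continuous_within_subset\<close>)

lemma mu_Ioc: "a \<le> b \<Longrightarrow> measure mu {a<..b} = dens b - dens a"
  unfolding mu_def
  by (rule measure_interval_measure_Ioc) (use dens_mono dens_isCont in \<open>auto intro: continuous_within_subset\<close>)

lemma mu_Icc: 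
  assumes "a \<le> b" shows "measure mu {a..b} = dens b - dens a"
proof -
  interpret real_distribution mu by (rule mu_prob)
  have "measure mu {a} \<le> e" if e: "e > 0" for e
  proof -
    have "measure mu {a} \<le> measure mu {a - \<gamma> * e <..a}" using gam e by (intro finite_measure_mono) auto
    also have "\<dots> = dens a - dens (a - \<gamma> * e)" using gam e by (intro mu_Ioc) simp
    also have "\<dots> \<le> e" using dens_Lipschitz[of "\<gamma> * e" "a - \<gamma> * e"] gam e by simp
    finally show ?thesis .
  qed
  then have "measure mu {a} \<le> 0" by (metis dense not_le)
  then have z: "measure mu {a} = 0" using measure_nonneg[of mu "{a}"] by linarith
  have "{a..b} = {a} \<union> {a<..b}" using assms by auto
  moreover have "measure mu ({a} \<union> {a<..b}) = measure mu {a} + measure mu {a<..b}"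
    by (rule finite_measure_Union) auto
  ultimately have "measure mu {a..b} = measure mu {a} + measure mu {a<..b}" by simp
  then show ?thesis using z mu_Ioc[OF assms] by simp
qed

end

section \<open>Bounds for box determinants\<close>

text \<open>Off the singularity this is \<open>loggap\<close> with the distance
  \<open>|E - x|\<close> raised to at least \<open>\<rho>\<close>. Being bounded and nonincreasing
  in the distance, it can be summed from eigenvalue counts alone; the singular remainder is at most
  \<open>logp (\<rho> / |E - x|)\<close>.\<close>

definition clampgap :: "real \<Rightarrow> real \<Rightarrow> real \<Rightarrow> real \<Rightarrow> real" where
  "clampgap R \<rho> E x = ln (1 + R\<^sup>2 / (max \<bar>E - x\<bar> \<rho>)\<^sup>2) / 2"

lemma loggap_alt: "x \<noteq> E \<Longrightarrow> R > 0 \<Longrightarrow> loggap R E x = ln (1 + R\<^sup>2 / \<bar>E - x\<bar>\<^sup>2) / 2"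
proof -
  assume x: "x \<noteq> E" and R: "R > 0"
  let ?d = "\<bar>E - x\<bar>"
  have d: "?d > 0" using x by simp
  have "1 + R\<^sup>2 / ?d\<^sup>2 = ((E - x)\<^sup>2 + R\<^sup>2) / ?d\<^sup>2" using d by (simp add: field_simps)
  then have "ln (1 + R\<^sup>2 / ?d\<^sup>2) = ln ((E - x)\<^sup>2 + R\<^sup>2) - ln (?d\<^sup>2)"
    using d R by (simp add: ln_div add_nonneg_pos)
  also have "ln (?d\<^sup>2) = 2 * ln ?d" by (rule trans[OF ln_realpow]) simp
  finally show ?thesis unfolding loggap_def by (simp add: diff_divide_distrib)
qed

lemma clampgap_le_loggap:
  assumes "x \<noteq> E" "R > 0" "\<rho> > 0" shows "clampgap R \<rho> E x \<le> loggap R E x"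
proof -
  have d: "\<bar>E - x\<bar> > 0" using assms by simp
  have "R\<^sup>2 / (max \<bar>E - x\<bar> \<rho>)\<^sup>2 \<le> R\<^sup>2 / \<bar>E - x\<bar>\<^sup>2"
    using d by (intro divide_left_mono power_mono mult_pos_pos) (auto simp: max_def)
  then show ?thesis unfolding loggap_alt[OF assms(1,2)] clampgap_def
    by (intro divide_right_mono ln_mono) (auto intro: add_pos_nonneg)
qed

lemma loggap_le_clampgap:
  assumes "x \<noteq> E" "R > 0" "\<rho> > 0"
  shows "loggap R E x \<le> clampgap R \<rho> E x + logp (\<rho> / \<bar>E - x\<bar>)"
proof -
  let ?d = "\<bar>E - x\<bar>"
  have d: "?d > 0" using assms by simp
  show ?thesis
  proof (cases "\<rho> \<le> ?d")
    case True
    then show ?thesis unfolding loggap_alt[OF assms(1,2)] clampgap_def using logp_nonneg[of "\<rho> / ?d"]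
      by (simp add: max_def)
  next
    case False
    have p: "1 + R\<^sup>2 / \<rho>\<^sup>2 > 0" by (intro add_pos_nonneg) auto
    have "1 + R\<^sup>2 / ?d\<^sup>2 \<le> (1 + R\<^sup>2 / \<rho>\<^sup>2) * (\<rho> / ?d)\<^sup>2"
    proof -
      have "1 \<le> (\<rho> / ?d)\<^sup>2" using False d by simp
      moreover have "(1 + R\<^sup>2 / \<rho>\<^sup>2) * (\<rho> / ?d)\<^sup>2 = (\<rho> / ?d)\<^sup>2 + R\<^sup>2 / ?d\<^sup>2"
        using assms d by (simp add: field_simps)
      ultimately show ?thesis by linarith
    qed
    then have "ln (1 + R\<^sup>2 / ?d\<^sup>2) \<le> ln ((1 + R\<^sup>2 / \<rho>\<^sup>2) * (\<rho> / ?d)\<^sup>2)"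
      by (intro ln_mono) (auto intro: add_pos_nonneg)
    also have "\<dots> = ln (1 + R\<^sup>2 / \<rho>\<^sup>2) + 2 * ln (\<rho> / ?d)"
      using p assms d by (subst ln_mult_pos) (auto simp: ln_realpow)
    finally have "loggap R E x \<le> ln (1 + R\<^sup>2 / \<rho>\<^sup>2) / 2 + ln (\<rho> / ?d)"
      unfolding loggap_alt[OF assms(1,2)] by simp
    moreover have "clampgap R \<rho> E x = ln (1 + R\<^sup>2 / \<rho>\<^sup>2) / 2" using False unfolding clampgap_def by (simp add: max_def)
    moreover have "ln (\<rho> / ?d) \<le> logp (\<rho> / ?d)" unfolding logp_def by simp
    ultimately show ?thesis by linarith
  qed
qed

lemma clampgap_bounds:
  assumes "\<rho> > 0" shows "0 \<le> clampgap R \<rho> E x" "clampgap R \<rho> E x \<le> ln (1 + R\<^sup>2 / \<rho>\<^sup>2) / 2"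
proof -
  show "0 \<le> clampgap R \<rho> E x" unfolding clampgap_def by (auto intro: ln_ge_zero)
  have "R\<^sup>2 / (max \<bar>E - x\<bar> \<rho>)\<^sup>2 \<le> R\<^sup>2 / \<rho>\<^sup>2"
    using assms by (intro divide_left_mono power_mono mult_pos_pos) (auto simp: max_def)
  then show "clampgap R \<rho> E x \<le> ln (1 + R\<^sup>2 / \<rho>\<^sup>2) / 2" unfolding clampgap_def
    by (intro divide_right_mono ln_mono) (auto intro: add_pos_nonneg)
qed

text \<open>Solving for the distance gives the radius \<open>R / sqrt (exp (2 * t) - 1)\<close>. For
  levels up to the maximum it is at least \<open>\<rho>\<close>, where clamped and unclamped
  distances satisfy the same inequality.\<close>

lemma clampgap_level:
  assumes R: "R > 0" and \<rho>: "\<rho> > 0" and t: "0 < t" "t \<le> ln (1 + R\<^sup>2 / \<rho>\<^sup>2) / 2"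
  obtains g where "g > 0" "\<And>x. t \<le> clampgap R \<rho> E x \<longleftrightarrow> x \<in> {E - g..E + g}"
proof -
  define a where "a = exp (2 * t) - 1"
  have a: "a > 0" using t unfolding a_def by simp
  define g where "g = R / sqrt a"
  have g: "g > 0" unfolding g_def using R a by simp
  have key: "t \<le> ln (1 + R\<^sup>2 / d\<^sup>2) / 2 \<longleftrightarrow> d \<le> g" if d: "d > 0" for d
  proof -
    have p: "1 + R\<^sup>2 / d\<^sup>2 > 0" by (intro add_pos_nonneg) auto
    have "t \<le> ln (1 + R\<^sup>2 / d\<^sup>2) / 2 \<longleftrightarrow> 2 * t \<le> ln (1 + R\<^sup>2 / d\<^sup>2)" by auto
    also have "\<dots> \<longleftrightarrow> exp (2 * t) \<le> 1 + R\<^sup>2 / d\<^sup>2" using p by (rule ln_ge_iff)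
    also have "\<dots> \<longleftrightarrow> a \<le> R\<^sup>2 / d\<^sup>2" unfolding a_def by auto
    also have "\<dots> \<longleftrightarrow> d\<^sup>2 \<le> R\<^sup>2 / a" using a d by (simp add: field_simps)
    also have "R\<^sup>2 / a = g\<^sup>2" unfolding g_def using a by (simp add: power_divide)
    also have "d\<^sup>2 \<le> g\<^sup>2 \<longleftrightarrow> d \<le> g" using d g by (simp add: power_mono_iff)
    finally show ?thesis .
  qed
  have rg: "\<rho> \<le> g" using key[OF \<rho>] t by simp
  have "t \<le> clampgap R \<rho> E x \<longleftrightarrow> x \<in> {E - g..E + g}" for x
  proof -
    have "t \<le> clampgap R \<rho> E x \<longleftrightarrow> max \<bar>E - x\<bar> \<rho> \<le> g" unfolding clampgap_def using \<rho> by (intro key) simp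
    also have "\<dots> \<longleftrightarrow> \<bar>E - x\<bar> \<le> g" using rg by simp
    also have "\<dots> \<longleftrightarrow> x \<in> {E - g..E + g}" by (auto simp: abs_le_iff)
    finally show ?thesis .
  qed
  then show ?thesis using that g by blast
qed

lemma step_count:
  fixes g \<epsilon> :: real
  assumes e: "\<epsilon> > 0" and g: "0 \<le> g" "g \<le> T" and m: "m = nat \<lfloor>T / \<epsilon>\<rfloor>"
  defines "S \<equiv> (\<Sum>i=1..m. \<epsilon> * (if real i * \<epsilon> \<le> g then 1 else 0))"
  shows "S \<le> g" "g - \<epsilon> \<le> S"
proof -
  define n where "n = nat \<lfloor>g / \<epsilon>\<rfloor>"
  have g0: "g / \<epsilon> \<ge> 0" using g e by simp
  have "g / \<epsilon> \<le> T / \<epsilon>" using g e by (intro divide_right_mono) auto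
  then have nm: "n \<le> m" unfolding n_def m by (intro nat_mono floor_mono)
  have iff: "real i * \<epsilon> \<le> g \<longleftrightarrow> i \<le> n" for i
  proof -
    have "real i * \<epsilon> \<le> g \<longleftrightarrow> real i \<le> g / \<epsilon>" using e by (simp add: field_simps)
    also have "\<dots> \<longleftrightarrow> int i \<le> \<lfloor>g / \<epsilon>\<rfloor>" by (simp add: le_floor_iff)
    also have "\<dots> \<longleftrightarrow> i \<le> n" unfolding n_def using g0 by (simp add: le_nat_iff)
    finally show ?thesis .
  qed
  have "S = (\<Sum>i=1..m. if i \<in> {..n} then \<epsilon> else 0)" unfolding S_def iff by (intro sum.cong) auto
  also have "\<dots> = (\<Sum>i\<in>{1..m} \<inter> {..n}. \<epsilon>)" by (rule sum.inter_restrict[symmetric]) simp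
  also have "{1..m} \<inter> {..n} = {1..n}" using nm by auto
  finally have S: "S = real n * \<epsilon>" by simp
  have "real n \<le> g / \<epsilon>" "g / \<epsilon> - 1 \<le> real n" unfolding n_def using g0 by linarith+
  then show "S \<le> g" "g - \<epsilon> \<le> S" unfolding S using e by (simp_all add: field_simps)
qed

context mpot begin

text \<open>Eigenvalues equal to \<open>b\<close> lie strictly below \<open>b + s\<close>; the
  Lipschitz bound pays for \<open>s\<close>, which then tends to \<open>0\<close>.\<close>

lemma closed_count:
  assumes cl: "\<And>s. \<bar>of_int (cnt y h s) - real h * dens s\<bar> \<le> err"
    and sd: "spectral_data (orb y) h es m"
  shows "\<bar>real m + real (length (filter (\<lambda>e. e \<le> b) es)) - real h * dens b\<bar> \<le> err"
proof -
  let ?lt = "\<lambda>s. real (length (filter (\<lambda>e. e < s) es))" and ?le = "real (length (filter (\<lambda>e. e \<le> b) es))"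
  have c: "of_int (cnt y h s) = real m + ?lt s" for s
    using sd unfolding spectral_data_def cnt_def by (metis of_int_add of_int_of_nat_eq)
  have fm: "(\<And>x. P x \<Longrightarrow> Q x) \<Longrightarrow> length (filter P es) \<le> length (filter Q es)" for P Q
    by (induction es) auto
  have "?lt b \<le> ?le" using fm[of "\<lambda>e. e < b" "\<lambda>e. e \<le> b"] by simp
  then have lo: "real h * dens b - err \<le> real m + ?le" using cl[of b] c[of b] by linarith
  have "real m + ?le \<le> real h * dens b + err + z" if z: "z > 0" for z
  proof -
    define s where "s = \<gamma> * (z / (real h + 1))"
    have s: "s > 0" unfolding s_def using z gam by simp
    have "?le \<le> ?lt (b + s)" using fm[of "\<lambda>e. e \<le> b" "\<lambda>e. e < b + s"] s by simp
    then have "real m + ?le \<le> real h * dens (b + s) + err" using cl[of "b + s"] c[of "b + s"] by linarith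
    also have "dens (b + s) \<le> dens b + s / \<gamma>" using s by (intro dens_Lipschitz) simp
    then have "real h * dens (b + s) \<le> real h * (dens b + s / \<gamma>)" by (intro mult_left_mono) auto
    also have "s / \<gamma> = z / (real h + 1)" unfolding s_def using gam by simp
    then have "real h * (s / \<gamma>) \<le> z" using z by (simp add: pos_divide_le_eq algebra_simps)
    then have "real h * (dens b + s / \<gamma>) \<le> real h * dens b + z" by (simp add: distrib_left)
    finally show ?thesis by simp
  qed
  then have "real m + ?le \<le> real h * dens b + err" by (rule field_le_epsilon)
  then show ?thesis using lo by linarith
qed

text \<open>Layer cake with steps of height \<open>\<epsilon>\<close>: a level set is an interval
  around \<open>E\<close>, and its eigenvalue count is off by at most \<open>2 * err\<close>. With
  at most \<open>T / \<epsilon>\<close> levels the total is \<open>2 * T * err\<close>, free of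
  \<open>\<epsilon>\<close>. Rounding to the staircase costs \<open>\<epsilon>\<close> per
  eigenvalue and again \<open>\<epsilon> * h\<close> in the integral.\<close>

lemma sum_clampgap:
  assumes cl: "\<And>s. \<bar>of_int (cnt y h s) - real h * dens s\<bar> \<le> err"
    and sd: "spectral_data (orb y) h es m0" and R: "R > 0" and \<rho>: "\<rho> > 0" and e: "\<epsilon> > 0"
  shows "\<bar>(\<Sum>x\<leftarrow>es. clampgap R \<rho> E x) - real h * (\<integral>x. clampgap R \<rho> E x \<partial>mu)\<bar>
    \<le> 2 * \<epsilon> * real h + ln (1 + R\<^sup>2 / \<rho>\<^sup>2) * err"
proof -
  interpret real_distribution mu by (rule mu_prob)
  let ?G = "clampgap R \<rho> E"
  define T where "T = ln (1 + R\<^sup>2 / \<rho>\<^sup>2) / 2"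
  have T: "0 \<le> ?G x" "?G x \<le> T" for x unfolding T_def using clampgap_bounds[OF \<rho>] by auto
  have T0: "T \<ge> 0" using T[of 0] by linarith
  define m where "m = nat \<lfloor>T / \<epsilon>\<rfloor>"
  define I where "I i x = (if real i * \<epsilon> \<le> ?G x then 1 else 0 :: real)" for i x
  define S where "S x = (\<Sum>i=1..m. \<epsilon> * I i x)" for x
  have S: "S x \<le> ?G x" "?G x - \<epsilon> \<le> S x" for x
    unfolding S_def I_def using step_count[OF e T m_def] by auto
  have lev: "\<exists>g>0. \<forall>x. real i * \<epsilon> \<le> ?G x \<longleftrightarrow> x \<in> {E - g..E + g}" if i: "i \<in> {1..m}" for i
  proof -
    have "real m \<le> T / \<epsilon>" unfolding m_def using T0 e by (simp add: divide_nonneg_pos)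
    then have "real i \<le> T / \<epsilon>" using i by simp
    then have "real i * \<epsilon> \<le> T" using e by (simp add: field_simps)
    then have t: "real i * \<epsilon> \<le> ln (1 + R\<^sup>2 / \<rho>\<^sup>2) / 2" unfolding T_def .
    have t0: "0 < real i * \<epsilon>" using i e by simp
    show ?thesis by (rule clampgap_level[OF R \<rho> t0 t, of E]) blast
  qed
  have Gm: "?G \<in> borel_measurable mu"
    unfolding clampgap_def by (simp add: mu_def)
  have intG: "integrable mu ?G"
    by (rule integrable_const_bound[where B = T]) (use T Gm in auto)
  have each: "integrable mu (I i) \<and> \<bar>(\<Sum>x\<leftarrow>es. I i x) - real h * (\<integral>x. I i x \<partial>mu)\<bar> \<le> 2 * err" if i: "i \<in> {1..m}" for i
  proof -
    obtain g where g: "g > 0" "\<And>x. real i * \<epsilon> \<le> ?G x \<longleftrightarrow> x \<in> {E - g..E + g}" using lev[OF i] by blast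
    have Ii: "I i = indicator {E - g..E + g}" unfolding I_def g(2) by (auto simp: indicator_def)
    have int: "integrable mu (I i)" unfolding Ii
      by (rule integrable_const_bound[where B = 1]) (auto simp: mu_def indicator_def)
    have "(\<integral>x. I i x \<partial>mu) = measure mu {E - g..E + g}" unfolding Ii by (simp add: mu_def)
    also have "\<dots> = dens (E + g) - dens (E - g)" using g by (intro mu_Icc) simp
    finally have mI: "(\<integral>x. I i x \<partial>mu) = dens (E + g) - dens (E - g)" .
    have "(\<Sum>x\<leftarrow>es. I i x) = real (length (filter (\<lambda>x. x \<in> {E - g..E + g}) es))"
      unfolding Ii by (induction es) (auto simp: indicator_def)
    moreover have "length (filter (\<lambda>x. x \<in> {E - g..E + g}) es) + length (filter (\<lambda>e. e < E - g) es)
        = length (filter (\<lambda>e. e \<le> E + g) es)"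
      using g(1) by (induction es) auto
    ultimately have sI: "(\<Sum>x\<leftarrow>es. I i x) = real (length (filter (\<lambda>e. e \<le> E + g) es)) - real (length (filter (\<lambda>e. e < E - g) es))"
      by linarith
    have "\<bar>real m0 + real (length (filter (\<lambda>e. e \<le> E + g) es)) - real h * dens (E + g)\<bar> \<le> err"
      by (rule closed_count[OF cl sd])
    moreover have "of_int (cnt y h (E - g)) = real m0 + real (length (filter (\<lambda>e. e < E - g) es))"
      using sd unfolding spectral_data_def cnt_def by (metis of_int_add of_int_of_nat_eq)
    ultimately have "\<bar>(\<Sum>x\<leftarrow>es. I i x) - (real h * dens (E + g) - real h * dens (E - g))\<bar> \<le> 2 * err"
      unfolding sI using cl[of "E - g"] by linarith
    then show ?thesis using int unfolding mI by (simp add: right_diff_distrib)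
  qed
  have intS: "integrable mu S" unfolding S_def using each by (intro Bochner_Integration.integrable_sum) auto
  have iS: "(\<integral>x. S x \<partial>mu) = (\<Sum>i=1..m. \<epsilon> * (\<integral>x. I i x \<partial>mu))"
    unfolding S_def using each by (subst Bochner_Integration.integral_sum) auto
  have sS: "(\<Sum>x\<leftarrow>es. S x) = (\<Sum>i=1..m. \<epsilon> * (\<Sum>x\<leftarrow>es. I i x))"
    unfolding S_def by (induction es) (simp_all add: sum.distrib distrib_left)
  have "\<bar>(\<Sum>x\<leftarrow>es. S x) - real h * (\<integral>x. S x \<partial>mu)\<bar>
      = \<bar>\<Sum>i=1..m. \<epsilon> * ((\<Sum>x\<leftarrow>es. I i x) - real h * (\<integral>x. I i x \<partial>mu))\<bar>"
    unfolding iS sS by (simp add: sum_subtractf sum_distrib_left algebra_simps)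
  also have "\<dots> \<le> (\<Sum>i=1..m. \<epsilon> * (2 * err))"
  proof (rule order.trans[OF sum_abs], rule sum_mono)
    fix i assume "i \<in> {1..m}"
    then show "\<bar>\<epsilon> * ((\<Sum>x\<leftarrow>es. I i x) - real h * (\<integral>x. I i x \<partial>mu))\<bar> \<le> \<epsilon> * (2 * err)"
      using each[of i] e by (simp add: abs_mult)
  qed
  also have "\<dots> = (real m * \<epsilon>) * (2 * err)" by simp
  also have "\<dots> \<le> T * (2 * err)"
  proof -
    have "0 \<le> err" using cl[of 0] by linarith
    moreover have "real m \<le> T / \<epsilon>" unfolding m_def using T0 e by (simp add: divide_nonneg_pos)
    then have "real m * \<epsilon> \<le> T" using e by (simp add: field_simps)
    ultimately show ?thesis by (intro mult_right_mono) auto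
  qed
  finally have A: "\<bar>(\<Sum>x\<leftarrow>es. S x) - real h * (\<integral>x. S x \<partial>mu)\<bar> \<le> T * (2 * err)" .
  have B: "(\<Sum>x\<leftarrow>es. S x) \<le> (\<Sum>x\<leftarrow>es. ?G x)" "(\<Sum>x\<leftarrow>es. ?G x) \<le> (\<Sum>x\<leftarrow>es. S x) + \<epsilon> * real (length es)"
  proof -
    show "(\<Sum>x\<leftarrow>es. S x) \<le> (\<Sum>x\<leftarrow>es. ?G x)" by (rule sum_list_mono) (rule S)
    show "(\<Sum>x\<leftarrow>es. ?G x) \<le> (\<Sum>x\<leftarrow>es. S x) + \<epsilon> * real (length es)"
    proof (induction es)
      case (Cons a es) then show ?case using S(2)[of a] by (simp add: algebra_simps)
    qed simp
  qed
  have "length es \<le> h" using sd unfolding spectral_data_def by simp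
  then have le: "\<epsilon> * real (length es) \<le> \<epsilon> * real h" using e by simp
  have C1: "(\<integral>x. S x \<partial>mu) \<le> (\<integral>x. ?G x \<partial>mu)" by (rule integral_mono[OF intS intG]) (rule S)
  have "(\<integral>x. ?G x \<partial>mu) \<le> (\<integral>x. S x + \<epsilon> \<partial>mu)"
    by (rule integral_mono[OF intG]) (use S(2) intS in \<open>auto simp: algebra_simps\<close>)
  also have "\<dots> = (\<integral>x. S x \<partial>mu) + \<epsilon>" using intS prob_space by (subst Bochner_Integration.integral_add) auto
  finally have C2: "(\<integral>x. ?G x \<partial>mu) \<le> (\<integral>x. S x \<partial>mu) + \<epsilon>" .
  have D: "real h * (\<integral>x. S x \<partial>mu) \<le> real h * (\<integral>x. ?G x \<partial>mu)"
     "real h * (\<integral>x. ?G x \<partial>mu) \<le> real h * (\<integral>x. S x \<partial>mu) + \<epsilon> * real h"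
    using C1 mult_left_mono[OF C2, of "real h"] by (auto intro: mult_left_mono simp: algebra_simps)
  have "T * (2 * err) = ln (1 + R\<^sup>2 / \<rho>\<^sup>2) * err" unfolding T_def by simp
  then show ?thesis using A B D le unfolding abs_le_iff by linarith
qed

text \<open>Dyadic layer cake once more: the interval of radius \<open>\<rho> / 2 ^ i\<close> has
  mass at most \<open>2 * \<rho> / (\<gamma> * 2 ^ i)\<close> by \<open>dens_Lipschitz\<close>, and
  these bounds sum to \<open>4 * \<rho> / \<gamma>\<close>.\<close>

lemma logp_integral:
  assumes \<rho>: "\<rho> > 0"
  shows "integrable mu (\<lambda>x. logp (\<rho> / \<bar>E - x\<bar>))" "(\<integral>x. logp (\<rho> / \<bar>E - x\<bar>) \<partial>mu) \<le> 4 * \<rho> / \<gamma>"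
proof -
  interpret real_distribution mu by (rule mu_prob)
  let ?g = "\<lambda>x. logp (\<rho> / \<bar>E - x\<bar>)"
  have meas: "?g \<in> borel_measurable mu" unfolding logp_def by (simp add: mu_def)
  have pt: "ennreal (?g x) \<le> (\<Sum>i. indicator {E - \<rho> / 2 ^ i..E + \<rho> / 2 ^ i} x)" for x
  proof (cases "x = E")
    case True then show ?thesis by (simp add: logp_def)
  next
    case False
    then have d: "\<bar>E - x\<bar> > 0" by simp
    define N where "N = nat \<lceil>\<rho> / \<bar>E - x\<bar>\<rceil>"
    have "real N \<ge> \<rho> / \<bar>E - x\<bar>" unfolding N_def by linarith
    then have "?g x \<le> real (card {m. m \<le> N \<and> \<bar>E - x\<bar> \<le> \<rho> / 2 ^ m})"
      by (intro logp_le_count[of \<rho> "\<bar>E - x\<bar>"]) (use \<rho> d in auto)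
    then have "ennreal (?g x) \<le> of_nat (card {m. m \<le> N \<and> \<bar>E - x\<bar> \<le> \<rho> / 2 ^ m})"
      by (metis ennreal_leI ennreal_of_nat_eq_real_of_nat)
    also have "\<dots> = (\<Sum>m\<in>{m. m \<le> N \<and> \<bar>E - x\<bar> \<le> \<rho> / 2 ^ m}. 1)" by simp
    also have "\<dots> = (\<Sum>m\<in>{m. m \<le> N \<and> \<bar>E - x\<bar> \<le> \<rho> / 2 ^ m}. indicator {E - \<rho> / 2 ^ m..E + \<rho> / 2 ^ m} x)"
      by (intro sum.cong refl) (auto simp: indicator_def abs_le_iff algebra_simps)
    also have "\<dots> \<le> (\<Sum>i. indicator {E - \<rho> / 2 ^ i..E + \<rho> / 2 ^ i} x)"
      by (intro sum_le_suminf) auto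
    finally show ?thesis .
  qed
  have "(\<integral>\<^sup>+x. ennreal (?g x) \<partial>mu) \<le> (\<integral>\<^sup>+x. (\<Sum>i. indicator {E - \<rho> / 2 ^ i..E + \<rho> / 2 ^ i} x) \<partial>mu)"
    by (intro nn_integral_mono pt)
  also have "\<dots> = (\<Sum>i. \<integral>\<^sup>+x. indicator {E - \<rho> / 2 ^ i..E + \<rho> / 2 ^ i} x \<partial>mu)"
    by (intro nn_integral_suminf) (simp add: mu_def)
  also have "\<dots> = (\<Sum>i. emeasure mu {E - \<rho> / 2 ^ i..E + \<rho> / 2 ^ i})" by (simp add: mu_def)
  also have "\<dots> \<le> (\<Sum>i. ennreal ((2 * \<rho> / \<gamma>) * (1/2) ^ i))"
  proof (intro suminf_le)
    fix i
    have s: "\<rho> / 2 ^ i > 0" using \<rho> by simp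
    have "emeasure mu {E - \<rho> / 2 ^ i..E + \<rho> / 2 ^ i} = ennreal (dens (E + \<rho> / 2 ^ i) - dens (E - \<rho> / 2 ^ i))"
      using mu_Icc[of "E - \<rho> / 2 ^ i" "E + \<rho> / 2 ^ i"] s by (simp add: emeasure_eq_measure)
    moreover have "dens (E + \<rho> / 2 ^ i) - dens (E - \<rho> / 2 ^ i) \<le> (2 * \<rho> / \<gamma>) * (1/2) ^ i"
    proof -
      have e: "E - \<rho> / 2 ^ i + 2 * (\<rho> / 2 ^ i) = E + \<rho> / 2 ^ i" "2 * (\<rho> / 2 ^ i) / \<gamma> = (2 * \<rho> / \<gamma>) * (1/2) ^ i"
        by (simp_all add: power_divide)
      have "0 \<le> 2 * (\<rho> / 2 ^ i)" using s by simp
      from dens_Lipschitz[OF this, of "E - \<rho> / 2 ^ i"] show ?thesis unfolding e by linarith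
    qed
    ultimately show "emeasure mu {E - \<rho> / 2 ^ i..E + \<rho> / 2 ^ i} \<le> ennreal ((2 * \<rho> / \<gamma>) * (1/2) ^ i)"
      by (simp add: ennreal_leI)
  qed auto
  also have "\<dots> = ennreal (\<Sum>i. (2 * \<rho> / \<gamma>) * (1/2) ^ i)"
    using \<rho> gam by (intro suminf_ennreal2) (auto intro!: summable_mult summable_geometric)
  also have "(\<Sum>i. (2 * \<rho> / \<gamma>) * (1/2::real) ^ i) = 4 * \<rho> / \<gamma>"
    by (subst suminf_mult) (auto simp: suminf_geometric summable_geometric)
  finally have nn: "(\<integral>\<^sup>+x. ennreal (?g x) \<partial>mu) \<le> ennreal (4 * \<rho> / \<gamma>)" .
  show int: "integrable mu ?g"
  proof (rule integrableI_bounded[OF meas])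
    have "(\<integral>\<^sup>+x. ennreal (norm (?g x)) \<partial>mu) = (\<integral>\<^sup>+x. ennreal (?g x) \<partial>mu)" using logp_nonneg by simp
    then show "(\<integral>\<^sup>+x. ennreal (norm (?g x)) \<partial>mu) < \<infinity>" using nn by (simp add: order_le_less_trans)
  qed
  have "ennreal (\<integral>x. ?g x \<partial>mu) = (\<integral>\<^sup>+x. ennreal (?g x) \<partial>mu)"
    using int logp_nonneg by (intro nn_integral_eq_integral[symmetric]) auto
  then have "ennreal (\<integral>x. ?g x \<partial>mu) \<le> ennreal (4 * \<rho> / \<gamma>)" using nn by simp
  then show "(\<integral>x. ?g x \<partial>mu) \<le> 4 * \<rho> / \<gamma>" using \<rho> gam by (subst (asm) ennreal_le_iff) auto
qed

text \<open>A majorant of \<open>ln (|E + iR - x| / R)\<close> valid for all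
  \<open>|E| \<le> M\<close> at once.\<close>

definition tail :: "real \<Rightarrow> real \<Rightarrow> real \<Rightarrow> real" where
  "tail R M x = ln (1 + ((M + \<bar>x\<bar>) / R)\<^sup>2) / 2"

text \<open>At infinity \<open>tail\<close> and \<open>ln |E0 - x|\<close> both grow like
  \<open>ln |x|\<close>, so integrability at a single energy \<open>E0\<close> serves all energies
  up to \<open>M\<close>.\<close>

lemma tail_integrable:
  assumes int: "integrable mu (\<lambda>x. ln \<bar>E0 - x\<bar>)" and R: "R \<ge> 1" and M: "M \<ge> 0"
  shows "integrable mu (tail R M)"
proof -
  interpret real_distribution mu by (rule mu_prob)
  define A where "A = M + \<bar>E0\<bar>"
  have A: "A \<ge> 0" unfolding A_def using M by simp
  have b: "\<bar>tail R M x\<bar> \<le> ln (1 + A) + ln 2 + \<bar>ln \<bar>E0 - x\<bar>\<bar>" for x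
  proof -
    let ?d = "\<bar>E0 - x\<bar>"
    have "(M + \<bar>x\<bar>) / R \<le> (A + ?d) / 1" unfolding A_def using R M by (intro frac_le) auto
    moreover have "0 \<le> (M + \<bar>x\<bar>) / R" using R M by simp
    ultimately have "((M + \<bar>x\<bar>) / R)\<^sup>2 \<le> (A + ?d)\<^sup>2" by (intro power_mono) auto
    moreover have "1 + s\<^sup>2 \<le> (1 + s)\<^sup>2" if "s \<ge> 0" for s :: real using that by (simp add: power2_sum)
    then have "1 + (A + ?d)\<^sup>2 \<le> (1 + (A + ?d))\<^sup>2" using A by simp
    ultimately have "1 + ((M + \<bar>x\<bar>) / R)\<^sup>2 \<le> (1 + (A + ?d))\<^sup>2" by linarith
    also have "\<dots> \<le> ((1 + A) * (1 + ?d))\<^sup>2" using A by (intro power_mono) (auto simp: algebra_simps)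
    finally have "ln (1 + ((M + \<bar>x\<bar>) / R)\<^sup>2) \<le> ln (((1 + A) * (1 + ?d))\<^sup>2)"
      by (intro ln_mono) (auto intro: add_pos_nonneg)
    also have "\<dots> = 2 * ln ((1 + A) * (1 + ?d))" by (subst ln_realpow) simp
    also have "\<dots> = 2 * (ln (1 + A) + ln (1 + ?d))" using A by (subst ln_mult_pos) auto
    finally have "tail R M x \<le> ln (1 + A) + ln (1 + ?d)" unfolding tail_def by simp
    moreover have "ln (1 + ?d) \<le> ln 2 + \<bar>ln ?d\<bar>"
    proof (cases "?d \<le> 1")
      case True
      then have "ln (1 + ?d) \<le> ln 2" by (intro ln_mono) auto
      then show ?thesis using abs_ge_zero[of "ln ?d"] by linarith
    next
      case False
      then have "ln (1 + ?d) \<le> ln (2 * ?d)" by (intro ln_mono) auto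
      also have "\<dots> = ln 2 + ln ?d" using False by (intro ln_mult_pos) auto
      finally show ?thesis by simp
    qed
    moreover have "tail R M x \<ge> 0" unfolding tail_def by (auto intro: ln_ge_zero)
    ultimately show ?thesis by simp
  qed
  show ?thesis
  proof (rule Bochner_Integration.integrable_bound)
    show "integrable mu (\<lambda>x. ln (1 + A) + ln 2 + \<bar>ln \<bar>E0 - x\<bar>\<bar>)" using int by (intro Bochner_Integration.integrable_add) auto
    show "tail R M \<in> borel_measurable mu" unfolding tail_def by (simp add: mu_def)
    show "AE x in mu. norm (tail R M x) \<le> norm (ln (1 + A) + ln 2 + \<bar>ln \<bar>E0 - x\<bar>\<bar>)"
    proof (intro AE_I2)
      fix x show "norm (tail R M x) \<le> norm (ln (1 + A) + ln 2 + \<bar>ln \<bar>E0 - x\<bar>\<bar>)"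
        using b[of x] unfolding real_norm_def by linarith
    qed
  qed
qed

text \<open>Dominated convergence as \<open>R\<close> grows. It fixes the height of the reference
  point \<open>E + iR\<close> for all energies together.\<close>

lemma tail_small:
  assumes int: "integrable mu (\<lambda>x. ln \<bar>E0 - x\<bar>)" and M: "M \<ge> 0" and e: "\<epsilon> > 0"
  shows "\<exists>R\<ge>R0. R \<ge> 1 \<and> (\<integral>x. tail R M x \<partial>mu) < \<epsilon>"
proof -
  have "(\<lambda>n. \<integral>x. tail (real n + 1) M x \<partial>mu) \<longlonglongrightarrow> (\<integral>x. 0 \<partial>mu)"
  proof (rule integral_dominated_convergence[where w = "tail 1 M"])
    show "tail (real n + 1) M \<in> borel_measurable mu" for n unfolding tail_def by (simp add: mu_def)
    show "integrable mu (tail 1 M)" by (rule tail_integrable[OF int _ M]) simp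
    show "AE x in mu. (\<lambda>n. tail (real n + 1) M x) \<longlonglongrightarrow> 0"
    proof (intro AE_I2)
      fix x
      have "(\<lambda>n. (M + \<bar>x\<bar>) / (real n + 1)) \<longlonglongrightarrow> 0"
        using LIMSEQ_inverse_real_of_nat[THEN tendsto_mult_right_zero, of "M + \<bar>x\<bar>"]
        by (simp add: divide_inverse add.commute)
      then have "(\<lambda>n. ln (1 + ((M + \<bar>x\<bar>) / (real n + 1))\<^sup>2) / 2) \<longlonglongrightarrow> ln (1 + 0\<^sup>2) / 2"
        by (intro tendsto_intros) auto
      then show "(\<lambda>n. tail (real n + 1) M x) \<longlonglongrightarrow> 0" unfolding tail_def by simp
    qed
    show "AE x in mu. norm (tail (real n + 1) M x) \<le> tail 1 M x" for n
    proof (intro AE_I2)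
      fix x
      have "((M + \<bar>x\<bar>) / (real n + 1))\<^sup>2 \<le> ((M + \<bar>x\<bar>) / 1)\<^sup>2" using M by (intro power_mono frac_le) auto
      then have "tail (real n + 1) M x \<le> tail 1 M x" unfolding tail_def
        by (intro divide_right_mono ln_mono) (auto intro: add_pos_nonneg)
      moreover have "tail (real n + 1) M x \<ge> 0" unfolding tail_def by (auto intro: ln_ge_zero)
      ultimately show "norm (tail (real n + 1) M x) \<le> tail 1 M x" by simp
    qed
  qed simp
  then have "eventually (\<lambda>n. (\<integral>x. tail (real n + 1) M x \<partial>mu) < \<epsilon>) sequentially"
    using e by (intro order_tendstoD(2)) auto
  then obtain N where N: "\<And>n. n \<ge> N \<Longrightarrow> (\<integral>x. tail (real n + 1) M x \<partial>mu) < \<epsilon>"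
    unfolding eventually_sequentially by blast
  define n where "n = max N (nat \<lceil>R0\<rceil>)"
  have "real n + 1 \<ge> R0" unfolding n_def by linarith
  then show ?thesis using N[of n] unfolding n_def by (intro exI[of _ "real n + 1"]) (auto simp: n_def)
qed

text \<open>The middle term of \<open>ln R + ln (|E + iR - x| / R) - ln |E - x|\<close> lies between
  \<open>0\<close> and \<open>tail\<close>. When the gaps are subtracted from
  \<open>n * ln R\<close>, the \<open>ln R\<close> cancels and \<open>n\<close> times the Lyapunov
  exponent remains.\<close>

lemma loggap_integral:
  assumes int: "integrable mu (\<lambda>x. ln \<bar>E - x\<bar>)" and R: "R \<ge> 1" and M: "\<bar>E\<bar> \<le> M"
  shows "integrable mu (loggap R E)"
    "ln R - (\<integral>x. ln \<bar>E - x\<bar> \<partial>mu) \<le> (\<integral>x. loggap R E x \<partial>mu)"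
    "(\<integral>x. loggap R E x \<partial>mu) \<le> ln R + (\<integral>x. tail R M x \<partial>mu) - (\<integral>x. ln \<bar>E - x\<bar> \<partial>mu)"
proof -
  interpret real_distribution mu by (rule mu_prob)
  let ?t = "\<lambda>x. ln (1 + ((E - x) / R)\<^sup>2) / 2"
  have it: "integrable mu (tail R M)" using tail_integrable[OF int R] M by simp
  have tb: "0 \<le> ?t x" "?t x \<le> tail R M x" for x
  proof -
    show "0 \<le> ?t x" by (auto intro: ln_ge_zero)
    have "\<bar>(E - x) / R\<bar> \<le> \<bar>(M + \<bar>x\<bar>) / R\<bar>" using M R by (auto simp: abs_divide intro!: divide_right_mono)
    then have "((E - x) / R)\<^sup>2 \<le> ((M + \<bar>x\<bar>) / R)\<^sup>2" by (rule abs_le_square_iff[THEN iffD1])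
    then show "?t x \<le> tail R M x" unfolding tail_def by (intro divide_right_mono ln_mono) (auto intro: add_pos_nonneg)
  qed
  have i1: "integrable mu ?t"
  proof (rule Bochner_Integration.integrable_bound[OF it])
    show "?t \<in> borel_measurable mu" by (simp add: mu_def)
    show "AE x in mu. norm (?t x) \<le> norm (tail R M x)"
      using tb by (intro AE_I2) (smt (verit) real_norm_def)
  qed
  have lg: "loggap R E x = ln R + ?t x - ln \<bar>E - x\<bar>" for x
  proof -
    have "(E - x)\<^sup>2 + R\<^sup>2 = R\<^sup>2 * (1 + ((E - x) / R)\<^sup>2)" using R by (simp add: field_simps)
    then have "ln ((E - x)\<^sup>2 + R\<^sup>2) = ln (R\<^sup>2) + ln (1 + ((E - x) / R)\<^sup>2)"
      using R by (simp add: ln_mult_pos add_pos_nonneg)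
    moreover have "ln (R\<^sup>2) = 2 * ln R" using R by (simp add: ln_realpow)
    ultimately show ?thesis unfolding loggap_def by simp
  qed
  then have lgf: "loggap R E = (\<lambda>x. ln R + ?t x - ln \<bar>E - x\<bar>)" by auto
  show "integrable mu (loggap R E)" unfolding lgf using i1 int by auto
  have I: "(\<integral>x. loggap R E x \<partial>mu) = ln R + (\<integral>x. ?t x \<partial>mu) - (\<integral>x. ln \<bar>E - x\<bar> \<partial>mu)"
    unfolding lgf using i1 int prob_space by (simp add: Bochner_Integration.integral_diff Bochner_Integration.integral_add)
  have "0 \<le> (\<integral>x. ?t x \<partial>mu)" using tb by (intro integral_nonneg_AE) auto
  then show "ln R - (\<integral>x. ln \<bar>E - x\<bar> \<partial>mu) \<le> (\<integral>x. loggap R E x \<partial>mu)" unfolding I by simp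
  have "(\<integral>x. ?t x \<partial>mu) \<le> (\<integral>x. tail R M x \<partial>mu)" using tb by (intro integral_mono i1 it) auto
  then show "(\<integral>x. loggap R E x \<partial>mu) \<le> ln R + (\<integral>x. tail R M x \<partial>mu) - (\<integral>x. ln \<bar>E - x\<bar> \<partial>mu)" unfolding I by simp
qed

lemma AE_neq: "AE x in mu. x \<noteq> E"
proof -
  interpret real_distribution mu by (rule mu_prob)
  have "measure mu {E..E} = 0" using mu_Icc[of E E] by simp
  then have "{E} \<in> null_sets mu" by (auto simp: null_sets_def emeasure_eq_measure)
  then show ?thesis by (rule AE_I') auto
qed

lemma clampgap_integral:
  assumes int: "integrable mu (\<lambda>x. ln \<bar>E - x\<bar>)" and R: "R \<ge> 1" and M: "\<bar>E\<bar> \<le> M" and \<rho>: "\<rho> > 0"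
  shows "ln R - (\<integral>x. ln \<bar>E - x\<bar> \<partial>mu) - 4 * \<rho> / \<gamma> \<le> (\<integral>x. clampgap R \<rho> E x \<partial>mu)"
    "(\<integral>x. clampgap R \<rho> E x \<partial>mu) \<le> ln R + (\<integral>x. tail R M x \<partial>mu) - (\<integral>x. ln \<bar>E - x\<bar> \<partial>mu)"
proof -
  interpret real_distribution mu by (rule mu_prob)
  note lg = loggap_integral[OF int R M] and lp = logp_integral[OF \<rho>, of E]
  have ic: "integrable mu (clampgap R \<rho> E)"
  proof (rule integrable_const_bound[where B = "ln (1 + R\<^sup>2 / \<rho>\<^sup>2) / 2"])
    show "AE x in mu. norm (clampgap R \<rho> E x) \<le> ln (1 + R\<^sup>2 / \<rho>\<^sup>2) / 2" using clampgap_bounds[OF \<rho>] by auto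
    show "clampgap R \<rho> E \<in> borel_measurable mu" unfolding clampgap_def by (simp add: mu_def)
  qed
  have R0: "R > 0" using R by simp
  have "AE x in mu. clampgap R \<rho> E x \<le> loggap R E x"
    using AE_neq[of E] by eventually_elim (rule clampgap_le_loggap[OF _ R0 \<rho>])
  then have "(\<integral>x. clampgap R \<rho> E x \<partial>mu) \<le> (\<integral>x. loggap R E x \<partial>mu)" by (intro integral_mono_AE ic lg(1))
  then show "(\<integral>x. clampgap R \<rho> E x \<partial>mu) \<le> ln R + (\<integral>x. tail R M x \<partial>mu) - (\<integral>x. ln \<bar>E - x\<bar> \<partial>mu)"
    using lg(3) by linarith
  have "AE x in mu. loggap R E x \<le> clampgap R \<rho> E x + logp (\<rho> / \<bar>E - x\<bar>)"
    using AE_neq[of E] by eventually_elim (rule loggap_le_clampgap[OF _ R0 \<rho>])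
  then have "(\<integral>x. loggap R E x \<partial>mu) \<le> (\<integral>x. clampgap R \<rho> E x + logp (\<rho> / \<bar>E - x\<bar>) \<partial>mu)"
    by (intro integral_mono_AE lg(1) Bochner_Integration.integrable_add ic lp(1))
  also have "\<dots> = (\<integral>x. clampgap R \<rho> E x \<partial>mu) + (\<integral>x. logp (\<rho> / \<bar>E - x\<bar>) \<partial>mu)"
    using ic lp(1) by (rule Bochner_Integration.integral_add)
  finally show "ln R - (\<integral>x. ln \<bar>E - x\<bar> \<partial>mu) - 4 * \<rho> / \<gamma> \<le> (\<integral>x. clampgap R \<rho> E x \<partial>mu)"
    using lg(2) lp(2) by linarith
qed

text \<open>The phase at which the labelled angle falls through \<open>\<kappa> - 1/2\<close>, that
  is, where the eigenvalue with this label passes \<open>E\<close>. A supremum is taken because the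
  potential, and with it the angle, may be discontinuous in the phase.\<close>

definition xing :: "nat \<Rightarrow> real \<Rightarrow> int \<Rightarrow> real" where
  "xing h E \<kappa> = Sup {y. rot (orb y) E h 0 - of_int (fsum \<alpha> y h) > of_int \<kappa> - 1/2}"

lemma fsum_int: "fsum \<alpha> (y + of_int c) h = fsum \<alpha> y h + int h * c"
proof -
  have e: "y + of_int c + real j * \<alpha> = (y + real j * \<alpha>) + of_int c" for j by simp
  show ?thesis unfolding fsum_def e floor_add_int[symmetric] by (simp add: sum.distrib)
qed

lemma lab_int: "rot (orb (y + of_int c)) E h 0 - of_int (fsum \<alpha> (y + of_int c) h)
    = rot (orb y) E h 0 - of_int (fsum \<alpha> y h) - real h * of_int c"
  unfolding orb_int fsum_int by simp

lemma lab_mono: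
  assumes "x \<le> y"
  shows "rot (orb y) E h 0 - of_int (fsum \<alpha> y h) \<le> rot (orb x) E h 0 - of_int (fsum \<alpha> x h)"
proof -
  have "rot (orb y) E h 0 \<le> rot (orb (x + (y - x))) (E + \<gamma> * (y - x)) h 0"
    using gam assms by (simp add: rot_mono_E)
  then show ?thesis using rot_label[of "y - x" x E h] assms by simp
qed

lemma xing_set:
  assumes "h > 0"
  shows "bdd_above {y. rot (orb y) E h 0 - of_int (fsum \<alpha> y h) > of_int \<kappa> - 1/2}"
    "{y. rot (orb y) E h 0 - of_int (fsum \<alpha> y h) > of_int \<kappa> - 1/2} \<noteq> {}"
proof -
  let ?L = "\<lambda>y. rot (orb y) E h 0 - of_int (fsum \<alpha> y h)"
  have L: "?L (of_int c) = ?L 0 - real h * of_int c" for c using lab_int[of 0 c E h] by simp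
  define c where "c = \<lceil>\<bar>?L 0 - (of_int \<kappa> - 1/2)\<bar>\<rceil> + 1"
  have c: "of_int c > \<bar>?L 0 - (of_int \<kappa> - 1/2)\<bar>" unfolding c_def by linarith
  have h1: "real h \<ge> 1" using assms by simp
  have "real h * of_int c \<ge> 1 * of_int c" using h1 c by (intro mult_right_mono) auto
  then have hc: "real h * of_int c > \<bar>?L 0 - (of_int \<kappa> - 1/2)\<bar>" using c by linarith
  have "y \<le> of_int c" if "?L y > of_int \<kappa> - 1/2" for y
  proof (rule ccontr)
    assume "\<not> y \<le> of_int c"
    then have "?L y \<le> ?L (of_int c)" by (intro lab_mono) simp
    then show False using that hc unfolding L by linarith
  qed
  then show "bdd_above {y. ?L y > of_int \<kappa> - 1/2}" by (intro bdd_aboveI[of _ "of_int c"]) auto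
  have "?L (of_int (- c)) > of_int \<kappa> - 1/2" unfolding L using hc by simp
  then show "{y. ?L y > of_int \<kappa> - 1/2} \<noteq> {}" by blast
qed

text \<open>When the phase rises by \<open>1\<close>, each of the \<open>h\<close> sites passes one
  integer, so labels shift by \<open>h\<close>. Modulo \<open>1\<close> there are thus only
  \<open>h\<close> crossings.\<close>

lemma xing_int:
  assumes "h > 0" shows "xing h E (\<kappa> + int h * c) = xing h E \<kappa> - of_int c"
proof -
  let ?L = "\<lambda>y. rot (orb y) E h 0 - of_int (fsum \<alpha> y h)"
  let ?U = "\<lambda>\<kappa>. {y. ?L y > of_int \<kappa> - 1/2}"
  have "?U (\<kappa> + int h * c) = (\<lambda>y. y - of_int c) ` ?U \<kappa>"
  proof (intro equalityI subsetI)
    fix y assume y: "y \<in> ?U (\<kappa> + int h * c)"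
    have "y + of_int c \<in> ?U \<kappa>" using y lab_int[of y c E h] by simp
    then show "y \<in> (\<lambda>y. y - of_int c) ` ?U \<kappa>" by (intro image_eqI[of _ _ "y + of_int c"]) auto
  next
    fix y assume "y \<in> (\<lambda>y. y - of_int c) ` ?U \<kappa>"
    then obtain z where z: "z \<in> ?U \<kappa>" "y = z - of_int c" by blast
    then show "y \<in> ?U (\<kappa> + int h * c)" using lab_int[of y c E h] by simp
  qed
  moreover have "Sup ((\<lambda>y. y - of_int c) ` ?U \<kappa>) = Sup (?U \<kappa>) - of_int c"
  proof (rule antisym)
    note X = xing_set[OF assms, of \<kappa> E]
    show "Sup ((\<lambda>y. y - of_int c) ` ?U \<kappa>) \<le> Sup (?U \<kappa>) - of_int c"
      using X by (intro cSup_least) (auto intro: cSup_upper)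
    have "bdd_above ((\<lambda>y. y - of_int c) ` ?U \<kappa>)" using X(1) by (intro bdd_above_image_mono) (auto simp: mono_def)
    then have "z - of_int c \<le> Sup ((\<lambda>y. y - of_int c) ` ?U \<kappa>)" if "z \<in> ?U \<kappa>" for z
      using that by (intro cSup_upper) auto
    then have "Sup (?U \<kappa>) \<le> Sup ((\<lambda>y. y - of_int c) ` ?U \<kappa>) + of_int c"
      using X(2) by (intro cSup_least) (auto simp: algebra_simps)
    then show "Sup (?U \<kappa>) - of_int c \<le> Sup ((\<lambda>y. y - of_int c) ` ?U \<kappa>)" by simp
  qed
  ultimately show ?thesis unfolding xing_def by simp
qed

lemma sorted_count:
  assumes "sorted es" "j < length es"
  shows "es ! j < s \<longleftrightarrow> j < length (filter (\<lambda>e. e < s) es)"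
proof -
  have len: "length (filter (\<lambda>e. e < s) es) = card {i. i < length es \<and> es ! i < s}"
    by (rule length_filter_conv_card)
  show ?thesis
  proof
    assume a: "es ! j < s"
    have "{0..j} \<subseteq> {i. i < length es \<and> es ! i < s}"
    proof
      fix i assume "i \<in> {0..j}"
      then have "es ! i \<le> es ! j" using assms by (intro sorted_nth_mono) auto
      then show "i \<in> {i. i < length es \<and> es ! i < s}" using a assms \<open>i \<in> {0..j}\<close> by auto
    qed
    then have "card {0..j} \<le> length (filter (\<lambda>e. e < s) es)" unfolding len by (intro card_mono) auto
    then show "j < length (filter (\<lambda>e. e < s) es)" by simp
  next
    assume b: "j < length (filter (\<lambda>e. e < s) es)"
    show "es ! j < s"
    proof (rule ccontr)
      assume "\<not> es ! j < s"
      have "{i. i < length es \<and> es ! i < s} \<subseteq> {..<j}"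
      proof
        fix i assume i: "i \<in> {i. i < length es \<and> es ! i < s}"
        show "i \<in> {..<j}"
        proof (rule ccontr)
          assume "i \<notin> {..<j}"
          then have "es ! j \<le> es ! i" using assms i by (intro sorted_nth_mono) auto
          then show False using i \<open>\<not> es ! j < s\<close> by auto
        qed
      qed
      then have "card {i. i < length es \<and> es ! i < s} \<le> card {..<j}" by (intro card_mono) auto
      then show False using b unfolding len by simp
    qed
  qed
qed

text \<open>Since the labelled eigenvalues increase in \<open>y\<close> with speed at least \<open>\<gamma>\<close>, an eigenvalue close to \<open>E\<close>
  forces \<open>y\<close> to be close to the point where that eigenvalue crosses \<open>E\<close>.\<close>
lemma eigenvalue_xing:
  assumes h: "h > 0" and sd: "spectral_data (orb y) h es m" and j: "j < length es"
  shows "\<gamma> * \<bar>y - xing h E (int m + int j + 1 - fsum \<alpha> y h)\<bar> \<le> \<bar>E - es ! j\<bar>"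
proof -
  let ?L = "\<lambda>E y. rot (orb y) E h 0 - of_int (fsum \<alpha> y h)"
  define \<kappa> where "\<kappa> = int m + int j + 1 - fsum \<alpha> y h"
  have iff: "es ! j < s \<longleftrightarrow> ?L s y > of_int \<kappa> - 1/2" for s
  proof -
    have c: "ecount (orb y) s h = int m + int (length (filter (\<lambda>e. e < s) es))" "sorted es"
      using sd unfolding spectral_data_def by auto
    have "es ! j < s \<longleftrightarrow> int m + int j < ecount (orb y) s h" using sorted_count[OF c(2) j, of s] c(1) by simp
    also have "\<dots> \<longleftrightarrow> of_int (int m + int j) < rot (orb y) s h 0 - 1/2" unfolding ecount_def by (rule less_ceiling_iff)
    also have "\<dots> \<longleftrightarrow> ?L s y > of_int \<kappa> - 1/2" unfolding \<kappa>_def by auto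
    finally show ?thesis .
  qed
  let ?U = "{y. ?L E y > of_int \<kappa> - 1/2}"
  note X = xing_set[OF h, of \<kappa> E]
  show ?thesis
  proof (cases "es ! j < E")
    case True
    then have yU: "y \<in> ?U" using iff[of E] by simp
    then have "y \<le> xing h E \<kappa>" unfolding xing_def using X(1) by (rule cSup_upper)
    moreover have "xing h E \<kappa> \<le> y + (E - es ! j) / \<gamma>" unfolding xing_def
    proof (rule cSup_least[OF X(2)])
      fix z assume z: "z \<in> ?U"
      show "z \<le> y + (E - es ! j) / \<gamma>"
      proof (cases "z \<le> y")
        case True then show ?thesis using \<open>es ! j < E\<close> gam by (smt (verit) divide_nonneg_pos)
      next
        case False
        have "?L (E - \<gamma> * (z - y) + \<gamma> * (z - y)) (y + (z - y)) \<le> ?L (E - \<gamma> * (z - y)) y"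
          using False by (intro rot_label) simp
        then have "?L (E - \<gamma> * (z - y)) y > of_int \<kappa> - 1/2" using z by simp
        then have "es ! j < E - \<gamma> * (z - y)" using iff by simp
        then have "z - y \<le> (E - es ! j) / \<gamma>" using gam by (simp add: field_simps)
        then show ?thesis by simp
      qed
    qed
    ultimately have "\<bar>y - xing h E \<kappa>\<bar> \<le> (E - es ! j) / \<gamma>" by linarith
    then show ?thesis using True gam unfolding \<kappa>_def by (simp add: field_simps)
  next
    case False
    have "z \<le> y" if "z \<in> ?U" for z
    proof (rule ccontr)
      assume "\<not> z \<le> y"
      then have "?L E z \<le> ?L E y" by (intro lab_mono) simp
      then show False using that iff[of E] False by auto
    qed
    then have up: "xing h E \<kappa> \<le> y" unfolding xing_def using X(2) by (intro cSup_least) auto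
    have "y - (es ! j - E) / \<gamma> \<le> xing h E \<kappa>"
    proof (rule dense_le)
      fix z assume z: "z < y - (es ! j - E) / \<gamma>"
      then have zy: "z \<le> y" using False gam by (smt (verit) divide_nonneg_pos)
      have "(es ! j - E) / \<gamma> < y - z" using z by simp
      then have "es ! j < E + \<gamma> * (y - z)" using gam by (simp add: field_simps)
      then have "?L (E + \<gamma> * (y - z)) y > of_int \<kappa> - 1/2" using iff by simp
      moreover have "?L (E + \<gamma> * (y - z)) (z + (y - z)) \<le> ?L E z" using zy by (intro rot_label) simp
      ultimately have "z \<in> ?U" by simp
      then show "z \<le> xing h E \<kappa>" unfolding xing_def using X(1) by (rule cSup_upper)
    qed
    then have "\<bar>y - xing h E \<kappa>\<bar> \<le> (es ! j - E) / \<gamma>" using up by linarith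
    then show ?thesis using False gam unfolding \<kappa>_def by (simp add: field_simps)
  qed
qed

text \<open>The eigenvalues of one box carry consecutive labels, at most \<open>h\<close> of them,
  hence distinct ones modulo \<open>h\<close>: every crossing is charged at most once. Distance in
  energy is at least \<open>\<gamma>\<close> times distance in phase by
  \<open>eigenvalue_xing\<close>.\<close>

lemma near_sum:
  assumes h: "h > 0" and sd: "spectral_data (orb y) h es m" and r: "r > 0"
    and pos: "\<And>\<kappa>. \<kappa> < h \<Longrightarrow> circ_dist (y - xing h E (int \<kappa>)) > 0"
  shows "(\<Sum>x\<leftarrow>es. logp (\<gamma> * r / \<bar>E - x\<bar>)) \<le> (\<Sum>\<kappa><h. logp (r / circ_dist (y - xing h E (int \<kappa>))))"
    "E \<notin> set es"
proof -
  let ?d = "\<lambda>\<kappa>. circ_dist (y - xing h E (int \<kappa>))"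
  define g where "g j = nat ((int m + int j + 1 - fsum \<alpha> y h) mod int h)" for j :: nat
  have gh: "g j < h" for j unfolding g_def using h by (simp add: nat_less_iff)
  have dist: "\<gamma> * ?d (g j) \<le> \<bar>E - es ! j\<bar>" if j: "j < length es" for j
  proof -
    define k where "k = int m + int j + 1 - fsum \<alpha> y h"
    have "k = int (g j) + int h * (k div int h)" unfolding g_def k_def[symmetric] using h by simp
    then have "xing h E k = xing h E (int (g j)) - of_int (k div int h)" using xing_int[OF h] by metis
    then have "y - xing h E (int (g j)) = (y - xing h E k) + of_int (- (k div int h))" by simp
    then have "?d (g j) = circ_dist (y - xing h E k)" by (metis circ_dist_add_int)
    also have "\<dots> \<le> \<bar>y - xing h E k\<bar>" by (rule circ_dist_le_abs)
    finally have "\<gamma> * ?d (g j) \<le> \<gamma> * \<bar>y - xing h E k\<bar>" using gam by simp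
    then show ?thesis using eigenvalue_xing[OF h sd j, of E] unfolding k_def by linarith
  qed
  show "E \<notin> set es"
  proof
    assume "E \<in> set es"
    then obtain j where j: "j < length es" "es ! j = E" by (auto simp: in_set_conv_nth)
    then have "\<gamma> * ?d (g j) \<le> 0" using dist[OF j(1)] by simp
    then show False using mult_pos_pos[OF gam pos[OF gh[of j]]] by linarith
  qed
  have len: "length es \<le> h" using sd unfolding spectral_data_def by simp
  have inj: "inj_on g {..<length es}"
  proof (rule inj_onI)
    fix i j assume ij: "i \<in> {..<length es}" "j \<in> {..<length es}" "g i = g j"
    let ?a = "int m + int i + 1 - fsum \<alpha> y h" and ?b = "int m + int j + 1 - fsum \<alpha> y h"
    have "?a mod int h = ?b mod int h" using ij(3) h unfolding g_def by (simp add: eq_nat_nat_iff)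
    then have "int h dvd ?a - ?b" by (simp add: mod_eq_dvd_iff)
    then have "int h dvd int i - int j" by simp
    have "int i - int j = 0"
    proof (rule ccontr)
      assume "int i - int j \<noteq> 0"
      then have "\<bar>int h\<bar> \<le> \<bar>int i - int j\<bar>" using \<open>int h dvd int i - int j\<close> by (rule dvd_imp_le_int)
      then show False using ij len by auto
    qed
    then show "i = j" by simp
  qed
  have "(\<Sum>x\<leftarrow>es. logp (\<gamma> * r / \<bar>E - x\<bar>)) = (\<Sum>j<length es. logp (\<gamma> * r / \<bar>E - es ! j\<bar>))"
    by (simp add: sum_list_sum_nth atLeast0LessThan)
  also have "\<dots> \<le> (\<Sum>j<length es. logp (r / ?d (g j)))"
  proof (intro sum_mono logp_mono)
    fix j assume "j \<in> {..<length es}"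
    then have j: "j < length es" by simp
    have p: "0 < \<gamma> * ?d (g j)" using mult_pos_pos[OF gam pos[OF gh[of j]]] .
    then have p2: "0 < \<bar>E - es ! j\<bar>" using dist[OF j] by linarith
    then show "0 < \<gamma> * r / \<bar>E - es ! j\<bar>" using gam r by simp
    have "\<gamma> * r / \<bar>E - es ! j\<bar> \<le> \<gamma> * r / (\<gamma> * ?d (g j))"
      using dist[OF j] p p2 gam r by (intro divide_left_mono) auto
    then show "\<gamma> * r / \<bar>E - es ! j\<bar> \<le> r / ?d (g j)" using gam by simp
  qed
  also have "\<dots> = (\<Sum>\<kappa>\<in>g ` {..<length es}. logp (r / ?d \<kappa>))" using inj by (simp add: sum.reindex)
  also have "\<dots> \<le> (\<Sum>\<kappa><h. logp (r / ?d \<kappa>))" by (intro sum_mono2) (use gh logp_nonneg in auto)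
  finally show "(\<Sum>x\<leftarrow>es. logp (\<gamma> * r / \<bar>E - x\<bar>)) \<le> (\<Sum>\<kappa><h. logp (r / ?d \<kappa>))" .
qed

lemma orb_one_inf:
  assumes irr: "\<alpha> \<notin> \<rat>" and "orb y i = -\<infinity>" "orb y j = -\<infinity>" shows "i = j"
proof (rule ccontr)
  assume ne: "i \<noteq> j"
  have "y + real i * \<alpha> \<in> \<int>" "y + real j * \<alpha> \<in> \<int>" using assms fneg_int unfolding orbit_def by auto
  then have "(y + real i * \<alpha>) - (y + real j * \<alpha>) \<in> \<int>" by (rule Ints_diff)
  then have "(real i - real j) * \<alpha> \<in> \<int>" by (simp add: algebra_simps)
  then have "(real i - real j) * \<alpha> \<in> \<rat>" using Ints_subset_Rats by blast
  then have "((real i - real j) * \<alpha>) / (real i - real j) \<in> \<rat>" by (intro Rats_divide) auto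
  then show False using ne irr by simp
qed

text \<open>From above, gaps are bounded below by clamped gaps; from below, they are bounded above
  by clamped gaps plus logarithms that \<open>near_sum\<close> charges to the crossings. The
  quantifiers matter: \<open>R\<close> is chosen before \<open>r\<close> and \<open>C\<close> after
  it, both uniformly in energy, phase and box length.\<close>

lemma box_bounds:
  assumes irr: "\<alpha> \<notin> \<rat>" and int0: "integrable mu (\<lambda>x. ln \<bar>E0 - x\<bar>)" and M: "M \<ge> 0" and e: "\<epsilon> > 0"
  shows "\<exists>R\<ge>3. \<forall>r>0. \<exists>C\<ge>1. \<forall>E L. \<bar>E\<bar> \<le> M \<longrightarrow> integrable mu (\<lambda>x. ln \<bar>E - x\<bar>) \<longrightarrow>
     L = (\<integral>x. ln \<bar>E - x\<bar> \<partial>mu) \<longrightarrow>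
     (\<forall>y h. \<bar>pbox R E (orb y) h\<bar> \<le> C * exp ((L + \<epsilon>) * real h)) \<and>
     (\<forall>h. \<exists>xh. \<forall>y. (\<forall>\<kappa><h. circ_dist (y - xh \<kappa>) > 0) \<longrightarrow>
        exp ((L - \<epsilon>) * real h - (\<Sum>\<kappa><h. logp (r / circ_dist (y - xh \<kappa>)))) \<le> C * \<bar>pbox R E (orb y) h\<bar>)"
proof -
  obtain R where R: "R \<ge> max 3 (8 / \<epsilon>)" and tail: "(\<integral>x. tail R M x \<partial>mu) < \<epsilon> / 8"
    using tail_small[OF int0 M, of "\<epsilon> / 8" "max 3 (8 / \<epsilon>)"] e by auto
  have R3: "R \<ge> 3" and R0: "R > 0" and R1: "R \<ge> 1" using R by auto
  have "8 / \<epsilon> \<le> R" using R by simp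
  then have Re: "1 / R \<le> \<epsilon> / 8" using e R0 by (simp add: field_simps)
  have spec: "\<exists>es m. spectral_data (orb y) h es m" for y h
    by (rule box_spectrum) (use orb_ninf orb_one_inf[OF irr] in auto)
  have "\<exists>C\<ge>1. \<forall>E L. \<bar>E\<bar> \<le> M \<longrightarrow> integrable mu (\<lambda>x. ln \<bar>E - x\<bar>) \<longrightarrow>
     L = (\<integral>x. ln \<bar>E - x\<bar> \<partial>mu) \<longrightarrow>
     (\<forall>y h. \<bar>pbox R E (orb y) h\<bar> \<le> C * exp ((L + \<epsilon>) * real h)) \<and>
     (\<forall>h. \<exists>xh. \<forall>y. (\<forall>\<kappa><h. circ_dist (y - xh \<kappa>) > 0) \<longrightarrow>
        exp ((L - \<epsilon>) * real h - (\<Sum>\<kappa><h. logp (r / circ_dist (y - xh \<kappa>)))) \<le> C * \<bar>pbox R E (orb y) h\<bar>)"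
    if r: "r > 0" for r
  proof -
    \<comment> \<open>Makes the clamping loss \<open>4 * \<rho>u / \<gamma>\<close> equal to
      \<open>\<epsilon> / 8\<close>.\<close>
    define \<rho>u where "\<rho>u = \<epsilon> * \<gamma> / 32"
    define \<rho> where "\<rho> = \<gamma> * r"
    have ru: "\<rho>u > 0" and rr: "\<rho> > 0" unfolding \<rho>u_def \<rho>_def using e gam r by auto
    define T where "T = ln (1 + R\<^sup>2 / \<rho>u\<^sup>2) + ln (1 + R\<^sup>2 / \<rho>\<^sup>2)"
    have T1: "ln (1 + R\<^sup>2 / \<rho>u\<^sup>2) \<ge> 0" "ln (1 + R\<^sup>2 / \<rho>\<^sup>2) \<ge> 0" by (auto intro: ln_ge_zero)
    have T0: "T \<ge> 0" unfolding T_def using T1 by simp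
    \<comment> \<open>The accuracy carries \<open>T + 1\<close> in the denominator because
      \<open>sum_clampgap\<close> multiplies the counting error by up to \<open>T\<close>.\<close>
    obtain C0 where C0: "C0 \<ge> 0" "\<And>y n E. \<bar>of_int (cnt y n E) - real n * dens E\<bar> \<le> \<epsilon> / (8 * (T + 1)) * real n + C0"
      using dens_uniform[of "\<epsilon> / (8 * (T + 1))"] e T0 by auto
    have err: "t * (\<epsilon> / (8 * (T + 1)) * real n + C0) \<le> \<epsilon> / 8 * real n + T * C0" if t: "0 \<le> t" "t \<le> T" for t n
    proof -
      have "t * (\<epsilon> / (8 * (T + 1)) * real n + C0) \<le> T * (\<epsilon> / (8 * (T + 1)) * real n + C0)"
        using t e T0 C0 by (intro mult_right_mono) auto
      also have "\<dots> = (T / (T + 1)) * (\<epsilon> / 8 * real n) + T * C0" using T0 by (simp add: field_simps)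
      also have "(T / (T + 1)) * (\<epsilon> / 8 * real n) \<le> 1 * (\<epsilon> / 8 * real n)"
        using T0 e by (intro mult_right_mono) auto
      finally show ?thesis by simp
    qed
    define C where "C = exp (T * C0)"
    have C1: "C \<ge> 1" unfolding C_def using T0 C0 by simp
    show ?thesis
    proof (intro exI[of _ C] conjI allI impI)
      show "C \<ge> 1" by (rule C1)
      fix E L assume EM: "\<bar>E\<bar> \<le> M" and int: "integrable mu (\<lambda>x. ln \<bar>E - x\<bar>)" and L: "L = (\<integral>x. ln \<bar>E - x\<bar> \<partial>mu)"
      { fix y h
        obtain es m where sd: "spectral_data (orb y) h es m" using spec by blast
        show "\<bar>pbox R E (orb y) h\<bar> \<le> C * exp ((L + \<epsilon>) * real h)"
        proof (cases "E \<in> set es")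
          case True
          then have "pbox R E (orb y) h = 0" using sd R3 unfolding spectral_data_def by blast
          then show ?thesis using C1 by simp
        next
          case False
          then have p: "pbox R E (orb y) h \<noteq> 0"
            "\<bar>ln \<bar>pbox R E (orb y) h\<bar> - (real h * ln R - (\<Sum>e\<leftarrow>es. loggap R E e))\<bar> \<le> real h / R"
            using sd R3 unfolding spectral_data_def by blast+
          have "(\<Sum>x\<leftarrow>es. clampgap R \<rho>u E x) \<le> (\<Sum>x\<leftarrow>es. loggap R E x)"
            using False R0 ru by (intro sum_list_mono clampgap_le_loggap) auto
          moreover have "\<bar>(\<Sum>x\<leftarrow>es. clampgap R \<rho>u E x) - real h * (\<integral>x. clampgap R \<rho>u E x \<partial>mu)\<bar>
             \<le> 2 * (\<epsilon> / 8) * real h + (\<epsilon> / 8 * real h + T * C0)"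
            using sum_clampgap[OF C0(2) sd R0 ru, of "\<epsilon> / 8" E] err[of "ln (1 + R\<^sup>2 / \<rho>u\<^sup>2)" h] T1 e
            unfolding T_def by linarith
          moreover have "real h * (ln R - L - \<epsilon> / 8) \<le> real h * (\<integral>x. clampgap R \<rho>u E x \<partial>mu)"
            using clampgap_integral(1)[OF int R1 EM ru] gam unfolding L \<rho>u_def
            by (intro mult_left_mono) auto
          moreover have "real h / R \<le> \<epsilon> / 8 * real h"
            using mult_right_mono[OF Re, of "real h"] by simp
          ultimately have "ln \<bar>pbox R E (orb y) h\<bar> \<le> T * C0 + (L + \<epsilon>) * real h"
            using p(2) e mult_nonneg_nonneg[of \<epsilon> "real h"] by (simp add: algebra_simps abs_le_iff)
          then have "\<bar>pbox R E (orb y) h\<bar> \<le> exp (T * C0 + (L + \<epsilon>) * real h)"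
            using p(1) by (metis exp_le_cancel_iff exp_ln zero_less_abs_iff)
          then show ?thesis unfolding C_def by (simp add: exp_add)
        qed }
      { fix h
        show "\<exists>xh. \<forall>y. (\<forall>\<kappa><h. circ_dist (y - xh \<kappa>) > 0) \<longrightarrow>
          exp ((L - \<epsilon>) * real h - (\<Sum>\<kappa><h. logp (r / circ_dist (y - xh \<kappa>)))) \<le> C * \<bar>pbox R E (orb y) h\<bar>"
        proof (cases "h = 0")
          case True
          then show ?thesis using C1 by (simp add: pbox_def)
        next
          case False
          show ?thesis
          proof (intro exI[of _ "\<lambda>\<kappa>. xing h E (int \<kappa>)"] allI impI)
            fix y assume pos: "\<forall>\<kappa><h. circ_dist (y - xing h E (int \<kappa>)) > 0"
            obtain es m where sd: "spectral_data (orb y) h es m" using spec by blast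
            have h: "h > 0" using False by simp
            let ?Z = "\<Sum>\<kappa><h. logp (r / circ_dist (y - xing h E (int \<kappa>)))"
            have Ees: "E \<notin> set es" and Z: "(\<Sum>x\<leftarrow>es. logp (\<rho> / \<bar>E - x\<bar>)) \<le> ?Z"
              using near_sum[OF h sd r, of E] pos unfolding \<rho>_def by auto
            have p: "pbox R E (orb y) h \<noteq> 0"
              "\<bar>ln \<bar>pbox R E (orb y) h\<bar> - (real h * ln R - (\<Sum>e\<leftarrow>es. loggap R E e))\<bar> \<le> real h / R"
              using sd R3 Ees unfolding spectral_data_def by blast+
            have "(\<Sum>x\<leftarrow>es. loggap R E x) \<le> (\<Sum>x\<leftarrow>es. clampgap R \<rho> E x + logp (\<rho> / \<bar>E - x\<bar>))"
              using Ees R0 rr by (intro sum_list_mono loggap_le_clampgap) auto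
            also have "\<dots> = (\<Sum>x\<leftarrow>es. clampgap R \<rho> E x) + (\<Sum>x\<leftarrow>es. logp (\<rho> / \<bar>E - x\<bar>))"
              by (rule sum_list_addf)
            finally have "(\<Sum>x\<leftarrow>es. loggap R E x) \<le> (\<Sum>x\<leftarrow>es. clampgap R \<rho> E x) + ?Z" using Z by linarith
            moreover have "\<bar>(\<Sum>x\<leftarrow>es. clampgap R \<rho> E x) - real h * (\<integral>x. clampgap R \<rho> E x \<partial>mu)\<bar>
               \<le> 2 * (\<epsilon> / 8) * real h + (\<epsilon> / 8 * real h + T * C0)"
              using sum_clampgap[OF C0(2) sd R0 rr, of "\<epsilon> / 8" E] err[of "ln (1 + R\<^sup>2 / \<rho>\<^sup>2)" h] T1 e
              unfolding T_def by linarith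
            moreover have "real h * (\<integral>x. clampgap R \<rho> E x \<partial>mu) \<le> real h * (ln R + \<epsilon> / 8 - L)"
              using clampgap_integral(2)[OF int R1 EM rr] tail unfolding L
              by (intro mult_left_mono) auto
            moreover have "real h / R \<le> \<epsilon> / 8 * real h"
              using mult_right_mono[OF Re, of "real h"] by simp
            ultimately have "(L - \<epsilon>) * real h - ?Z \<le> T * C0 + ln \<bar>pbox R E (orb y) h\<bar>"
              using p(2) e mult_nonneg_nonneg[of \<epsilon> "real h"] by (simp add: algebra_simps abs_le_iff)
            then have "exp ((L - \<epsilon>) * real h - ?Z) \<le> exp (T * C0 + ln \<bar>pbox R E (orb y) h\<bar>)" by simp
            also have "\<dots> = C * \<bar>pbox R E (orb y) h\<bar>" unfolding C_def exp_add using p(1) by simp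
            finally show "exp ((L - \<epsilon>) * real h - ?Z) \<le> C * \<bar>pbox R E (orb y) h\<bar>" .
          qed
        qed }
    qed
  qed
  then show ?thesis using R3 by (intro exI[of _ R]) blast
qed

end

section \<open>Green's function estimates\<close>

text \<open>Cramer's rule for the box with normalised rows. It is kept free of division so that it
  applies to singular boxes; in the application the products of weights are at most
  \<open>1\<close>.\<close>

lemma tcont_green:
  fixes u v :: "int \<Rightarrow> real" and \<psi> :: "int \<Rightarrow> complex"
  assumes eq: "\<And>n. of_real (u n) * \<psi> n = of_real (v n) * (\<psi> (n + 1) + \<psi> (n - 1))"
  defines "P \<equiv> \<lambda>i h. tcont (\<lambda>j. u (i + int j)) (\<lambda>j. v (i + int j)) h"
  shows "of_real (P a (m + 1 + l)) * \<psi> (a + int m)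
    = of_real ((\<Prod>j\<le>m. v (a + int j)) * P (a + int m + 1) l) * \<psi> (a - 1)
    + of_real ((\<Prod>j\<le>l. v (a + int m + int j)) * P a m) * \<psi> (a + int m + int l + 1)"
proof -
  have rec: "P i (Suc (Suc k)) = u (i + int k + 1) * P i (Suc k) - v (i + int k + 1) * v (i + int k) * P i k" for i k
    unfolding P_def by (simp add: add_ac)
  have P01: "P i 0 = 1" "P i (Suc 0) = u i" for i by (simp_all add: P_def)
  have fwd: "of_real (P a (Suc m)) * \<psi> (a + int m) = of_real (\<Prod>j\<le>m. v (a + int j)) * \<psi> (a - 1)
      + of_real (v (a + int m) * P a m) * \<psi> (a + int m + 1)" for m
  proof (induction m)
    case 0 show ?case using eq[of a] by (simp add: P_def algebra_simps)
  next
    case (Suc m)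
    define b where "b = a + int m + 1"
    have "of_real (P a (Suc (Suc m))) * \<psi> b
       = of_real (P a (Suc m)) * (of_real (u b) * \<psi> b) - of_real (v b) * (of_real (v (a + int m) * P a m) * \<psi> b)"
      unfolding rec b_def by (simp add: algebra_simps)
    also have "\<dots> = of_real (P a (Suc m)) * (of_real (v b) * (\<psi> (b + 1) + \<psi> (b - 1)))
       - of_real (v b) * (of_real (P a (Suc m)) * \<psi> (b - 1) - of_real (\<Prod>j\<le>m. v (a + int j)) * \<psi> (a - 1))"
      unfolding eq using Suc by (simp add: b_def)
    also have "\<dots> = of_real (v b * P a (Suc m)) * \<psi> (b + 1) + of_real ((\<Prod>j\<le>m. v (a + int j)) * v b) * \<psi> (a - 1)"
      by (simp add: algebra_simps)
    finally show ?case by (simp add: b_def add_ac)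
  qed
  define A where "A = (\<Prod>j\<le>m. v (a + int j))"
  define c where "c = a + int m + 1"
  define B where "B l = (\<Prod>j\<le>l. v (a + int m + int j))" for l
  have B: "B 0 = v (a + int m)" "B (Suc l) = B l * v (c + int l)" for l
    by (simp_all add: B_def c_def add_ac)
  have "of_real (P a (m + 1 + l)) * \<psi> (a + int m)
    = of_real (A * P c l) * \<psi> (a - 1) + of_real (B l * P a m) * \<psi> (c + int l)"
  \<comment> \<open>By \<open>fwd\<close> the identity holds for a box ending at the site itself.
    Lengthening the box to the right, both determinants that depend on \<open>l\<close> obey the
    same two-step recursion.\<close>
  proof (induction l rule: induct_nat_012)
    case 0
    show ?case using fwd[of m] by (simp add: A_def c_def B P01)
  next
    case 1
    have r: "P a (m + 1 + 1) = u c * P a (Suc m) - v c * v (a + int m) * P a m"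
      using rec[of a m] by (simp add: c_def add_ac)
    have "of_real (P a (m + 1 + 1)) * \<psi> (a + int m) = of_real (u c) * (of_real (P a (Suc m)) * \<psi> (a + int m))
      - of_real (v (a + int m) * P a m) * (of_real (v c) * \<psi> (c - 1))"
      unfolding r by (simp add: c_def algebra_simps)
    also have "\<dots> = of_real (u c * A) * \<psi> (a - 1)
      + of_real (v (a + int m) * P a m) * (of_real (u c) * \<psi> c - of_real (v c) * \<psi> (c - 1))"
      unfolding fwd A_def[symmetric] c_def[symmetric] by (simp add: algebra_simps)
    also have "of_real (u c) * \<psi> c - of_real (v c) * \<psi> (c - 1) = of_real (v c) * \<psi> (c + 1)"
      unfolding eq by (simp add: algebra_simps)
    finally show ?case by (simp add: B P01 algebra_simps)
  next
    case (ge2 l)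
    define b where "b = c + int (Suc l)"
    have r: "P a (m + 1 + Suc (Suc l)) = u b * P a (m + 1 + Suc l) - v b * v (b - 1) * P a (m + 1 + l)"
      using rec[of a "m + 1 + l"] by (simp add: b_def c_def add_ac)
    have r': "P c (Suc (Suc l)) = u b * P c (Suc l) - v b * v (b - 1) * P c l"
      using rec[of c l] by (simp add: b_def add_ac)
    have "of_real (P a (m + 1 + Suc (Suc l))) * \<psi> (a + int m)
      = of_real (u b) * (of_real (P a (m + 1 + Suc l)) * \<psi> (a + int m))
        - of_real (v b * v (b - 1)) * (of_real (P a (m + 1 + l)) * \<psi> (a + int m))"
      unfolding r by (simp add: algebra_simps)
    also have "\<dots> = of_real (u b) * (of_real (A * P c (Suc l)) * \<psi> (a - 1) + of_real (B (Suc l) * P a m) * \<psi> b)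
        - of_real (v b * v (b - 1)) * (of_real (A * P c l) * \<psi> (a - 1) + of_real (B l * P a m) * \<psi> (b - 1))"
      using ge2 unfolding b_def by simp
    also have "\<dots> = of_real (A * P c (Suc (Suc l))) * \<psi> (a - 1)
        + of_real (B (Suc l) * P a m) * (of_real (u b) * \<psi> b - of_real (v b) * \<psi> (b - 1))"
      unfolding r' B(2) by (simp add: b_def algebra_simps)
    also have "of_real (u b) * \<psi> b - of_real (v b) * \<psi> (b - 1) = of_real (v b) * \<psi> (b + 1)"
      unfolding eq by (simp add: algebra_simps)
    finally show ?case by (simp add: B b_def algebra_simps)
  qed
  then show ?thesis by (simp add: A_def B_def c_def add_ac)
qed

text \<open>Moving by at most \<open>s\<close> changes the comparison function by at most the factor
  \<open>exp (g * s) \<le> exp G\<close>. Among the violating sites take one where \<open>a\<close>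
  itself is largest: its partner \<open>m\<close> has a strictly larger value, hence violates
  nothing or lies in a boundary collar of width \<open>s\<close>, and the bound at \<open>m\<close>
  carries back.\<close>

lemma max_principle:
  fixes a :: "int \<Rightarrow> real" and A B s :: int
  assumes a0: "\<And>n. a n \<ge> 0" and W: "Wa \<ge> 0" "Wb \<ge> 0" and g: "g \<ge> 0" "g * of_int s \<le> G" "G > 0"
    and step: "\<And>n. A < n \<Longrightarrow> n < B \<Longrightarrow> \<exists>m. \<bar>m - n\<bar> \<le> s \<and> a n \<le> exp (- G) * a m"
    and left: "\<And>n. A - s \<le> n \<Longrightarrow> n \<le> A \<Longrightarrow> a n \<le> Wa"
    and right: "\<And>n. B \<le> n \<Longrightarrow> n \<le> B + s \<Longrightarrow> a n \<le> Wb"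
    and n: "A < n" "n < B"
  shows "a n \<le> max (Wa * exp (- g * of_int (n - A))) (Wb * exp (- g * of_int (B - n)))"
proof (rule ccontr)
  define \<phi> where "\<phi> n = max (Wa * exp (- g * of_int (n - A))) (Wb * exp (- g * of_int (B - n)))" for n
  define D where "D = {n. A < n \<and> n < B \<and> \<phi> n < a n}"
  assume "\<not> ?thesis"
  then have "\<phi> n < a n" unfolding \<phi>_def by (rule not_le_imp_less)
  then have nD: "n \<in> D" unfolding D_def using n by blast
  have fin: "finite D" by (rule finite_subset[of _ "{A..B}"]) (auto simp: D_def)
  from nD fin have aD: "finite (a ` D)" "a ` D \<noteq> {}" by auto
  obtain k where kD: "k \<in> D" "Max (a ` D) = a k" using Max_in[OF aD] by auto
  have k: "k \<in> D" "\<And>m. m \<in> D \<Longrightarrow> a m \<le> a k" using kD Max_ge[OF aD(1)] by auto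
  have kk: "A < k" "k < B" "\<phi> k < a k" using k(1) by (auto simp: D_def)
  obtain m where m: "\<bar>m - k\<bar> \<le> s" "a k \<le> exp (- G) * a m" using step[OF kk(1,2)] by blast
  have ph0: "0 \<le> \<phi> k" unfolding \<phi>_def using W by (simp add: le_max_iff_disj)
  have "exp (- G) < 1" using g by simp
  have am0: "a m > 0" using m(2) kk(3) ph0 a0[of m] by (cases "a m = 0") auto
  then have "exp (- G) * a m < 1 * a m" using \<open>exp (- G) < 1\<close> by (rule mult_strict_right_mono[rotated])
  then have "a k < a m" using m(2) by linarith
  then have "m \<notin> D" using k(2)[of m] by force
  have am: "a m \<le> \<phi> m"
  proof (cases "A < m \<and> m < B")
    case True then show ?thesis using \<open>m \<notin> D\<close> by (auto simp: D_def)
  next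
    case False
    then consider "m \<le> A" | "B \<le> m" by linarith
    then show ?thesis
    proof cases
      case 1
      have "a m \<le> Wa" using left[of m] 1 m kk by linarith
      also have "\<dots> \<le> Wa * exp (- g * of_int (m - A))"
        using mult_left_mono[of 1 "exp (- g * of_int (m - A))" Wa] W 1 g by (simp add: mult_nonneg_nonpos)
      finally show ?thesis unfolding \<phi>_def by linarith
    next
      case 2
      have "a m \<le> Wb" using right[of m] 2 m kk by linarith
      also have "\<dots> \<le> Wb * exp (- g * of_int (B - m))"
        using mult_left_mono[of 1 "exp (- g * of_int (B - m))" Wb] W 2 g by (simp add: mult_nonneg_nonpos)
      finally show ?thesis unfolding \<phi>_def by linarith
    qed
  qed
  have sh: "exp (- G) * exp (- g * of_int (c1)) \<le> exp (- g * of_int c2)" if "c2 \<le> c1 + s" for c1 c2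
  proof -
    have "g * of_int c2 \<le> g * of_int (c1 + s)" using that g by (intro mult_left_mono) simp_all
    then have "- G + - g * of_int c1 \<le> - g * of_int c2" using g by (simp add: algebra_simps)
    then show ?thesis by (simp add: exp_add[symmetric])
  qed
  have "exp (- G) * (Wa * exp (- g * of_int (m - A))) \<le> Wa * exp (- g * of_int (k - A))"
    using mult_left_mono[OF sh[of "k - A" "m - A"] W(1)] m(1) by (simp add: mult_ac)
  moreover have "exp (- G) * (Wb * exp (- g * of_int (B - m))) \<le> Wb * exp (- g * of_int (B - k))"
    using mult_left_mono[OF sh[of "B - k" "B - m"] W(2)] m(1) by (simp add: mult_ac)
  ultimately have "exp (- G) * \<phi> m \<le> \<phi> k" unfolding \<phi>_def
    by (simp add: max_mult_distrib_left) linarith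
  moreover have "exp (- G) * a m \<le> exp (- G) * \<phi> m" using am by simp
  ultimately show False using m(2) kk(3) by linarith
qed

section \<open>Localization from box estimates\<close>

text \<open>Here \<open>a\<close> stands for \<open>|\<psi>|\<close> recentred at a peak and
  \<open>p y h\<close> for the size of the normalised determinant of the box of length
  \<open>h\<close> at phase \<open>y\<close>. The abstraction exists because the left half-line has
  the same structure with \<open>- \<alpha>\<close> and boxes read backwards
  (\<open>eigenbox_left\<close>).\<close>

locale eigenbox =
  fixes \<alpha> x :: real and a :: "int \<Rightarrow> real" and p :: "real \<Rightarrow> nat \<Rightarrow> real" and L \<epsilon> r C :: real
  assumes a0: "0 \<le> a n" and a1: "a n \<le> 1" and origin: "1/2 \<le> a 0" and p0: "0 \<le> p y h"
    and green: "i \<le> n \<Longrightarrow> n < i + int h \<Longrightarrow>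
      p (x + of_int i * \<alpha>) h * a n
        \<le> p (x + of_int (n + 1) * \<alpha>) (nat (i + int h - 1 - n)) * a (i - 1)
          + p (x + of_int i * \<alpha>) (nat (n - i)) * a (i + int h)"
    and upper: "p y h \<le> C * exp ((L + \<epsilon>) * real h)"
    and lower: "\<exists>xh. \<forall>y. (\<forall>\<kappa><h. circ_dist (y - xh \<kappa>) > 0) \<longrightarrow>
      exp ((L - \<epsilon>) * real h - (\<Sum>\<kappa><h. logp (r / circ_dist (y - xh \<kappa>)))) \<le> C * p y h"
    and L0: "L > 0" and e0: "\<epsilon> > 0" and r0: "r > 0" and C1: "C \<ge> 1"
begin

definition pt :: "int \<Rightarrow> real" where "pt i = x + of_int i * \<alpha>"

definition crossings :: "nat \<Rightarrow> (nat \<Rightarrow> real) \<Rightarrow> bool" where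
  "crossings h xh \<longleftrightarrow> (\<forall>y. (\<forall>\<kappa><h. circ_dist (y - xh \<kappa>) > 0) \<longrightarrow>
      exp ((L - \<epsilon>) * real h - (\<Sum>\<kappa><h. logp (r / circ_dist (y - xh \<kappa>)))) \<le> C * p y h)"

definition near :: "nat \<Rightarrow> (nat \<Rightarrow> real) \<Rightarrow> real \<Rightarrow> int \<Rightarrow> nat set" where
  "near h xh \<sigma> i = {\<kappa>. \<kappa> < h \<and> circ_dist (pt i - xh \<kappa>) < \<sigma> / 8}"

text \<open>The logarithmic cost of crossings that are not very close. The factor in
  \<open>2 * r\<close> leaves room for halving all distances, which happens when
  \<open>central_box\<close> translates a box by a multiple of \<open>q\<close>. The cutoff lies
  below that of \<open>near\<close>, so every crossing outside \<open>near\<close> is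
  included.\<close>

definition zsum :: "nat \<Rightarrow> (nat \<Rightarrow> real) \<Rightarrow> real \<Rightarrow> int \<Rightarrow> real" where
  "zsum h xh \<sigma> i = (\<Sum>\<kappa>\<in>{\<kappa>. \<kappa> < h \<and> \<sigma> / 16 \<le> circ_dist (pt i - xh \<kappa>)}. logp (2 * r / circ_dist (pt i - xh \<kappa>)))"

lemma pt_diff: "pt i - pt j = of_int (i - j) * \<alpha>"
  unfolding pt_def by (simp add: algebra_simps)

lemma green_bound:
  assumes "i \<le> n" "n < i + int h" "of_int (i + int h - 1 - n) \<le> s" "of_int (n - i) \<le> s"
  shows "p (pt i) h * a n \<le> C * exp ((L + \<epsilon>) * s) * (a (i - 1) + a (i + int h))"
proof -
  have u: "p y k \<le> C * exp ((L + \<epsilon>) * s)" if "real k \<le> s" for y k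
  proof -
    have "(L + \<epsilon>) * real k \<le> (L + \<epsilon>) * s" using that L0 e0 by (intro mult_left_mono) auto
    then have "C * exp ((L + \<epsilon>) * real k) \<le> C * exp ((L + \<epsilon>) * s)" using C1 by simp
    then show ?thesis using upper[of y k] by linarith
  qed
  have "p (x + of_int (n + 1) * \<alpha>) (nat (i + int h - 1 - n)) * a (i - 1) \<le> C * exp ((L + \<epsilon>) * s) * a (i - 1)"
    using assms a0 by (intro mult_right_mono u) (auto simp: of_nat_nat)
  moreover have "p (x + of_int i * \<alpha>) (nat (n - i)) * a (i + int h) \<le> C * exp ((L + \<epsilon>) * s) * a (i + int h)"
    using assms a0 by (intro mult_right_mono u) (auto simp: of_nat_nat)
  ultimately show ?thesis using green[OF assms(1,2)] unfolding pt_def by (simp add: distrib_left)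
qed

text \<open>Averaging: for each crossing, the cost summed over the separated starting points is
  bounded by \<open>sum_logp_separated\<close>. The total over \<open>h\<close> crossings is at most
  \<open>(40 * r / \<sigma> + 2) * h\<close>, and Markov's inequality counts the exceptions.\<close>

lemma zsum_few:
  assumes "finite A" "0 < \<sigma>" "\<sigma> \<le> 1" "0 < \<zeta>" "0 < h"
    and sep: "\<And>i j. i \<in> A \<Longrightarrow> j \<in> A \<Longrightarrow> i \<noteq> j \<Longrightarrow> \<sigma> \<le> circ_dist (of_int (i - j) * \<alpha>)"
  shows "real (card {i \<in> A. \<zeta> * real h < zsum h xh \<sigma> i}) \<le> (40 * r / \<sigma> + 2) / \<zeta>"
proof -
  let ?B = "{i \<in> A. \<zeta> * real h < zsum h xh \<sigma> i}"
  let ?t = "\<lambda>i \<kappa>. logp (2 * r / circ_dist (pt i - xh \<kappa>))"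
  have sg: "0 \<le> zsum h xh \<sigma> i" for i unfolding zsum_def by (intro sum_nonneg logp_nonneg)
  have "real (card ?B) * (\<zeta> * real h) = (\<Sum>i\<in>?B. \<zeta> * real h)" by simp
  also have "\<dots> \<le> (\<Sum>i\<in>?B. zsum h xh \<sigma> i)" by (intro sum_mono) auto
  also have "\<dots> \<le> (\<Sum>i\<in>A. zsum h xh \<sigma> i)" using assms(1) sg by (intro sum_mono2) auto
  also have "\<dots> = (\<Sum>i\<in>A. \<Sum>\<kappa><h. if \<sigma> / 16 \<le> circ_dist (pt i - xh \<kappa>) then ?t i \<kappa> else 0)"
    unfolding zsum_def by (intro sum.cong[OF refl], subst sum.inter_filter[symmetric]) simp_all
  also have "\<dots> = (\<Sum>\<kappa><h. \<Sum>i\<in>A. if \<sigma> / 16 \<le> circ_dist (pt i - xh \<kappa>) then ?t i \<kappa> else 0)"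
    by (rule sum.swap)
  also have "\<dots> = (\<Sum>\<kappa><h. \<Sum>i\<in>{i\<in>A. circ_dist (pt i - xh \<kappa>) \<ge> \<sigma> / 16}. ?t i \<kappa>)"
    using assms(1) by (intro sum.cong refl sum.inter_filter[symmetric])
  also have "\<dots> \<le> (\<Sum>\<kappa><h. 20 * (2 * r) / \<sigma> + 2)"
    using assms r0 by (intro sum_mono sum_logp_separated) (auto simp: pt_diff)
  also have "\<dots> = (40 * r / \<sigma> + 2) * real h" by simp
  finally have "real (card ?B) * \<zeta> \<le> 40 * r / \<sigma> + 2" using assms(5) by (simp add: mult.assoc[symmetric])
  then show ?thesis using assms(4) by (simp add: pos_le_divide_eq)
qed

lemma good_box:
  assumes "crossings h xh" "0 < \<sigma>" "near h xh \<sigma> i = {}" "zsum h xh \<sigma> i \<le> \<zeta> * real h"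
  shows "exp ((L - \<epsilon> - \<zeta>) * real h) \<le> C * p (pt i) h"
proof -
  have d: "\<sigma> / 8 \<le> circ_dist (pt i - xh \<kappa>)" if "\<kappa> < h" for \<kappa>
    using assms(3) that unfolding near_def by (metis (mono_tags, lifting) empty_iff mem_Collect_eq not_less)
  have pos: "0 < circ_dist (pt i - xh \<kappa>)" if "\<kappa> < h" for \<kappa> using d[OF that] assms(2) by simp
  have "(\<Sum>\<kappa><h. logp (r / circ_dist (pt i - xh \<kappa>))) \<le> (\<Sum>\<kappa><h. logp (2 * r / circ_dist (pt i - xh \<kappa>)))"
    using pos r0 by (intro sum_mono logp_mono divide_right_mono) (auto simp: circ_dist_nonneg)
  also have "{..<h} = {\<kappa>. \<kappa> < h \<and> \<sigma> / 16 \<le> circ_dist (pt i - xh \<kappa>)}" using d assms(2) by force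
  finally have "(\<Sum>\<kappa>\<in>{..<h}. logp (r / circ_dist (pt i - xh \<kappa>))) \<le> \<zeta> * real h"
    using assms(4) unfolding zsum_def \<open>{..<h} = _\<close>[symmetric] by simp
  then have "exp ((L - \<epsilon> - \<zeta>) * real h) \<le> exp ((L - \<epsilon>) * real h - (\<Sum>\<kappa><h. logp (r / circ_dist (pt i - xh \<kappa>))))"
    by (simp add: algebra_simps)
  also have "\<dots> \<le> C * p (pt i) h" using assms(1) pos unfolding crossings_def by blast
  finally show ?thesis .
qed

text \<open>A crossing within \<open>\<sigma> / 8\<close> of two starting phases would bring these
  within \<open>\<sigma> / 4\<close>, so each of the \<open>h\<close> crossings is counted at most
  once.\<close>

lemma sum_card_near:
  assumes "finite I" "\<And>i j. i \<in> I \<Longrightarrow> j \<in> I \<Longrightarrow> i \<noteq> j \<Longrightarrow> \<sigma> / 2 \<le> circ_dist (of_int (i - j) * \<alpha>)" "0 < \<sigma>"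
  shows "(\<Sum>i\<in>I. card (near h xh \<sigma> i)) \<le> h"
proof -
  have fin: "finite (near h xh \<sigma> i)" for i unfolding near_def by simp
  have "near h xh \<sigma> i \<inter> near h xh \<sigma> j = {}" if ij: "i \<in> I" "j \<in> I" "i \<noteq> j" for i j
  proof (rule ccontr)
    assume "\<not> ?thesis"
    then obtain \<kappa> where "circ_dist (pt i - xh \<kappa>) < \<sigma> / 8" "circ_dist (pt j - xh \<kappa>) < \<sigma> / 8"
      unfolding near_def by blast
    moreover have "circ_dist (pt i - pt j) \<le> circ_dist (pt i - xh \<kappa>) + circ_dist (xh \<kappa> - pt j)"
      by (rule circ_dist_triangle2)
    ultimately have "circ_dist (pt i - pt j) < \<sigma> / 4" using circ_dist_commute[of "xh \<kappa>" "pt j"] by simp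
    then show False using assms(2)[OF ij] assms(3) unfolding pt_diff by simp
  qed
  then have "(\<Sum>i\<in>I. card (near h xh \<sigma> i)) = card (\<Union>i\<in>I. near h xh \<sigma> i)"
    using assms(1) fin by (intro card_UN_disjoint[symmetric]) auto
  also have "\<dots> \<le> card {..<h}" by (rule card_mono) (auto simp: near_def)
  finally show ?thesis by simp
qed

text \<open>For such a box the peak stays about \<open>e\<close> away from both ends. A good box
  would have a determinant of size \<open>exp (L * h)\<close> up to small losses, whereas Green's
  formula together with \<open>a 0 \<ge> 1/2\<close> only permits
  \<open>exp (L * (h - e))\<close>.\<close>

lemma near_nonempty:
  assumes c: "crossings h xh" "0 < \<sigma>" and z: "zsum h xh \<sigma> i \<le> \<zeta> * real h"
    and i: "i \<in> {- int h + int e .. - int e}" and e: "e > 0"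
    and gap: "4 * C\<^sup>2 * exp ((L + \<epsilon>) * (real h - real e)) < exp ((L - \<epsilon> - \<zeta>) * real h)"
  shows "near h xh \<sigma> i \<noteq> {}"
proof
  assume "near h xh \<sigma> i = {}"
  from good_box[OF c this z] have g: "exp ((L - \<epsilon> - \<zeta>) * real h) \<le> C * p (pt i) h" .
  let ?X = "exp ((L + \<epsilon>) * (real h - real e))"
  have "p (pt i) h * a 0 \<le> C * ?X * (a (i - 1) + a (i + int h))"
    using i e by (intro green_bound) auto
  also have "\<dots> \<le> C * ?X * 2" using a1[of "i - 1"] a1[of "i + int h"] C1 by (intro mult_left_mono) auto
  finally have "p (pt i) h * (1/2) \<le> C * ?X * 2"
    using mult_left_mono[OF origin p0[of "pt i" h]] by linarith
  then have "C * p (pt i) h \<le> C * (4 * C * ?X)" using C1 by (intro mult_left_mono) auto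
  then show False using g gap by (simp add: power2_eq_square mult_ac)
qed

text \<open>Pigeonhole with \<open>h\<close> crossings. The central family \<open>S\<close> has
  \<open>h - 2 * e + 1\<close> boxes and \<open>A\<close> at least \<open>2 * e + 2 * b\<close>;
  each family has at most \<open>b\<close> exceptional boxes. More than \<open>h\<close> crossings
  would be needed if every other box of \<open>A\<close> had a crossing of its own
  (\<open>far_box\<close>) or, for \<open>A\<close> inside \<open>S\<close>, a second one
  (\<open>single_box\<close>).\<close>

lemma box_selection:
  assumes h: "2 * e \<le> h" "e > 0" and sg: "0 < \<sigma>" "\<sigma> \<le> 1" and ze: "0 < \<zeta>"
    and gap: "4 * C\<^sup>2 * exp ((L + \<epsilon>) * (real h - real e)) < exp ((L - \<epsilon> - \<zeta>) * real h)"
    and c: "crossings h xh" and S: "S = {- int h + int e .. - int e}"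
    and sepS: "\<And>i j. i \<in> S \<Longrightarrow> j \<in> S \<Longrightarrow> i \<noteq> j \<Longrightarrow> \<sigma> \<le> circ_dist (of_int (i - j) * \<alpha>)"
    and A: "finite A" "real (card A) \<ge> 2 * real e + 2 * ((40 * r / \<sigma> + 2) / \<zeta>)"
    and sepA: "\<And>i j. i \<in> A \<Longrightarrow> j \<in> A \<Longrightarrow> i \<noteq> j \<Longrightarrow> \<sigma> \<le> circ_dist (of_int (i - j) * \<alpha>)"
  shows far_box: "(\<And>i j. i \<in> S \<Longrightarrow> j \<in> A \<Longrightarrow> \<sigma> / 2 \<le> circ_dist (of_int (j - i) * \<alpha>)) \<Longrightarrow>
      \<exists>i\<in>A. exp ((L - \<epsilon> - \<zeta>) * real h) \<le> C * p (pt i) h"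
    and single_box: "A \<subseteq> S \<Longrightarrow> \<exists>i\<in>A. zsum h xh \<sigma> i \<le> \<zeta> * real h \<and> card (near h xh \<sigma> i) = 1"
proof -
  define b where "b = (40 * r / \<sigma> + 2) / \<zeta>"
  define G where "G = {i. zsum h xh \<sigma> i \<le> \<zeta> * real h}"
  have h0: "h > 0" using h by simp
  have finS: "finite S" unfolding S by simp
  have few: "real (card B) - b \<le> real (card (B \<inter> G))" if "finite B"
    "\<And>i j. i \<in> B \<Longrightarrow> j \<in> B \<Longrightarrow> i \<noteq> j \<Longrightarrow> \<sigma> \<le> circ_dist (of_int (i - j) * \<alpha>)" for B
  proof -
    have "real (card {i \<in> B. \<zeta> * real h < zsum h xh \<sigma> i}) \<le> b"
      unfolding b_def by (rule zsum_few[OF that(1) sg ze h0 that(2)])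
    moreover have "card B = card (B \<inter> G) + card {i \<in> B. \<zeta> * real h < zsum h xh \<sigma> i}"
      using that(1) by (subst card_Un_disjoint[symmetric]) (auto simp: G_def intro!: arg_cong[of _ _ card])
    ultimately show ?thesis by simp
  qed
  have fin: "finite (near h xh \<sigma> i)" for i unfolding near_def by simp
  have cS: "real (card S) = real h - 2 * real e + 1" using h unfolding S by (simp add: of_nat_diff)
  have S1: "1 \<le> card (near h xh \<sigma> i)" if "i \<in> S \<inter> G" for i
    using near_nonempty[OF c sg(1) _ _ h(2) gap, of i] that fin unfolding G_def S by (simp add: Suc_le_eq card_gt_0_iff)
  have fS: "real (card S) - b \<le> real (card (S \<inter> G))" by (rule few[OF finS sepS])
  have fA: "real (card A) - b \<le> real (card (A \<inter> G))" by (rule few[OF A(1) sepA])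
  have big: "real (card (S \<inter> G)) + real (card (A \<inter> G)) > real h"
    using fS fA A(2) cS unfolding b_def by linarith
  { assume away: "\<And>i j. i \<in> S \<Longrightarrow> j \<in> A \<Longrightarrow> \<sigma> / 2 \<le> circ_dist (of_int (j - i) * \<alpha>)"
    show "\<exists>i\<in>A. exp ((L - \<epsilon> - \<zeta>) * real h) \<le> C * p (pt i) h"
    proof (rule ccontr)
      assume no: "\<not> ?thesis"
      have A1: "1 \<le> card (near h xh \<sigma> i)" if "i \<in> A \<inter> G" for i
        using good_box[OF c sg(1), of i \<zeta>] no that fin unfolding G_def by (auto simp: Suc_le_eq card_gt_0_iff)
      have z: "circ_dist 0 = 0" using circ_dist_le_abs[of 0] circ_dist_nonneg[of 0] by simp
      have dj: "(S \<inter> G) \<inter> (A \<inter> G) = {}" using away sg z by force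
      have sw: "circ_dist (of_int (i - j) * \<alpha>) = circ_dist (of_int (j - i) * \<alpha>)" for i j
        using circ_dist_minus[of "of_int (j - i) * \<alpha>"] by (simp add: algebra_simps)
      have "(\<Sum>i\<in>(S \<inter> G) \<union> (A \<inter> G). card (near h xh \<sigma> i)) \<le> h"
      proof (rule sum_card_near)
        fix i j assume ij: "i \<in> (S \<inter> G) \<union> (A \<inter> G)" "j \<in> (S \<inter> G) \<union> (A \<inter> G)" "i \<noteq> j"
        consider "i \<in> S" "j \<in> S" | "i \<in> A" "j \<in> A" | "i \<in> S" "j \<in> A" | "i \<in> A" "j \<in> S" using ij by blast
        then show "\<sigma> / 2 \<le> circ_dist (of_int (i - j) * \<alpha>)"
        proof cases
          case 1 then show ?thesis using sepS[of i j] ij sg by simp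
        next
          case 2 then show ?thesis using sepA[of i j] ij sg by simp
        next
          case 3 then show ?thesis using away[of i j] sw by simp
        next
          case 4 then show ?thesis using away[of j i] by simp
        qed
      qed (use finS A sg in auto)
      moreover have "card ((S \<inter> G) \<union> (A \<inter> G)) \<le> (\<Sum>i\<in>(S \<inter> G) \<union> (A \<inter> G). card (near h xh \<sigma> i))"
        using sum_mono[of "(S \<inter> G) \<union> (A \<inter> G)" "\<lambda>_. 1::nat"] S1 A1 by force
      moreover have "card ((S \<inter> G) \<union> (A \<inter> G)) = card (S \<inter> G) + card (A \<inter> G)"
        using dj finS A by (intro card_Un_disjoint) auto
      ultimately show False using big by linarith
    qed }
  { assume sub: "A \<subseteq> S"
    show "\<exists>i\<in>A. zsum h xh \<sigma> i \<le> \<zeta> * real h \<and> card (near h xh \<sigma> i) = 1"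
    proof (rule ccontr)
      assume no: "\<not> ?thesis"
      have A2: "2 \<le> card (near h xh \<sigma> i)" if "i \<in> A \<inter> G" for i
      proof -
        have "card (near h xh \<sigma> i) \<noteq> 1" using no that unfolding G_def by auto
        then show ?thesis using S1[of i] that sub by force
      qed
      have "card (S \<inter> G) + card (A \<inter> G) = (\<Sum>i\<in>S \<inter> G. 1 + (if i \<in> A then 1 else 0))"
      proof -
        have "(\<Sum>i\<in>S \<inter> G. if i \<in> A then 1 else 0::nat) = card {i \<in> S \<inter> G. i \<in> A}"
          using finS by (simp add: sum.If_cases Int_def)
        also have "{i \<in> S \<inter> G. i \<in> A} = A \<inter> G" using sub by auto
        finally show ?thesis by (simp only: sum.distrib card_eq_sum[of "S \<inter> G"])
      qed
      also have "\<dots> \<le> (\<Sum>i\<in>S \<inter> G. card (near h xh \<sigma> i))"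
        using S1 A2 by (intro sum_mono) force
      also have "\<dots> \<le> h"
      proof (rule sum_card_near)
        fix i j assume "i \<in> S \<inter> G" "j \<in> S \<inter> G" "i \<noteq> j"
        then show "\<sigma> / 2 \<le> circ_dist (of_int (i - j) * \<alpha>)" using sepS[of i j] sg by simp
      qed (use finS sg in auto)
      finally show False using big by linarith
    qed }
qed

end

text \<open>The scale is a denominator \<open>q\<close>, with \<open>h2\<close> a box length of
  about \<open>\<eta> * q\<close> and \<open>\<eta>\<close> the unit of relative loss in the rate.
  The conditions on \<open>h2\<close> make the exceptional boxes of \<open>zsum_few\<close> and the
  constant \<open>C\<close> cost at most a small multiple of \<open>\<eta>\<close> for every box of
  length at least \<open>h2\<close>.\<close>

locale scale = eigenbox +
  fixes q h2 :: nat and \<sigma> \<zeta> \<eta> \<delta> :: real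
  assumes eta: "0 < \<eta>" "\<eta> \<le> 1 / 2000" and delta: "0 < \<delta>" "\<delta> \<le> L"
    and zeta: "0 < \<zeta>" "2 * \<epsilon> + \<zeta> \<le> \<delta> * \<eta> / 4" and sigma: "0 < \<sigma>" "\<sigma> \<le> 1"
    and sep: "d \<noteq> 0 \<Longrightarrow> \<bar>d\<bar> < int q \<Longrightarrow> \<sigma> \<le> circ_dist (of_int d * \<alpha>)"
    and h2: "real h2 \<le> \<eta> * real q" "3 \<le> \<eta> * real h2" "(40 * r / \<sigma> + 2) / \<zeta> \<le> \<eta> * real h2 / 2"
      "ln (4 * C\<^sup>2) \<le> \<delta> * \<eta> * real h2 / 4"
begin

lemma h2_ge: "real h2 \<ge> 6000"
proof -
  have "\<eta> * real h2 \<le> 1 / 2000 * real h2" using eta by (intro mult_right_mono) auto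
  then show ?thesis using h2(2) by linarith
qed

lemma h2_q: "2000 * real h2 \<le> real q"
proof -
  have "\<eta> * real q \<le> 1 / 2000 * real q" using eta by (intro mult_right_mono) auto
  then show ?thesis using h2(1) by linarith
qed

lemma lnC: "ln (2 * C\<^sup>2) \<le> ln (4 * C\<^sup>2)" "C\<^sup>2 \<ge> 1" "ln (4 * C\<^sup>2) \<ge> 0"
proof -
  show c: "C\<^sup>2 \<ge> 1" using C1 by simp
  then show "ln (2 * C\<^sup>2) \<le> ln (4 * C\<^sup>2)" by (intro ln_mono) linarith+
  show "ln (4 * C\<^sup>2) \<ge> 0" using c by (intro ln_ge_zero) simp
qed

lemma C2pos: "0 < 2 * C\<^sup>2" "0 < 4 * C\<^sup>2"
  using lnC by linarith+

text \<open>With \<open>e\<close> about \<open>\<eta> * h\<close>, shortening the box by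
  \<open>e\<close> gains at least \<open>\<delta> * \<eta> * h\<close> in the exponent, of which
  \<open>2 * \<epsilon> + \<zeta>\<close> and \<open>ln (4 * C\<^sup>2)\<close> use at most a
  quarter each. The number \<open>m\<close> is the family size that \<open>box_selection\<close>
  asks for.\<close>

lemma box_params:
  assumes "h2 \<le> h"
  obtains e m :: nat where "e > 0" "2 * e \<le> h" "real m \<ge> 2 * real e + 2 * ((40 * r / \<sigma> + 2) / \<zeta>)"
    "real m \<le> 4 * \<eta> * real h" "m > 0"
    "4 * C\<^sup>2 * exp ((L + \<epsilon>) * (real h - real e)) < exp ((L - \<epsilon> - \<zeta>) * real h)"
proof -
  define b where "b = (40 * r / \<sigma> + 2) / \<zeta>"
  have hh: "real h2 \<le> real h" using assms by simp
  have eh: "\<eta> * real h2 \<le> \<eta> * real h" using hh eta by (intro mult_left_mono) auto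
  have b0: "b \<ge> 0" unfolding b_def using r0 sigma zeta by simp
  define e where "e = nat \<lceil>\<eta> * real h\<rceil>"
  define m where "m = nat \<lceil>2 * real e + 2 * b\<rceil>"
  have e: "real e \<ge> \<eta> * real h" "real e \<le> \<eta> * real h + 1" unfolding e_def using eh h2 by linarith+
  have m: "real m \<ge> 2 * real e + 2 * b" "real m \<le> 2 * real e + 2 * b + 1" unfolding m_def using b0 by linarith+
  have small: "\<eta> * real h \<le> 1 / 2000 * real h" using eta by (intro mult_right_mono) auto
  show ?thesis
  proof (rule that[of e m])
    show epos: "e > 0" using e h2 eh by (metis less_le_trans of_nat_0_less_iff zero_less_numeral)
    show "2 * e \<le> h"
    proof -
      have "2 * real e \<le> real h" using e small h2_ge hh by linarith
      then show ?thesis by linarith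
    qed
    show "real m \<ge> 2 * real e + 2 * ((40 * r / \<sigma> + 2) / \<zeta>)" using m(1) unfolding b_def .
    show "real m \<le> 4 * \<eta> * real h" using m(2) e(2) h2(2,3) eh unfolding b_def[symmetric] by linarith
    show "m > 0" using m(1) b0 epos by linarith
    have 1: "(2 * \<epsilon> + \<zeta>) * real h \<le> \<delta> * \<eta> / 4 * real h" using zeta by (intro mult_right_mono) auto
    have 2: "\<delta> * (\<eta> * real h2) \<le> \<delta> * (\<eta> * real h)" by (rule mult_left_mono[OF eh]) (use delta in simp)
    have 3: "\<delta> * (\<eta> * real h) \<le> (L + \<epsilon>) * real e" using e(1) delta epos eta
      by (intro mult_mono) (use e0 L0 in auto)
    have "0 < \<eta> * real h" using eh h2(2) by linarith
    then have "0 < \<delta> * (\<eta> * real h)" by (rule mult_pos_pos[OF delta(1)])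
    then have "ln (4 * C\<^sup>2) + (L + \<epsilon>) * (real h - real e) < (L - \<epsilon> - \<zeta>) * real h"
      using 1 2 3 h2(4) by (simp add: algebra_simps)
    then have "exp (ln (4 * C\<^sup>2) + (L + \<epsilon>) * (real h - real e)) < exp ((L - \<epsilon> - \<zeta>) * real h)" by simp
    moreover have "exp (ln (4 * C\<^sup>2)) = 4 * C\<^sup>2" by (rule exp_ln[OF C2pos(2)])
    ultimately show "4 * C\<^sup>2 * exp ((L + \<epsilon>) * (real h - real e)) < exp ((L - \<epsilon> - \<zeta>) * real h)"
      by (simp add: exp_add)
  qed
qed

lemma lowest:
  obtains xh where "crossings h xh"
  using lower[of h] unfolding crossings_def by blast

definition rate :: real where "rate = L * (1 - 20 * \<eta>)"

lemma rate_pos: "rate > 0"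
  unfolding rate_def using L0 eta by simp

text \<open>Between the windows around \<open>j * q\<close> and \<open>(j + 1) * q\<close>, boxes of
  length \<open>h2\<close> are separated from the central ones once the shift \<open>j * q\<close>,
  harmless up to \<open>\<sigma> / 16\<close>, is removed. So \<open>far_box\<close> finds a good
  box with \<open>n\<close> near its middle, and Green's formula provides the step for
  \<open>max_principle\<close>.\<close>

lemma between:
  fixes j n :: int
  assumes j: "circ_dist (of_int (j * int q) * \<alpha>) \<le> \<sigma> / 16"
    and W: "0 \<le> Wa" "0 \<le> Wb"
    and left: "\<And>n. \<bar>n - j * int q\<bar> \<le> int h2 \<Longrightarrow> a n \<le> Wa"
    and right: "\<And>n. \<bar>n - (j + 1) * int q\<bar> \<le> int h2 \<Longrightarrow> a n \<le> Wb"
    and n: "j * int q + int h2 \<le> n" "n \<le> (j + 1) * int q - int h2"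
  shows "a n \<le> max (Wa * exp (- rate * of_int (n - j * int q - int h2)))
                   (Wb * exp (- rate * of_int ((j + 1) * int q - int h2 - n)))"
proof -
  define h where "h = h2"
  obtain e m where em: "e > 0" "2 * e \<le> h" "real m \<ge> 2 * real e + 2 * ((40 * r / \<sigma> + 2) / \<zeta>)"
    "real m \<le> 4 * \<eta> * real h" "m > 0"
    "4 * C\<^sup>2 * exp ((L + \<epsilon>) * (real h - real e)) < exp ((L - \<epsilon> - \<zeta>) * real h)"
    using box_params[of h] unfolding h_def by auto
  obtain xh where xh: "crossings h xh" by (rule lowest)
  define hh where "hh = int (h div 2)"
  define J where "J = j * int q"
  have h6: "real h \<ge> 6000" "2000 * real h \<le> real q" using h2_ge h2_q by (simp_all add: h_def)
  have m500: "500 * real m \<le> real h"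
  proof -
    have "\<eta> * real h \<le> 1 / 2000 * real h" using eta by (intro mult_right_mono) auto
    then show ?thesis using em(4) by linarith
  qed
  have hhb: "2 * hh \<le> int h" "int h \<le> 2 * hh + 1" unfolding hh_def by linarith+
  have mi: "500 * int m \<le> int h" "2000 * int h \<le> int q" "6000 \<le> int h" using m500 h6 by linarith+
  define s where "s = hh + int m + 1"
  \<comment> \<open>The gain of one Green step: \<open>L * h\<close> from the whole box, minus
    \<open>L * (h / 2 + m)\<close> from the longer remaining piece, as the start of the good box is
    known only up to \<open>m\<close>.\<close>
  define G where "G = L * real h / 2 - L * real m - (2 * \<epsilon> + \<zeta>) * real h - ln (2 * C\<^sup>2)"
  have step: "\<exists>k. \<bar>k - n\<bar> \<le> s \<and> a n \<le> exp (- G) * a k" if nn: "J + hh + int m < n" "n < J + int q - hh" for n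
  proof -
    define S where "S = {- int h + int e .. - int e}"
    define A where "A = {n - hh - int m .. n - hh - 1}"
    have "\<exists>i\<in>A. exp ((L - \<epsilon> - \<zeta>) * real h) \<le> C * p (pt i) h"
    proof (rule far_box[OF em(2,1) sigma zeta(1) em(6) xh S_def])
      show "\<sigma> \<le> circ_dist (of_int (i - j) * \<alpha>)" if "i \<in> S" "j \<in> S" "i \<noteq> j" for i j
        by (rule sep) (use that em(1) mi in \<open>auto simp: S_def\<close>)
      show "\<sigma> \<le> circ_dist (of_int (i - j) * \<alpha>)" if "i \<in> A" "j \<in> A" "i \<noteq> j" for i j
        by (rule sep) (use that mi in \<open>auto simp: A_def\<close>)
      show "finite A" unfolding A_def by simp
      show "real (card A) \<ge> 2 * real e + 2 * ((40 * r / \<sigma> + 2) / \<zeta>)" using em(3) unfolding A_def by simp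
      fix i i' assume i: "i \<in> S" "i' \<in> A"
      \<comment> \<open>Boxes in \<open>A\<close> start to the right of \<open>J\<close> and boxes
        in \<open>S\<close> to the left of \<open>0\<close>; the position of \<open>n\<close> and
        the length of the boxes keep the difference below \<open>q\<close>.\<close>
      have "i' - J - i \<noteq> 0" "\<bar>i' - J - i\<bar> < int q"
        using i nn hhb mi em(1) unfolding S_def A_def by auto
      from sep[OF this] have 1: "\<sigma> \<le> circ_dist (of_int (i' - J - i) * \<alpha>)" .
      have "circ_dist (of_int (i' - J - i) * \<alpha>) \<le> circ_dist (of_int (i' - i) * \<alpha>) + circ_dist (- (of_int J * \<alpha>))"
        using circ_dist_triangle[of "of_int (i' - i) * \<alpha>" "- (of_int J * \<alpha>)"] by (simp add: algebra_simps)
      then show "\<sigma> / 2 \<le> circ_dist (of_int (i' - i) * \<alpha>)"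
        using 1 j sigma unfolding J_def[symmetric] circ_dist_minus by linarith
    qed
    then obtain i where i: "i \<in> A" "exp ((L - \<epsilon> - \<zeta>) * real h) \<le> C * p (pt i) h" by blast
    let ?s = "real h / 2 + real m"
    have ib: "n - hh - int m \<le> i" "i \<le> n - hh - 1" using i(1) unfolding A_def by auto
    have "p (pt i) h * a n \<le> C * exp ((L + \<epsilon>) * ?s) * (a (i - 1) + a (i + int h))"
      using ib hhb mi by (intro green_bound) linarith+
    then have gr: "C * p (pt i) h * a n \<le> C\<^sup>2 * exp ((L + \<epsilon>) * ?s) * (a (i - 1) + a (i + int h))"
      using mult_left_mono[of "p (pt i) h * a n" _ C] C1 by (simp add: power2_eq_square mult_ac)
    define k where "k = (if a (i - 1) \<le> a (i + int h) then i + int h else i - 1)"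
    have k: "a (i - 1) + a (i + int h) \<le> 2 * a k" "\<bar>k - n\<bar> \<le> s"
      using ib hhb mi unfolding k_def s_def by auto
    have "exp ((L - \<epsilon> - \<zeta>) * real h) * a n \<le> C * p (pt i) h * a n" using i(2) a0 by (intro mult_right_mono)
    also note gr
    also have "C\<^sup>2 * exp ((L + \<epsilon>) * ?s) * (a (i - 1) + a (i + int h)) \<le> C\<^sup>2 * exp ((L + \<epsilon>) * ?s) * (2 * a k)"
      using k(1) by (intro mult_left_mono) auto
    also have "\<dots> = exp (ln (2 * C\<^sup>2) + (L + \<epsilon>) * ?s) * a k"
      unfolding exp_add exp_ln[OF C2pos(1)] by simp
    finally have "exp (- ((L - \<epsilon> - \<zeta>) * real h)) * (exp ((L - \<epsilon> - \<zeta>) * real h) * a n)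
       \<le> exp (- ((L - \<epsilon> - \<zeta>) * real h)) * (exp (ln (2 * C\<^sup>2) + (L + \<epsilon>) * ?s) * a k)"
      by (intro mult_left_mono) auto
    then have "a n \<le> exp (- ((L - \<epsilon> - \<zeta>) * real h) + (ln (2 * C\<^sup>2) + (L + \<epsilon>) * ?s)) * a k"
      by (simp add: mult.assoc[symmetric] exp_add[symmetric])
    also have "\<dots> \<le> exp (- G) * a k"
    proof (intro mult_right_mono a0)
      have "\<epsilon> * real m \<le> \<epsilon> * (real h / 2)" using m500 e0 by (intro mult_left_mono) auto
      then have "- ((L - \<epsilon> - \<zeta>) * real h) + (ln (2 * C\<^sup>2) + (L + \<epsilon>) * ?s) \<le> - G"
        unfolding G_def by (simp add: algebra_simps add_divide_distrib)
      then show "exp (- ((L - \<epsilon> - \<zeta>) * real h) + (ln (2 * C\<^sup>2) + (L + \<epsilon>) * ?s)) \<le> exp (- G)" by simp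
    qed
    finally show ?thesis using k(2) by blast
  qed
  have e1: "(2 * \<epsilon> + \<zeta>) * real h \<le> \<delta> * \<eta> / 4 * real h" using zeta by (intro mult_right_mono) auto
  have e2: "L * real m \<le> L * (4 * \<eta> * real h)" using em(4) L0 by (intro mult_left_mono) auto
  have e3: "\<delta> * (\<eta> * real h) \<le> L * (\<eta> * real h)" using delta eta by (intro mult_right_mono) auto
  have lnb: "ln (2 * C\<^sup>2) \<le> \<delta> * \<eta> * real h / 4" using lnC h2(4) unfolding h_def by linarith
  define y where "y = L * real h"
  have y0: "y > 0" unfolding y_def using L0 h6 by simp
  have eta_y: "\<eta> * y \<ge> 0" "\<eta> * y \<le> y / 2000" using eta y0 mult_right_mono[of \<eta> "1 / 2000" y] by auto
  have G: "y / 2 - 9/2 * (\<eta> * y) \<le> G"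
    using e1 e2 e3 lnb unfolding G_def y_def by (simp add: algebra_simps)
  \<comment> \<open>A step has length at most \<open>(1/2 + 5 * \<eta>) * h\<close> and gains at
    least \<open>(1/2 - 9/2 * \<eta>) * L * h\<close>. The factor \<open>1 - 20 * \<eta>\<close> in
    \<open>rate\<close> brings the product down to \<open>1/2 - 5 * \<eta>\<close> at most.\<close>
  have gs: "rate * of_int s \<le> G"
  proof -
    have "of_int s \<le> real h / 2 + 4 * \<eta> * real h + 1" using hhb em(4) unfolding s_def by linarith
    then have "of_int s \<le> real h / 2 + 5 * \<eta> * real h" using h2(2) unfolding h_def by linarith
    then have "rate * of_int s \<le> rate * (real h / 2 + 5 * \<eta> * real h)"
      using rate_pos by (intro mult_left_mono) auto
    also have "\<dots> = y / 2 - 5 * (\<eta> * y) - 100 * (\<eta> * (\<eta> * y))"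
      unfolding rate_def y_def by (simp add: algebra_simps)
    also have "\<dots> \<le> y / 2 - 9/2 * (\<eta> * y)" using eta_y eta mult_nonneg_nonneg[of \<eta> "\<eta> * y"] by linarith
    finally show ?thesis using G by linarith
  qed
  have G0: "G > 0" using G eta_y y0 by linarith
  have nn: "J + hh + int m < n" "n < J + int q - hh" 
    using n hhb mi unfolding J_def h_def by (simp_all add: algebra_simps)
  have "a n \<le> max (Wa * exp (- rate * of_int (n - (J + hh + int m)))) (Wb * exp (- rate * of_int (J + int q - hh - n)))"
  proof (rule max_principle[OF a0 W _ gs G0 step _ _ nn])
    show "0 \<le> rate" using rate_pos by simp
    show "a k \<le> Wa" if "J + hh + int m - s \<le> k" "k \<le> J + hh + int m" for k
      by (rule left) (use that hhb mi in \<open>auto simp: s_def J_def[symmetric] h_def[symmetric]\<close>)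
    show "a k \<le> Wb" if "J + int q - hh \<le> k" "k \<le> J + int q - hh + s" for k
      by (rule right) (use that hhb mi in \<open>auto simp: s_def J_def[symmetric] h_def[symmetric] distrib_right\<close>)
  qed
  also have "\<dots> \<le> max (Wa * exp (- rate * of_int (n - j * int q - int h2)))
                   (Wb * exp (- rate * of_int ((j + 1) * int q - int h2 - n)))"
  proof (rule max.mono; rule mult_left_mono[OF _ W(1)] mult_left_mono[OF _ W(2)])
    have "rate * of_int (n - j * int q - int h2) \<le> rate * of_int (n - (J + hh + int m))"
      using rate_pos hhb mi unfolding J_def h_def by (intro mult_left_mono) linarith+
    then show "exp (- rate * of_int (n - (J + hh + int m))) \<le> exp (- rate * of_int (n - j * int q - int h2))" by simp
    have "rate * of_int ((j + 1) * int q - int h2 - n) \<le> rate * of_int (J + int q - hh - n)"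
      using rate_pos hhb mi unfolding J_def h_def by (intro mult_left_mono) (auto simp: algebra_simps)
    then show "exp (- rate * of_int (J + int q - hh - n)) \<le> exp (- rate * of_int ((j + 1) * int q - int h2 - n))" by simp
  qed
  finally show ?thesis .
qed

text \<open>This is \<open>between\<close> for \<open>j = 0\<close> with the trivial boundary value
  \<open>1\<close>; up to \<open>q / 2\<close> the left exponential is the larger one. The collar
  satisfies \<open>h2 \<le> 1000 * \<eta> * n\<close>, whence
  \<open>1020 = 20 + 1000\<close>.\<close>

lemma scale_decay:
  assumes n: "real q / 1000 \<le> of_int n" "of_int n \<le> real q / 2"
  shows "a n \<le> exp (- (L * (1 - 1020 * \<eta>)) * of_int n)"
proof -
  have z: "circ_dist 0 \<le> 0" using circ_dist_le_abs[of 0] by simp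
  have q: "2 * real h2 \<le> of_int n" "real h2 \<le> 1000 * \<eta> * of_int n"
  proof -
    show "2 * real h2 \<le> of_int n" using h2_q n by linarith
    have "\<eta> * real q \<le> \<eta> * (1000 * of_int n)" using eta n by (intro mult_left_mono) auto
    then show "real h2 \<le> 1000 * \<eta> * of_int n" using h2(1) by simp
  qed
  have "a n \<le> max (1 * exp (- rate * of_int (n - 0 * int q - int h2))) (1 * exp (- rate * of_int ((0 + 1) * int q - int h2 - n)))"
    by (rule between) (use z sigma q n a1 h2_q in \<open>auto simp: a1\<close>)
  also have "\<dots> \<le> exp (- rate * (of_int n - real h2))"
    using n rate_pos by (auto intro!: mult_left_mono simp: max_def)
  also have "\<dots> \<le> exp (- (L * (1 - 1020 * \<eta>)) * of_int n)"
  proof -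
    have "L * (1 - 1020 * \<eta>) * of_int n \<le> L * (1 - 20 * \<eta>) * ((1 - 1000 * \<eta>) * of_int n)"
    proof -
      have "L * (1 - 1020 * \<eta>) \<le> L * ((1 - 20 * \<eta>) * (1 - 1000 * \<eta>))"
        using L0 eta by (intro mult_left_mono) (auto simp: algebra_simps)
      then have "L * (1 - 1020 * \<eta>) * of_int n \<le> L * ((1 - 20 * \<eta>) * (1 - 1000 * \<eta>)) * of_int n"
        using q by (intro mult_right_mono) auto
      then show ?thesis by (simp add: mult.assoc)
    qed
    also have "\<dots> \<le> rate * (of_int n - real h2)"
      unfolding rate_def[symmetric] using rate_pos q by (intro mult_left_mono) (auto simp: algebra_simps)
    finally show ?thesis by simp
  qed
  finally show ?thesis .
qed

end

text \<open>The points \<open>j * q\<close>, \<open>|j| \<le> J\<close>, are the resonances: their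
  phases are within \<open>\<sigma> / 16\<close> of that of the peak, yet not within
  \<open>t\<close>, which will be the next error \<open>cf_err\<close>. Through \<open>lnt\<close>
  the exponent \<open>\<beta>\<close> enters, and \<open>etaL\<close> keeps the accumulated losses
  below \<open>L - \<beta>\<close>.\<close>

locale resonant_scale = scale +
  fixes \<beta> t :: real and J :: int
  assumes J: "1 \<le> J" and near_res: "\<bar>j\<bar> \<le> J \<Longrightarrow> circ_dist (of_int (j * int q) * \<alpha>) \<le> \<sigma> / 16"
    and far_res: "j \<noteq> 0 \<Longrightarrow> \<bar>j\<bar> \<le> J \<Longrightarrow> t \<le> circ_dist (of_int (j * int q) * \<alpha>)"
    and t0: "0 < t" and lnt: "logp (4 * r / t) \<le> (\<beta> + \<epsilon>) * real q"
    and beta: "0 \<le> \<beta>" "\<beta> + \<delta> \<le> L" and etaL: "44 * L * \<eta> \<le> \<delta>"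
begin

definition wmax :: "int \<Rightarrow> real" where
  "wmax j = Max (a ` {j * int q - int h2 .. j * int q + int h2})"

lemma wmax_ge: "\<bar>n - j * int q\<bar> \<le> int h2 \<Longrightarrow> a n \<le> wmax j"
  unfolding wmax_def by (intro Max_ge imageI) (auto simp: abs_le_iff)

lemma wmax_attained: "\<exists>n. \<bar>n - j * int q\<bar> \<le> int h2 \<and> wmax j = a n"
proof -
  have "wmax j \<in> a ` {j * int q - int h2 .. j * int q + int h2}"
    unfolding wmax_def by (intro Max_in) auto
  then obtain n where "wmax j = a n" "j * int q - int h2 \<le> n" "n \<le> j * int q + int h2" by auto
  then show ?thesis by (intro exI[of _ n]) (auto simp: abs_le_iff)
qed

lemma wmax_bounds: "0 \<le> wmax j" "wmax j \<le> 1"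
  using wmax_attained[of j] a0 a1 by auto

text \<open>Halfway between two windows both exponentials of \<open>between\<close> have about
  \<open>q / 2\<close> to act. The \<open>6\<close> is composed of the offset \<open>4\<close> of
  \<open>i\<close>, the window radius \<open>h2 \<le> \<eta> * q\<close>, and the rounding
  \<open>2 \<le> \<eta> * q\<close>.\<close>

lemma midpoint:
  assumes j: "\<bar>j\<bar> \<le> J" and i: "\<bar>of_int (i - j * int q) - real q / 2\<bar> \<le> 4 * \<eta> * real q + 2"
  shows "a i \<le> exp (- rate * (real q / 2 - 6 * \<eta> * real q)) * max (wmax j) (wmax (j + 1))"
proof -
  have eq: "\<eta> * real h2 \<le> \<eta> * (1 / 2000 * real q)" using eta h2_q by (intro mult_left_mono) auto
  have eq2: "\<eta> * real q \<le> real q / 2000" using mult_right_mono[OF eta(2), of "real q"] by simp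
  define d where "d = real q / 2 - 6 * \<eta> * real q"
  define k where "k = i - j * int q"
  have ik: "\<bar>of_int k - real q / 2\<bar> \<le> 4 * \<eta> * real q + 2" using i unfolding k_def .
  have d1: "d \<le> of_int (k - int h2)" "d \<le> of_int (int q - int h2 - k)"
    using ik h2 eq unfolding d_def by (simp_all add: abs_le_iff)
  have k1: "int h2 \<le> k" "k \<le> int q - int h2" 
  proof -
    have "of_int k - real q / 2 \<le> 4 * (\<eta> * real q) + 2" "real q / 2 - of_int k \<le> 4 * (\<eta> * real q) + 2"
      using ik by (simp_all add: abs_le_iff)
    then have "real h2 \<le> of_int k" "of_int k \<le> real q - real h2" using h2_q h2_ge eq2 by linarith+
    then show "int h2 \<le> k" "k \<le> int q - int h2" by linarith+
  qed
  have "a i \<le> max (wmax j * exp (- rate * of_int (i - j * int q - int h2)))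
             (wmax (j + 1) * exp (- rate * of_int ((j + 1) * int q - int h2 - i)))"
    by (rule between[OF near_res[OF j] wmax_bounds(1) wmax_bounds(1) wmax_ge wmax_ge])
      (use k1 in \<open>auto simp: k_def algebra_simps\<close>)
  also have "\<dots> \<le> max (wmax j * exp (- rate * d)) (wmax (j + 1) * exp (- rate * d))"
  proof (intro max.mono mult_left_mono wmax_bounds)
    show "exp (- rate * of_int (i - j * int q - int h2)) \<le> exp (- rate * d)"
      using mult_left_mono[OF d1(1), of rate] rate_pos unfolding k_def by simp
    show "exp (- rate * of_int ((j + 1) * int q - int h2 - i)) \<le> exp (- rate * d)"
      using mult_left_mono[OF d1(2), of rate] rate_pos unfolding k_def by (simp add: algebra_simps)
  qed
  also have "\<dots> = exp (- rate * d) * max (wmax j) (wmax (j + 1))"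
    by (simp add: max_mult_distrib_left mult.commute)
  finally show ?thesis unfolding d_def .
qed

lemma edges:
  assumes j: "\<bar>j - 1\<bar> \<le> J" "\<bar>j\<bar> \<le> J" and i: "\<bar>of_int (i - j * int q) + real q / 2\<bar> \<le> 4 * \<eta> * real q + 1"
  shows "a (i - 1) + a (i + int q)
    \<le> 2 * exp (- rate * (real q / 2 - 6 * \<eta> * real q)) * max (wmax (j - 1)) (max (wmax j) (wmax (j + 1)))"
proof -
  let ?X = "exp (- rate * (real q / 2 - 6 * \<eta> * real q))"
  have "a (i - 1) \<le> ?X * max (wmax (j - 1)) (wmax (j - 1 + 1))"
    by (rule midpoint[OF j(1)]) (use i in \<open>simp add: algebra_simps abs_le_iff\<close>)
  moreover have "a (i + int q) \<le> ?X * max (wmax j) (wmax (j + 1))"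
    by (rule midpoint[OF j(2)]) (use i in \<open>simp add: algebra_simps abs_le_iff\<close>)
  moreover have "?X * max (wmax (j - 1)) (wmax (j - 1 + 1)) \<le> ?X * max (wmax (j - 1)) (max (wmax j) (wmax (j + 1)))"
    "?X * max (wmax j) (wmax (j + 1)) \<le> ?X * max (wmax (j - 1)) (max (wmax j) (wmax (j + 1)))"
    by (intro mult_left_mono; simp)+
  ultimately show ?thesis by linarith
qed

text \<open>Forcing leaves the central box starting at \<open>i\<close> a single nearby crossing, and since the box
  determinant at \<open>i\<close> is small, this crossing is so close that no translate by a multiple
  of \<open>q\<close> can be close to it.\<close>

lemma central_box:
  obtains i where "\<bar>of_int i + real q / 2\<bar> \<le> 4 * \<eta> * real q + 1"
    "\<And>j. j \<noteq> 0 \<Longrightarrow> \<bar>j\<bar> \<le> J \<Longrightarrow>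
       exp ((L - 2 * \<epsilon> - \<zeta> - \<beta>) * real q) \<le> C * p (pt (i + j * int q)) q"
proof -
  have q6: "real q \<ge> 12000000" using h2_q h2_ge by linarith
  obtain e m where em: "e > 0" "2 * e \<le> q" "real m \<ge> 2 * real e + 2 * ((40 * r / \<sigma> + 2) / \<zeta>)"
    "real m \<le> 4 * \<eta> * real q" "m > 0"
    "4 * C\<^sup>2 * exp ((L + \<epsilon>) * (real q - real e)) < exp ((L - \<epsilon> - \<zeta>) * real q)"
    using box_params[of q] h2_q by auto
  have eq2: "\<eta> * real q \<le> real q / 2000" using mult_right_mono[OF eta(2), of "real q"] by simp
  have bpos: "0 \<le> (40 * r / \<sigma> + 2) / \<zeta>" using r0 sigma zeta by simp
  have me: "2 * int e \<le> int m" using em(3) bpos by linarith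
  have m500: "500 * int m \<le> int q" using em(4) eq2 by linarith
  obtain xh where xh: "crossings q xh" by (rule lowest)
  define hh where "hh = int (q div 2)"
  have hhb: "2 * hh \<le> int q" "int q \<le> 2 * hh + 1" unfolding hh_def by linarith+
  define S where "S = {- int q + int e .. - int e}"
  define A where "A = {- hh - int m + 1 .. - hh}"
  have AS: "A \<subseteq> S" using hhb me m500 q6 unfolding A_def S_def by auto
  have sepS: "\<sigma> \<le> circ_dist (of_int (i - j) * \<alpha>)" if "i \<in> S" "j \<in> S" "i \<noteq> j" for i j
    by (rule sep) (use that em(1) in \<open>auto simp: S_def\<close>)
  have "\<exists>i\<in>A. zsum q xh \<sigma> i \<le> \<zeta> * real q \<and> card (near q xh \<sigma> i) = 1"
  proof (rule single_box[OF em(2,1) sigma zeta(1) em(6) xh S_def sepS _ _ _ AS])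
    show "finite A" unfolding A_def by simp
    show "real (card A) \<ge> 2 * real e + 2 * ((40 * r / \<sigma> + 2) / \<zeta>)" using em(3) unfolding A_def by simp
    show "\<sigma> \<le> circ_dist (of_int (i - j) * \<alpha>)" if "i \<in> A" "j \<in> A" "i \<noteq> j" for i j
      using sepS that AS by blast
  qed
  then obtain i \<kappa>0 where i: "i \<in> A" "zsum q xh \<sigma> i \<le> \<zeta> * real q" and nr: "near q xh \<sigma> i = {\<kappa>0}"
    by (auto simp: card_1_singleton_iff)
  have ib: "- hh - int m + 1 \<le> i" "i \<le> - hh" using i(1) unfolding A_def by auto
  have icent: "\<bar>of_int i + real q / 2\<bar> \<le> 4 * \<eta> * real q + 1"
    using ib hhb em(4) by (simp add: abs_le_iff)
  have k0: "\<kappa>0 < q" and knear: "\<And>\<kappa>. \<kappa> < q \<Longrightarrow> \<kappa> \<noteq> \<kappa>0 \<Longrightarrow> \<sigma> / 8 \<le> circ_dist (pt i - xh \<kappa>)"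
  proof -
    show "\<kappa>0 < q" using nr unfolding near_def by blast
    show "\<sigma> / 8 \<le> circ_dist (pt i - xh \<kappa>)" if "\<kappa> < q" "\<kappa> \<noteq> \<kappa>0" for \<kappa>
    proof (rule ccontr)
      assume "\<not> ?thesis"
      then have "\<kappa> \<in> near q xh \<sigma> i" using that unfolding near_def by simp
      then show False using nr that by simp
    qed
  qed
  \<comment> \<open>The crossing \<open>\<kappa>0\<close> is kept apart. All others may come closer
    by a factor \<open>2\<close>, which the \<open>2 * r\<close> in \<open>zsum\<close> has already
    paid for.\<close>
  have low: "exp ((L - \<epsilon> - \<zeta>) * real q - logp (r / circ_dist (y - xh \<kappa>0))) \<le> C * p y q"
    if pos: "circ_dist (y - xh \<kappa>0) > 0" and half: "\<And>\<kappa>. \<kappa> < q \<Longrightarrow> \<kappa> \<noteq> \<kappa>0 \<Longrightarrow> circ_dist (pt i - xh \<kappa>) / 2 \<le> circ_dist (y - xh \<kappa>)" for y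
  proof -
    have hp: "0 < circ_dist (pt i - xh \<kappa>) / 2" if "\<kappa> < q" "\<kappa> \<noteq> \<kappa>0" for \<kappa> using knear[OF that] sigma by simp
    have pos': "\<forall>\<kappa><q. 0 < circ_dist (y - xh \<kappa>)" using pos hp half by (metis less_le_trans)
    have "(\<Sum>\<kappa><q. logp (r / circ_dist (y - xh \<kappa>)))
       = logp (r / circ_dist (y - xh \<kappa>0)) + (\<Sum>\<kappa>\<in>{..<q} - {\<kappa>0}. logp (r / circ_dist (y - xh \<kappa>)))"
      using k0 by (intro sum.remove) auto
    also have "(\<Sum>\<kappa>\<in>{..<q} - {\<kappa>0}. logp (r / circ_dist (y - xh \<kappa>)))
      \<le> (\<Sum>\<kappa>\<in>{..<q} - {\<kappa>0}. logp (2 * r / circ_dist (pt i - xh \<kappa>)))"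
    proof (intro sum_mono logp_mono)
      fix \<kappa> assume k: "\<kappa> \<in> {..<q} - {\<kappa>0}"
      then have 1: "0 < circ_dist (pt i - xh \<kappa>) / 2" "circ_dist (pt i - xh \<kappa>) / 2 \<le> circ_dist (y - xh \<kappa>)"
        using hp half by auto
      show "0 < r / circ_dist (y - xh \<kappa>)" using 1 r0 by simp
      have "r / circ_dist (y - xh \<kappa>) \<le> r / (circ_dist (pt i - xh \<kappa>) / 2)"
        using 1 r0 by (intro divide_left_mono) auto
      then show "r / circ_dist (y - xh \<kappa>) \<le> 2 * r / circ_dist (pt i - xh \<kappa>)" by (simp add: mult.commute)
    qed
    also have "\<dots> \<le> zsum q xh \<sigma> i"
      unfolding zsum_def
    proof (intro sum_mono2 subsetI)
      fix \<kappa> assume "\<kappa> \<in> {..<q} - {\<kappa>0}"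
      then show "\<kappa> \<in> {\<kappa>. \<kappa> < q \<and> \<sigma> / 16 \<le> circ_dist (pt i - xh \<kappa>)}" using knear[of \<kappa>] sigma by auto
    qed (auto simp: logp_nonneg)
    finally have "(\<Sum>\<kappa><q. logp (r / circ_dist (y - xh \<kappa>))) \<le> logp (r / circ_dist (y - xh \<kappa>0)) + \<zeta> * real q"
      using i(2) by linarith
    then have "exp ((L - \<epsilon> - \<zeta>) * real q - logp (r / circ_dist (y - xh \<kappa>0)))
      \<le> exp ((L - \<epsilon>) * real q - (\<Sum>\<kappa><q. logp (r / circ_dist (y - xh \<kappa>))))"
      by (simp add: algebra_simps)
    also have "\<dots> \<le> C * p y q" using xh pos' unfolding crossings_def by blast
    finally show ?thesis .
  qed
  have logt: "logp (r / d) \<le> (\<beta> + \<epsilon>) * real q" if "t / 4 \<le> d" for d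
  proof -
    have "r / d \<le> r / (t / 4)" using that t0 r0 by (intro divide_left_mono) auto
    then have "logp (r / d) \<le> logp (4 * r / t)" using that t0 r0 by (intro logp_mono) (auto simp: mult.commute)
    then show ?thesis using lnt by linarith
  qed
  have low2: "exp ((L - 2 * \<epsilon> - \<zeta> - \<beta>) * real q) \<le> C * p y q"
    if d: "t / 4 \<le> circ_dist (y - xh \<kappa>0)" and half: "\<And>\<kappa>. \<kappa> < q \<Longrightarrow> \<kappa> \<noteq> \<kappa>0 \<Longrightarrow> circ_dist (pt i - xh \<kappa>) / 2 \<le> circ_dist (y - xh \<kappa>)" for y
  proof -
    have "exp ((L - 2 * \<epsilon> - \<zeta> - \<beta>) * real q) \<le> exp ((L - \<epsilon> - \<zeta>) * real q - logp (r / circ_dist (y - xh \<kappa>0)))"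
      using logt[OF d] by (simp add: algebra_simps)
    also have "\<dots> \<le> C * p y q" by (rule low[OF _ half]) (use d t0 in auto)
    finally show ?thesis .
  qed
  \<comment> \<open>Otherwise the determinant has size at least
    \<open>exp ((L - \<beta>) * q)\<close> up to small losses. The box ends lie at midpoints, where
    \<open>a\<close> is about \<open>exp (- L * q / 2)\<close>, so Green's formula at the peak
    bounds it by roughly \<open>exp (20 * L * \<eta> * q)\<close>. As
    \<open>L - \<beta> \<ge> \<delta> \<ge> 44 * L * \<eta>\<close>, both cannot hold.\<close>
  have close: "circ_dist (pt i - xh \<kappa>0) < t / 4"
  proof (rule ccontr)
    assume "\<not> ?thesis"
    then have g: "exp ((L - 2 * \<epsilon> - \<zeta> - \<beta>) * real q) \<le> C * p (pt i) q"
      by (intro low2) (use circ_dist_nonneg in auto)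
    let ?s = "real q / 2 + 4 * \<eta> * real q"
    let ?X = "exp (- rate * (real q / 2 - 6 * \<eta> * real q))"
    have "p (pt i) q * a 0 \<le> C * exp ((L + \<epsilon>) * ?s) * (a (i - 1) + a (i + int q))"
      using ib hhb em(4) m500 q6 by (intro green_bound) linarith+
    also have "\<dots> \<le> C * exp ((L + \<epsilon>) * ?s) * (2 * ?X)"
    proof (intro mult_left_mono)
      have "a (i - 1) + a (i + int q) \<le> 2 * ?X * max (wmax (0 - 1)) (max (wmax 0) (wmax (0 + 1)))"
        by (rule edges) (use J icent in auto)
      also have "\<dots> \<le> 2 * ?X * 1" using wmax_bounds by (intro mult_left_mono) auto
      finally show "a (i - 1) + a (i + int q) \<le> 2 * ?X" by simp
    qed (use C1 in auto)
    finally have "p (pt i) q * (1/2) \<le> C * exp ((L + \<epsilon>) * ?s) * (2 * ?X)"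
      using mult_left_mono[OF origin p0[of "pt i" q]] by linarith
    then have "C * p (pt i) q \<le> C * (4 * C * (exp ((L + \<epsilon>) * ?s) * ?X))" using C1 by (intro mult_left_mono) auto
    also have "\<dots> = 4 * C\<^sup>2 * (exp ((L + \<epsilon>) * ?s) * ?X)" by (simp add: power2_eq_square)
    also have "\<dots> = exp (ln (4 * C\<^sup>2)) * (exp ((L + \<epsilon>) * ?s) * ?X)" unfolding exp_ln[OF C2pos(2)] ..
    also have "\<dots> = exp (ln (4 * C\<^sup>2) + (L + \<epsilon>) * ?s - rate * (real q / 2 - 6 * \<eta> * real q))"
    proof -
      have "exp u * (exp v * exp (- c * d)) = exp (u + v - c * d)" for u v c d :: real
        by (simp add: exp_add exp_diff exp_minus field_simps)
      then show ?thesis .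
    qed
    finally have "exp ((L - 2 * \<epsilon> - \<zeta> - \<beta>) * real q) \<le> \<dots>" using g by linarith
    then have le: "(L - 2 * \<epsilon> - \<zeta> - \<beta>) * real q \<le> ln (4 * C\<^sup>2) + (L + \<epsilon>) * ?s - rate * (real q / 2 - 6 * \<eta> * real q)"
      by simp
    define y where "y = L * real q"
    have y: "\<eta> * y \<ge> 0" unfolding y_def using L0 eta by simp
    have "ln (4 * C\<^sup>2) \<le> \<delta> * (\<eta> * real h2) / 4" using h2(4) by simp
    also have "\<dots> \<le> \<delta> * (real q / 2000) / 4"
    proof -
      have "\<eta> * real h2 \<le> real q / 2000" 
        using mult_right_mono[OF eta(2), of "real h2"] h2_q by linarith
      then show ?thesis using delta by (intro divide_right_mono mult_left_mono) auto
    qed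
    finally have 1: "ln (4 * C\<^sup>2) \<le> \<delta> * real q / 8000" by simp
    have e1: "(2 * \<epsilon> + \<zeta>) * real q \<le> \<delta> * \<eta> / 4 * real q" using zeta by (intro mult_right_mono) auto
    have e2: "\<delta> * (\<eta> * real q) \<le> \<delta> * (real q / 2000)" using eq2 delta by (intro mult_left_mono) auto
    have e3: "0 \<le> \<zeta> * real q" "0 \<le> \<epsilon> * real q" using zeta e0 by auto
    have e4: "\<epsilon> * (\<eta> * real q) \<le> \<epsilon> * (real q / 2000)" using eq2 e0 by (intro mult_left_mono) auto
    have e5: "44 * (\<eta> * y) \<le> \<delta> * real q" using mult_right_mono[OF etaL, of "real q"] unfolding y_def by (simp add: mult_ac)
    have e6: "\<delta> * real q \<le> y - \<beta> * real q" using mult_right_mono[OF beta(2), of "real q"] unfolding y_def by (simp add: algebra_simps)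
    have "(L - 2 * \<epsilon> - \<zeta> - \<beta>) * real q = y - \<beta> * real q - (2 * \<epsilon> + \<zeta>) * real q" unfolding y_def by (simp add: algebra_simps)
    moreover have "(L + \<epsilon>) * ?s = y / 2 + 4 * (\<eta> * y) + \<epsilon> * real q / 2 + 4 * (\<epsilon> * (\<eta> * real q))"
      unfolding y_def by (simp add: algebra_simps)
    moreover have "rate * (real q / 2 - 6 * \<eta> * real q) = y / 2 - 16 * (\<eta> * y) + 120 * (\<eta> * (\<eta> * y))"
      unfolding rate_def y_def by (simp add: algebra_simps)
    moreover have "0 \<le> \<eta> * (\<eta> * y)" using y eta by simp
    moreover have "0 < \<delta> * real q" using delta q6 by simp
    ultimately show False using le 1 e1 e2 e3 e4 e5 e6 by (simp add: algebra_simps)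
  qed
  show ?thesis
  proof (rule that[OF icent])
    fix j assume j: "j \<noteq> 0" "\<bar>j\<bar> \<le> J"
    have shift: "pt (i + j * int q) - pt i = of_int (j * int q) * \<alpha>" unfolding pt_diff by simp
    have tri: "circ_dist (pt i - xh \<kappa>) \<le> circ_dist (pt (i + j * int q) - xh \<kappa>) + circ_dist (of_int (j * int q) * \<alpha>)"
      "circ_dist (of_int (j * int q) * \<alpha>) \<le> circ_dist (pt (i + j * int q) - xh \<kappa>) + circ_dist (pt i - xh \<kappa>)" for \<kappa>
    proof -
      show "circ_dist (pt i - xh \<kappa>) \<le> circ_dist (pt (i + j * int q) - xh \<kappa>) + circ_dist (of_int (j * int q) * \<alpha>)"
        using circ_dist_triangle2[of "pt i" "xh \<kappa>" "pt (i + j * int q)"] circ_dist_commute[of "pt i" "pt (i + j * int q)"]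
        unfolding shift by linarith
      show "circ_dist (of_int (j * int q) * \<alpha>) \<le> circ_dist (pt (i + j * int q) - xh \<kappa>) + circ_dist (pt i - xh \<kappa>)"
        using circ_dist_triangle2[of "pt (i + j * int q)" "pt i" "xh \<kappa>"] circ_dist_commute[of "xh \<kappa>" "pt i"]
        unfolding shift by linarith
    qed
    show "exp ((L - 2 * \<epsilon> - \<zeta> - \<beta>) * real q) \<le> C * p (pt (i + j * int q)) q"
    proof (rule low2)
      show "t / 4 \<le> circ_dist (pt (i + j * int q) - xh \<kappa>0)" using tri(2)[of \<kappa>0] far_res[OF j] close t0 by linarith
      show "circ_dist (pt i - xh \<kappa>) / 2 \<le> circ_dist (pt (i + j * int q) - xh \<kappa>)" if "\<kappa> < q" "\<kappa> \<noteq> \<kappa>0" for \<kappa>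
        using tri(1)[of \<kappa>] near_res[OF j(2)] knear[OF that] by linarith
    qed
  qed
qed

definition res_rate :: real where "res_rate = (L - \<beta> - 23 * L * \<eta>) * real q"

lemma res_rate_pos: "res_rate > 0"
proof -
  have "real q > 0" using h2_q h2_ge by linarith
  moreover have "L - \<beta> - 23 * L * \<eta> > 0" using beta etaL delta by linarith
  ultimately show ?thesis unfolding res_rate_def by simp
qed

text \<open>The translate of the central box to window \<open>j\<close> has a determinant of about
  \<open>exp ((L - \<beta>) * q)\<close>. In Green's formula the upper bounds for determinants of
  length about \<open>q / 2\<close> nearly cancel against the midpoint decay, at a loss of
  \<open>22 = 6 + 16\<close> units of \<open>L * \<eta> * q\<close>; the smaller losses make it
  \<open>23\<close>.\<close>

lemma wmax_step:
  assumes j: "0 < j" "j < J"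
  shows "\<exists>k. \<bar>k - j\<bar> \<le> 1 \<and> wmax j \<le> exp (- res_rate) * wmax k"
proof -
  obtain i where i: "\<bar>of_int i + real q / 2\<bar> \<le> 4 * \<eta> * real q + 1"
    "\<And>j. j \<noteq> 0 \<Longrightarrow> \<bar>j\<bar> \<le> J \<Longrightarrow> exp ((L - 2 * \<epsilon> - \<zeta> - \<beta>) * real q) \<le> C * p (pt (i + j * int q)) q"
    using central_box by blast
  have q6: "real q \<ge> 12000000" using h2_q h2_ge by linarith
  have eq2: "\<eta> * real q \<le> real q / 2000" using mult_right_mono[OF eta(2), of "real q"] by simp
  obtain n where n: "\<bar>n - j * int q\<bar> \<le> int h2" "wmax j = a n" using wmax_attained by blast
  define i' where "i' = i + j * int q"
  define n' where "n' = n - j * int q"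
  have n': "\<bar>real_of_int n'\<bar> \<le> \<eta> * real q" using n(1) h2(1) unfolding n'_def by linarith
  have nn: "n - i' = n' - i" unfolding n'_def i'_def by simp
  let ?s = "real q / 2 + 6 * \<eta> * real q"
  let ?X = "exp (- rate * (real q / 2 - 6 * \<eta> * real q))"
  have g1: "1 \<le> \<eta> * real q" using h2 h2_q h2_ge by linarith
  let ?m = "max (wmax (j - 1)) (max (wmax j) (wmax (j + 1)))"
  have ni: "real_of_int n' \<le> \<eta> * real q" "- real_of_int n' \<le> \<eta> * real q"
    "real_of_int i + real q / 2 \<le> 4 * (\<eta> * real q) + 1" "- (real_of_int i + real q / 2) \<le> 4 * (\<eta> * real q) + 1"
    using n' i(1) by (simp_all add: abs_le_iff)
  have "real_of_int (n' - i) \<ge> 0" "real_of_int (n' - i) < real q"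
    "real_of_int (int q - 1 - (n' - i)) \<le> ?s" "real_of_int (n' - i) \<le> ?s"
    unfolding of_int_diff of_int_of_nat_eq using ni eq2 g1 q6 by linarith+
  then have "p (pt i') q * a n \<le> C * exp ((L + \<epsilon>) * ?s) * (a (i' - 1) + a (i' + int q))"
    unfolding nn[symmetric] by (intro green_bound) (auto simp: algebra_simps)
  also have "\<dots> \<le> C * exp ((L + \<epsilon>) * ?s) * (2 * ?X * ?m)"
    using C1 j i(1) by (intro mult_left_mono edges) (auto simp: i'_def)
  finally have "C * (p (pt i') q * a n) \<le> C * (C * exp ((L + \<epsilon>) * ?s) * (2 * ?X * ?m))" using C1 by (intro mult_left_mono) auto
  moreover have "exp ((L - 2 * \<epsilon> - \<zeta> - \<beta>) * real q) * a n \<le> C * p (pt i') q * a n"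
    unfolding i'_def by (rule mult_right_mono[OF i(2) a0]) (use j in auto)
  ultimately have "exp ((L - 2 * \<epsilon> - \<zeta> - \<beta>) * real q) * a n \<le> 2 * C\<^sup>2 * (exp ((L + \<epsilon>) * ?s) * ?X * ?m)"
    by (simp add: power2_eq_square mult_ac)
  also have "\<dots> = exp (ln (2 * C\<^sup>2)) * (exp ((L + \<epsilon>) * ?s) * ?X * ?m)" unfolding exp_ln[OF C2pos(1)] ..
  also have "\<dots> = exp (ln (2 * C\<^sup>2) + (L + \<epsilon>) * ?s - rate * (real q / 2 - 6 * \<eta> * real q)) * ?m"
  proof -
    have "exp u * (exp v * exp (- c * d) * w) = exp (u + v - c * d) * w" for u v c d w :: real
      by (simp add: exp_add exp_diff exp_minus field_simps)
    then show ?thesis .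
  qed
  finally have "exp (- ((L - 2 * \<epsilon> - \<zeta> - \<beta>) * real q)) * (exp ((L - 2 * \<epsilon> - \<zeta> - \<beta>) * real q) * a n)
     \<le> exp (- ((L - 2 * \<epsilon> - \<zeta> - \<beta>) * real q)) * (exp (ln (2 * C\<^sup>2) + (L + \<epsilon>) * ?s - rate * (real q / 2 - 6 * \<eta> * real q)) * ?m)"
    by (intro mult_left_mono) auto
  then have "a n \<le> exp (- ((L - 2 * \<epsilon> - \<zeta> - \<beta>) * real q) + (ln (2 * C\<^sup>2) + (L + \<epsilon>) * ?s - rate * (real q / 2 - 6 * \<eta> * real q))) * ?m"
    by (simp add: mult.assoc[symmetric] exp_add[symmetric])
  also have "\<dots> \<le> exp (- res_rate) * ?m"
  proof (rule mult_right_mono)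
    define y where "y = L * real q"
    have y: "\<eta> * y \<ge> 0" unfolding y_def using L0 eta by simp
    have hq: "\<eta> * real h2 \<le> \<eta> * real q" using eta h2_q by (intro mult_left_mono) auto
    have "ln (2 * C\<^sup>2) \<le> \<delta> * (\<eta> * real h2) / 4" using h2(4) lnC by simp
    also have "\<dots> \<le> \<delta> * (\<eta> * real q) / 4"
      using mult_left_mono[OF hq, of \<delta>] delta by simp
    finally have 1: "ln (2 * C\<^sup>2) \<le> \<delta> * (\<eta> * real q) / 4" .
    have e1: "(2 * \<epsilon> + \<zeta>) * real q \<le> \<delta> * \<eta> / 4 * real q" using zeta by (intro mult_right_mono) auto
    have e2: "\<delta> * (\<eta> * real q) \<le> \<eta> * y" using mult_right_mono[OF delta(2), of "\<eta> * real q"] eta unfolding y_def by (simp add: mult_ac)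
    have e3: "0 \<le> \<zeta> * real q" "0 \<le> \<epsilon> * real q" using zeta e0 by auto
    have e4: "\<epsilon> * (\<eta> * real q) \<le> \<epsilon> * (real q / 2000)" using eq2 e0 by (intro mult_left_mono) auto
    have "(L - 2 * \<epsilon> - \<zeta> - \<beta>) * real q = y - \<beta> * real q - (2 * \<epsilon> + \<zeta>) * real q" unfolding y_def by (simp add: algebra_simps)
    moreover have "(L + \<epsilon>) * ?s = y / 2 + 6 * (\<eta> * y) + \<epsilon> * real q / 2 + 6 * (\<epsilon> * (\<eta> * real q))"
      unfolding y_def by (simp add: algebra_simps)
    moreover have "rate * (real q / 2 - 6 * \<eta> * real q) = y / 2 - 16 * (\<eta> * y) + 120 * (\<eta> * (\<eta> * y))"
      unfolding rate_def y_def by (simp add: algebra_simps)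
    moreover have "res_rate = y - \<beta> * real q - 23 * (\<eta> * y)" unfolding res_rate_def y_def by (simp add: algebra_simps)
    moreover have "0 \<le> \<eta> * (\<eta> * y)" using y eta by simp
    ultimately have "- ((L - 2 * \<epsilon> - \<zeta> - \<beta>) * real q) + (ln (2 * C\<^sup>2) + (L + \<epsilon>) * ?s - rate * (real q / 2 - 6 * \<eta> * real q)) \<le> - res_rate"
      using 1 e1 e2 e3 e4 by (simp add: algebra_simps)
    then show "exp (- ((L - 2 * \<epsilon> - \<zeta> - \<beta>) * real q) + (ln (2 * C\<^sup>2) + (L + \<epsilon>) * ?s - rate * (real q / 2 - 6 * \<eta> * real q))) \<le> exp (- res_rate)"
      by simp
  qed (use wmax_bounds in \<open>auto simp: le_max_iff_disj\<close>)
  finally have "wmax j \<le> exp (- res_rate) * ?m" using n(2) by simp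
  moreover have "\<exists>k. \<bar>k - j\<bar> \<le> 1 \<and> ?m = wmax k"
  proof -
    consider "?m = wmax (j - 1)" | "?m = wmax j" | "?m = wmax (j + 1)" unfolding max_def by presburger
    then show ?thesis
    proof cases
      case 1 then show ?thesis by (intro exI[of _ "j - 1"]) simp
    next
      case 2 then show ?thesis by (intro exI[of _ j]) simp
    next
      case 3 then show ?thesis by (intro exI[of _ "j + 1"]) simp
    qed
  qed
  ultimately show ?thesis by metis
qed

text \<open>\<open>max_principle\<close> on the lattice of windows with step \<open>1\<close>.
  Beyond the middle of the range the trivial bound at \<open>J\<close> would dominate, hence the
  restriction \<open>2 * j \<le> J\<close>.\<close>

lemma wmax_decay:
  assumes j: "0 \<le> j" "2 * j \<le> J" shows "wmax j \<le> exp (- res_rate * of_int j)"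
proof (cases "j = 0")
  case True then show ?thesis using wmax_bounds by simp
next
  case False
  have "wmax j \<le> max (1 * exp (- res_rate * of_int (j - 0))) (1 * exp (- res_rate * of_int (J - j)))"
  proof (rule max_principle[where s = 1 and G = res_rate])
    fix n :: int assume "0 < n" "n < J"
    then show "\<exists>m. \<bar>m - n\<bar> \<le> 1 \<and> wmax n \<le> exp (- res_rate) * wmax m" by (rule wmax_step)
  qed (use wmax_bounds res_rate_pos False j in simp_all)
  also have "\<dots> \<le> exp (- res_rate * of_int j)"
  proof -
    have "res_rate * of_int j \<le> res_rate * of_int (J - j)" using res_rate_pos j by (intro mult_left_mono) auto
    then show ?thesis by simp
  qed
  finally show ?thesis .
qed

text \<open>Window maxima decay at rate \<open>\<Lambda>\<close> per site, and
  \<open>between\<close> interpolates at the faster \<open>rate\<close>. The window radius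
  \<open>h2 \<le> 2 * \<eta> * n\<close> accounts for the difference between \<open>23\<close> and
  \<open>25\<close>.\<close>

lemma resonant_decay:
  assumes n: "real q / 2 \<le> of_int n" "2 * (n + int q) \<le> J * int q"
  shows "a n \<le> exp (- (L - \<beta> - 25 * L * \<eta>) * of_int n)"
proof -
  have q6: "real q \<ge> 12000000" using h2_q h2_ge by linarith
  have q0: "int q > 0" using q6 by linarith
  define \<Lambda> where "\<Lambda> = L - \<beta> - 23 * L * \<eta>"
  have Lam: "\<Lambda> > 0" "\<Lambda> \<le> L" unfolding \<Lambda>_def using beta etaL delta L0 eta by (auto simp: algebra_simps)
  have Lrate: "\<Lambda> \<le> rate" unfolding \<Lambda>_def rate_def using beta L0 eta by (simp add: algebra_simps)
  define j where "j = n div int q"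
  have n0: "n \<ge> 0" using n by linarith
  have jn: "j * int q \<le> n" "n < (j + 1) * int q" 
  proof -
    have "n = j * int q + n mod int q" unfolding j_def by simp
    then show "j * int q \<le> n" "n < (j + 1) * int q"
      using pos_mod_sign[OF q0, of n] pos_mod_bound[OF q0, of n] unfolding distrib_right by linarith+
  qed
  have j0: "0 \<le> j" unfolding j_def using n0 q0 by (simp add: pos_imp_zdiv_nonneg_iff)
  have "(2 * (j + 1)) * int q \<le> J * int q" using jn(1) n(2) by (simp add: algebra_simps)
  then have jJ: "2 * (j + 1) \<le> J" using q0 by simp
  have h2n: "real h2 \<le> 2 * \<eta> * of_int n"
  proof -
    have "\<eta> * real q \<le> \<eta> * (2 * of_int n)" using eta n by (intro mult_left_mono) auto
    then show ?thesis using h2(1) by simp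
  qed
  have wj: "wmax j \<le> exp (- \<Lambda> * of_int (j * int q))" "wmax (j + 1) \<le> exp (- \<Lambda> * of_int ((j + 1) * int q))"
  proof -
    have e: "- res_rate * of_int i = - \<Lambda> * of_int (i * int q)" for i unfolding res_rate_def \<Lambda>_def by (simp add: algebra_simps)
    then show "wmax j \<le> exp (- \<Lambda> * of_int (j * int q))" "wmax (j + 1) \<le> exp (- \<Lambda> * of_int ((j + 1) * int q))"
      using wmax_decay[of j, unfolded e] wmax_decay[of "j + 1", unfolded e] j0 jJ by simp_all
  qed
  have main: "a n \<le> exp (- \<Lambda> * (of_int n - real h2))"
  proof -
    have right: "exp (- \<Lambda> * of_int ((j + 1) * int q)) \<le> exp (- \<Lambda> * (of_int n - real h2))"
    proof -
      have "of_int n - real h2 \<le> of_int ((j + 1) * int q)" using jn(2) by linarith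
      then show ?thesis using mult_left_mono[of _ _ \<Lambda>] Lam by simp
    qed
    consider "n \<le> j * int q + int h2" | "n \<ge> (j + 1) * int q - int h2"
      | "j * int q + int h2 \<le> n" "n \<le> (j + 1) * int q - int h2" by linarith
    then show ?thesis
    proof cases
      case 1
      have "a n \<le> exp (- \<Lambda> * of_int (j * int q))" using wmax_ge[of n j] wj(1) 1 jn by linarith
      also have "\<dots> \<le> exp (- \<Lambda> * (of_int n - real h2))"
      proof -
        have "of_int n - real h2 \<le> of_int (j * int q)" using 1 by linarith
        then show ?thesis using mult_left_mono[of _ _ \<Lambda>] Lam by simp
      qed
      finally show ?thesis .
    next
      case 2
      have "a n \<le> exp (- \<Lambda> * of_int ((j + 1) * int q))" using wmax_ge[of n "j + 1"] wj(2) 2 jn by linarith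
      then show ?thesis using right by linarith
    next
      case 3
      have "a n \<le> max (wmax j * exp (- rate * of_int (n - j * int q - int h2)))
             (wmax (j + 1) * exp (- rate * of_int ((j + 1) * int q - int h2 - n)))"
        by (rule between[OF near_res wmax_bounds(1) wmax_bounds(1) wmax_ge wmax_ge 3]) (use j0 jJ in auto)
      also have "\<dots> \<le> exp (- \<Lambda> * (of_int n - real h2))"
      proof (rule max.boundedI)
        have "wmax j * exp (- rate * of_int (n - j * int q - int h2))
          \<le> exp (- \<Lambda> * of_int (j * int q)) * exp (- \<Lambda> * of_int (n - j * int q - int h2))"
        proof (intro mult_mono wj(1))
          have "0 \<le> real_of_int (n - j * int q - int h2)" unfolding of_int_0_le_iff using 3 by linarith
          from mult_right_mono[OF Lrate this]
          show "exp (- rate * of_int (n - j * int q - int h2)) \<le> exp (- \<Lambda> * of_int (n - j * int q - int h2))" by simp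
        qed simp_all
        also have "\<dots> = exp (- \<Lambda> * (of_int n - real h2))" by (simp add: exp_add[symmetric] algebra_simps)
        finally show "wmax j * exp (- rate * of_int (n - j * int q - int h2)) \<le> exp (- \<Lambda> * (of_int n - real h2))" .
        have "exp (- rate * of_int ((j + 1) * int q - int h2 - n)) \<le> 1"
        proof -
          have "0 \<le> rate * of_int ((j + 1) * int q - int h2 - n)"
            by (rule mult_nonneg_nonneg) (use rate_pos 3 in linarith)+
          then show ?thesis by simp
        qed
        then have "wmax (j + 1) * exp (- rate * of_int ((j + 1) * int q - int h2 - n)) \<le> wmax (j + 1) * 1"
          using wmax_bounds by (intro mult_left_mono) auto
        then show "wmax (j + 1) * exp (- rate * of_int ((j + 1) * int q - int h2 - n)) \<le> exp (- \<Lambda> * (of_int n - real h2))"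
          using wj(2) right by linarith
      qed
      finally show ?thesis .
    qed
  qed
  also have "\<dots> \<le> exp (- (L - \<beta> - 25 * L * \<eta>) * of_int n)"
  proof -
    have "\<Lambda> * real h2 \<le> L * (2 * \<eta> * of_int n)" using Lam h2n by (intro mult_mono) auto
    then show ?thesis unfolding \<Lambda>_def by (simp add: algebra_simps)
  qed
  finally show ?thesis .
qed

end

section \<open>Decay at all scales\<close>

lemma circ_dist_mult_int: "circ_dist (of_int j * y) \<le> \<bar>of_int j\<bar> * circ_dist y"
proof -
  obtain m where m: "circ_dist y = \<bar>y - of_int m\<bar>" by (rule circ_dist_attained)
  have "circ_dist (of_int j * y) \<le> \<bar>of_int j * y - of_int (j * m)\<bar>" by (rule circ_dist_le)
  also have "\<dots> = \<bar>of_int j * (y - of_int m)\<bar>" by (simp add: algebra_simps)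
  finally show ?thesis by (simp add: m abs_mult)
qed

lemma circ_dist_denom_le: "circ_dist (of_int (cf_denom \<alpha> k) * \<alpha>) \<le> \<bar>cf_err \<alpha> k\<bar>"
  unfolding cf_err_def by (rule circ_dist_le)

text \<open>Origin of \<open>640\<close>: \<open>1 / \<sigma> \<le> 2 * q\<close> gives
  \<open>40 * r / \<sigma> \<le> 80 * q * r\<close>, at most an eighth of
  \<open>\<zeta> * \<eta>\<^sup>2 * q\<close>. Another eighth pays for the \<open>2\<close>, and
  together they fit because rounding \<open>\<eta> * q\<close> down loses at most half of
  it.\<close>

lemma scale_params:
  fixes \<eta> \<zeta> \<delta> r \<sigma> C Q :: real
  assumes pos: "0 < \<eta>" "\<eta> \<le> 1 / 2000" "0 < \<zeta>" "0 < \<delta>" "0 < r" "r \<le> \<eta>\<^sup>2 * \<zeta> / 640" "C \<ge> 1" "0 < \<sigma>"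
    and sg: "1 / (2 * real q) \<le> \<sigma>" and q: "q > 0"
    and Q: "6 + 16 / \<zeta> + 8 * ln (4 * C\<^sup>2) / \<delta> \<le> \<eta>\<^sup>2 * real q"
  defines "h \<equiv> nat \<lfloor>\<eta> * real q\<rfloor>"
  shows "real h \<le> \<eta> * real q" "3 \<le> \<eta> * real h" "(40 * r / \<sigma> + 2) / \<zeta> \<le> \<eta> * real h / 2"
      "ln (4 * C\<^sup>2) \<le> \<delta> * \<eta> * real h / 4"
proof -
  have C2: "C\<^sup>2 \<ge> 1" using pos by simp
  then have lnC: "ln (4 * C\<^sup>2) \<ge> 0" by (intro ln_ge_zero) simp
  have a: "0 \<le> 16 / \<zeta>" "0 \<le> 8 * ln (4 * C\<^sup>2) / \<delta>" using pos lnC by auto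
  have big: "6 \<le> \<eta>\<^sup>2 * real q" "16 / \<zeta> \<le> \<eta>\<^sup>2 * real q" "8 * ln (4 * C\<^sup>2) / \<delta> \<le> \<eta>\<^sup>2 * real q" using Q a by linarith+
  have hq: "0 \<le> \<eta> * real q" using pos by simp
  show h1: "real h \<le> \<eta> * real q" unfolding h_def using hq by linarith
  have "\<eta>\<^sup>2 * real q \<le> \<eta> * 1 * real q" unfolding power2_eq_square using pos by (intro mult_right_mono mult_left_mono) auto
  then have "\<eta> * real q \<ge> 2" using big by linarith
  then have "real h \<ge> \<eta> * real q / 2" unfolding h_def by linarith
  then have "\<eta> * (\<eta> * real q / 2) \<le> \<eta> * real h" using pos by (intro mult_left_mono) auto
  then have eh: "\<eta>\<^sup>2 * real q / 2 \<le> \<eta> * real h" by (simp add: power2_eq_square mult_ac)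
  show "3 \<le> \<eta> * real h" using eh big by linarith
  have "1 / \<sigma> \<le> 2 * real q"
  proof -
    have "1 / \<sigma> \<le> 1 / (1 / (2 * real q))" using sg pos q by (intro divide_left_mono) auto
    then show ?thesis by simp
  qed
  then have "40 * r * (1 / \<sigma>) \<le> 40 * r * (2 * real q)" using pos by (intro mult_left_mono) auto
  also have "\<dots> = 80 * real q * r" by simp
  also have "\<dots> \<le> 80 * real q * (\<eta>\<^sup>2 * \<zeta> / 640)" using pos by (intro mult_left_mono) auto
  finally have "40 * r / \<sigma> \<le> \<zeta> * (\<eta>\<^sup>2 * real q / 8)" by (simp add: mult_ac)
  moreover have "2 \<le> \<zeta> * (\<eta>\<^sup>2 * real q / 8)" using big(2) pos by (simp add: pos_divide_le_eq mult_ac)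
  moreover have "\<zeta> * (\<eta>\<^sup>2 * real q / 2) \<le> \<zeta> * (\<eta> * real h)" by (rule mult_left_mono[OF eh]) (use pos in simp)
  ultimately have "40 * r / \<sigma> + 2 \<le> \<zeta> * (\<eta> * real h / 2)" by linarith
  then show "(40 * r / \<sigma> + 2) / \<zeta> \<le> \<eta> * real h / 2" using pos by (simp add: pos_divide_le_eq mult_ac)
  have "8 * ln (4 * C\<^sup>2) \<le> \<delta> * (\<eta>\<^sup>2 * real q)" using big(3) pos by (simp add: pos_divide_le_eq mult_ac)
  moreover have "\<delta> * (\<eta>\<^sup>2 * real q / 2) \<le> \<delta> * (\<eta> * real h)" by (rule mult_left_mono[OF eh]) (use pos in simp)
  ultimately have "4 * ln (4 * C\<^sup>2) \<le> \<delta> * (\<eta> * real h)" by linarith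
  then show "ln (4 * C\<^sup>2) \<le> \<delta> * \<eta> * real h / 4" by simp
qed

text \<open>The quantifiers are arranged to fit \<open>box_bounds\<close>: \<open>\<epsilon>\<close>
  and \<open>r\<close> are fixed, a constant \<open>C\<close> is supplied for them, and only then
  \<open>n1\<close> is chosen. Admitting every \<open>\<alpha>'\<close> with the same circular
  distances covers \<open>\<alpha>\<close> and \<open>- \<alpha>\<close>, hence both
  half-lines.\<close>

lemma eigenbox_decay:
  fixes \<alpha> \<beta> \<delta> Lb \<kappa> :: real
  assumes irr: "\<alpha> \<notin> \<rat>" and b: "0 \<le> \<beta>" and d: "0 < \<delta>" and Lb: "0 < Lb" and k: "0 < \<kappa>"
    and growth: "\<And>\<epsilon>. \<epsilon> > 0 \<Longrightarrow> eventually (\<lambda>k. ln (of_int (cf_denom \<alpha> (Suc k))) \<le> (\<beta> + \<epsilon>) * of_int (cf_denom \<alpha> k)) sequentially"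
  shows "\<exists>\<epsilon>>0. \<exists>r>0. \<forall>C\<ge>1. \<exists>n1::int. n1 > 0 \<and> (\<forall>\<alpha>' x a p L. (\<forall>d. circ_dist (of_int d * \<alpha>') = circ_dist (of_int d * \<alpha>)) \<longrightarrow>
     eigenbox \<alpha>' x a p L \<epsilon> r C \<longrightarrow> \<beta> + \<delta> \<le> L \<longrightarrow> L \<le> Lb \<longrightarrow>
     (\<forall>n\<ge>n1. a n \<le> exp (- (L - \<beta> - \<kappa>) * of_int n)))"
proof -
  \<comment> \<open>The \<open>44\<close> is demanded by \<open>resonant_scale\<close>, the
    \<open>1020\<close> is the loss in \<open>scale_decay\<close>; the resonant loss
    \<open>25\<close> is smaller.\<close>
  define \<eta> where "\<eta> = min (1 / 2000) (min (\<delta> / (44 * Lb)) (\<kappa> / (1020 * Lb)))"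
  have eta: "0 < \<eta>" "\<eta> \<le> 1 / 2000" "\<eta> \<le> \<delta> / (44 * Lb)" "\<eta> \<le> \<kappa> / (1020 * Lb)"
    unfolding \<eta>_def using d Lb k by auto
  have eta_Lb: "44 * L * \<eta> \<le> \<delta>" "1020 * L * \<eta> \<le> \<kappa>" if "L \<le> Lb" for L
  proof -
    have "44 * L * \<eta> \<le> 44 * Lb * \<eta>" "1020 * L * \<eta> \<le> 1020 * Lb * \<eta>" using that eta by (auto intro!: mult_right_mono)
    moreover have "44 * Lb * \<eta> \<le> \<delta>" "1020 * Lb * \<eta> \<le> \<kappa>" using eta Lb by (auto simp: pos_le_divide_eq mult_ac)
    ultimately show "44 * L * \<eta> \<le> \<delta>" "1020 * L * \<eta> \<le> \<kappa>" by linarith+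
  qed
  define \<zeta> where "\<zeta> = \<delta> * \<eta> / 8"
  define \<epsilon> where "\<epsilon> = \<delta> * \<eta> / 16"
  \<comment> \<open>With \<open>t \<ge> 1 / (2 * q')\<close> the bound \<open>1 / 8\<close> gives
    \<open>4 * r / t \<le> q'\<close>; the other bound is the one of
    \<open>scale_params\<close>.\<close>
  define r where "r = min (1 / 8) (\<eta>\<^sup>2 * \<zeta> / 640)"
  have ze: "0 < \<zeta>" "0 < \<epsilon>" "2 * \<epsilon> + \<zeta> \<le> \<delta> * \<eta> / 4" unfolding \<zeta>_def \<epsilon>_def using d eta by auto
  have r: "0 < r" "r \<le> 1 / 8" "r \<le> \<eta>\<^sup>2 * \<zeta> / 640" unfolding r_def using ze eta by auto
  have main: "\<exists>n1::int. n1 > 0 \<and> (\<forall>\<alpha>' x a p L. (\<forall>d. circ_dist (of_int d * \<alpha>') = circ_dist (of_int d * \<alpha>)) \<longrightarrow>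
     eigenbox \<alpha>' x a p L \<epsilon> r C \<longrightarrow> \<beta> + \<delta> \<le> L \<longrightarrow> L \<le> Lb \<longrightarrow>
     (\<forall>n\<ge>n1. a n \<le> exp (- (L - \<beta> - \<kappa>) * of_int n)))" if C: "C \<ge> 1" for C
  proof -
    define Q where "Q = (6 + 16 / \<zeta> + 8 * ln (4 * C\<^sup>2) / \<delta>) / \<eta>\<^sup>2"
    obtain k1 where k1: "\<And>k. k \<ge> k1 \<Longrightarrow> ln (of_int (cf_denom \<alpha> (Suc k))) \<le> (\<beta> + \<epsilon>) * of_int (cf_denom \<alpha> k)"
      using growth[OF ze(2)] unfolding eventually_sequentially by blast
    define k0 where "k0 = max k1 (nat \<lceil>Q\<rceil>)"
    define qn where "qn k = nat (cf_denom \<alpha> (Suc k))" for k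
    have qpos: "cf_denom \<alpha> k \<ge> 1" for k using cf_denom_pos[OF irr] by blast
    have qn: "int (qn k) = cf_denom \<alpha> (Suc k)" "real (qn k) = of_int (cf_denom \<alpha> (Suc k))" "qn k > 0" for k
      using qpos[of "Suc k"] unfolding qn_def by auto
    have qQ: "6 + 16 / \<zeta> + 8 * ln (4 * C\<^sup>2) / \<delta> \<le> \<eta>\<^sup>2 * real (qn k)" if "k \<ge> k0" for k
    proof -
      have "Q \<le> real k" using that unfolding k0_def by linarith
      also have "real k \<le> real (qn k)" using cf_denom_ge[OF irr, of k] unfolding qn(1)[symmetric] by linarith
      finally show ?thesis unfolding Q_def using eta by (simp add: pos_divide_le_eq mult.commute)
    qed
    have decay: "a n \<le> exp (- (L - \<beta> - \<kappa>) * of_int n)"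
      if al: "\<forall>d. circ_dist (of_int d * \<alpha>') = circ_dist (of_int d * \<alpha>)" and eb: "eigenbox \<alpha>' x a p L \<epsilon> r C"
        and L: "\<beta> + \<delta> \<le> L" "L \<le> Lb" and n: "cf_denom \<alpha> (Suc k0) \<le> n" for \<alpha>' x a p L n
    proof -
      have scale: "scale \<alpha>' x a p L \<epsilon> r C (qn k) (nat \<lfloor>\<eta> * real (qn k)\<rfloor>) \<bar>cf_err \<alpha> k\<bar> \<zeta> \<eta> \<delta>" if "k \<ge> k0" for k
      proof -
        have s1: "1 / (2 * real (qn k)) \<le> \<bar>cf_err \<alpha> k\<bar>" unfolding qn using cf_err_ge[OF irr] .
        then have s0: "0 < \<bar>cf_err \<alpha> k\<bar>" using qn(3)[of k] by (smt (verit) divide_pos_pos of_nat_0_less_iff)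
        have s2: "\<bar>cf_err \<alpha> k\<bar> \<le> 1"
        proof -
          have "\<bar>cf_err \<alpha> k\<bar> \<le> 1 / real (qn k)" unfolding qn using cf_err_le[OF irr] .
          also have "\<dots> \<le> 1" using qn(3)[of k] by simp
          finally show ?thesis .
        qed
        note sp = scale_params[OF eta(1,2) ze(1) d r(1,3) C s0 s1 qn(3) qQ[OF that]]
        show ?thesis
        proof (intro scale.intro eb scale_axioms.intro)
          fix d :: int assume "d \<noteq> 0" "\<bar>d\<bar> < int (qn k)"
          then show "\<bar>cf_err \<alpha> k\<bar> \<le> circ_dist (of_int d * \<alpha>')"
            using cf_best_approx[OF irr, of d k] al unfolding qn by simp
        qed (use eta d ze s0 s2 sp L b in auto)
      qed
      \<comment> \<open>Selects consecutive denominators with \<open>q \<le> 2 * n < q'\<close>. If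
        \<open>n \<ge> q' / 1000\<close>, the scale \<open>q'\<close> applies through
        \<open>scale_decay\<close>; otherwise \<open>q' \<ge> 500 * q\<close>, and the resonances of
        \<open>q\<close> reach beyond \<open>n\<close>.\<close>
      define K where "K = {k. of_int (cf_denom \<alpha> (Suc k)) \<le> 2 * n}"
      have "k \<le> nat (2 * n)" if "k \<in> K" for k
        using that cf_denom_ge[OF irr, of k] unfolding K_def by simp
      then have finK: "finite K" by (meson atMost_iff finite_atMost finite_subset subsetI)
      have n0: "n > 0" using n qpos[of "Suc k0"] by linarith
      have k0K: "k0 \<in> K" using n n0 unfolding K_def by simp
      define k where "k = Max K"
      have kK: "k \<in> K" unfolding k_def using finK k0K by (intro Max_in) auto
      have kk: "k \<ge> k0" unfolding k_def using finK k0K by (rule Max_ge)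
      have "Suc k \<notin> K" unfolding k_def using Max_ge[OF finK, of "Suc (Max K)"] by auto
      then have nlt: "2 * n < cf_denom \<alpha> (Suc (Suc k))" unfolding K_def by auto
      have nge: "real (qn k) / 2 \<le> of_int n" using kK unfolding K_def qn(1)[symmetric] by simp
      have nlt': "of_int n \<le> real (qn (Suc k)) / 2" using nlt unfolding qn(1)[symmetric] by linarith
      show ?thesis
      proof (cases "real (qn (Suc k)) / 1000 \<le> of_int n")
        case True
        interpret scale \<alpha>' x a p L \<epsilon> r C "qn (Suc k)" "nat \<lfloor>\<eta> * real (qn (Suc k))\<rfloor>" "\<bar>cf_err \<alpha> (Suc k)\<bar>" \<zeta> \<eta> \<delta>
          using scale kk by simp
        have "a n \<le> exp (- (L * (1 - 1020 * \<eta>)) * of_int n)" by (rule scale_decay[OF True nlt'])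
        also have "\<dots> \<le> exp (- (L - \<beta> - \<kappa>) * of_int n)"
        proof -
          have "L - \<beta> - \<kappa> \<le> L * (1 - 1020 * \<eta>)" using eta_Lb(2)[OF L(2)] b by (simp add: algebra_simps)
          then have "(L - \<beta> - \<kappa>) * of_int n \<le> L * (1 - 1020 * \<eta>) * of_int n" using n0 by (intro mult_right_mono) auto
          then show ?thesis by (simp only: exp_le_cancel_iff mult_minus_left neg_le_iff_le)
        qed
        finally show ?thesis .
      next
        case False
        define q where "q = qn k"
        define q' where "q' = qn (Suc k)"
        have q1: "500 * real q \<le> real q'" using False nge unfolding q_def q'_def by simp
        \<comment> \<open>The \<open>32\<close> yields
          \<open>|j| / q' \<le> 1 / (32 * q) \<le> \<sigma> / 16\<close> for
          \<open>|j| \<le> J\<close>, because \<open>\<sigma> \<ge> 1 / (2 * q)\<close>.\<close>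
        define J where "J = \<lfloor>real q' / (32 * real q)\<rfloor>"
        have q0: "real q > 0" unfolding q_def using qn(3) by simp
        have Jb: "of_int J \<le> real q' / (32 * real q)" "real q' / (32 * real q) < of_int J + 1" unfolding J_def by linarith+
        have J32: "of_int J * (32 * real q) \<le> real q'" using Jb(1) q0 by (simp add: pos_le_divide_eq)
        have J32': "real q' < (of_int J + 1) * (32 * real q)" using Jb(2) q0 by (simp add: pos_divide_less_eq)
        define t where "t = \<bar>cf_err \<alpha> (Suc k)\<bar>"
        have t: "1 / (2 * real q') \<le> t" "t \<le> 1 / real q'"
          unfolding t_def q'_def qn using cf_err_ge[OF irr] cf_err_le[OF irr] by blast+
        have q'0: "real q' > 0" using q1 q0 by linarith
        have t0: "t > 0" using t(1) q'0 by (smt (verit) divide_pos_pos)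
        have res: "resonant_scale \<alpha>' x a p L \<epsilon> r C q (nat \<lfloor>\<eta> * real q\<rfloor>) \<bar>cf_err \<alpha> k\<bar> \<zeta> \<eta> \<delta> \<beta> t J"
        proof (intro resonant_scale.intro resonant_scale_axioms.intro)
          show "scale \<alpha>' x a p L \<epsilon> r C q (nat \<lfloor>\<eta> * real q\<rfloor>) \<bar>cf_err \<alpha> k\<bar> \<zeta> \<eta> \<delta>"
            unfolding q_def using scale kk by simp
          show "1 \<le> J"
          proof -
            have "1 \<le> real q' / (32 * real q)" using q1 q0 by (simp add: pos_le_divide_eq)
            then show ?thesis unfolding J_def by linarith
          qed
          show "circ_dist (of_int (j * int q) * \<alpha>') \<le> \<bar>cf_err \<alpha> k\<bar> / 16" if "\<bar>j\<bar> \<le> J" for j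
          proof -
            have "circ_dist (of_int (j * int q) * \<alpha>') = circ_dist (of_int j * (of_int (cf_denom \<alpha> (Suc k)) * \<alpha>))"
              using al[rule_format, of "j * int q"] unfolding q_def qn by (simp add: mult.assoc qn(2)[symmetric])
            also have "\<dots> \<le> \<bar>of_int j\<bar> * circ_dist (of_int (cf_denom \<alpha> (Suc k)) * \<alpha>)" by (rule circ_dist_mult_int)
            also have "\<dots> \<le> of_int J * (1 / real q')"
            proof (intro mult_mono)
              have "\<bar>real_of_int j\<bar> = of_int \<bar>j\<bar>" by simp
              then show "\<bar>real_of_int j\<bar> \<le> of_int J" using that by linarith
              then show "0 \<le> real_of_int J" by linarith
              show "circ_dist (of_int (cf_denom \<alpha> (Suc k)) * \<alpha>) \<le> 1 / real q'"
                using circ_dist_denom_le[of \<alpha> "Suc k"] t(2) unfolding t_def by linarith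
            qed (rule circ_dist_nonneg)
            also have "\<dots> \<le> 1 / (2 * real q) / 16" using J32 q0 q'0 by (simp add: field_simps)
            also have "\<dots> \<le> \<bar>cf_err \<alpha> k\<bar> / 16" unfolding q_def qn using cf_err_ge[OF irr, of k] by simp
            finally show ?thesis .
          qed
          show "t \<le> circ_dist (of_int (j * int q) * \<alpha>')" if "j \<noteq> 0" "\<bar>j\<bar> \<le> J" for j
          proof -
            have "real_of_int \<bar>j * int q\<bar> < real q'"
            proof -
              have "real_of_int \<bar>j * int q\<bar> = of_int \<bar>j\<bar> * real q" by (simp add: abs_mult)
              also have "\<dots> \<le> of_int J * real q" using that by (intro mult_right_mono) auto
              finally show ?thesis using J32 q'0 by linarith
            qed
            then have "\<bar>j * int q\<bar> < cf_denom \<alpha> (Suc (Suc k))" unfolding q'_def qn by linarith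
            then show ?thesis using cf_best_approx[OF irr, of "j * int q" "Suc k"] that q0 al[rule_format, of "j * int q"] unfolding t_def by simp
          qed
          show "0 < t" by (rule t0)
          show "logp (4 * r / t) \<le> (\<beta> + \<epsilon>) * real q"
          proof -
            have "4 * r / t \<le> 4 * r / (1 / (2 * real q'))" using t(1) t0 r q'0 by (intro divide_left_mono) auto
            also have "\<dots> = 8 * r * real q'" by simp
            also have "\<dots> \<le> 1 * real q'" using r by (intro mult_right_mono) auto
            finally have "logp (4 * r / t) \<le> logp (real q')" using r t0 by (intro logp_mono) auto
            also have "\<dots> = ln (real q')" using q1 q0 qn(3)[of "Suc k"] unfolding logp_def q'_def by simp
            also have "\<dots> \<le> (\<beta> + \<epsilon>) * real q"
              using k1[of "Suc k"] kk unfolding q'_def q_def qn k0_def by simp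
            finally show ?thesis .
          qed
          show "0 \<le> \<beta>" "\<beta> + \<delta> \<le> L" by (rule b, rule L)
          show "44 * L * \<eta> \<le> \<delta>" by (rule eta_Lb[OF L(2)])
        qed
        interpret resonant_scale \<alpha>' x a p L \<epsilon> r C q "nat \<lfloor>\<eta> * real q\<rfloor>" "\<bar>cf_err \<alpha> k\<bar>" \<zeta> \<eta> \<delta> \<beta> t J by (rule res)
        have "a n \<le> exp (- (L - \<beta> - 25 * L * \<eta>) * of_int n)"
        proof (rule resonant_decay)
          show "real q / 2 \<le> of_int n" using nge unfolding q_def .
          have "of_int n < real q' / 1000" using False unfolding q'_def by simp
          then have "2 * (of_int n + real q) \<le> of_int J * real q" using J32' q1 by (simp add: algebra_simps)
          then have "real_of_int (2 * (n + int q)) \<le> real_of_int (J * int q)" by simp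
          then show "2 * (n + int q) \<le> J * int q" by (simp only: of_int_le_iff)
        qed
        also have "\<dots> \<le> exp (- (L - \<beta> - \<kappa>) * of_int n)"
        proof -
          have "25 * L * \<eta> \<le> 1020 * L * \<eta>" using L b d eta by (intro mult_right_mono) auto
          then have "L - \<beta> - \<kappa> \<le> L - \<beta> - 25 * L * \<eta>" using eta_Lb(2)[OF L(2)] by linarith
          then have "(L - \<beta> - \<kappa>) * of_int n \<le> (L - \<beta> - 25 * L * \<eta>) * of_int n" using n0 by (intro mult_right_mono) auto
          then show ?thesis by (simp only: exp_le_cancel_iff mult_minus_left neg_le_iff_le)
        qed
        finally show ?thesis .
      qed
    qed
    have "cf_denom \<alpha> (Suc k0) > 0" using qpos[of "Suc k0"] by linarith
    then show ?thesis using decay by (intro exI[of _ "cf_denom \<alpha> (Suc k0)"]) blast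
  qed
  show ?thesis using ze(2) r(1) main by blast
qed

section \<open>Green's inequality for eigenfunctions\<close>

text \<open>Both kinds of site obey one relation: at \<open>-\<infinity>\<close> the left side
  vanishes with \<open>\<psi> n\<close> and the right side with \<open>shop\<close>.\<close>

lemma eigen_solution_normalised:
  assumes "eigen_solution f \<alpha> x E \<psi>"
  shows "of_real (sdiag R E (f (x + of_int n * \<alpha>))) * \<psi> n
    = of_real (shop R E (f (x + of_int n * \<alpha>))) * (\<psi> (n + 1) + \<psi> (n - 1))"
proof (cases "f (x + of_int n * \<alpha>) = -\<infinity>")
  case True
  then have "\<psi> n = 0" using assms unfolding eigen_solution_def by metis
  then show ?thesis using True by (simp add: shop_def)
next
  case False
  define v where "v = real_of_ereal (f (x + of_int n * \<alpha>))"
  have "\<psi> (n + 1) + \<psi> (n - 1) + of_real v * \<psi> n = of_real E * \<psi> n"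
    using assms False unfolding eigen_solution_def v_def by metis
  then have "\<psi> (n + 1) + \<psi> (n - 1) = of_real (E - v) * \<psi> n" by (simp add: algebra_simps)
  then show ?thesis using False unfolding sdiag_def shop_def v_def[symmetric] by simp
qed

lemma eigen_solution_green:
  fixes R :: real
  assumes es: "eigen_solution f \<alpha> x E \<psi>" and n: "i \<le> n" "n < i + int h"
  defines "p \<equiv> \<lambda>y h. \<bar>pbox R E (orbit f \<alpha> y) h\<bar>"
  shows "p (x + of_int i * \<alpha>) h * cmod (\<psi> n)
    \<le> p (x + of_int (n + 1) * \<alpha>) (nat (i + int h - 1 - n)) * cmod (\<psi> (i - 1))
      + p (x + of_int i * \<alpha>) (nat (n - i)) * cmod (\<psi> (i + int h))"
proof -
  define u where "u n = sdiag R E (f (x + of_int n * \<alpha>))" for n :: int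
  define v where "v n = shop R E (f (x + of_int n * \<alpha>))" for n :: int
  define P where "P i h = tcont (\<lambda>j. u (i + int j)) (\<lambda>j. v (i + int j)) h" for i :: int and h
  have p: "p (x + of_int i * \<alpha>) h = \<bar>P i h\<bar>" for i h
    unfolding p_def P_def pbox_def u_def v_def orbit_def by (simp add: algebra_simps)
  define m where "m = nat (n - i)"
  define l where "l = nat (i + int h - 1 - n)"
  have hml: "h = m + 1 + l" "i + int m = n" "n + int l + 1 = i + int h" using n unfolding m_def l_def by linarith+
  have v01: "0 \<le> v k" "v k \<le> 1" for k unfolding v_def by (rule shop_bounds)+
  have pr: "\<bar>\<Prod>j\<le>k. v (c + int j)\<bar> \<le> 1" for k c
    using v01 by (simp add: abs_prod prod_le_1)
  have bnd: "cmod (of_real (w * z) * \<phi>) \<le> \<bar>z\<bar> * cmod \<phi>" if "\<bar>w\<bar> \<le> 1" for w z \<phi>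
  proof -
    have "\<bar>w\<bar> * (\<bar>z\<bar> * cmod \<phi>) \<le> 1 * (\<bar>z\<bar> * cmod \<phi>)" using that by (intro mult_right_mono) auto
    then show ?thesis by (simp add: norm_mult abs_mult mult.assoc)
  qed
  have "of_real (P i (m + 1 + l)) * \<psi> (i + int m)
    = of_real ((\<Prod>j\<le>m. v (i + int j)) * P (i + int m + 1) l) * \<psi> (i - 1)
    + of_real ((\<Prod>j\<le>l. v (i + int m + int j)) * P i m) * \<psi> (i + int m + int l + 1)"
    unfolding P_def by (rule tcont_green) (unfold u_def v_def, rule eigen_solution_normalised[OF es])
  then have "cmod (of_real (P i h) * \<psi> n) \<le> cmod (of_real ((\<Prod>j\<le>m. v (i + int j)) * P (n + 1) l) * \<psi> (i - 1))
    + cmod (of_real ((\<Prod>j\<le>l. v (n + int j)) * P i m) * \<psi> (i + int h))"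
    using norm_triangle_ineq unfolding hml(1,2) hml(3)[unfolded hml(1)] by (metis hml(2) hml(3)[unfolded hml(1)])
  also have "\<dots> \<le> \<bar>P (n + 1) l\<bar> * cmod (\<psi> (i - 1)) + \<bar>P i m\<bar> * cmod (\<psi> (i + int h))"
    by (intro add_mono bnd pr)
  finally show ?thesis unfolding p m_def l_def by (simp add: norm_mult)
qed

lemma eigenbox_right:
  assumes es: "eigen_solution f \<alpha> x E \<psi>" and bd: "\<And>n. cmod (\<psi> n) \<le> 1" and n0: "1 / 2 \<le> cmod (\<psi> n0)"
    and pos: "L > 0" "\<epsilon> > 0" "r > 0" "C \<ge> 1"
    and U: "\<And>y h. \<bar>pbox R E (orbit f \<alpha> y) h\<bar> \<le> C * exp ((L + \<epsilon>) * real h)"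
    and Lw: "\<And>h. \<exists>xh. \<forall>y. (\<forall>\<kappa><h. circ_dist (y - xh \<kappa>) > 0) \<longrightarrow>
        exp ((L - \<epsilon>) * real h - (\<Sum>\<kappa><h. logp (r / circ_dist (y - xh \<kappa>)))) \<le> C * \<bar>pbox R E (orbit f \<alpha> y) h\<bar>"
  shows "eigenbox \<alpha> (x + of_int n0 * \<alpha>) (\<lambda>n. cmod (\<psi> (n0 + n))) (\<lambda>y h. \<bar>pbox R E (orbit f \<alpha> y) h\<bar>) L \<epsilon> r C"
proof
  fix i n :: int and h assume "i \<le> n" "n < i + int h"
  then show "\<bar>pbox R E (orbit f \<alpha> (x + of_int n0 * \<alpha> + of_int i * \<alpha>)) h\<bar> * cmod (\<psi> (n0 + n))
    \<le> \<bar>pbox R E (orbit f \<alpha> (x + of_int n0 * \<alpha> + of_int (n + 1) * \<alpha>)) (nat (i + int h - 1 - n))\<bar> * cmod (\<psi> (n0 + (i - 1)))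
      + \<bar>pbox R E (orbit f \<alpha> (x + of_int n0 * \<alpha> + of_int i * \<alpha>)) (nat (n - i))\<bar> * cmod (\<psi> (n0 + (i + int h)))"
    using eigen_solution_green[OF es, of "n0 + i" "n0 + n" h R] by (simp add: algebra_simps)
qed (use assms in auto)

text \<open>Reflection about \<open>n0\<close>. A box of length \<open>h\<close> read from phase
  \<open>y\<close> in direction \<open>- \<alpha>\<close> is an ordinary box ending at
  \<open>y\<close>, so it starts at \<open>y - (h - 1) * \<alpha>\<close>; the crossings shift
  accordingly, and the two terms of Green's formula change places.\<close>

lemma eigenbox_left:
  assumes es: "eigen_solution f \<alpha> x E \<psi>" and bd: "\<And>n. cmod (\<psi> n) \<le> 1" and n0: "1 / 2 \<le> cmod (\<psi> n0)"
    and pos: "L > 0" "\<epsilon> > 0" "r > 0" "C \<ge> 1"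
    and U: "\<And>y h. \<bar>pbox R E (orbit f \<alpha> y) h\<bar> \<le> C * exp ((L + \<epsilon>) * real h)"
    and Lw: "\<And>h. \<exists>xh. \<forall>y. (\<forall>\<kappa><h. circ_dist (y - xh \<kappa>) > 0) \<longrightarrow>
        exp ((L - \<epsilon>) * real h - (\<Sum>\<kappa><h. logp (r / circ_dist (y - xh \<kappa>)))) \<le> C * \<bar>pbox R E (orbit f \<alpha> y) h\<bar>"
  shows "eigenbox (- \<alpha>) (x + of_int n0 * \<alpha>) (\<lambda>n. cmod (\<psi> (n0 - n)))
    (\<lambda>y h. \<bar>pbox R E (orbit f \<alpha> (y - (real h - 1) * \<alpha>)) h\<bar>) L \<epsilon> r C"
proof
  fix i n :: int and h assume n: "i \<le> n" "n < i + int h"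
  let ?I = "n0 - i - int h + 1" and ?y = "x + of_int n0 * \<alpha>"
  have 1: "x + of_int ?I * \<alpha> = ?y + of_int i * - \<alpha> - (real h - 1) * \<alpha>" by (simp add: algebra_simps)
  have 2: "x + of_int (n0 - n + 1) * \<alpha> = ?y + of_int i * - \<alpha> - (real (nat (n - i)) - 1) * \<alpha>"
    using n by (simp add: algebra_simps)
  have 3: "x + of_int ?I * \<alpha> = ?y + of_int (n + 1) * - \<alpha> - (real (nat (i + int h - 1 - n)) - 1) * \<alpha>"
    using n by (simp add: algebra_simps)
  have 4: "?I + int h - 1 - (n0 - n) = n - i" "n0 - n - ?I = i + int h - 1 - n" "?I - 1 = n0 - (i + int h)" "?I + int h = n0 - (i - 1)"
    by simp_all
  have "\<bar>pbox R E (orbit f \<alpha> (x + of_int ?I * \<alpha>)) h\<bar> * cmod (\<psi> (n0 - n))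
    \<le> \<bar>pbox R E (orbit f \<alpha> (x + of_int (n0 - n + 1) * \<alpha>)) (nat (n - i))\<bar> * cmod (\<psi> (n0 - (i + int h)))
      + \<bar>pbox R E (orbit f \<alpha> (x + of_int ?I * \<alpha>)) (nat (i + int h - 1 - n))\<bar> * cmod (\<psi> (n0 - (i - 1)))"
    using eigen_solution_green[OF es, of ?I "n0 - n" h R] n unfolding 4 by simp
  then show "\<bar>pbox R E (orbit f \<alpha> (?y + of_int i * - \<alpha> - (real h - 1) * \<alpha>)) h\<bar> * cmod (\<psi> (n0 - n))
    \<le> \<bar>pbox R E (orbit f \<alpha> (?y + of_int (n + 1) * - \<alpha> - (real (nat (i + int h - 1 - n)) - 1) * \<alpha>)) (nat (i + int h - 1 - n))\<bar>
        * cmod (\<psi> (n0 - (i - 1)))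
      + \<bar>pbox R E (orbit f \<alpha> (?y + of_int i * - \<alpha> - (real (nat (n - i)) - 1) * \<alpha>)) (nat (n - i))\<bar> * cmod (\<psi> (n0 - (i + int h)))"
    unfolding 1[symmetric] 2[symmetric] 3[symmetric] by linarith
next
  fix h
  obtain xh where xh: "\<forall>y. (\<forall>\<kappa><h. circ_dist (y - xh \<kappa>) > 0) \<longrightarrow>
        exp ((L - \<epsilon>) * real h - (\<Sum>\<kappa><h. logp (r / circ_dist (y - xh \<kappa>)))) \<le> C * \<bar>pbox R E (orbit f \<alpha> y) h\<bar>"
    using Lw by blast
  show "\<exists>xh. \<forall>y. (\<forall>\<kappa><h. circ_dist (y - xh \<kappa>) > 0) \<longrightarrow>
        exp ((L - \<epsilon>) * real h - (\<Sum>\<kappa><h. logp (r / circ_dist (y - xh \<kappa>))))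
          \<le> C * \<bar>pbox R E (orbit f \<alpha> (y - (real h - 1) * \<alpha>)) h\<bar>"
  proof (intro exI[of _ "\<lambda>\<kappa>. xh \<kappa> + (real h - 1) * \<alpha>"] allI impI)
    fix y
    have s: "y - (xh \<kappa> + (real h - 1) * \<alpha>) = y - (real h - 1) * \<alpha> - xh \<kappa>" for \<kappa> by simp
    assume "\<forall>\<kappa><h. circ_dist (y - (xh \<kappa> + (real h - 1) * \<alpha>)) > 0"
    then show "exp ((L - \<epsilon>) * real h - (\<Sum>\<kappa><h. logp (r / circ_dist (y - (xh \<kappa> + (real h - 1) * \<alpha>)))))
          \<le> C * \<bar>pbox R E (orbit f \<alpha> (y - (real h - 1) * \<alpha>)) h\<bar>"
      unfolding s using xh by blast
  qed
qed (use assms in auto)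

section \<open>Uniform localization\<close>

lemma cf_beta_growth:
  assumes irr: "\<alpha> \<notin> \<rat>" and b: "cf_beta \<alpha> = ereal \<beta>" and e: "\<epsilon> > 0"
  shows "eventually (\<lambda>k. ln (of_int (cf_denom \<alpha> (Suc k))) \<le> (\<beta> + \<epsilon>) * of_int (cf_denom \<alpha> k)) sequentially"
proof -
  have "limsup (\<lambda>k. ereal (ln (of_int (cf_denom \<alpha> (Suc k))) / of_int (cf_denom \<alpha> k))) < ereal (\<beta> + \<epsilon>)"
    using b e unfolding cf_beta_def by simp
  then have "eventually (\<lambda>k. ereal (ln (of_int (cf_denom \<alpha> (Suc k))) / of_int (cf_denom \<alpha> k)) < ereal (\<beta> + \<epsilon>)) sequentially"
    by (rule Limsup_lessD)
  then show ?thesis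
  proof eventually_elim
    case (elim k)
    have "cf_denom \<alpha> k \<ge> 1" using cf_denom_pos[OF irr] by blast
    then have "real_of_int (cf_denom \<alpha> k) > 0" by simp
    then show ?case using elim by (simp add: pos_divide_less_eq)
  qed
qed

lemma cf_beta_nonneg:
  assumes irr: "\<alpha> \<notin> \<rat>" shows "0 \<le> cf_beta \<alpha>"
  unfolding cf_beta_def
proof (rule le_Limsup)
  show "eventually (\<lambda>k. 0 \<le> ereal (ln (of_int (cf_denom \<alpha> (Suc k))) / of_int (cf_denom \<alpha> k))) sequentially"
  proof (intro always_eventually allI)
    fix k
    have "cf_denom \<alpha> k \<ge> 1" "cf_denom \<alpha> (Suc k) \<ge> 1" using cf_denom_pos[OF irr] by blast+
    then show "0 \<le> ereal (ln (of_int (cf_denom \<alpha> (Suc k))) / of_int (cf_denom \<alpha> k))"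
      by (simp add: ln_ge_zero)
  qed
qed simp

text \<open>The supremum need not be attained, which is why the peak is only asked to reach
  \<open>1 / 2\<close>.\<close>

lemma linf_norm_eq_1:
  assumes "linf_norm_eq \<psi> 1"
  shows "cmod (\<psi> n) \<le> 1" "\<exists>n0. 1 / 2 \<le> cmod (\<psi> n0)"
proof -
  have b: "bdd_above (range (\<lambda>n. cmod (\<psi> n)))" and s: "(SUP n. cmod (\<psi> n)) = 1"
    using assms unfolding linf_norm_eq_def by auto
  show "cmod (\<psi> n) \<le> 1" using cSUP_upper[OF UNIV_I b, of n] s by simp
  have "1 / 2 < (SUP n. cmod (\<psi> n))" using s by simp
  then show "\<exists>n0. 1 / 2 \<le> cmod (\<psi> n0)" using less_cSUP_iff[OF _ b, of "1 / 2"] by (auto intro: less_imp_le)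
qed

text \<open>Diagonal choice: \<open>\<epsilon> n\<close> is \<open>1 / (k + 1)\<close> for the
  largest \<open>k \<le> n\<close> whose threshold \<open>N k\<close> is already reached, and the
  always valid rate \<open>K\<close> while there is none.\<close>

lemma vanishing_rate:
  fixes P :: "real \<Rightarrow> nat \<Rightarrow> bool"
  assumes P: "\<And>\<kappa>. \<kappa> > 0 \<Longrightarrow> \<exists>n1. \<forall>n\<ge>n1. P \<kappa> n" and K: "K > 0" "\<And>n. P K n"
  shows "\<exists>\<epsilon> :: nat \<Rightarrow> real. (\<forall>n. \<epsilon> n > 0) \<and> \<epsilon> \<longlonglongrightarrow> 0 \<and> (\<forall>n. P (\<epsilon> n) n)"
proof -
  have "\<exists>n1. \<forall>n\<ge>n1. P (1 / (real k + 1)) n" for k by (rule P) simp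
  then obtain N where N: "\<And>k n. n \<ge> N k \<Longrightarrow> P (1 / (real k + 1)) n" by metis
  define S where "S n = {k. k \<le> n \<and> N k \<le> n}" for n
  define \<epsilon> where "\<epsilon> n = (if S n = {} then K else 1 / (real (Max (S n)) + 1))" for n
  have fin: "finite (S n)" for n unfolding S_def by simp
  have "\<epsilon> \<longlonglongrightarrow> 0"
  proof (rule tendstoI)
    fix e :: real assume "e > 0"
    then obtain k where k: "1 / (real k + 1) < e" using nat_approx_posE[of e] by (auto simp: add.commute)
    have "dist (\<epsilon> n) 0 < e" if "n \<ge> max k (N k)" for n
    proof -
      have kS: "k \<in> S n" using that unfolding S_def by simp
      then have "\<epsilon> n = 1 / (real (Max (S n)) + 1)" unfolding \<epsilon>_def by auto
      also have "\<dots> \<le> 1 / (real k + 1)" using Max_ge[OF fin kS] by (intro divide_left_mono) auto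
      moreover have "\<epsilon> n > 0" unfolding \<epsilon>_def using K by auto
      ultimately show ?thesis using k by simp
    qed
    then show "eventually (\<lambda>n. dist (\<epsilon> n) 0 < e) sequentially" unfolding eventually_sequentially by blast
  qed
  moreover have "P (\<epsilon> n) n" for n
  proof (cases "S n = {}")
    case True then show ?thesis using K unfolding \<epsilon>_def by simp
  next
    case False
    then have "Max (S n) \<in> S n" using fin by (intro Max_in)
    then have "P (1 / (real (Max (S n)) + 1)) n" by (intro N) (simp add: S_def)
    then show ?thesis using False unfolding \<epsilon>_def by simp
  qed
  moreover have "\<epsilon> n > 0" for n unfolding \<epsilon>_def using K by auto
  ultimately show ?thesis by blast
qed

context mpot
begin

text \<open>Bounds the Lyapunov exponent on \<open>|E| \<le> M\<close>. The relative loss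
  \<open>\<eta>\<close> and the initial rate \<open>K\<close> are chosen in terms of this
  bound.\<close>

lemma lyapunov_le:
  assumes int: "integrable mu (\<lambda>x. ln \<bar>E - x\<bar>)" and M: "\<bar>E\<bar> \<le> M"
  shows "(\<integral>x. ln \<bar>E - x\<bar> \<partial>mu) \<le> (\<integral>x. tail 1 M x \<partial>mu)"
proof (rule integral_mono[OF int])
  have M0: "M \<ge> 0" using M by linarith
  show "integrable mu (tail 1 M)" by (rule tail_integrable[OF int _ M0]) simp
  fix x
  show "ln \<bar>E - x\<bar> \<le> tail 1 M x"
  proof (cases "E = x")
    case True
    then show ?thesis unfolding tail_def by (simp add: ln_ge_zero)
  next
    case False
    have "\<bar>E - x\<bar> \<le> M + \<bar>x\<bar>" using M by linarith
    then have "\<bar>E - x\<bar>\<^sup>2 \<le> (M + \<bar>x\<bar>)\<^sup>2" by (intro power_mono) auto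
    then have "ln (\<bar>E - x\<bar>\<^sup>2) \<le> ln (1 + (M + \<bar>x\<bar>)\<^sup>2)" using False by (intro ln_mono) auto
    then show ?thesis unfolding tail_def ln_realpow by simp
  qed
qed

text \<open>\<open>C\<close> and \<open>n1\<close> are fixed before \<open>x\<close>,
  \<open>E\<close> and \<open>\<psi>\<close> appear. The energy \<open>E0\<close> certifies
  integrability of \<open>tail\<close>, from which the common \<open>R\<close> is obtained.\<close>

lemma uniform_decay:
  assumes irr: "\<alpha> \<notin> \<rat>" and b: "cf_beta \<alpha> = ereal \<beta>" and d: "0 < \<delta>" and M: "0 < M" and k: "0 < \<kappa>"
    and E0: "integrable mu (\<lambda>x. ln \<bar>E0 - x\<bar>)"
  shows "\<exists>n1::int. \<forall>x E \<psi> n0 n. eigen_solution f \<alpha> x E \<psi> \<longrightarrow> linf_norm_eq \<psi> 1 \<longrightarrow> \<beta> + \<delta> \<le> lyapunov f \<alpha> E \<longrightarrow>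
     \<bar>E\<bar> \<le> M \<longrightarrow> 1 / 2 \<le> cmod (\<psi> n0) \<longrightarrow> n1 \<le> \<bar>n - n0\<bar> \<longrightarrow>
     cmod (\<psi> n) \<le> exp (- (lyapunov f \<alpha> E - \<beta> - \<kappa>) * of_int \<bar>n - n0\<bar>)"
proof -
  define Lb where "Lb = max 1 (\<integral>x. tail 1 M x \<partial>mu)"
  have Lb: "Lb > 0" unfolding Lb_def by simp
  have b0: "0 \<le> \<beta>" using cf_beta_nonneg[OF irr] b by simp
  obtain \<epsilon> r where er: "\<epsilon> > 0" "r > 0" and dec: "\<And>C. C \<ge> 1 \<Longrightarrow> \<exists>n1::int. n1 > 0 \<and>
      (\<forall>\<alpha>' x a p L. (\<forall>d. circ_dist (of_int d * \<alpha>') = circ_dist (of_int d * \<alpha>)) \<longrightarrow>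
       eigenbox \<alpha>' x a p L \<epsilon> r C \<longrightarrow> \<beta> + \<delta> \<le> L \<longrightarrow> L \<le> Lb \<longrightarrow> (\<forall>n\<ge>n1. a n \<le> exp (- (L - \<beta> - \<kappa>) * of_int n)))"
    using eigenbox_decay[OF irr b0 d Lb k cf_beta_growth[OF irr b]] by blast
  obtain R C where "R \<ge> 3" and C: "C \<ge> 1" and bounds: "\<And>E L. \<bar>E\<bar> \<le> M \<Longrightarrow> integrable mu (\<lambda>x. ln \<bar>E - x\<bar>) \<Longrightarrow>
     L = (\<integral>x. ln \<bar>E - x\<bar> \<partial>mu) \<Longrightarrow>
     (\<forall>y h. \<bar>pbox R E (orb y) h\<bar> \<le> C * exp ((L + \<epsilon>) * real h)) \<and>
     (\<forall>h. \<exists>xh. \<forall>y. (\<forall>\<kappa><h. circ_dist (y - xh \<kappa>) > 0) \<longrightarrow>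
        exp ((L - \<epsilon>) * real h - (\<Sum>\<kappa><h. logp (r / circ_dist (y - xh \<kappa>)))) \<le> C * \<bar>pbox R E (orb y) h\<bar>)"
    using box_bounds[OF irr E0 less_imp_le[OF M] er(1)] er(2) by blast
  obtain n1 :: int where n1: "n1 > 0" and main: "\<And>\<alpha>' x a p L n. (\<forall>d. circ_dist (of_int d * \<alpha>') = circ_dist (of_int d * \<alpha>)) \<Longrightarrow>
       eigenbox \<alpha>' x a p L \<epsilon> r C \<Longrightarrow> \<beta> + \<delta> \<le> L \<Longrightarrow> L \<le> Lb \<Longrightarrow> n1 \<le> n \<Longrightarrow> a n \<le> exp (- (L - \<beta> - \<kappa>) * of_int n)"
    using dec[OF C] by blast
  show ?thesis
  proof (intro exI[of _ n1] allI impI)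
    fix x E \<psi> n0 n
    assume es: "eigen_solution f \<alpha> x E \<psi>" and nm: "linf_norm_eq \<psi> 1" and bL: "\<beta> + \<delta> \<le> lyapunov f \<alpha> E"
      and EM: "\<bar>E\<bar> \<le> M" and half: "1 / 2 \<le> cmod (\<psi> n0)" and n: "n1 \<le> \<bar>n - n0\<bar>"
    let ?L = "lyapunov f \<alpha> E"
    have L: "?L = (\<integral>x. ln \<bar>E - x\<bar> \<partial>mu)" unfolding lyapunov_def dos_measure_eq ..
    have L0: "?L > 0" using bL b0 d by linarith
    \<comment> \<open>The integral of a non-integrable function is \<open>0\<close> by convention,
      so a positive exponent entails integrability.\<close>
    have int: "integrable mu (\<lambda>x. ln \<bar>E - x\<bar>)"
      using L0 not_integrable_integral_eq[of mu "\<lambda>x. ln \<bar>E - x\<bar>"] unfolding L by fastforce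
    have LLb: "?L \<le> Lb" using lyapunov_le[OF int EM] unfolding L Lb_def by simp
    note bd = bounds[OF EM int L]
    have U: "\<bar>pbox R E (orb y) h\<bar> \<le> C * exp ((?L + \<epsilon>) * real h)" for y h using bd by blast
    have Lw: "\<exists>xh. \<forall>y. (\<forall>\<kappa><h. circ_dist (y - xh \<kappa>) > 0) \<longrightarrow>
        exp ((?L - \<epsilon>) * real h - (\<Sum>\<kappa><h. logp (r / circ_dist (y - xh \<kappa>)))) \<le> C * \<bar>pbox R E (orb y) h\<bar>" for h
      using bd by blast
    show "cmod (\<psi> n) \<le> exp (- (?L - \<beta> - \<kappa>) * of_int \<bar>n - n0\<bar>)"
    proof (cases "n \<ge> n0")
      case True
      from main[OF _ eigenbox_right[OF es linf_norm_eq_1(1)[OF nm] half L0 er C U Lw] bL LLb, of "n - n0"]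
      show ?thesis using True n by simp
    next
      case False
      have "\<forall>d. circ_dist (of_int d * - \<alpha>) = circ_dist (of_int d * \<alpha>)" by (simp add: circ_dist_minus)
      from main[OF this eigenbox_left[OF es linf_norm_eq_1(1)[OF nm] half L0 er C U Lw] bL LLb, of "n0 - n"]
      show ?thesis using False n by simp
    qed
  qed
qed

end

theorem corollary5p13:
  fixes \<alpha> \<gamma> \<delta> M :: real and f :: "real \<Rightarrow> ereal"
  assumes "\<alpha> \<notin> \<rat>" and "\<gamma> > 0" and "monotone_potential \<gamma> f" and "\<delta> > 0" and "M > 0"
  shows "\<exists>\<epsilon> :: nat \<Rightarrow> real.
           (\<forall>n. \<epsilon> n > 0) \<and> \<epsilon> \<longlonglongrightarrow> 0 \<and>
           (\<forall>(x :: real) (E :: real) (\<psi> :: int \<Rightarrow> complex).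
              eigen_solution f \<alpha> x E \<psi> \<and> linf_norm_eq \<psi> 1 \<and>
              ereal (lyapunov f \<alpha> E) > cf_beta \<alpha> + ereal \<delta> \<and> \<bar>E\<bar> < M \<longrightarrow>
              (\<exists>n0 :: int. \<forall>n :: int.
                 cmod (\<psi> n) \<le>
                   exp (- (lyapunov f \<alpha> E - real_of_ereal (cf_beta \<alpha>) - \<epsilon> (nat \<bar>n - n0\<bar>))
                        * of_int \<bar>n - n0\<bar>)))"
proof -
  interpret mpot \<alpha> \<gamma> f by (rule mpot_monotone_potential[OF assms(1-3)])
  define adm where "adm E \<longleftrightarrow> ereal (lyapunov f \<alpha> E) > cf_beta \<alpha> + ereal \<delta> \<and> \<bar>E\<bar> < M" for E
  have b0: "0 \<le> cf_beta \<alpha>" by (rule cf_beta_nonneg[OF assms(1)])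
  show ?thesis
  \<comment> \<open>Without an admissible energy any positive null sequence will do. With one,
    \<open>cf_beta \<alpha>\<close> is finite and that energy serves as the reference
    \<open>E0\<close>.\<close>
  proof (cases "\<exists>E. adm E")
    case False
    then show ?thesis
      by (intro exI[of _ "\<lambda>n. inverse (real (Suc n))"]) (use LIMSEQ_inverse_real_of_nat in \<open>auto simp: adm_def\<close>)
  next
    case True
    then obtain E0 where E0: "adm E0" by blast
    have "cf_beta \<alpha> \<noteq> \<infinity>" using E0 unfolding adm_def by auto
    then obtain \<beta> where b: "cf_beta \<alpha> = ereal \<beta>" using b0 by (cases "cf_beta \<alpha>") auto
    have \<beta>0: "0 \<le> \<beta>" using b0 b by simp
    have admD: "\<beta> + \<delta> \<le> lyapunov f \<alpha> E" "\<bar>E\<bar> \<le> M" if "adm E" for E using that unfolding adm_def b by auto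
    have lyap: "lyapunov f \<alpha> E = (\<integral>x. ln \<bar>E - x\<bar> \<partial>mu)" for E unfolding lyapunov_def dos_measure_eq ..
    have int: "integrable mu (\<lambda>x. ln \<bar>E - x\<bar>)" if "adm E" for E
    proof (rule ccontr)
      assume "\<not> ?thesis"
      then have "lyapunov f \<alpha> E = 0" unfolding lyap by (rule not_integrable_integral_eq)
      then show False using admD(1)[OF that] \<beta>0 assms(4) by linarith
    qed
    define P where "P \<kappa> N \<longleftrightarrow> (\<forall>x E \<psi> n0 n. eigen_solution f \<alpha> x E \<psi> \<longrightarrow> linf_norm_eq \<psi> 1 \<longrightarrow> adm E \<longrightarrow>
      1 / 2 \<le> cmod (\<psi> n0) \<longrightarrow> nat \<bar>n - n0\<bar> = N \<longrightarrow>
      cmod (\<psi> n) \<le> exp (- (lyapunov f \<alpha> E - \<beta> - \<kappa>) * of_int \<bar>n - n0\<bar>))" for \<kappa> N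
    \<comment> \<open>At least as large as every admissible Lyapunov exponent, so with this rate the
      claim follows from \<open>|\<psi>| \<le> 1\<close>.\<close>
    define K where "K = max 1 (\<integral>x. tail 1 M x \<partial>mu)"
    have "\<exists>\<epsilon>. (\<forall>n. \<epsilon> n > 0) \<and> \<epsilon> \<longlonglongrightarrow> 0 \<and> (\<forall>n. P (\<epsilon> n) n)"
    proof (rule vanishing_rate)
      fix \<kappa> :: real assume k: "\<kappa> > 0"
      obtain n1 :: int where n1: "\<forall>x E \<psi> n0 n. eigen_solution f \<alpha> x E \<psi> \<longrightarrow> linf_norm_eq \<psi> 1 \<longrightarrow> \<beta> + \<delta> \<le> lyapunov f \<alpha> E \<longrightarrow>
          \<bar>E\<bar> \<le> M \<longrightarrow> 1 / 2 \<le> cmod (\<psi> n0) \<longrightarrow> n1 \<le> \<bar>n - n0\<bar> \<longrightarrow>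
          cmod (\<psi> n) \<le> exp (- (lyapunov f \<alpha> E - \<beta> - \<kappa>) * of_int \<bar>n - n0\<bar>)"
        using uniform_decay[OF assms(1) b assms(4,5) k int[OF E0]] by blast
      have "P \<kappa> N" if "N \<ge> nat n1" for N
        unfolding P_def
      proof (intro allI impI)
        fix x E \<psi> n0 n
        assume a: "eigen_solution f \<alpha> x E \<psi>" "linf_norm_eq \<psi> 1" "adm E" "1 / 2 \<le> cmod (\<psi> n0)" "nat \<bar>n - n0\<bar> = N"
        have "n1 \<le> \<bar>n - n0\<bar>" using a(5) that by linarith
        then show "cmod (\<psi> n) \<le> exp (- (lyapunov f \<alpha> E - \<beta> - \<kappa>) * of_int \<bar>n - n0\<bar>)"
          using n1 a(1,2,4) admD[OF a(3)] by blast
      qed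
      then show "\<exists>n1. \<forall>N\<ge>n1. P \<kappa> N" by blast
    next
      show "K > 0" unfolding K_def by simp
      show "P K N" for N
        unfolding P_def
      proof (intro allI impI)
        fix x E \<psi> n0 n
        assume nm: "linf_norm_eq \<psi> 1" and aE: "adm E"
        have "lyapunov f \<alpha> E \<le> K" unfolding lyap K_def using lyapunov_le[OF int[OF aE] admD(2)[OF aE]] by simp
        then have "(lyapunov f \<alpha> E - \<beta> - K) * of_int \<bar>n - n0\<bar> \<le> 0" using \<beta>0 by (intro mult_nonpos_nonneg) auto
        then have "1 \<le> exp (- (lyapunov f \<alpha> E - \<beta> - K) * of_int \<bar>n - n0\<bar>)"
          by (simp only: mult_minus_left one_le_exp_iff neg_0_le_iff_le)
        then show "cmod (\<psi> n) \<le> exp (- (lyapunov f \<alpha> E - \<beta> - K) * of_int \<bar>n - n0\<bar>)"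
          using linf_norm_eq_1(1)[OF nm, of n] by linarith
      qed
    qed
    then obtain \<epsilon> where e: "\<forall>n. \<epsilon> n > 0" "\<epsilon> \<longlonglongrightarrow> 0" "\<And>n. P (\<epsilon> n) n" by blast
    have rb: "real_of_ereal (cf_beta \<alpha>) = \<beta>" using b by simp
    show ?thesis
    proof (intro exI[of _ \<epsilon>] conjI e(1,2) allI impI)
      fix x E \<psi>
      assume "eigen_solution f \<alpha> x E \<psi> \<and> linf_norm_eq \<psi> 1 \<and>
              ereal (lyapunov f \<alpha> E) > cf_beta \<alpha> + ereal \<delta> \<and> \<bar>E\<bar> < M"
      then have a: "eigen_solution f \<alpha> x E \<psi>" "linf_norm_eq \<psi> 1" "adm E" unfolding adm_def by auto
      obtain n0 where n0: "1 / 2 \<le> cmod (\<psi> n0)" using linf_norm_eq_1(2)[OF a(2)] by blast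
      show "\<exists>n0 :: int. \<forall>n :: int. cmod (\<psi> n) \<le>
                   exp (- (lyapunov f \<alpha> E - real_of_ereal (cf_beta \<alpha>) - \<epsilon> (nat \<bar>n - n0\<bar>)) * of_int \<bar>n - n0\<bar>)"
        unfolding rb using e(3) a n0 unfolding P_def by (intro exI[of _ n0] allI) blast
    qed
  qed
qed

end
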